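(* Let $E=\mathbb{C}^d$, let $K_0\subset E$ be a compact absolutely convex neighbourhood of $0$, let $p\in\mathbb{R}^d$ and $K:=p+K_0$. Let $V:K\to E$ be analytic and consider the ODE $\dot z=V(z)$. Let $\mu$ be a Borel probability measure on $K_0\cap\mathbb{R}^d$ absolutely continuous with respect to the Lebesgue measure on $K_0\cap\mathbb{R}^d$. Let $\{x^i\}_{i=1}^\infty\subset\mathrm{supp}(\mu)$ and $X_N:=(p+x^1,\dots,p+x^N)\in K^N$. Assume that (i) $V(p)=0$; (ii) the eigenvalues of the Jacobian matrix of $V$ at $p$ are real; (iii) there exists $T>0$ such that for any initial point $w\in K$ the ODE $\dot z=V(z)$, $z(0)=w$, has a solution on $[0,T]$; (iv) $N^{-1}\sum_{i=1}^N\delta_{x^i}$ converges weakly to $\mu$ as $N\to\infty$; (v) there exists $\rho\in(0,1)$ such that $\rho>R_\mu/\liminf_{n\to\infty}\Lambda_n(\mu)^{1/(2n)}$, where $R_\mu:=\sup_{x\in\mathrm{supp}(\mu)}|x|_{K_0}$. Let $f:=\phi^T$ be the time-$T$ flow map and form the matrix $\widehat{\mathbf{C}}_{m,n,X_N}$ for this $f$. For all sufficiently large $N$ for which $\widehat{\mathbf{C}}_{m,n,X_N}$ has no non-positive real eigenvalues, define $\widehat{\mathbf{A}}_{m,n,X_N}:=\frac1T\log\widehat{\mathbf{C}}_{m,n,X_N}$ (principal matrix logarithm), and for $i=1,\dots,d$, $z\in E$, $$\widehat{V}_{m,n,X_N,i}(z):=\mathbf{u}_{p,m}(z)\,\widehat{\mathbf{A}}_{m,n,X_N}^*\Big(\frac{\partial\mathbf{u}_{p,m}}{\partial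 z_i}(0)\Big)^*,\qquad\widehat{V}_{m,n,X_N}:=(\widehat{V}_{m,n,X_N,1},\dots,\widehat{V}_{m,n,X_N,d}):E\to E.$$ Then there exists a positive sequence $\{C_m\}_{m=0}^\infty\subset\mathbb{R}_{>0}$ such that for any compact set $K_1\Subset K_0$, any $m\in\mathbb{Z}_{\ge0}$, and all sufficiently large $n$, $$\limsup_{N\to\infty}\sup_{z\in p+K_1}\big\|\widehat{V}_{m,n,X_N}(z)-V(z)\big\|_E\le C'\Big(C_m\rho^n+\frac{R_{K_1}^m}{1-R_{K_1}}\Big),$$ where $R_{K_1}:=\sup_{z\in K_1}|z|_{K_0}$ and $C'$ is a constant depending only on $f,p,K_0,K_1$ and $\mu$.
   Context: $E=\mathbb{C}^d$ carries the standard Hermitian inner product and norm. A set $S$ is absolutely convex if $ax+by\in S$ whenever $x,y\in S$ and $a,b\in\mathbb{C}$, $|a|+|b|\le1$. $|z|_{K_0}:=\inf\{t>0: z\in tK_0\}$. $K_1\Subset K_0$ means $K_1\subset\mathrm{int}(K_0)$. A map on a compact set $K$ is analytic if it is the restriction of a holomorphic map on an open neighbourhood of $K$. The flow map $\phi^t:K\to E$ is $\phi^t(w):=z(t)$, where $z(\cdot)$ solves $\dot z=V(z)$, $z(0)=w$; it is regarded as an analytic map on $K$. $^*$ on matrices and vectors is conjugate transpose, $\dagger$ the Moore–Penrose pseudo-inverse. The principal logarithm of a square matrix $\mathbf{A}$ with no non-positive real eigenvalues is $\log(\mathbf{A}):=(\mathbf{A}-\mathbf{I})\int_0^1(\mathbf{I}+t(\mathbf{A}-\mathbf{I}))^{-1}dt$.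 Fix a numbering $\{\alpha^{(i)}\}_{i\ge1}$ of $\mathbb{Z}_{\ge0}^d$ with $\alpha^{(1)}=0$, $\alpha^{(i+1)}$ the $i$-th elementary vector for $1\le i\le d$, and $|\alpha^{(i)}|\le|\alpha^{(j)}|$ for $i\le j$. Put $r_n^E=\binom{n+d}{d}$, $$u_{p,i}(z)=\frac{e^{-\|p\|^2/2}}{\sqrt{\alpha^{(i)}!}}(z-p)^{\alpha^{(i)}}e^{p^*z},$$ and the row vector $\mathbf{u}_{p,n}(z)=(u_{p,1}(z),\dots,u_{p,r_n^E}(z))$. For $Z=(z^1,\dots,z^N)\in E^N$ let $\mathbf{U}_{p,n,Z}\in\mathbb{C}^{N\times r_n^E}$ be the matrix with rows $\mathbf{u}_{p,n}(z^i)$. For $f:K\to E$ with $f(p)=p$, $Z\in K^N$, $W=(f(z^1),\dots,f(z^N))$ and $m\le n$, $\widehat{\mathbf{C}}_{m,n,Z}\in\mathbb{C}^{r_m^E\times r_m^E}$ consists of the first $r_m^E$ columns of $\mathbf{U}_{p,m,W}^*(\mathbf{U}_{p,n,Z}^* )^\dagger$. For a Borel measure $\mu$ on $E$ (with the relevant moments finite), $\mathbf{D}_n(\mu)=\big(\int\overline{z^{\alpha^{(i)}}}z^{\alpha^{(j)}}d\mu(z)\big)_{i,j=1}^{r_n^E}$ and $\Lambda_n(\mu)$ is its smallest eigenvalue.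
   Formalization: The constant C' is allowed to depend on T as well as on f, p, K_0, K_1 and μ; without T the claim fails, since replacing (V,T) by (V/s,sT) keeps f but multiplies the error by 1/s. *)

theory Defs
  imports
    "HOL-Probability.Probability"
    "Jordan_Normal_Form.Gauss_Jordan_Elimination"
    "Jordan_Normal_Form.Schur_Decomposition"
begin

text \<open>
  The space E is \<open>complex ^ 'd\<close>, whose norm is the one of the standard Hermitian inner product.
  Matrices whose size depends on natural numbers are matrices of \<open>Jordan_Normal_Form\<close>; their rows
  and columns are counted from 0, whereas sample points and multi-indices are counted from 1.
\<close>

no_notation vec_index (infixl \<open>$\<close> 100)


section \<open>Sets and maps in complex space\<close>

definition absolutely_convex :: "(complex ^ 'd) set \<Rightarrow> bool" where
  "absolutely_convex S \<longleftrightarrow>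
     (\<forall>x\<in>S. \<forall>y\<in>S. \<forall>a b. cmod a + cmod b \<le> 1 \<longrightarrow> a *s x + b *s y \<in> S)"

definition minkowski_norm :: "(complex ^ 'd) set \<Rightarrow> complex ^ 'd \<Rightarrow> real" where
  "minkowski_norm K0 z = Inf {t. t > 0 \<and> z \<in> (\<lambda>w. t *\<^sub>R w) ` K0}"

text \<open>This is \<open>R\<^bsub>K1\<^esub>\<close> for \<open>S = K1\<close>, and \<open>R\<^sub>\<mu>\<close> if \<open>S\<close> is the support of \<open>\<mu>\<close>.\<close>

definition gauge_radius :: "(complex ^ 'd) set \<Rightarrow> (complex ^ 'd) set \<Rightarrow> real" where
  "gauge_radius K0 S = (SUP z\<in>S. minkowski_norm K0 z)"

definition real_points :: "(complex ^ 'd) set" where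
  "real_points = {z. \<forall>k. z $ k \<in> \<real>}"

definition of_real_vec :: "real ^ 'd \<Rightarrow> complex ^ 'd" where
  "of_real_vec x = (\<chi> k. complex_of_real (x $ k))"

text \<open>Holomorphy in several variables: the Frechet derivative exists and is complex linear.\<close>

definition holomorphic_map_on ::
    "(complex ^ 'd \<Rightarrow> complex ^ 'd) \<Rightarrow> (complex ^ 'd) set \<Rightarrow> bool" where
  "holomorphic_map_on F U \<longleftrightarrow>
     (\<forall>z\<in>U. \<exists>D. (F has_derivative D) (at z) \<and> (\<forall>c v. D (c *s v) = c *s D v))"

definition jacobian_matrix ::
    "(complex ^ 'd \<Rightarrow> complex ^ 'd) \<Rightarrow> complex ^ 'd \<Rightarrow> complex ^ 'd ^ 'd" where
  "jacobian_matrix F p = (\<chi> i j. deriv (\<lambda>t. F (p + axis j t) $ i) 0)"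


section \<open>Ordinary differential equations\<close>

text \<open>
  The vector field is considered on the set \<open>U\<close> only, so a solution has to stay in \<open>U\<close>.
\<close>

definition ode_solution ::
    "(complex ^ 'd \<Rightarrow> complex ^ 'd) \<Rightarrow> (complex ^ 'd) set \<Rightarrow> real \<Rightarrow> complex ^ 'd \<Rightarrow>
     (real \<Rightarrow> complex ^ 'd) \<Rightarrow> bool" where
  "ode_solution V U t w z \<longleftrightarrow>
     z 0 = w \<and>
     (\<forall>s\<in>{0..t}. z s \<in> U \<and> (z has_vector_derivative V (z s)) (at s within {0..t}))"

text \<open>If \<open>V\<close> is holomorphic on the open set \<open>U\<close>, solutions are unique, so that the description
  below is proper whenever a solution exists.\<close>

definition flow_map ::
    "(complex ^ 'd \<Rightarrow> complex ^ 'd) \<Rightarrow> (complex ^ 'd) set \<Rightarrow> real \<Rightarrow> complex ^ 'd \<Rightarrow> complex ^ 'd"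
  where "flow_map V U t w = (THE y. \<exists>z. ode_solution V U t w z \<and> y = z t)"


section \<open>Matrices\<close>

definition moore_penrose :: "complex mat \<Rightarrow> complex mat" where
  "moore_penrose A = (THE X. X \<in> carrier_mat (dim_col A) (dim_row A) \<and>
     A * X * A = A \<and> X * A * X = X \<and>
     mat_adjoint (A * X) = A * X \<and> mat_adjoint (X * A) = X * A)"

definition no_nonpos_real_eigenvalue :: "complex mat \<Rightarrow> bool" where
  "no_nonpos_real_eigenvalue A \<longleftrightarrow> (\<forall>k. eigenvalue A k \<longrightarrow> \<not> (k \<in> \<real> \<and> Re k \<le> 0))"

text \<open>The integral in the definition of the principal logarithm is taken entrywise.\<close>

definition principal_log :: "complex mat \<Rightarrow> complex mat" where
  "principal_log A =
     (let r = dim_row A; B = A - 1\<^sub>m r in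
        B * Matrix.mat r r (\<lambda>(i, j).
          integral {0..1::real}
            (\<lambda>t. the (mat_inverse (1\<^sub>m r + complex_of_real t \<cdot>\<^sub>m B)) $$ (i, j))))"

definition smallest_eigenvalue :: "complex mat \<Rightarrow> real" where
  "smallest_eigenvalue A = Min {l. eigenvalue A (complex_of_real l)}"


section \<open>Multi-indices, the functions u and the matrices built from them\<close>

text \<open>
  In a numbering \<open>\<alpha> 1, \<alpha> 2, \<dots>\<close> of the multi-indices (the value \<open>\<alpha> 0\<close> is irrelevant), the
  function \<open>e\<close> lists the coordinates: \<open>e i\<close> is the \<open>i\<close>-th one, for \<open>1 \<le> i \<le> d\<close>.
\<close>

definition graded_numbering :: "(nat \<Rightarrow> 'd) \<Rightarrow> (nat \<Rightarrow> nat ^ 'd) \<Rightarrow> bool" where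
  "graded_numbering e \<alpha> \<longleftrightarrow>
     bij_betw e {1..CARD('d)} UNIV \<and>
     bij_betw \<alpha> {1..} UNIV \<and>
     \<alpha> 1 = 0 \<and>
     (\<forall>i\<in>{1..CARD('d)}. \<alpha> (i + 1) = axis (e i) 1) \<and>
     (\<forall>i j. 1 \<le> i \<longrightarrow> i \<le> j \<longrightarrow> (\<Sum>k\<in>UNIV. \<alpha> i $ k) \<le> (\<Sum>k\<in>UNIV. \<alpha> j $ k))"

definition monomial_fun :: "nat ^ 'd \<Rightarrow> complex ^ 'd \<Rightarrow> complex" where
  "monomial_fun a z = (\<Prod>k\<in>UNIV. (z $ k) ^ (a $ k))"

definition jet_dim :: "'d itself \<Rightarrow> nat \<Rightarrow> nat" where
  "jet_dim _ n = (n + CARD('d)) choose CARD('d)"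

definition u_fun ::
    "(nat \<Rightarrow> nat ^ 'd) \<Rightarrow> complex ^ 'd \<Rightarrow> nat \<Rightarrow> complex ^ 'd \<Rightarrow> complex" where
  "u_fun \<alpha> p i z =
     complex_of_real (exp (- (norm p)\<^sup>2 / 2) / sqrt (\<Prod>k\<in>UNIV. fact (\<alpha> i $ k))) *
     monomial_fun (\<alpha> i) (z - p) * exp (\<Sum>k\<in>UNIV. cnj (p $ k) * z $ k)"

definition u_row ::
    "(nat \<Rightarrow> nat ^ 'd) \<Rightarrow> complex ^ 'd \<Rightarrow> nat \<Rightarrow> complex ^ 'd \<Rightarrow> complex mat" where
  "u_row \<alpha> p n z = Matrix.mat 1 (jet_dim TYPE('d) n) (\<lambda>(_, j). u_fun \<alpha> p (j + 1) z)"

text \<open>The row vector of the partial derivatives in the \<open>k\<close>-th coordinate.\<close>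

definition du_row ::
    "(nat \<Rightarrow> nat ^ 'd) \<Rightarrow> complex ^ 'd \<Rightarrow> nat \<Rightarrow> 'd \<Rightarrow> complex ^ 'd \<Rightarrow> complex mat" where
  "du_row \<alpha> p n k z =
     Matrix.mat 1 (jet_dim TYPE('d) n)
       (\<lambda>(_, j). deriv (\<lambda>t. u_fun \<alpha> p (j + 1) (z + axis k t)) 0)"

text \<open>The sample is \<open>Z 1, \<dots>, Z N\<close>.\<close>

definition U_mat ::
    "(nat \<Rightarrow> nat ^ 'd) \<Rightarrow> complex ^ 'd \<Rightarrow> nat \<Rightarrow> nat \<Rightarrow> (nat \<Rightarrow> complex ^ 'd) \<Rightarrow> complex mat" where
  "U_mat \<alpha> p n N Z =
     Matrix.mat N (jet_dim TYPE('d) n) (\<lambda>(i, j). u_fun \<alpha> p (j + 1) (Z (i + 1)))"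

definition C_hat ::
    "(nat \<Rightarrow> nat ^ 'd) \<Rightarrow> complex ^ 'd \<Rightarrow> (complex ^ 'd \<Rightarrow> complex ^ 'd) \<Rightarrow>
     nat \<Rightarrow> nat \<Rightarrow> nat \<Rightarrow> (nat \<Rightarrow> complex ^ 'd) \<Rightarrow> complex mat" where
  "C_hat \<alpha> p f m n N Z =
     Matrix.mat (jet_dim TYPE('d) m) (jet_dim TYPE('d) m)
       (\<lambda>ij. (mat_adjoint (U_mat \<alpha> p m N (\<lambda>i. f (Z i))) *
              moore_penrose (mat_adjoint (U_mat \<alpha> p n N Z))) $$ ij)"

definition A_hat ::
    "(nat \<Rightarrow> nat ^ 'd) \<Rightarrow> complex ^ 'd \<Rightarrow> (complex ^ 'd \<Rightarrow> complex ^ 'd) \<Rightarrow> real \<Rightarrow>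
     nat \<Rightarrow> nat \<Rightarrow> nat \<Rightarrow> (nat \<Rightarrow> complex ^ 'd) \<Rightarrow> complex mat" where
  "A_hat \<alpha> p f T m n N Z = complex_of_real (1 / T) \<cdot>\<^sub>m principal_log (C_hat \<alpha> p f m n N Z)"

definition V_hat ::
    "(nat \<Rightarrow> nat ^ 'd) \<Rightarrow> complex ^ 'd \<Rightarrow> (complex ^ 'd \<Rightarrow> complex ^ 'd) \<Rightarrow> real \<Rightarrow>
     nat \<Rightarrow> nat \<Rightarrow> nat \<Rightarrow> (nat \<Rightarrow> complex ^ 'd) \<Rightarrow> complex ^ 'd \<Rightarrow> complex ^ 'd" where
  "V_hat \<alpha> p f T m n N Z z =
     (\<chi> k. (u_row \<alpha> p m z * mat_adjoint (A_hat \<alpha> p f T m n N Z) *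
            mat_adjoint (du_row \<alpha> p m k 0)) $$ (0, 0))"


section \<open>Measures\<close>

text \<open>Lebesgue measure on the real points of \<open>S\<close>, as a Borel measure on the complex space.\<close>

definition real_lebesgue_on :: "(complex ^ 'd) set \<Rightarrow> (complex ^ 'd) measure" where
  "real_lebesgue_on S = distr (restrict_space lborel (of_real_vec -` S)) borel of_real_vec"

definition measure_support :: "'a::topological_space measure \<Rightarrow> 'a set" where
  "measure_support \<mu> = {x. \<forall>U. open U \<longrightarrow> x \<in> U \<longrightarrow> emeasure \<mu> U > 0}"

text \<open>For \<open>N > 0\<close>, the mean of the Dirac measures at \<open>x 1, \<dots>, x N\<close>.\<close>

definition empirical_measure :: "nat \<Rightarrow> (nat \<Rightarrow> 'a::topological_space) \<Rightarrow> 'a measure" where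
  "empirical_measure N x = distr (uniform_count_measure {1..N}) borel x"

text \<open>The library has weak convergence only for measures on the real line.\<close>

definition weakly_converges :: "(nat \<Rightarrow> 'a::topological_space measure) \<Rightarrow> 'a measure \<Rightarrow> bool" where
  "weakly_converges \<nu> \<mu> \<longleftrightarrow>
     (\<forall>g :: 'a \<Rightarrow> real. continuous_on UNIV g \<longrightarrow> bounded (range g) \<longrightarrow>
        (\<lambda>N. \<integral>x. g x \<partial>\<nu> N) \<longlonglongrightarrow> (\<integral>x. g x \<partial>\<mu>))"

definition moment_matrix :: "(nat \<Rightarrow> nat ^ 'd) \<Rightarrow> nat \<Rightarrow> (complex ^ 'd) measure \<Rightarrow> complex mat" where
  "moment_matrix \<alpha> n \<mu> =
     Matrix.mat (jet_dim TYPE('d) n) (jet_dim TYPE('d) n)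
       (\<lambda>(i, j). \<integral>z. cnj (monomial_fun (\<alpha> (i + 1)) z) * monomial_fun (\<alpha> (j + 1)) z \<partial>\<mu>)"

definition Lambda_eig :: "(nat \<Rightarrow> nat ^ 'd) \<Rightarrow> nat \<Rightarrow> (complex ^ 'd) measure \<Rightarrow> real" where
  "Lambda_eig \<alpha> n \<mu> = smallest_eigenvalue (moment_matrix \<alpha> n \<mu>)"

end

theory Submission
  imports Defs "HOL-Complex_Analysis.Complex_Analysis"
begin

text \<open>Write x = z - p. Since V(p) = 0, the Koopman generator h -> V . grad h maps holomorphic
  functions that are O(|x|^(m+1)) at p to functions of the same kind, so it acts on m-jets at p. In
  the basis of the functions u_i its matrix A is \<open>generator_matrix\<close>. Along a trajectory
  the row of the u_i satisfies y' = y A up to order m+1, so pulling back by the time-T flow acts on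
  m-jets by exp(TA) (\<open>flow_pullback_jet\<close>). The estimator recovers the adjoint of
  exp(TA), then A by a logarithm, then V from A.

  Koopman matrix. The function u_j o f is holomorphic inside K, and its expansion in the u_i up to
  order n has a remainder O(R_mu^n) at the sample points; its first coefficients are the entries of
  exp(TA), because jets are unique (\<open>pullback_expansion\<close>). The matrix C_hat is the
  conjugated least-squares fit of these coefficients. Least squares amplifies a uniform error by at
  most the inverse square root of the smallest eigenvalue of the empirical moment matrix, and weak
  convergence keeps this eigenvalue above Lambda_n / 2 for large N
  (\<open>moment_matrix_bounds\<close>). So the error of C_hat is O(R_mu^n / sqrt Lambda_n), which
  the hypothesis on \<rho> turns into O(\<rho>^n) (\<open>koopman_estimate\<close>).

  Logarithm. All eigenvalues of A are real (\<open>field_jet_matrix_eigenvalue_real\<close>): the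
  lowest-order homogeneous part q of an eigenfunction satisfies dq(Dx) = \<nu> q, where D is the
  derivative of V at p. Since D has real spectrum, the flows of iD and -iD grow only polynomially,
  while q changes along them by the exact factors exp(i \<nu> s) and exp(-i \<nu> s); hence Im \<nu>
  = 0. With real spectrum the principal logarithm of exp(TA) is TA
  (\<open>principal_log_mat_exp\<close>), it is Lipschitz near this matrix, and nearby matrices have
  no non-positive real eigenvalue (\<open>principal_log_lipschitz\<close>). Hence A_hat is
  O(\<rho>^n)-close to the adjoint of A (\<open>generator_estimate\<close>).

  Vector field. The u_i are truncated pieces of the kernel exp(w^* z), whose derivative at w = 0
  reproduces the coordinate z_k. So z_k agrees to order m+1 with a combination of the u_j whose
  coefficients are the conjugated derivatives of u_j at 0 (\<open>jet_reproducing\<close>). Applying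
  A to this combination gives the m-jet of V_k (\<open>field_component_jet\<close>), and Taylor's
  remainder on K1 is geometric in R_K1 (\<open>field_remainder\<close>).

  Constant. C' may depend on f but not on V. This is possible because f determines V: equal time-T
  maps give equal exp(TA), by the logarithm equal A for every m, hence equal Taylor series and equal
  fields inside K (\<open>flow_determines_field_sum\<close>,
  \<open>field_remainder_uniform\<close>).

  Complex analysis in several variables is reduced to complex lines
  (\<open>line_holomorphic\<close>). The flow is holomorphic in this sense as a uniform limit of
  Euler iterates (\<open>flow_line_holomorphic\<close>).\<close>

no_notation fps_nth (infixl "$" 75)


section \<open>Complex lines, holomorphy along lines, Cauchy's estimate for the derivative\<close>

lemma norm_vector_scalar_mult: "norm (c *s (v :: complex ^ 'd)) = cmod c * norm v"
proof -
  have "norm (c *s v) = L2_set (\<lambda>i. cmod c * cmod (v $ i)) UNIV"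
    by (simp add: norm_vec_def norm_mult)
  also have "\<dots> = cmod c * L2_set (\<lambda>i. cmod (v $ i)) UNIV"
    by (simp add: L2_set_right_distrib)
  finally show ?thesis by (simp add: norm_vec_def)
qed

lemma continuous_on_vector_scalar_mult [continuous_intros]:
  "continuous_on S f \<Longrightarrow> continuous_on S g \<Longrightarrow>
    continuous_on S (\<lambda>x. f x *s (g x :: complex ^ 'd))"
  unfolding vector_scalar_mult_def
  by (intro continuous_on_vec_lambda continuous_on_mult continuous_on_component)

lemma scaleR_vector_scalar_mult:
  "r *\<^sub>R (c *s (v :: complex ^ 'd)) = (of_real r * c) *s v" "c *s (r *\<^sub>R v) = (of_real r * c) *s v"
  by (simp_all add: Finite_Cartesian_Product.vec_eq_iff scaleR_conv_of_real[where 'a = complex])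

lemma bounded_linear_vector_scalar_mult_left: "bounded_linear (\<lambda>t. t *s (v :: complex ^ 'd))"
  by (rule bounded_linear_intro[where K = "norm v"])
     (auto simp: norm_vector_scalar_mult vector_sadd_rdistrib scaleR_vector_scalar_mult scaleR_conv_of_real[where 'a = complex])

lemma norm_le_sum_components: "norm (v :: complex ^ 'd) \<le> (\<Sum>k\<in>UNIV. cmod (v $ k))"
  unfolding norm_vec_def by (rule L2_set_le_sum) simp

lemma component_le_norm: "cmod ((v :: complex ^ 'd) $ k) \<le> norm v"
  using Finite_Cartesian_Product.norm_nth_le by blast

lemma open_line_preimage:
  assumes "open W"
  shows "open {t. a + t *s (v :: complex ^ 'd) \<in> W}"
proof -
  have "continuous_on UNIV (\<lambda>t. a + t *s v)" by (intro continuous_intros)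
  then have "open ((\<lambda>t. a + t *s v) -` W)"
    using assms open_vimage by blast
  then show ?thesis by (simp add: vimage_def)
qed

lemma holomorphic_map_line_derivative:
  fixes F :: "complex ^ 'd \<Rightarrow> complex ^ 'd"
  assumes "(F has_derivative D) (at (a + t *s v))" and "\<And>c v. D (c *s v) = c *s D v"
  shows "((\<lambda>t. F (a + t *s v) $ k) has_field_derivative (D v $ k)) (at t)"
proof -
  have 1: "((\<lambda>t. a + t *s v) has_derivative (\<lambda>t. t *s v)) (at t)"
    using has_derivative_add[OF has_derivative_const
        bounded_linear_imp_has_derivative[OF bounded_linear_vector_scalar_mult_left]] by simp
  have "((\<lambda>t. F (a + t *s v)) has_derivative (\<lambda>t. D (t *s v))) (at t)"
    using diff_chain_at[OF 1 assms(1)] by (simp add: o_def)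
  then have "((\<lambda>t. F (a + t *s v) $ k) has_derivative (\<lambda>t. D (t *s v) $ k)) (at t)"
    by (rule bounded_linear.has_derivative[OF bounded_linear_vec_nth])
  moreover have "(\<lambda>t. D (t *s v) $ k) = (*) (D v $ k)"
    by (auto simp: assms(2) mult.commute)
  ultimately show ?thesis by (simp add: has_field_derivative_def)
qed

text \<open>Continuity plus holomorphy on every complex affine line (Gateaux holomorphy). It reduces
  several variables to one-variable complex analysis and passes to locally uniform limits without
  any statement about convergence of derivatives.\<close>

definition line_holomorphic :: "(complex ^ 'd \<Rightarrow> complex) \<Rightarrow> (complex ^ 'd) set \<Rightarrow> bool" where
  "line_holomorphic h W \<longleftrightarrow> continuous_on W h \<and>
     (\<forall>a v. (\<lambda>t. h (a + t *s v)) holomorphic_on {t. a + t *s v \<in> W})"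

lemma holomorphic_map_continuous:
  assumes "holomorphic_map_on F U" shows "continuous_on U F"
  unfolding continuous_on_eq_continuous_within
  using assms unfolding holomorphic_map_on_def
  by (meson continuous_at_imp_continuous_at_within has_derivative_continuous)

lemma holomorphic_map_imp_line_holomorphic:
  assumes "holomorphic_map_on F U" "open U"
  shows "line_holomorphic (\<lambda>z. F z $ k) U"
  unfolding line_holomorphic_def
proof (intro conjI allI)
  show "continuous_on U (\<lambda>z. F z $ k)"
    using holomorphic_map_continuous[OF assms(1)] by (intro continuous_intros)
  fix a v
  show "(\<lambda>t. F (a + t *s v) $ k) holomorphic_on {t. a + t *s v \<in> U}"
    using assms holomorphic_map_line_derivative
    unfolding holomorphic_on_open[OF open_line_preimage[OF assms(2)]] holomorphic_map_on_def
    by (metis (mono_tags, lifting) mem_Collect_eq)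
qed

text \<open>Restricted to the complex line through \<open>z\<close> in direction \<open>v\<close>,
  each component of \<open>F\<close> is bounded by \<open>M\<close> on a disc of radius
  \<open>\<delta> / norm v\<close>, so the one-variable Cauchy inequality applies. The factor
  \<open>CARD('d)\<close> comes from bounding a norm by the sum of the components.\<close>

lemma Cauchy_derivative_bound:
  fixes F :: "complex ^ 'd \<Rightarrow> complex ^ 'd"
  assumes hol: "holomorphic_map_on F U" and U: "open U" "cball z \<delta> \<subseteq> U" and \<delta>: "\<delta> > 0"
    and M: "\<And>y. y \<in> cball z \<delta> \<Longrightarrow> norm (F y) \<le> M"
    and D: "(F has_derivative D) (at z)" "\<And>c v. D (c *s v) = c *s D v"
  shows "norm (D v) \<le> (real CARD('d) * M / \<delta>) * norm v"
proof (cases "v = 0")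
  case True
  then show ?thesis using D(1) by (simp add: has_derivative_bounded_linear linear_0 bounded_linear.linear)
next
  case False
  define r where "r = \<delta> / norm v"
  have r: "r > 0" using False \<delta> by (simp add: r_def)
  have sub: "cball 0 r \<subseteq> {t. z + t *s v \<in> U}"
  proof
    fix t :: complex assume "t \<in> cball 0 r"
    then have "cmod t * norm v \<le> \<delta>" using False by (simp add: r_def field_simps)
    then have "z + t *s v \<in> cball z \<delta>" by (simp add: dist_norm norm_vector_scalar_mult)
    then show "t \<in> {t. z + t *s v \<in> U}" using U by auto
  qed
  have "cmod (D v $ k) \<le> M / r" for k
  proof -
    let ?g = "\<lambda>t. F (z + t *s v) $ k"
    have h: "?g holomorphic_on cball 0 r"
      using holomorphic_map_imp_line_holomorphic[OF hol U(1)] sub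
      unfolding line_holomorphic_def by (meson holomorphic_on_subset)
    have "cmod ((deriv ^^ 1) ?g 0) \<le> fact 1 * M / r ^ 1"
    proof (rule Cauchy_inequality)
      show "?g holomorphic_on ball 0 r" using h ball_subset_cball holomorphic_on_subset by blast
      show "continuous_on (cball 0 r) ?g" using h by (rule holomorphic_on_imp_continuous_on)
      fix x :: complex assume "cmod (0 - x) = r"
      then have "z + x *s v \<in> cball z \<delta>" using False
        by (simp add: dist_norm norm_vector_scalar_mult r_def)
      then show "cmod (?g x) \<le> M" using M component_le_norm order_trans by blast
    qed (use r in auto)
    moreover have "deriv ?g 0 = D v $ k"
      using holomorphic_map_line_derivative[of F D z 0 v k] D by (simp add: DERIV_imp_deriv)
    ultimately show ?thesis by simp
  qed
  then have "(\<Sum>k\<in>UNIV. cmod (D v $ k)) \<le> (\<Sum>k\<in>(UNIV :: 'd set). M / r)"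
    by (intro sum_mono)
  with norm_le_sum_components[of "D v"] show ?thesis
    by (simp add: r_def)
qed

section \<open>Solutions of the differential equation: dependence on the start, Euler's method,
  holomorphy of the flow\<close>

text \<open>The estimate goes in two steps, from \<open>S\<close> to \<open>a\<close> and from
  \<open>a\<close> to \<open>b\<close>, because an Euler polygon will be compared with a solution
  that itself is only known to stay near a reference solution.\<close>

definition lipschitz_tube where
  "lipschitz_tube V U S \<delta> M L \<longleftrightarrow> \<delta> > 0 \<and> M > 0 \<and> L > (0::real) \<and>
     (\<forall>s\<in>S. \<forall>a. norm (a - s) \<le> \<delta> \<longrightarrow> norm (V a) \<le> M \<and>
       (\<forall>b. norm (b - a) \<le> \<delta> \<longrightarrow> b \<in> U \<and> norm (V b - V a) \<le> L * norm (b - a)))"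

lemma lipschitz_tubeD:
  assumes "lipschitz_tube V U (z0 ` A) \<delta> M L"
  shows "\<delta> > 0" "M > 0" "L > 0"
    "\<And>s a. s \<in> A \<Longrightarrow> norm (a - z0 s) \<le> \<delta> \<Longrightarrow> norm (V a) \<le> M"
    "\<And>s a b. s \<in> A \<Longrightarrow> norm (a - z0 s) \<le> \<delta> \<Longrightarrow> norm (b - a) \<le> \<delta> \<Longrightarrow>
       b \<in> U \<and> norm (V b - V a) \<le> L * norm (b - a)"
  using assms unfolding lipschitz_tube_def by auto

lemma lipschitz_tube_exists:
  fixes V :: "complex ^ 'd \<Rightarrow> complex ^ 'd"
  assumes hol: "holomorphic_map_on V U" and U: "open U" and S: "compact S" "S \<subseteq> U"
  shows "\<exists>\<delta> M L. lipschitz_tube V U S \<delta> M L"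
proof -
  obtain e where e: "e > 0" "(\<Union>x\<in>S. cball x e) \<subseteq> U"
    using compact_subset_open_imp_cball_epsilon_subset[OF S(1) U S(2)] by blast
  define Q where "Q = {x + y |x y. x \<in> S \<and> y \<in> cball 0 e}"
  have Q: "compact Q" unfolding Q_def using compact_sums[OF S(1) compact_cball] by blast
  have inQ: "b \<in> Q" if "s \<in> S" "norm (b - s) \<le> e" for s b
  proof -
    have "b = s + (b - s)" "b - s \<in> cball 0 e" using that by auto
    then show ?thesis using that unfolding Q_def by blast
  qed
  have QU: "Q \<subseteq> U"
  proof
    fix q assume "q \<in> Q"
    then obtain x y where "q = x + y" "x \<in> S" "y \<in> cball 0 e" unfolding Q_def by blast
    then have "q \<in> cball x e" by (simp add: dist_norm)
    then show "q \<in> U" using e(2) \<open>x \<in> S\<close> by blast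
  qed
  have "bounded (V ` Q)"
    using compact_continuous_image[OF continuous_on_subset[OF holomorphic_map_continuous[OF hol] QU] Q]
      compact_imp_bounded by blast
  then obtain M where M: "M > 0" "\<And>q. q \<in> Q \<Longrightarrow> norm (V q) \<le> M"
    unfolding bounded_pos by blast
  \<comment> \<open>Three distances of length \<delta> have to fit into \<open>e\<close>: from
    \<open>S\<close> to \<open>a\<close>, from \<open>a\<close> to a point of the segment towards
    \<open>b\<close>, and the radius of the disc in Cauchy's estimate.\<close>
  define \<delta> where "\<delta> = e / 3"
  define L where "L = real CARD('d) * M / \<delta>"
  have \<delta>: "\<delta> > 0" and L: "L > 0" using e(1) M(1) by (auto simp: \<delta>_def L_def)
  have "norm (V a) \<le> M" if "s \<in> S" "norm (a - s) \<le> \<delta>" for s a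
    using that inQ M(2) \<delta> by (simp add: \<delta>_def)
  moreover have "b \<in> U \<and> norm (V b - V a) \<le> L * norm (b - a)"
    if s: "s \<in> S" "norm (a - s) \<le> \<delta>" "norm (b - a) \<le> \<delta>" for s a b
  proof
    have "norm (b - s) \<le> \<delta> + \<delta>"
      using norm_triangle_mono[OF s(2,3)] by (simp add: algebra_simps)
    then show "b \<in> U" using s(1) inQ QU \<delta> by (force simp: \<delta>_def)
    have c: "norm (c - s) \<le> 2 * \<delta>" if "c \<in> cball a \<delta>" for c
      using that norm_triangle_mono[OF s(2), of "c - a" \<delta>]
      by (simp add: dist_norm norm_minus_commute algebra_simps)
    obtain D where D: "\<And>z. z \<in> U \<Longrightarrow> (V has_derivative D z) (at z) \<and> (\<forall>c v. D z (c *s v) = c *s D z v)"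
      using hol unfolding holomorphic_map_on_def by metis
    have bound: "onorm (D z) \<le> L" if z: "z \<in> cball a \<delta>" for z
    proof (rule onorm_le)
      fix v
      have in2: "norm (y - s) \<le> e" if "y \<in> cball z \<delta>" for y
        using norm_triangle_mono[OF c[OF z], of "y - z" \<delta>] that
        by (simp add: dist_norm norm_minus_commute algebra_simps \<delta>_def)
      then have sub: "cball z \<delta> \<subseteq> Q" using inQ[OF s(1)] by blast
      then have "z \<in> U" using QU \<delta> by (meson centre_in_cball less_imp_le subsetD)
      show "norm (D z v) \<le> L * norm v" unfolding L_def
        by (rule Cauchy_derivative_bound[OF hol U]) (use sub QU \<delta> M(2) D[OF \<open>z \<in> U\<close>] in auto)
    qed
    have "norm (V b - V a) \<le> L * norm (b - a)"
    proof (rule differentiable_bound[of "cball a \<delta>" V D])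
      fix z assume z: "z \<in> cball a \<delta>"
      have "z \<in> U" using inQ[OF s(1)] c[OF z] QU \<delta> by (force simp: \<delta>_def)
      then show "(V has_derivative D z) (at z within cball a \<delta>)"
        using D has_derivative_at_withinI by blast
    qed (use bound s \<delta> in \<open>auto simp: dist_norm norm_minus_commute\<close>)
    then show "norm (V b - V a) \<le> L * norm (b - a)" .
  qed
  ultimately show ?thesis unfolding lipschitz_tube_def using \<delta> M(1) L by blast
qed

text \<open>A bootstrap: the differential inequality is available only while
  \<open>norm (g s)\<close> is at most \<delta>. Before the first time at which the norm reaches
  \<delta> it holds, and then Gronwall's bound together with \<open>small\<close> keeps the norm
  strictly below \<delta> at that time, a contradiction.\<close>

lemma gronwall_local:
  fixes g :: "real \<Rightarrow> 'a :: real_inner"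
  assumes der: "\<And>s. s \<in> {0..T} \<Longrightarrow> (g has_vector_derivative g' s) (at s within {0..T})"
    and bd: "\<And>s. s \<in> {0..T} \<Longrightarrow> norm (g s) \<le> \<delta> \<Longrightarrow> norm (g' s) \<le> L * norm (g s)"
    and L: "L \<ge> 0" and small: "norm (g 0) * exp (L * T) < \<delta>" and s: "s \<in> {0..T}"
  shows "norm (g s) \<le> norm (g 0) * exp (L * s)"
proof -
  have cont: "continuous_on {0..T} g"
    using der by (meson continuous_on_eq_continuous_within has_vector_derivative_continuous)
  have step: "norm (g s1) \<le> norm (g 0) * exp (L * s1)"
    if s1: "s1 \<in> {0..T}" and le: "\<And>s. 0 < s \<Longrightarrow> s < s1 \<Longrightarrow> norm (g s) \<le> \<delta>" for s1
  proof (cases "s1 = 0")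
    case False
    \<comment> \<open>The squared norm is differentiable also where \<open>g\<close> vanishes; the
      exponential factor makes it nonincreasing.\<close>
    define h where "h = (\<lambda>s. (g s \<bullet> g s) * exp (- 2 * L * s))"
    have "h s1 \<le> h 0"
    proof (rule DERIV_nonpos_imp_decreasing_open[of 0 s1 h])
      show "0 \<le> s1" using s1 by simp
      have "continuous_on {0..s1} g" by (rule continuous_on_subset[OF cont]) (use s1 in auto)
      then show "continuous_on {0..s1} h" unfolding h_def by (intro continuous_intros)
      fix x assume x: "0 < x" "x < s1"
      have "(g has_vector_derivative g' x) (at x within {0<..<T})"
        by (rule has_vector_derivative_within_subset[OF der]) (use x s1 in auto)
      then have gx: "(g has_vector_derivative g' x) (at x)"
        using x s1 by (simp add: at_within_open[of x "{0<..<T}"])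
      have "((\<lambda>s. g s \<bullet> g s) has_real_derivative (2 * (g x \<bullet> g' x))) (at x)"
        using has_derivative_inner[OF gx[unfolded has_vector_derivative_def] gx[unfolded has_vector_derivative_def]]
        unfolding has_field_derivative_def
        by (rule has_derivative_eq_rhs) (simp add: inner_commute fun_eq_iff)
      then have "(h has_real_derivative
          (2 * (g x \<bullet> g' x) * exp (- 2 * L * x) + (g x \<bullet> g x) * (exp (- 2 * L * x) * (- 2 * L)))) (at x)"
        unfolding h_def by (auto intro!: derivative_eq_intros)
      moreover have "g x \<bullet> g' x \<le> L * (g x \<bullet> g x)"
      proof -
        have "g x \<bullet> g' x \<le> norm (g x) * norm (g' x)" by (rule norm_cauchy_schwarz)
        also have "\<dots> \<le> norm (g x) * (L * norm (g x))"
          using bd[of x] le[OF x] x s1 by (intro mult_left_mono) auto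
        finally show ?thesis by (simp add: power2_norm_eq_inner[symmetric] power2_eq_square mult_ac)
      qed
      then have "2 * (g x \<bullet> g' x) * exp (- 2 * L * x) \<le> 2 * (L * (g x \<bullet> g x)) * exp (- 2 * L * x)"
        by (intro mult_right_mono) auto
      ultimately show "\<exists>y. (h has_real_derivative y) (at x) \<and> y \<le> 0"
        by (intro exI conjI) (auto simp: algebra_simps)
    qed
    then have "(g s1 \<bullet> g s1) * exp (- 2 * L * s1) * exp (2 * L * s1) \<le> (g 0 \<bullet> g 0) * exp (2 * L * s1)"
      by (simp add: h_def)
    then have "(norm (g s1))\<^sup>2 \<le> (norm (g 0) * exp (L * s1))\<^sup>2"
      by (simp add: mult.assoc exp_add[symmetric] power_mult_distrib power2_norm_eq_inner
          exp_double[symmetric])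
    then show ?thesis by (rule power2_le_imp_le) simp
  qed simp
  have "norm (g s) < \<delta>" if "s \<in> {0..T}" for s
  proof (rule ccontr)
    assume "\<not> norm (g s) < \<delta>"
    define A where "A = {0..T} \<inter> (\<lambda>s. norm (g s)) -` {\<delta>..}"
    have "closed A" unfolding A_def
      by (intro continuous_closed_preimage continuous_on_norm cont closed_atLeast closed_real_atLeastAtMost)
    then have A: "compact A" "A \<noteq> {}"
      using \<open>\<not> norm (g s) < \<delta>\<close> that unfolding A_def
      by (auto simp: compact_eq_bounded_closed intro: bounded_subset[of "{0..T}"])
    then obtain s1 where s1: "s1 \<in> A" "\<And>s. s \<in> A \<Longrightarrow> s1 \<le> s"
      using compact_attains_inf by metis
    have "norm (g s1) \<le> norm (g 0) * exp (L * s1)"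
    proof (rule step)
      fix s assume "0 < s" "s < s1"
      moreover from this have "s \<notin> A" using s1(2)[of s] by auto
      ultimately show "norm (g s) \<le> \<delta>" using s1(1) by (auto simp: A_def)
    qed (use s1 in \<open>auto simp: A_def\<close>)
    also have "\<dots> \<le> norm (g 0) * exp (L * T)"
      using s1 L by (intro mult_left_mono) (auto simp: A_def mult_left_mono)
    finally show False using small s1(1) by (auto simp: A_def)
  qed
  then show ?thesis using s by (intro step[OF s] less_imp_le) auto
qed


lemma ode_solution_diff:
  assumes "ode_solution V U T w0 z0" "ode_solution V U T w z" "s \<in> {0..T}"
  shows "((\<lambda>s. z s - z0 s) has_vector_derivative V (z s) - V (z0 s)) (at s within {0..T})"
  using assms unfolding ode_solution_def by (auto intro!: has_vector_derivative_diff)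

lemma ode_solution_continuous:
  "ode_solution V U T w z \<Longrightarrow> continuous_on {0..T} z"
  unfolding ode_solution_def
  by (meson continuous_on_eq_continuous_within has_vector_derivative_continuous)

lemma ode_lipschitz_tube:
  fixes V :: "complex ^ 'd \<Rightarrow> complex ^ 'd"
  assumes hol: "holomorphic_map_on V U" "open U" and sol: "ode_solution V U T w0 z0"
  shows "\<exists>\<delta> M L. lipschitz_tube V U (z0 ` {0..T}) \<delta> M L"
proof (rule lipschitz_tube_exists[OF hol])
  show "compact (z0 ` {0..T})"
    using ode_solution_continuous[OF sol] by (intro compact_continuous_image) auto
  show "z0 ` {0..T} \<subseteq> U" using sol unfolding ode_solution_def by blast
qed

lemma ode_dependence:
  fixes V :: "complex ^ 'd \<Rightarrow> complex ^ 'd"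
  assumes tube: "lipschitz_tube V U (z0 ` {0..T}) \<delta> M L" and sol: "ode_solution V U T w0 z0"
    and z: "ode_solution V U T w z" and small: "norm (w - w0) * exp (L * T) < \<delta>"
    and s: "s \<in> {0..T}"
  shows "norm (z s - z0 s) \<le> norm (w - w0) * exp (L * s)"
proof -
  note * = lipschitz_tubeD[OF tube]
  have 0: "z 0 - z0 0 = w - w0" using z sol by (simp add: ode_solution_def)
  have "norm (z s - z0 s) \<le> norm (z 0 - z0 0) * exp (L * s)"
  proof (rule gronwall_local[OF ode_solution_diff[OF sol z]])
    fix s assume "s \<in> {0..T}" "norm (z s - z0 s) \<le> \<delta>"
    then show "norm (V (z s) - V (z0 s)) \<le> L * norm (z s - z0 s)"
      using *(5)[of s "z0 s" "z s"] *(1) by simp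
  qed (use small s * 0 in auto)
  then show ?thesis by (simp only: 0)
qed

lemma ode_solution_unique:
  fixes V :: "complex ^ 'd \<Rightarrow> complex ^ 'd"
  assumes hol: "holomorphic_map_on V U" "open U" and z0: "ode_solution V U T w0 z0"
    and z: "ode_solution V U T w0 z" and s: "s \<in> {0..T}"
  shows "z s = z0 s"
proof -
  obtain \<delta> M L where tube: "lipschitz_tube V U (z0 ` {0..T}) \<delta> M L"
    using ode_lipschitz_tube[OF hol z0] by blast
  from ode_dependence[OF tube z0 z _ s] lipschitz_tubeD(1)[OF tube] show ?thesis by simp
qed

lemma flow_map_eq:
  fixes V :: "complex ^ 'd \<Rightarrow> complex ^ 'd"
  assumes "holomorphic_map_on V U" "open U" "ode_solution V U T w z" "T \<ge> 0"
  shows "flow_map V U T w = z T"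
  unfolding flow_map_def
proof (rule the_equality)
  show "\<exists>z'. ode_solution V U T w z' \<and> z T = z' T" using assms(3) by blast
  fix y assume "\<exists>z. ode_solution V U T w z \<and> y = z T"
  then obtain z' where z': "ode_solution V U T w z'" "y = z' T" by blast
  show "y = z T" unfolding z'(2)
    by (rule ode_solution_unique[OF assms(1,2,3) z'(1)]) (use assms(4) in simp)
qed

lemma flow_local_lipschitz:
  fixes V :: "complex ^ 'd \<Rightarrow> complex ^ 'd"
  assumes hol: "holomorphic_map_on V U" "open U" and T: "T \<ge> 0"
    and sol: "\<And>w. w \<in> K \<Longrightarrow> \<exists>z. ode_solution V U T w z" and w0: "w0 \<in> K"
  obtains \<eta> B where "\<eta> > 0" "\<And>w. w \<in> K \<Longrightarrow> norm (w - w0) < \<eta> \<Longrightarrow>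
    norm (flow_map V U T w - flow_map V U T w0) \<le> B * norm (w - w0)"
proof -
  obtain z0 where z0: "ode_solution V U T w0 z0" using sol w0 by blast
  obtain \<delta> M L where tube: "lipschitz_tube V U (z0 ` {0..T}) \<delta> M L"
    using ode_lipschitz_tube[OF hol z0] by blast
  note * = lipschitz_tubeD[OF tube]
  show thesis
  proof (rule that[of "\<delta> / exp (L * T)" "exp (L * T)"])
    show "\<delta> / exp (L * T) > 0" using * by simp
    fix w assume w: "w \<in> K" "norm (w - w0) < \<delta> / exp (L * T)"
    obtain z where z: "ode_solution V U T w z" using sol w by blast
    show "norm (flow_map V U T w - flow_map V U T w0) \<le> exp (L * T) * norm (w - w0)"
      using ode_dependence[OF tube z0 z, of T] w T
      by (simp add: flow_map_eq[OF hol z T] flow_map_eq[OF hol z0 T] field_simps)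
  qed
qed

lemma flow_continuous:
  fixes V :: "complex ^ 'd \<Rightarrow> complex ^ 'd"
  assumes hol: "holomorphic_map_on V U" "open U" and T: "T \<ge> 0"
    and sol: "\<And>w. w \<in> K \<Longrightarrow> \<exists>z. ode_solution V U T w z"
  shows "continuous_on K (flow_map V U T)"
  unfolding continuous_on_eq_continuous_within continuous_within
proof
  fix w0 assume "w0 \<in> K"
  then obtain \<eta> B where *: "\<eta> > 0" "\<And>w. w \<in> K \<Longrightarrow> norm (w - w0) < \<eta> \<Longrightarrow>
      norm (flow_map V U T w - flow_map V U T w0) \<le> B * norm (w - w0)"
    using flow_local_lipschitz[OF hol T sol] by metis
  have "\<forall>\<^sub>F w in at w0 within K. norm (w - w0) < \<eta> \<and> w \<in> K"
    using *(1) unfolding eventually_at dist_norm by auto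
  then have "\<forall>\<^sub>F w in at w0 within K. norm (flow_map V U T w - flow_map V U T w0) \<le> B * norm (w - w0)"
    by eventually_elim (use *(2) in auto)
  moreover have "((\<lambda>w. B * norm (w - w0)) \<longlongrightarrow> 0) (at w0 within K)"
    by (auto intro!: tendsto_eq_intros)
  ultimately have "((\<lambda>w. flow_map V U T w - flow_map V U T w0) \<longlongrightarrow> 0) (at w0 within K)"
    by (rule Lim_null_comparison)
  then show "(flow_map V U T \<longlongrightarrow> flow_map V U T w0) (at w0 within K)"
    by (simp add: LIM_zero_iff)
qed

definition euler_step :: "(complex ^ 'd \<Rightarrow> complex ^ 'd) \<Rightarrow> real \<Rightarrow> complex ^ 'd \<Rightarrow> complex ^ 'd" where
  "euler_step V h w = w + h *\<^sub>R V w"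

text \<open>The mean value theorem is used twice: on a step of length \<open>h\<close> the solution
  moves by at most M h, so V changes along it by at most L M h, and this bounds the derivative of
  z(a) - a V(z(s)).\<close>

lemma ode_local_error:
  fixes V :: "complex ^ 'd \<Rightarrow> complex ^ 'd"
  assumes z: "ode_solution V U T w z" and s: "0 \<le> s" "h \<ge> 0" "s + h \<le> T"
    and M: "\<And>s. s \<in> {0..T} \<Longrightarrow> norm (V (z s)) \<le> M"
    and L: "\<And>s s'. s \<in> {0..T} \<Longrightarrow> s' \<in> {0..T} \<Longrightarrow> norm (z s' - z s) \<le> \<delta> \<Longrightarrow>
         norm (V (z s') - V (z s)) \<le> L * norm (z s' - z s)"
    and "M * h \<le> \<delta>" "L \<ge> 0"
  shows "norm (z (s + h) - euler_step V h (z s)) \<le> L * M * h\<^sup>2"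
proof -
  have der: "(z has_derivative (\<lambda>x. x *\<^sub>R V (z y))) (at y within {s..s + h})" if "y \<in> {s..s + h}" for y
    using z that s has_derivative_subset[of z _ y "{0..T}" "{s..s+h}"]
    unfolding ode_solution_def has_vector_derivative_def by auto
  have "norm (V (z 0)) \<le> M" using M[of 0] s by simp
  then have M0: "M \<ge> 0" using norm_ge_zero order_trans by blast
  have mv: "norm (z y - z s) \<le> M * h" if y: "y \<in> {s..s + h}" for y
  proof -
    have "norm (z y - z s) \<le> M * norm (y - s)"
    proof (rule differentiable_bound[OF _ der])
      fix u assume "u \<in> {s..s + h}"
      then show "onorm (\<lambda>x. x *\<^sub>R V (z u)) \<le> M"
        using M[of u] s by (intro onorm_le) (simp add: mult.commute[of M] mult_left_mono)
    qed (use y s in auto)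
    also have "\<dots> \<le> M * h" using y M0 by (intro mult_left_mono) auto
    finally show ?thesis .
  qed
  have "norm ((z (s + h) - (s + h) *\<^sub>R V (z s)) - (z s - s *\<^sub>R V (z s))) \<le> (L * (M * h)) * norm ((s + h) - s)"
  proof (rule differentiable_bound[of "{s..s+h}" _ "\<lambda>u x. x *\<^sub>R V (z u) - x *\<^sub>R V (z s)"])
    fix u assume u: "u \<in> {s..s + h}"
    show "((\<lambda>a. z a - a *\<^sub>R V (z s)) has_derivative (\<lambda>x. x *\<^sub>R V (z u) - x *\<^sub>R V (z s))) (at u within {s..s + h})"
      using der[OF u] by (auto intro!: derivative_eq_intros)
    have "norm (V (z u) - V (z s)) \<le> L * norm (z u - z s)"
      using mv[OF u] u s assms(7) by (intro L) auto
    also have "\<dots> \<le> L * (M * h)" using mv[OF u] assms(8) by (intro mult_left_mono)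
    finally show "onorm (\<lambda>x. x *\<^sub>R V (z u) - x *\<^sub>R V (z s)) \<le> L * (M * h)"
      by (intro onorm_le) (simp add: scaleR_diff_right[symmetric] mult.commute[of "L * (M * h)"] mult_left_mono del: mult.assoc)
  qed (use s in auto)
  then show ?thesis using s
    by (simp add: euler_step_def algebra_simps power2_eq_square)
qed

text \<open>Discrete Gronwall: the error e_j after j steps satisfies e_(j+1) <= (1 + hL) e_j + L M
  h^2, whence e_j <= L M h^2 j (1 + hL)^j, and hj <= T makes this a multiple of h. As the bound
  stays below \<delta>, the polygon never leaves the region where the Lipschitz estimate
  holds.\<close>

lemma euler_error:
  fixes V :: "complex ^ 'd \<Rightarrow> complex ^ 'd"
  assumes z: "ode_solution V U T w z"
    and M: "\<And>s. s \<in> {0..T} \<Longrightarrow> norm (V (z s)) \<le> M"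
    and L: "\<And>s b. s \<in> {0..T} \<Longrightarrow> norm (b - z s) \<le> \<delta> \<Longrightarrow>
         b \<in> U \<and> norm (V b - V (z s)) \<le> L * norm (b - z s)"
    and pos: "L > 0" "T \<ge> 0" "k > 0" and h: "h = T / real k"
    and small: "M * h \<le> \<delta>" "L * M * T * exp (L * T) * h \<le> \<delta>"
    and j: "j \<le> k"
  shows "(euler_step V h ^^ j) w \<in> U \<and>
    norm ((euler_step V h ^^ j) w - z (real j * h)) \<le> L * M * T * exp (L * T) * h"
proof -
  have h0: "h \<ge> 0" and hk: "h * real k = T" using pos h by auto
  have "norm (V (z 0)) \<le> M" using M[of 0] pos by simp
  then have M0: "M \<ge> 0" using norm_ge_zero order_trans by blast
  have bound: "L * M * h\<^sup>2 * real j * (1 + h * L) ^ j \<le> L * M * T * exp (L * T) * h"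
    if "j \<le> k" for j
  proof -
    have hj: "h * real j \<le> T" using that h0 unfolding hk[symmetric] by (intro mult_left_mono) auto
    have "(1 + h * L) ^ j \<le> exp (h * L) ^ j" using h0 pos by (intro power_mono) auto
    also have "\<dots> = exp (L * (h * real j))" by (simp add: exp_of_nat_mult[symmetric] mult_ac)
    also have "\<dots> \<le> exp (L * T)" using hj pos by simp
    finally have "(h * real j) * (1 + h * L) ^ j \<le> T * exp (L * T)"
      using hj h0 pos by (intro mult_mono) auto
    then have "(L * M * h) * ((h * real j) * (1 + h * L) ^ j) \<le> (L * M * h) * (T * exp (L * T))"
      using M0 h0 pos by (intro mult_left_mono) auto
    then show ?thesis by (simp add: power2_eq_square mult_ac)
  qed
  have time: "real j * h \<in> {0..T}" if "j \<le> k" for j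
  proof -
    have "real j * h \<le> real k * h" using that h0 by (intro mult_right_mono) auto
    then show ?thesis using hk h0 by (simp add: mult.commute)
  qed
  have main: "norm ((euler_step V h ^^ j) w - z (real j * h)) \<le> L * M * h\<^sup>2 * real j * (1 + h * L) ^ j"
    if "j \<le> k" for j
    using that
  proof (induction j)
    case 0
    then show ?case using z by (simp add: ode_solution_def)
  next
    case (Suc j)
    let ?e = "(euler_step V h ^^ j) w" and ?a = "z (real j * h)"
    let ?c = "L * M * h\<^sup>2"
    have c: "?c \<ge> 0" using M0 pos by simp
    have IH: "norm (?e - ?a) \<le> ?c * real j * (1 + h * L) ^ j" using Suc by simp
    then have "norm (?e - ?a) \<le> \<delta>" using bound[of j] small(2) Suc.prems by linarith
    then have lip: "norm (V ?e - V ?a) \<le> L * norm (?e - ?a)"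
      using L time[of j] Suc.prems by simp
    have T1: "real j * h + h \<le> T" using time[of "Suc j"] Suc.prems by (simp add: algebra_simps)
    have loc: "norm (z (real j * h + h) - euler_step V h ?a) \<le> ?c"
    proof (rule ode_local_error[OF z, where \<delta> = \<delta>])
      show "\<And>s s'. s \<in> {0..T} \<Longrightarrow> s' \<in> {0..T} \<Longrightarrow> norm (z s' - z s) \<le> \<delta> \<Longrightarrow>
         norm (V (z s') - V (z s)) \<le> L * norm (z s' - z s)" using L by blast
    qed (use T1 h0 M small pos in auto)
    have "(euler_step V h ^^ Suc j) w - z (real (Suc j) * h) =
        (?e - ?a) + h *\<^sub>R (V ?e - V ?a) - (z (real j * h + h) - euler_step V h ?a)"
      by (simp add: euler_step_def algebra_simps)
    also have "norm \<dots> \<le> norm (?e - ?a) + norm (h *\<^sub>R (V ?e - V ?a)) +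
        norm (z (real j * h + h) - euler_step V h ?a)"
      by (intro order_trans[OF norm_triangle_ineq4] add_right_mono norm_triangle_ineq)
    also have "\<dots> \<le> norm (?e - ?a) + h * (L * norm (?e - ?a)) + ?c"
      using lip h0 loc by (auto intro!: add_mono mult_left_mono)
    also have "\<dots> = (1 + h * L) * norm (?e - ?a) + ?c" by (simp add: algebra_simps)
    also have "\<dots> \<le> (1 + h * L) * (?c * real j * (1 + h * L) ^ j) + ?c * (1 + h * L) ^ Suc j"
    proof (intro add_mono mult_left_mono IH)
      have "1 \<le> (1 + h * L) ^ Suc j" using h0 pos by (intro one_le_power) auto
      then show "?c \<le> ?c * (1 + h * L) ^ Suc j" using c mult_left_mono by fastforce
    qed (use h0 pos in auto)
    also have "\<dots> = ?c * real (Suc j) * (1 + h * L) ^ Suc j" by (simp add: algebra_simps)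
    finally show ?case .
  qed
  have "norm ((euler_step V h ^^ j) w - z (real j * h)) \<le> L * M * T * exp (L * T) * h"
    using main[OF j] bound[OF j] by linarith
  with small(2) L[OF time[OF j]] show ?thesis by auto
qed

lemma holomorphic_map_euler_step:
  assumes hol: "holomorphic_map_on V U"
    and "\<And>i w. i < j \<Longrightarrow> w \<in> W \<Longrightarrow> (euler_step V h ^^ i) w \<in> U"
  shows "holomorphic_map_on (euler_step V h ^^ j) W"
  using assms(2)
proof (induction j)
  case 0
  have "\<exists>D. ((\<lambda>w. w) has_derivative D) (at z) \<and> (\<forall>c v. D (c *s v) = c *s D v)" for z :: "complex ^ 'a"
    by (rule exI[of _ "\<lambda>w. w"]) auto
  then show ?case by (auto simp: holomorphic_map_on_def id_def)
next
  case (Suc j)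
  let ?E = "euler_step V h ^^ j"
  have IH: "holomorphic_map_on ?E W" using Suc by auto
  show ?case unfolding holomorphic_map_on_def
  proof
    fix z assume z: "z \<in> W"
    then obtain D where D: "(?E has_derivative D) (at z)" "\<And>c v. D (c *s v) = c *s D v"
      using IH unfolding holomorphic_map_on_def by blast
    have "?E z \<in> U" using Suc.prems z by auto
    then obtain D' where D': "(V has_derivative D') (at (?E z))" "\<And>c v. D' (c *s v) = c *s D' v"
      using hol unfolding holomorphic_map_on_def by blast
    have "((\<lambda>w. V (?E w)) has_derivative (\<lambda>v. D' (D v))) (at z)"
      using diff_chain_at[OF D(1) D'(1)] by (simp add: o_def)
    then have "((\<lambda>w. ?E w + h *\<^sub>R V (?E w)) has_derivative (\<lambda>v. D v + h *\<^sub>R D' (D v))) (at z)"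
      by (intro derivative_intros D(1))
    moreover have "D (c *s v) + h *\<^sub>R D' (D (c *s v)) = c *s (D v + h *\<^sub>R D' (D v))" for c v
      by (simp add: D(2) D'(2) vector_add_ldistrib scaleR_vector_scalar_mult)
    ultimately show "\<exists>D. (euler_step V h ^^ Suc j has_derivative D) (at z) \<and> (\<forall>c v. D (c *s v) = c *s D v)"
      by (intro exI[of _ "\<lambda>v. D v + h *\<^sub>R D' (D v)"]) (auto simp: euler_step_def[abs_def] o_def)
  qed
qed

text \<open>No derivative of the flow with respect to the initial value is computed. Near each point
  the flow is the uniform limit of the Euler iterates with step T / n, which are holomorphic as
  compositions, and Weierstrass' theorem on complex lines gives holomorphy of the limit.\<close>

lemma flow_line_holomorphic:
  fixes V :: "complex ^ 'd \<Rightarrow> complex ^ 'd"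
  assumes hol: "holomorphic_map_on V U" "open U" and T: "T > 0"
    and sol: "\<And>w. w \<in> K \<Longrightarrow> \<exists>z. ode_solution V U T w z"
  shows "line_holomorphic (\<lambda>w. flow_map V U T w $ k) (interior K)"
  unfolding line_holomorphic_def
proof (intro conjI allI)
  let ?f = "flow_map V U T"
  have fc: "continuous_on (interior K) ?f"
    by (rule continuous_on_subset[OF flow_continuous[OF hol less_imp_le[OF T] sol] interior_subset])
  then show "continuous_on (interior K) (\<lambda>w. ?f w $ k)" by (intro continuous_intros)
  fix a v
  let ?P = "{t. a + t *s v \<in> interior K}"
  show "(\<lambda>t. ?f (a + t *s v) $ k) holomorphic_on ?P"
    unfolding holomorphic_on_open[OF open_line_preimage[OF open_interior]]
  proof
    fix t0 assume t0: "t0 \<in> ?P"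
    define w0 where "w0 = a + t0 *s v"
    then have w0: "w0 \<in> interior K" using t0 by simp
    then have "w0 \<in> K" using interior_subset by blast
    then obtain z0 where z0: "ode_solution V U T w0 z0" using sol by blast
    obtain \<delta> M L where tube: "lipschitz_tube V U (z0 ` {0..T}) \<delta> M L"
      using ode_lipschitz_tube[OF hol z0] by blast
    note * = lipschitz_tubeD[OF tube]
    \<comment> \<open>For starting points in \<open>W\<close> the solutions stay within \<delta> of
      \<open>z0\<close>, so a single tube controls all Euler errors and they are uniform on
      \<open>W\<close>.\<close>
    define W where "W = interior K \<inter> ball w0 (\<delta> / exp (L * T))"
    have W: "open W" "w0 \<in> W" using w0 *(1) by (auto simp: W_def)
    define E where "E = (\<lambda>n. euler_step V (T / real n) ^^ n)"
    define c where "c = L * M * T * exp (L * T) * T"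
    have c: "c > 0" using * T by (simp add: c_def)
    have lim: "(\<lambda>n. x / real n) \<longlonglongrightarrow> 0" for x by (rule lim_const_over_n)
    have ev: "\<forall>\<^sub>F n in sequentially. n > 0 \<and> M * T / real n < \<delta> \<and> c / real n < \<delta>"
      using eventually_gt_at_top[of 0] order_tendstoD(2)[OF lim *(1)]
      by (intro eventually_conj) auto
    \<comment> \<open>Two uses in one statement: all partial iterates stay in \<open>U\<close>,
      which makes their composition holomorphic, and the full iterate is close to the flow.\<close>
    have err: "(euler_step V (T / real n) ^^ j) w \<in> U \<and> (j = n \<longrightarrow> norm (E n w - ?f w) \<le> c / real n)"
      if n: "n > 0 \<and> M * T / real n < \<delta> \<and> c / real n < \<delta>" and w: "w \<in> W" and j: "j \<le> n" for n w j
    proof -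
      have "w \<in> K" using w interior_subset unfolding W_def by blast
      then obtain z where z: "ode_solution V U T w z" using sol by blast
      have sm: "norm (w - w0) * exp (L * T) < \<delta>"
        using w by (simp add: W_def dist_norm norm_minus_commute field_simps)
      have near: "norm (z s - z0 s) \<le> \<delta>" if "s \<in> {0..T}" for s
      proof -
        have "norm (z s - z0 s) \<le> norm (w - w0) * exp (L * s)" using ode_dependence[OF tube z0 z sm that] .
        also have "\<dots> \<le> norm (w - w0) * exp (L * T)"
          using that *(3) by (intro mult_left_mono) auto
        finally show ?thesis using sm by simp
      qed
      have "(euler_step V (T / real n) ^^ j) w \<in> U \<and>
        norm ((euler_step V (T / real n) ^^ j) w - z (real j * (T / real n)))
          \<le> L * M * T * exp (L * T) * (T / real n)"
      proof (rule euler_error[OF z, where \<delta> = \<delta> and k = n])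
        show "\<And>s. s \<in> {0..T} \<Longrightarrow> norm (V (z s)) \<le> M" using near *(4) by blast
        show "\<And>s b. s \<in> {0..T} \<Longrightarrow> norm (b - z s) \<le> \<delta> \<Longrightarrow>
          b \<in> U \<and> norm (V b - V (z s)) \<le> L * norm (b - z s)" using near *(5) by blast
      qed (use n T j *(3) in \<open>auto simp: c_def\<close>)
      moreover have "?f w = z T" using flow_map_eq[OF hol z] T by simp
      ultimately show ?thesis using n by (auto simp: c_def E_def)
    qed
    obtain r where r: "r > 0" "cball t0 r \<subseteq> {t. a + t *s v \<in> W}"
      using open_contains_cball open_line_preimage[OF W(1)] W(2) unfolding w0_def by blast
    have "(\<lambda>t. ?f (a + t *s v) $ k) holomorphic_on ball t0 r"
    proof (rule holomorphic_uniform_limit)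
      show "\<forall>\<^sub>F n in sequentially. continuous_on (cball t0 r) (\<lambda>t. E n (a + t *s v) $ k) \<and>
          (\<lambda>t. E n (a + t *s v) $ k) holomorphic_on ball t0 r"
        using ev
      proof eventually_elim
        case (elim n)
        have "holomorphic_map_on (E n) W" unfolding E_def
          by (rule holomorphic_map_euler_step[OF hol(1)]) (use err[OF elim] in auto)
        then have "(\<lambda>t. E n (a + t *s v) $ k) holomorphic_on cball t0 r"
          using holomorphic_map_imp_line_holomorphic[OF _ W(1)] r(2)
          unfolding line_holomorphic_def by (meson holomorphic_on_subset)
        then show ?case
          using holomorphic_on_imp_continuous_on ball_subset_cball holomorphic_on_subset by blast
      qed
      show "uniform_limit (cball t0 r) (\<lambda>n t. E n (a + t *s v) $ k) (\<lambda>t. ?f (a + t *s v) $ k) sequentially"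
        unfolding uniform_limit_iff
      proof (intro allI impI)
        fix e :: real assume "e > 0"
        then have "\<forall>\<^sub>F n in sequentially. c / real n < e" using order_tendstoD(2)[OF lim] by blast
        with ev show "\<forall>\<^sub>F n in sequentially. \<forall>t\<in>cball t0 r.
            dist (E n (a + t *s v) $ k) (?f (a + t *s v) $ k) < e"
        proof eventually_elim
          case (elim n)
          show ?case
          proof
            fix t assume "t \<in> cball t0 r"
            then have "a + t *s v \<in> W" using r by blast
            from err[OF elim(1) this, of n]
            have "norm (E n (a + t *s v) - ?f (a + t *s v)) < e" using elim(2) by simp
            then show "dist (E n (a + t *s v) $ k) (?f (a + t *s v) $ k) < e"
              using component_le_norm[of "E n (a + t *s v) - ?f (a + t *s v)" k]
              by (simp add: dist_norm)
          qed
        qed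
      qed
    qed auto
    then show "\<exists>f'. ((\<lambda>t. ?f (a + t *s v) $ k) has_field_derivative f') (at t0)"
      using r(1) by (meson centre_in_ball holomorphic_on_open open_ball)
  qed
qed


section \<open>Multi-indices and polynomials in several variables\<close>

definition mdeg :: "nat ^ 'd \<Rightarrow> nat" where
  "mdeg a = (\<Sum>k\<in>UNIV. a $ k)"

lemma mdeg_add: "mdeg (a + b) = mdeg a + mdeg b"
  by (simp add: mdeg_def sum.distrib)

lemma mdeg_component_le: "a $ k \<le> mdeg a"
  unfolding mdeg_def by (rule member_le_sum) auto

text \<open>Stars and bars: appending the slack \<open>n - mdeg a\<close> as a last entry turns the
  multi-indices of degree at most n into the lists of d + 1 naturals with sum n, for which a
  counting formula is available.\<close>

lemma bij_betw_multiindex_list: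
  fixes ks :: "'d::finite list"
  assumes ks: "distinct ks" "set ks = UNIV"
  shows "bij_betw (\<lambda>a :: nat ^ 'd. map (\<lambda>k. a $ k) ks @ [n - mdeg a]) {a. mdeg a \<le> n}
           {l. length l = Suc CARD('d) \<and> sum_list l = n}"
proof -
  have len: "length ks = CARD('d)" using ks distinct_card by fastforce
  have sumks: "sum_list (map (\<lambda>k. a $ k) ks) = mdeg a" for a :: "nat ^ 'd"
    using sum_list_distinct_conv_sum_set[OF ks(1), of "\<lambda>k. a $ k"] by (simp add: ks(2) mdeg_def)
  show ?thesis
  proof (rule bij_betwI')
    fix a b :: "nat ^ 'd" assume "a \<in> {a. mdeg a \<le> n}" "b \<in> {a. mdeg a \<le> n}"
    show "(map (\<lambda>k. a $ k) ks @ [n - mdeg a] = map (\<lambda>k. b $ k) ks @ [n - mdeg b]) \<longleftrightarrow> a = b"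
      using ks(2) by (auto simp: Finite_Cartesian_Product.vec_eq_iff mdeg_def)
  next
    fix a :: "nat ^ 'd" assume "a \<in> {a. mdeg a \<le> n}"
    then show "map (\<lambda>k. a $ k) ks @ [n - mdeg a] \<in> {l. length l = Suc CARD('d) \<and> sum_list l = n}"
      using len sumks by simp
  next
    fix l :: "nat list" assume "l \<in> {l. length l = Suc CARD('d) \<and> sum_list l = n}"
    then have l: "length l = Suc CARD('d)" "sum_list l = n" by auto
    then obtain l' y where l': "l = l' @ [y]" "length l' = CARD('d)"
      by (cases l rule: rev_cases) auto
    define a :: "nat ^ 'd" where "a = (\<chi> k. the (map_of (zip ks l') k))"
    have m: "map (\<lambda>k. a $ k) ks = l'"
    proof (rule nth_equalityI)
      fix i assume i: "i < length (map (\<lambda>k. a $ k) ks)"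
      then have "map_of (zip ks l') (ks ! i) = Some (l' ! i)"
        using ks(1) len l'(2) by (intro map_of_zip_nth) auto
      with i show "map (\<lambda>k. a $ k) ks ! i = l' ! i" by (simp add: a_def)
    qed (simp add: len l')
    then have "mdeg a = sum_list l'" using sumks[of a] by simp
    moreover have "sum_list l' + y = n" using l(2) l'(1) by simp
    ultimately show "\<exists>a\<in>{a. mdeg a \<le> n}. l = map (\<lambda>k. a $ k) ks @ [n - mdeg a]"
      using m l' by (intro bexI[of _ a]) auto
  qed
qed

lemma card_multiindices:
  "finite {a :: nat ^ 'd::finite. mdeg a \<le> n}"
  "card {a :: nat ^ 'd. mdeg a \<le> n} = (n + CARD('d)) choose CARD('d)"
proof -
  obtain ks :: "'d list" where ks: "distinct ks" "set ks = UNIV"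
    using finite_distinct_list[OF finite[of "UNIV :: 'd set"]] by blast
  note bij = bij_betw_multiindex_list[OF ks, of n]
  let ?L = "{l :: nat list. length l = Suc CARD('d) \<and> sum_list l = n}"
  have card: "card ?L = (n + CARD('d)) choose CARD('d)"
    using card_length_sum_list[of "Suc CARD('d)" n] binomial_symmetric[of n "n + CARD('d)"] by simp
  moreover have "(n + CARD('d)) choose CARD('d) > 0" by simp
  ultimately have "card ?L > 0" by (simp only:)
  then have "finite ?L" by (rule card_ge_0_finite)
  then show "finite {a :: nat ^ 'd. mdeg a \<le> n}" using bij_betw_finite[OF bij] by blast
  show "card {a :: nat ^ 'd. mdeg a \<le> n} = (n + CARD('d)) choose CARD('d)"
    by (simp only: bij_betw_same_card[OF bij] card)
qed

lemma monomial_fun_scale: "monomial_fun a (t *s x) = t ^ mdeg a * monomial_fun a x"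
  by (simp add: monomial_fun_def mdeg_def power_mult_distrib prod.distrib power_sum)

lemma monomial_fun_add: "monomial_fun (a + b) x = monomial_fun a x * monomial_fun b x"
  by (simp add: monomial_fun_def power_add prod.distrib)

lemma monomial_fun_zero [simp]: "monomial_fun 0 x = 1"
  by (simp add: monomial_fun_def)

lemma monomial_fun_axis: "monomial_fun (axis k 1) x = x $ k"
proof -
  have "monomial_fun (axis k 1) x = (\<Prod>i\<in>UNIV. if i = k then x $ k else 1)"
    unfolding monomial_fun_def by (intro prod.cong) (auto simp: axis_def)
  then show ?thesis by simp
qed

lemma norm_monomial_fun_le: "cmod (monomial_fun a x) \<le> norm x ^ mdeg a"
proof -
  have "cmod (monomial_fun a x) = (\<Prod>k\<in>UNIV. cmod (x $ k) ^ (a $ k))"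
    by (simp add: monomial_fun_def prod_norm[symmetric] norm_power)
  also have "\<dots> \<le> (\<Prod>k\<in>UNIV. norm x ^ (a $ k))"
    by (intro prod_mono conjI power_mono component_le_norm) auto
  finally show ?thesis by (simp add: mdeg_def power_sum)
qed

lemma continuous_on_monomial_fun [continuous_intros]:
  "continuous_on S f \<Longrightarrow> continuous_on S (\<lambda>x. monomial_fun a (f x))"
  unfolding monomial_fun_def by (intro continuous_intros)

text \<open>Terms with the same exponent are collected before the coefficients of the vanishing
  polynomial are compared.\<close>

lemma polyfun_sum_eq_0:
  fixes c :: "'a \<Rightarrow> complex"
  assumes F: "finite F" and z: "\<And>t. (\<Sum>a\<in>F. c a * t ^ g a) = 0"
  shows "(\<Sum>a\<in>{a\<in>F. g a = i}. c a) = 0"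
proof -
  define n where "n = Max (insert i (g ` F))"
  have n: "g ` F \<subseteq> {..n}" "i \<le> n" unfolding n_def using F by auto
  have "(\<Sum>j\<le>n. (\<Sum>a\<in>{a\<in>F. g a = j}. c a) * t ^ j) = 0" for t
  proof -
    have "(\<Sum>j\<le>n. (\<Sum>a\<in>{a\<in>F. g a = j}. c a) * t ^ j) =
        (\<Sum>j\<le>n. (\<Sum>a\<in>{a\<in>F. g a = j}. c a * t ^ g a))"
      by (simp add: sum_distrib_right)
    also have "\<dots> = (\<Sum>a\<in>F. c a * t ^ g a)"
      by (rule sum.group) (use F n in auto)
    finally show ?thesis using z by simp
  qed
  then show ?thesis using Transcendental.polyfun_eq_0[of "\<lambda>j. \<Sum>a\<in>{a\<in>F. g a = j}. c a" n] n(2) by blast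
qed

text \<open>The variables are separated one at a time: as a polynomial in x_k the sum vanishes, so
  the part with exponent \<open>b $ k\<close> already vanishes. After all variables only the term of
  \<open>b\<close> is left.\<close>

lemma monomial_fun_independent:
  fixes c :: "nat ^ 'd \<Rightarrow> complex"
  assumes F: "finite F" and z: "\<And>x. (\<Sum>a\<in>F. c a * monomial_fun a x) = 0" and b: "b \<in> F"
  shows "c b = 0"
proof -
  have main: "(\<Sum>a\<in>{a\<in>G. \<forall>k\<in>S. a $ k = b $ k}. c a) = 0"
    if "finite S" "finite G" "\<And>x. (\<Sum>a\<in>G. c a * (\<Prod>k\<in>S. (x k) ^ (a $ k))) = 0" for S G
    using that
  proof (induction S arbitrary: G rule: finite_induct)
    case empty
    then show ?case by simp
  next
    case (insert k S)
    have "(\<Sum>a\<in>{a\<in>{a\<in>G. a $ k = b $ k}. \<forall>k\<in>S. a $ k = b $ k}. c a) = 0"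
    proof (rule insert.IH)
      show "finite {a\<in>G. a $ k = b $ k}" using insert.prems by simp
      fix x :: "'d \<Rightarrow> complex"
      show "(\<Sum>a\<in>{a\<in>G. a $ k = b $ k}. c a * (\<Prod>k\<in>S. (x k) ^ (a $ k))) = 0"
      proof (rule polyfun_sum_eq_0)
        fix t
        have "(\<Prod>i\<in>S. (x(k := t)) i ^ (a $ i)) = (\<Prod>i\<in>S. x i ^ (a $ i))" for a
          using insert.hyps by (intro prod.cong) auto
        then show "(\<Sum>a\<in>G. c a * (\<Prod>k\<in>S. (x k) ^ (a $ k)) * t ^ (a $ k)) = 0"
          using insert.prems(2)[of "x(k := t)"] insert.hyps by (simp add: mult_ac)
      qed (use insert.prems in simp)
    qed
    moreover have "{a\<in>{a\<in>G. a $ k = b $ k}. \<forall>k\<in>S. a $ k = b $ k} = {a\<in>G. \<forall>k\<in>insert k S. a $ k = b $ k}"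
      by auto
    ultimately show ?case by simp
  qed
  have "(\<Sum>a\<in>{a\<in>F. \<forall>k\<in>UNIV. a $ k = b $ k}. c a) = 0"
  proof (rule main)
    fix x :: "'d \<Rightarrow> complex"
    show "(\<Sum>a\<in>F. c a * (\<Prod>k\<in>UNIV. (x k) ^ (a $ k))) = 0"
      using z[of "\<chi> k. x k"] by (simp add: monomial_fun_def)
  qed (use F in auto)
  moreover have "{a\<in>F. \<forall>k\<in>UNIV. a $ k = b $ k} = {b}"
    using b by (auto simp: Finite_Cartesian_Product.vec_eq_iff)
  ultimately show ?thesis by simp
qed

definition multipoly :: "(complex ^ 'd \<Rightarrow> complex) \<Rightarrow> bool" where
  "multipoly h \<longleftrightarrow> (\<exists>F c. finite F \<and> (\<forall>x. h x = (\<Sum>a\<in>F. c a * monomial_fun a x)))"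

text \<open>The exponents \<open>g i\<close> may repeat, so sums and products can be indexed by
  disjoint unions and pairs without merging equal monomials.\<close>

lemma multipoly_family:
  assumes "finite I" "\<And>x. h x = (\<Sum>i\<in>I. c i * monomial_fun (g i) x)"
  shows "multipoly h"
  unfolding multipoly_def
proof (intro exI conjI allI)
  show "finite (g ` I)" using assms by simp
  fix x
  have "(\<Sum>a\<in>g ` I. (\<Sum>i\<in>{i\<in>I. g i = a}. c i) * monomial_fun a x) =
      (\<Sum>a\<in>g ` I. (\<Sum>i\<in>{i\<in>I. g i = a}. c i * monomial_fun (g i) x))"
    by (simp add: sum_distrib_right)
  also have "\<dots> = h x" unfolding assms(2) by (rule sum.group) (use assms in auto)
  finally show "h x = (\<Sum>a\<in>g ` I. (\<Sum>i\<in>{i\<in>I. g i = a}. c i) * monomial_fun a x)" ..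
qed

lemma multipoly_const: "multipoly (\<lambda>x. b)"
  by (rule multipoly_family[of "{()}" _ "\<lambda>_. b" "\<lambda>_. 0"]) auto

lemma multipoly_component: "multipoly (\<lambda>x. x $ k)"
  by (rule multipoly_family[of "{()}" _ "\<lambda>_. 1" "\<lambda>_. axis k 1"]) (simp_all add: monomial_fun_axis[unfolded One_nat_def])

lemma multipoly_add:
  assumes "multipoly f" "multipoly g" shows "multipoly (\<lambda>x. f x + g x)"
proof -
  obtain F c G d where *: "finite F" "\<And>x. f x = (\<Sum>a\<in>F. c a * monomial_fun a x)"
    "finite G" "\<And>x. g x = (\<Sum>a\<in>G. d a * monomial_fun a x)"
    using assms unfolding multipoly_def by metis
  show ?thesis
    by (rule multipoly_family[of "F <+> G" _ "case_sum c d" "case_sum id id"])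
       (use * in \<open>simp_all add: sum.Plus\<close>)
qed

lemma multipoly_mult:
  assumes "multipoly f" "multipoly g" shows "multipoly (\<lambda>x. f x * g x)"
proof -
  obtain F c G d where *: "finite F" "\<And>x. f x = (\<Sum>a\<in>F. c a * monomial_fun a x)"
    "finite G" "\<And>x. g x = (\<Sum>a\<in>G. d a * monomial_fun a x)"
    using assms unfolding multipoly_def by metis
  show ?thesis
    by (rule multipoly_family[of "F \<times> G" _ "\<lambda>(a, b). c a * d b" "\<lambda>(a, b). a + b"])
       (use * in \<open>auto simp: sum_product sum.cartesian_product monomial_fun_add
          intro!: sum.cong\<close>)
qed

lemma multipoly_sum: "(\<And>i. i \<in> I \<Longrightarrow> multipoly (f i)) \<Longrightarrow> multipoly (\<lambda>x. \<Sum>i\<in>I. f i x)"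
  by (induction I rule: infinite_finite_induct) (auto intro: multipoly_const multipoly_add)

lemma multipoly_prod: "(\<And>i. i \<in> I \<Longrightarrow> multipoly (f i)) \<Longrightarrow> multipoly (\<lambda>x. \<Prod>i\<in>I. f i x)"
  by (induction I rule: infinite_finite_induct) (auto intro: multipoly_const multipoly_mult)

text \<open>Lagrange polynomials for the nodes 0, ..., l. The body uses only sums, products and
  constants, so that the closure rules of \<open>multipoly\<close> apply to it directly.\<close>

definition lagrange_basis :: "nat \<Rightarrow> nat \<Rightarrow> complex \<Rightarrow> complex" where
  "lagrange_basis l j t = (\<Prod>i\<in>{..l} - {j}. inverse (of_nat j - of_nat i) * (t + - of_nat i))"

lemma lagrange_interpolation:
  fixes b :: "nat \<Rightarrow> complex"
  assumes f: "\<And>t. f t = (\<Sum>i\<le>l. b i * t ^ i)"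
  shows "f t = (\<Sum>j\<le>l. lagrange_basis l j t * f (of_nat j))"
proof -
  define P where "P = (\<Sum>i\<le>l. monom (b i) i)"
  define B where "B j = (\<Prod>i\<in>{..l} - {j}. [:- of_nat i * inverse (of_nat j - of_nat i),
    inverse (of_nat j - of_nat i :: complex):])" for j
  define Q where "Q = (\<Sum>j\<le>l. Polynomial.smult (f (of_nat j)) (B j))"
  have P: "poly P t = f t" for t
    by (simp add: P_def f poly_sum poly_monom)
  have B: "poly (B j) t = lagrange_basis l j t" for j t
    by (simp add: B_def lagrange_basis_def poly_prod algebra_simps)
  have Q: "poly Q t = (\<Sum>j\<le>l. lagrange_basis l j t * f (of_nat j))" for t
    by (simp add: Q_def poly_sum B mult.commute)
  have node: "lagrange_basis l j (of_nat i) = (if i = j then 1 else 0)" if "i \<le> l" "j \<le> l" for i j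
  proof (cases "i = j")
    case True
    then show ?thesis unfolding lagrange_basis_def by (auto intro!: prod.neutral)
  next
    case False
    then show ?thesis unfolding lagrange_basis_def using that by (auto intro!: prod_zero)
  qed
  have degB: "degree (B j) \<le> l" if "j \<le> l" for j
  proof -
    have "degree (B j) \<le> sum (degree \<circ> (\<lambda>i. [:- of_nat i * inverse (of_nat j - of_nat i),
        inverse (of_nat j - of_nat i :: complex):])) ({..l} - {j})"
      unfolding B_def by (rule degree_prod_sum_le) simp
    also have "\<dots> \<le> (\<Sum>i\<in>{..l} - {j}. 1)" by (intro sum_mono) (auto simp: degree_pCons_le)
    finally show ?thesis using that by simp
  qed
  have "P = Q"
  proof (rule poly_eqI_degree)
    fix x :: complex assume "x \<in> of_nat ` {..l}"
    then obtain i where i: "x = of_nat i" "i \<le> l" by auto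
    have "poly Q x = (\<Sum>j\<le>l. (if i = j then f (of_nat j) else 0))"
      unfolding Q i(1) by (intro sum.cong) (use i node in auto)
    then show "poly P x = poly Q x" using i by (simp add: P)
  next
    have c: "card (of_nat ` {..l} :: complex set) = Suc l"
      by (subst card_image) (auto simp: inj_on_def)
    have "degree P \<le> l" unfolding P_def
      by (intro degree_sum_le) (auto intro: order_trans[OF degree_monom_le])
    then show "degree P < card (of_nat ` {..l} :: complex set)" using c by simp
    have "degree Q \<le> l" unfolding Q_def
      by (intro degree_sum_le) (auto simp: degB)
    then show "degree Q < card (of_nat ` {..l} :: complex set)" using c by simp
  qed
  then show ?thesis using P Q by metis
qed

text \<open>Interpolate in one coordinate after another. Along the k-th axis the degree is at most
  l, so \<open>h\<close> is a combination of its values at x_k = 0, ..., l with Lagrange polynomials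
  in x_k as coefficients; these values no longer depend on x_k.\<close>

lemma multipoly_if_polynomial_on_lines:
  fixes h :: "complex ^ 'd \<Rightarrow> complex"
  assumes "\<And>a v. \<exists>b. \<forall>t. h (a + t *s v) = (\<Sum>i\<le>l. b i * t ^ i)"
  shows "multipoly h"
proof -
  \<comment> \<open>Only the coordinates in \<open>S\<close> vary, the others are frozen at
    \<open>y\<close>. The induction needs every \<open>y\<close>, because the interpolation nodes
    are inserted there.\<close>
  have "multipoly (\<lambda>x. h (\<chi> k. if k \<in> S then x $ k else y $ k))" if "finite S" for S y
    using that
  proof (induction S arbitrary: y rule: finite_induct)
    case empty
    then show ?case by (simp add: multipoly_const)
  next
    case (insert k S)
    let ?mix = "\<lambda>x y. (\<chi> i. if i \<in> S then x $ i else y $ i) :: complex ^ 'd"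
    let ?upd = "\<lambda>t. (\<chi> i. if i = k then t else y $ i) :: complex ^ 'd"
    have "h (\<chi> i. if i \<in> insert k S then x $ i else y $ i) =
      (\<Sum>j\<le>l. lagrange_basis l j (x $ k) * h (?mix x (?upd (of_nat j))))" for x
    proof -
      have line: "?mix x (?upd t) = ?mix x (?upd 0) + t *s axis k 1" for t
        using insert.hyps by (auto simp: Finite_Cartesian_Product.vec_eq_iff axis_def)
      obtain b where b: "\<And>t. h (?mix x (?upd 0) + t *s axis k 1) = (\<Sum>i\<le>l. b i * t ^ i)"
        using assms by blast
      have "(\<chi> i. if i \<in> insert k S then x $ i else y $ i) = ?mix x (?upd (x $ k))"
        using insert.hyps by (auto simp: Finite_Cartesian_Product.vec_eq_iff)
      then show ?thesis
        using lagrange_interpolation[OF b, of "x $ k"] by (simp add: line[symmetric])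
    qed
    moreover have "multipoly (\<lambda>x. \<Sum>j\<le>l. lagrange_basis l j (x $ k) * h (?mix x (?upd (of_nat j))))"
      unfolding lagrange_basis_def
      by (intro multipoly_sum multipoly_mult multipoly_prod multipoly_add multipoly_const
            multipoly_component insert.IH)
    ultimately show ?case by simp
  qed
  from this[of UNIV] show ?thesis by simp
qed

lemma multipoly_homogeneous:
  fixes h :: "complex ^ 'd \<Rightarrow> complex"
  assumes "multipoly h" "\<And>t x. h (t *s x) = t ^ l * h x"
  shows "\<exists>c. \<forall>x. h x = (\<Sum>a | mdeg a = l. c a * monomial_fun a x)"
proof -
  obtain F c where F: "finite F" "\<And>x. h x = (\<Sum>a\<in>F. c a * monomial_fun a x)"
    using assms(1) unfolding multipoly_def by blast
  have fin: "finite {a :: nat ^ 'd. mdeg a = l}"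
    by (rule finite_subset[OF _ card_multiindices(1)[of l]]) auto
  show ?thesis
  proof (intro exI allI)
    fix x
    \<comment> \<open>The value \<open>- h x\<close> is added as one more term of degree l, under
      the index \<open>None\<close>, so that homogeneity becomes the vanishing of a single
      polynomial in t.\<close>
    let ?e = "\<lambda>i. case i of None \<Rightarrow> - h x | Some a \<Rightarrow> c a * monomial_fun a x"
    let ?g = "\<lambda>i. case i of None \<Rightarrow> l | Some a \<Rightarrow> mdeg a"
    have "(\<Sum>i\<in>{i \<in> insert None (Some ` F). ?g i = l}. ?e i) = 0"
    proof (rule polyfun_sum_eq_0)
      fix t
      have "(\<Sum>a\<in>F. c a * monomial_fun a x * t ^ mdeg a) = t ^ l * h x"
        using assms(2)[of t x] unfolding F(2) by (simp add: monomial_fun_scale mult_ac)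
      then show "(\<Sum>i\<in>insert None (Some ` F). ?e i * t ^ ?g i) = 0"
        using F(1) by (simp add: sum.reindex)
    qed (use F in auto)
    also have "{i \<in> insert None (Some ` F). ?g i = l} = insert None (Some ` {a\<in>F. mdeg a = l})"
      by auto
    also have "(\<Sum>i\<in>\<dots>. ?e i) = - h x + (\<Sum>a\<in>{a\<in>F. mdeg a = l}. c a * monomial_fun a x)"
      using F(1) by (simp add: sum.reindex)
    finally have "h x = (\<Sum>a\<in>{a\<in>F. mdeg a = l}. c a * monomial_fun a x)" by simp
    also have "\<dots> = (\<Sum>a | mdeg a = l. (if a \<in> F then c a else 0) * monomial_fun a x)"
      using fin by (intro sum.mono_neutral_cong_left) auto
    finally show "h x = (\<Sum>a | mdeg a = l. (if a \<in> F then c a else 0) * monomial_fun a x)" .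
  qed
qed


section \<open>Taylor expansion at 0 of functions holomorphic on lines\<close>

text \<open>Cauchy's inequality requires continuity on a closed disc; it is used for radii s < r,
  and s then tends to r.\<close>

lemma power_series_coefficient_le:
  assumes g: "g holomorphic_on ball 0 r" and r: "r > 0"
    and M: "\<And>t. cmod t < r \<Longrightarrow> cmod (g t) \<le> M"
  shows "cmod ((deriv ^^ l) g 0 / fact l) \<le> M / r ^ l"
proof (rule tendsto_lowerbound)
  show "((\<lambda>s. M / s ^ l) \<longlongrightarrow> M / r ^ l) (at_left r)"
    using r by (auto intro!: tendsto_intros)
  show "\<forall>\<^sub>F s in at_left r. cmod ((deriv ^^ l) g 0 / fact l) \<le> M / s ^ l"
    using eventually_at_left_real[OF r]
  proof eventually_elim
    case (elim s)
    have sub: "cball 0 s \<subseteq> ball (0::complex) r" using elim by auto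
    have "cmod ((deriv ^^ l) g 0) \<le> fact l * M / s ^ l"
    proof (rule Cauchy_inequality)
      show "g holomorphic_on ball 0 s" using g sub ball_subset_cball holomorphic_on_subset by blast
      show "continuous_on (cball 0 s) g"
        using g sub holomorphic_on_imp_continuous_on holomorphic_on_subset by blast
      fix x :: complex assume "cmod (0 - x) = s"
      then show "cmod (g x) \<le> M" using elim by (intro M) simp
    qed (use elim in auto)
    then show ?case by (simp add: norm_divide field_simps)
  qed
qed (rule trivial_limit_at_left_real)

lemma power_series_remainder_le:
  assumes g: "g holomorphic_on ball 0 r" and r: "r > 1"
    and M: "\<And>t. cmod t < r \<Longrightarrow> cmod (g t) \<le> M"
  shows "cmod (g 1 - (\<Sum>l\<le>n. (deriv ^^ l) g 0 / fact l)) \<le> M * (1 / r) ^ Suc n / (1 - 1 / r)"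
proof (rule norm_sums_le)
  let ?a = "\<lambda>l. (deriv ^^ l) g 0 / fact l"
  have "?a sums g 1" using holomorphic_power_series[OF g, of 1] r by simp
  from sums_split_initial_segment[OF this, of "Suc n"]
  show "(\<lambda>k. ?a (k + Suc n)) sums (g 1 - (\<Sum>l\<le>n. ?a l))"
    by (simp only: lessThan_Suc_atMost)
  have "(\<lambda>k. (1 / r) ^ k) sums (1 / (1 - 1 / r))" using r by (intro geometric_sums) auto
  from sums_mult[OF this, of "M * (1 / r) ^ Suc n"]
  show "(\<lambda>k. M * (1 / r) ^ Suc n * (1 / r) ^ k) sums (M * (1 / r) ^ Suc n / (1 - 1 / r))" by simp
  fix k
  have "cmod (?a (k + Suc n)) \<le> M / r ^ (k + Suc n)"
    by (rule power_series_coefficient_le[OF g]) (use r M in auto)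
  also have "\<dots> = M * (1 / r) ^ Suc n * (1 / r) ^ k"
    using r by (simp add: power_add power_one_over field_simps)
  finally show "cmod (?a (k + Suc n)) \<le> M * (1 / r) ^ Suc n * (1 / r) ^ k" .
qed

text \<open>The homogeneous part of degree l of the Taylor series at 0, read off along the ray
  through \<open>x\<close> so that no higher partial derivatives are needed. That it is a polynomial
  in \<open>x\<close> is the content of \<open>taylor_term_polynomial\<close>.\<close>

definition taylor_term :: "(complex ^ 'd \<Rightarrow> complex) \<Rightarrow> nat \<Rightarrow> complex ^ 'd \<Rightarrow> complex" where
  "taylor_term h l x = (deriv ^^ l) (\<lambda>t. h (t *s x)) 0 / fact l"

lemma line_holomorphic_ray:
  assumes "line_holomorphic h W" "\<And>t. cmod t < r \<Longrightarrow> t *s x \<in> W"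
  shows "(\<lambda>t. h (t *s x)) holomorphic_on ball 0 r"
proof -
  have "(\<lambda>t. h (0 + t *s x)) holomorphic_on {t. 0 + t *s x \<in> W}"
    using assms(1) unfolding line_holomorphic_def by blast
  then show ?thesis using assms(2) by (auto intro: holomorphic_on_subset)
qed

lemma taylor_term_le:
  assumes "line_holomorphic h W" "r > 0"
    and "\<And>t. cmod t < r \<Longrightarrow> t *s x \<in> W \<and> cmod (h (t *s x)) \<le> M"
  shows "cmod (taylor_term h l x) \<le> M / r ^ l"
  unfolding taylor_term_def
  by (rule power_series_coefficient_le[OF line_holomorphic_ray[OF assms(1)]]) (use assms in auto)

lemma taylor_remainder_le:
  assumes "line_holomorphic h W" "r > 1"
    and "\<And>t. cmod t < r \<Longrightarrow> t *s x \<in> W \<and> cmod (h (t *s x)) \<le> M"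
  shows "cmod (h x - (\<Sum>l\<le>n. taylor_term h l x)) \<le> M * (1 / r) ^ Suc n / (1 - 1 / r)"
  unfolding taylor_term_def
  using power_series_remainder_le[OF line_holomorphic_ray[OF assms(1)] assms(2), of x M n] assms(3)
  by simp

lemma taylor_term_scale:
  assumes h: "line_holomorphic h W" and W: "open W" "0 \<in> W"
  shows "taylor_term h l (c *s x) = c ^ l * taylor_term h l x"
proof -
  let ?T = "{t. 0 + t *s x \<in> W}" and ?S = "{t. 0 + t *s (c *s x) \<in> W}"
  have "(\<lambda>t. h (0 + t *s x)) holomorphic_on ?T"
    using h unfolding line_holomorphic_def by blast
  then have "(deriv ^^ l) (\<lambda>w. (\<lambda>t. h (0 + t *s x)) (c * w)) 0 = c ^ l * (deriv ^^ l) (\<lambda>t. h (0 + t *s x)) (c * 0)"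
  proof (rule higher_deriv_compose_linear[where S = ?S])
    show "open ?S" "open ?T" using open_line_preimage[OF W(1)] by blast+
  qed (use W in \<open>auto simp: mult.commute\<close>)
  then show ?thesis by (simp add: taylor_term_def mult.commute)
qed

lemma line_holomorphic_subset: "line_holomorphic h W \<Longrightarrow> W' \<subseteq> W \<Longrightarrow> line_holomorphic h W'"
  unfolding line_holomorphic_def
  by (auto intro: continuous_on_subset holomorphic_on_subset)

lemma line_holomorphic_const: "line_holomorphic (\<lambda>x. c) W"
  unfolding line_holomorphic_def by auto

lemma line_holomorphic_diff:
  "line_holomorphic f W \<Longrightarrow> line_holomorphic g W \<Longrightarrow> line_holomorphic (\<lambda>x. f x - g x) W"
  unfolding line_holomorphic_def by (auto intro!: continuous_intros holomorphic_intros)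

lemma line_holomorphic_add:
  "line_holomorphic f W \<Longrightarrow> line_holomorphic g W \<Longrightarrow> line_holomorphic (\<lambda>x. f x + g x) W"
  unfolding line_holomorphic_def by (auto intro!: continuous_intros holomorphic_intros)

lemma line_holomorphic_mult:
  "line_holomorphic f W \<Longrightarrow> line_holomorphic g W \<Longrightarrow> line_holomorphic (\<lambda>x. f x * g x) W"
  unfolding line_holomorphic_def by (auto intro!: continuous_intros holomorphic_intros)

lemma line_holomorphic_sum:
  "(\<And>i. i \<in> I \<Longrightarrow> line_holomorphic (f i) W) \<Longrightarrow> line_holomorphic (\<lambda>x. \<Sum>i\<in>I. f i x) W"
  by (induction I rule: infinite_finite_induct) (auto intro: line_holomorphic_const line_holomorphic_add)

lemma line_holomorphic_power:
  "line_holomorphic f W \<Longrightarrow> line_holomorphic (\<lambda>x. f x ^ n) W"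
  by (induction n) (auto intro: line_holomorphic_const line_holomorphic_mult)

lemma line_holomorphic_prod:
  "(\<And>i. i \<in> I \<Longrightarrow> line_holomorphic (f i) W) \<Longrightarrow> line_holomorphic (\<lambda>x. \<Prod>i\<in>I. f i x) W"
  by (induction I rule: infinite_finite_induct) (auto intro: line_holomorphic_const line_holomorphic_mult)

lemma line_holomorphic_exp:
  "line_holomorphic f W \<Longrightarrow> line_holomorphic (\<lambda>x. exp (f x)) W"
  unfolding line_holomorphic_def by (auto intro!: continuous_intros holomorphic_intros)

lemma line_holomorphic_component: "line_holomorphic (\<lambda>x. x $ k) W"
  unfolding line_holomorphic_def by (auto intro!: continuous_intros holomorphic_intros)

lemma line_holomorphic_affine:
  assumes "line_holomorphic h W" "\<And>x. x \<in> W' \<Longrightarrow> p + c *s x \<in> W"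
  shows "line_holomorphic (\<lambda>x. h (p + c *s x)) W'"
  unfolding line_holomorphic_def
proof (intro conjI allI)
  have "continuous_on ((\<lambda>x. p + c *s x) ` W') h"
    using assms unfolding line_holomorphic_def by (auto intro: continuous_on_subset)
  then show "continuous_on W' (\<lambda>x. h (p + c *s x))"
    by (rule continuous_on_compose2) (auto intro!: continuous_intros)
  fix a v
  have "(\<lambda>t. h ((p + c *s a) + t *s (c *s v))) holomorphic_on {t. (p + c *s a) + t *s (c *s v) \<in> W}"
    using assms(1) unfolding line_holomorphic_def by blast
  moreover have "(p + c *s a) + t *s (c *s v) = p + c *s (a + t *s v)" for t
    by (simp add: vector_add_ldistrib mult.commute add.assoc)
  ultimately have "(\<lambda>t. h (p + c *s (a + t *s v))) holomorphic_on {t. p + c *s (a + t *s v) \<in> W}"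
    by (simp only:)
  then show "(\<lambda>t. h (p + c *s (a + t *s v))) holomorphic_on {t. a + t *s v \<in> W'}"
    by (rule holomorphic_on_subset) (use assms(2) in blast)
qed

lemma uniform_limit_boundI:
  fixes F :: "'c \<Rightarrow> 'a \<Rightarrow> 'b::metric_space"
  assumes ev: "\<forall>\<^sub>F n in G. \<forall>x\<in>S. dist (F n x) (h x) \<le> b n" and b: "(b \<longlongrightarrow> (0::real)) G"
  shows "uniform_limit S F h G"
  unfolding uniform_limit_iff
proof (intro allI impI)
  fix e :: real assume "e > 0"
  then have "\<forall>\<^sub>F n in G. b n < e" using b order_tendstoD(2) by blast
  with ev show "\<forall>\<^sub>F n in G. \<forall>x\<in>S. dist (F n x) (h x) < e"
    by eventually_elim (auto intro: le_less_trans)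
qed

lemma line_holomorphic_uniform_limit:
  assumes loc: "\<And>z. z \<in> W \<Longrightarrow> \<exists>e F. e > 0 \<and> uniform_limit (ball z e) F h sequentially \<and>
      (\<forall>\<^sub>F n in sequentially. line_holomorphic (F n) (ball z e))" and W: "open W"
  shows "line_holomorphic h W"
  unfolding line_holomorphic_def
proof (intro conjI allI)
  show "continuous_on W h"
  proof (intro continuous_at_imp_continuous_on ballI)
    fix z assume "z \<in> W"
    then obtain e F where e: "e > 0" "uniform_limit (ball z e) F h sequentially"
      "\<forall>\<^sub>F n in sequentially. line_holomorphic (F n) (ball z e)" using loc by blast
    have "\<forall>\<^sub>F n in sequentially. continuous_on (ball z e) (F n)"
      using e(3) by eventually_elim (simp add: line_holomorphic_def)
    then have "continuous_on (ball z e) h"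
      by (rule uniform_limit_theorem[OF _ e(2)]) simp
    then show "isCont h z" using e(1) continuous_on_interior by force
  qed
  fix a v
  show "(\<lambda>t. h (a + t *s v)) holomorphic_on {t. a + t *s v \<in> W}"
    unfolding holomorphic_on_open[OF open_line_preimage[OF W]]
  proof
    fix t0 assume "t0 \<in> {t. a + t *s v \<in> W}"
    then obtain e F where e: "e > 0" "uniform_limit (ball (a + t0 *s v) e) F h sequentially"
      "\<forall>\<^sub>F n in sequentially. line_holomorphic (F n) (ball (a + t0 *s v) e)" using loc by blast
    obtain r where r: "r > 0" "cball t0 r \<subseteq> {t. a + t *s v \<in> ball (a + t0 *s v) e}"
    proof -
      have "t0 \<in> {t. a + t *s v \<in> ball (a + t0 *s v) e}" using e(1) by simp
      then show ?thesis using that open_line_preimage[OF open_ball] open_contains_cball by blast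
    qed
    have "(\<lambda>t. h (a + t *s v)) holomorphic_on ball t0 r"
    proof (rule holomorphic_uniform_limit)
      show "\<forall>\<^sub>F n in sequentially. continuous_on (cball t0 r) (\<lambda>t. F n (a + t *s v)) \<and>
          (\<lambda>t. F n (a + t *s v)) holomorphic_on ball t0 r"
        using e(3)
      proof eventually_elim
        case (elim n)
        then have "(\<lambda>t. F n (a + t *s v)) holomorphic_on cball t0 r"
          using r(2) unfolding line_holomorphic_def by (meson holomorphic_on_subset)
        then show ?case
          using holomorphic_on_imp_continuous_on ball_subset_cball holomorphic_on_subset by blast
      qed
      have "uniform_limit (cball t0 r) (\<lambda>n t. F n (a + t *s v)) (\<lambda>t. h (a + t *s v)) sequentially"
        by (rule uniform_limit_compose'[OF e(2)]) (use r(2) in auto)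
      then show "uniform_limit (cball t0 r) (\<lambda>n t. F n (a + t *s v)) (\<lambda>t. h (a + t *s v)) sequentially" .
    qed auto
    then show "\<exists>f'. ((\<lambda>t. h (a + t *s v)) has_field_derivative f') (at t0)"
      using r(1) by (meson centre_in_ball holomorphic_on_open open_ball)
  qed
qed

text \<open>As \<epsilon> tends to 0, \<epsilon>^(-l) times h(\<epsilon> x) minus its Taylor terms
  of degree below l converges locally uniformly in x to the term of degree l, with error
  O(\<epsilon>) by the remainder estimate on rays. The approximants are holomorphic on lines by
  induction on l.\<close>

lemma taylor_term_line_holomorphic:
  fixes h :: "complex ^ 'd \<Rightarrow> complex"
  assumes h: "line_holomorphic h (ball 0 R)" and R: "R > 0"
    and M: "\<And>x. norm x < R \<Longrightarrow> cmod (h x) \<le> M"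
  shows "line_holomorphic (taylor_term h l) UNIV"
proof (induction l rule: less_induct)
  case (less l)
  have "cmod (h 0) \<le> M" using M[of 0] R by simp
  then have M0: "M \<ge> 0" using norm_ge_zero order_trans by blast
  show ?case
  proof (rule line_holomorphic_uniform_limit)
    fix z :: "complex ^ 'd"
    define B where "B = norm z + 1"
    have B: "B > 0" by (simp add: B_def add_nonneg_pos)
    define \<epsilon> where "\<epsilon> n = 1 / real (Suc n)" for n
    define F where "F n x = (h (of_real (\<epsilon> n) *s x) - (\<Sum>i<l. taylor_term h i x * of_real (\<epsilon> n) ^ i)) *
      inverse (of_real (\<epsilon> n) ^ l)" for n x
    have \<epsilon>0: "\<epsilon> n > 0" for n by (simp add: \<epsilon>_def)
    have \<epsilon>lim: "\<epsilon> \<longlonglongrightarrow> 0" unfolding \<epsilon>_def using LIMSEQ_Suc[OF lim_const_over_n[of 1]] by simp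
    have "(\<lambda>n. 2 * \<epsilon> n * B) \<longlonglongrightarrow> 2 * 0 * B" by (intro tendsto_intros \<epsilon>lim)
    then have ev: "\<forall>\<^sub>F n in sequentially. 2 * \<epsilon> n * B < R"
      using R order_tendstoD(2)[of _ 0] by simp
    have nx: "norm x < B" if "x \<in> ball z 1" for x
      using that norm_triangle_ineq2[of x z] by (simp add: B_def dist_norm norm_minus_commute)
    have dom: "cmod t * (\<epsilon> n * norm x) < R" if "x \<in> ball z 1" "cmod t < R / (\<epsilon> n * B)" for t n x
    proof -
      have "cmod t * (\<epsilon> n * norm x) \<le> cmod t * (\<epsilon> n * B)"
        using nx[OF that(1)] \<epsilon>0[of n] by (intro mult_left_mono) auto
      also have "\<dots> < R" using that(2) \<epsilon>0[of n] B by (simp add: field_simps)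
      finally show ?thesis .
    qed
    have "uniform_limit (ball z 1) F (taylor_term h l) sequentially"
    proof (rule uniform_limit_boundI)
      show "\<forall>\<^sub>F n in sequentially. \<forall>x\<in>ball z 1. dist (F n x) (taylor_term h l x) \<le> 2 * M * (B / R) ^ Suc l * \<epsilon> n"
        using ev
      proof eventually_elim
        case (elim n)
        show ?case
        proof
          fix x assume x: "x \<in> ball z 1"
          \<comment> \<open>For |t| < 1 / q the point t \<epsilon> x stays in the ball of radius
            \<open>R\<close>, so q is the ratio of the geometric remainder.\<close>
          define q where "q = \<epsilon> n * B / R"
          have q: "q > 0" "q < 1 / 2" using elim \<epsilon>0[of n] B R by (auto simp: q_def field_simps)
          let ?e = "complex_of_real (\<epsilon> n)"
          have e: "?e \<noteq> 0" using \<epsilon>0[of n] by simp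
          have "cmod (h (?e *s x) - (\<Sum>i\<le>l. taylor_term h i (?e *s x)))
              \<le> M * (1 / (1 / q)) ^ Suc l / (1 - 1 / (1 / q))"
          proof (rule taylor_remainder_le[OF h])
            fix t assume "cmod t < 1 / q"
            then have "cmod t * (\<epsilon> n * norm x) < R" using x by (intro dom) (auto simp: q_def)
            then have "norm (t *s (?e *s x)) < R"
              using \<epsilon>0[of n] by (simp add: norm_vector_scalar_mult mult.assoc norm_mult)
            then show "t *s (?e *s x) \<in> ball 0 R \<and> cmod (h (t *s (?e *s x))) \<le> M"
              using M by auto
          qed (use q in auto)
          also have "\<dots> \<le> M * q ^ Suc l / (1 / 2)"
          proof -
            have "M * q ^ Suc l / (1 - q) \<le> M * q ^ Suc l / (1 / 2)"
              using q M0 by (intro divide_left_mono) auto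
            then show ?thesis by simp
          qed
          finally have rem: "cmod (h (?e *s x) - (\<Sum>i\<le>l. taylor_term h i (?e *s x))) \<le> 2 * M * q ^ Suc l"
            by simp
          have sc: "taylor_term h i (?e *s x) = ?e ^ i * taylor_term h i x" for i
            by (rule taylor_term_scale[OF h]) (use R in auto)
          have "(\<Sum>i\<le>l. taylor_term h i (?e *s x)) =
              (\<Sum>i<l. taylor_term h i x * ?e ^ i) + ?e ^ l * taylor_term h l x"
            unfolding lessThan_Suc_atMost[symmetric] sc by (simp add: mult.commute)
          then have "F n x - taylor_term h l x = (h (?e *s x) - (\<Sum>i\<le>l. taylor_term h i (?e *s x))) * inverse (?e ^ l)"
            using e by (simp add: F_def field_simps)
          then have "cmod (F n x - taylor_term h l x) \<le> 2 * M * q ^ Suc l * inverse (\<epsilon> n ^ l)"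
            using rem \<epsilon>0[of n] by (simp add: norm_mult norm_inverse norm_power mult_right_mono del: power_Suc)
          also have "\<dots> = 2 * M * (B / R) ^ Suc l * \<epsilon> n"
            using \<epsilon>0[of n] R by (simp add: q_def power_divide power_mult_distrib field_simps)
          finally show "dist (F n x) (taylor_term h l x) \<le> 2 * M * (B / R) ^ Suc l * \<epsilon> n"
            by (simp add: dist_norm)
        qed
      qed
      show "(\<lambda>n. 2 * M * (B / R) ^ Suc l * \<epsilon> n) \<longlonglongrightarrow> 0"
        by (rule tendsto_eq_rhs[OF tendsto_mult_left[OF \<epsilon>lim]]) simp
    qed
    moreover have "\<forall>\<^sub>F n in sequentially. line_holomorphic (F n) (ball z 1)"
      using ev
    proof eventually_elim
      case (elim n)
      have "line_holomorphic (\<lambda>x. h (0 + of_real (\<epsilon> n) *s x)) (ball z 1)"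
      proof (rule line_holomorphic_affine[OF h])
        fix x assume "x \<in> ball z 1"
        then show "0 + of_real (\<epsilon> n) *s x \<in> ball 0 R"
          using dom[of x 1 n] elim \<epsilon>0[of n] mult_pos_pos[OF B \<epsilon>0[of n]]
          by (simp add: norm_vector_scalar_mult field_simps)
      qed
      then show ?case unfolding F_def
        by (intro line_holomorphic_mult line_holomorphic_diff line_holomorphic_sum line_holomorphic_const
            line_holomorphic_subset[OF less.IH]) auto
    qed
    ultimately show "\<exists>e F. e > 0 \<and> uniform_limit (ball z e) F (taylor_term h l) sequentially \<and>
      (\<forall>\<^sub>F n in sequentially. line_holomorphic (F n) (ball z e))" 
      by (intro exI[of _ "1::real"] exI[of _ F] conjI) simp_all
  qed simp
qed

text \<open>On a line the term is entire and, by Cauchy's bound M (|x| / R)^l, grows at most like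
  |t|^l, so Liouville makes it a polynomial of degree at most l there. Being polynomial on all lines
  it is a polynomial, and homogeneity leaves only monomials of degree l.\<close>

lemma taylor_term_polynomial:
  fixes h :: "complex ^ 'd \<Rightarrow> complex"
  assumes h: "line_holomorphic h (ball 0 R)" and R: "R > 0"
    and M: "\<And>x. norm x < R \<Longrightarrow> cmod (h x) \<le> M"
  shows "\<exists>c. \<forall>x. taylor_term h l x = (\<Sum>a | mdeg a = l. c a * monomial_fun a x)"
proof (rule multipoly_homogeneous)
  have "cmod (h 0) \<le> M" using M[of 0] R by simp
  then have M0: "M \<ge> 0" using norm_ge_zero order_trans by blast
  show "taylor_term h l (t *s x) = t ^ l * taylor_term h l x" for t x
    by (rule taylor_term_scale[OF h]) (use R in auto)
  have bound: "cmod (taylor_term h l x) \<le> M * (norm x / R) ^ l" for x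
  proof (cases "x = 0")
    case True
    then show ?thesis using M[of 0] R M0 by (simp add: taylor_term_def)
  next
    case False
    have "cmod (taylor_term h l x) \<le> M / (R / norm x) ^ l"
    proof (rule taylor_term_le[OF h])
      fix t assume "cmod t < R / norm x"
      then have "norm (t *s x) < R" using False by (simp add: norm_vector_scalar_mult field_simps)
      then show "t *s x \<in> ball 0 R \<and> cmod (h (t *s x)) \<le> M" using M by auto
    qed (use R False in auto)
    then show ?thesis using False by (simp add: power_divide)
  qed
  show "multipoly (taylor_term h l)"
  proof (rule multipoly_if_polynomial_on_lines)
    fix a v :: "complex ^ 'd"
    let ?f = "\<lambda>t. taylor_term h l (a + t *s v)"
    have "?f \<xi> = (\<Sum>k\<le>l. (deriv ^^ k) ?f 0 / fact k * \<xi> ^ k)" for \<xi>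
    proof (rule Liouville_polynomial)
      show "?f holomorphic_on UNIV"
        using taylor_term_line_holomorphic[OF assms, of l] unfolding line_holomorphic_def by simp
      fix t :: complex assume t: "1 \<le> cmod t"
      have "norm (a + t *s v) \<le> norm a * 1 + cmod t * norm v"
        using norm_triangle_ineq[of a "t *s v"] by (simp add: norm_vector_scalar_mult)
      also have "\<dots> \<le> norm a * cmod t + cmod t * norm v" using t by (intro add_mono mult_left_mono) auto
      finally have "norm (a + t *s v) \<le> (norm a + norm v) * cmod t" by (simp add: algebra_simps)
      then have "(norm (a + t *s v) / R) ^ l \<le> ((norm a + norm v) * cmod t / R) ^ l"
        using R by (intro power_mono divide_right_mono) auto
      then have "M * (norm (a + t *s v) / R) ^ l \<le> M * ((norm a + norm v) * cmod t / R) ^ l"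
        using M0 by (rule mult_left_mono)
      also have "\<dots> = M * ((norm a + norm v) / R) ^ l * cmod t ^ l"
        by (simp add: power_divide power_mult_distrib)
      finally show "cmod (?f t) \<le> M * ((norm a + norm v) / R) ^ l * cmod t ^ l"
        using bound[of "a + t *s v"] by linarith
    qed
    then show "\<exists>b. \<forall>t. ?f t = (\<Sum>i\<le>l. b i * t ^ i)"
      by (intro exI[of _ "\<lambda>k. (deriv ^^ k) ?f 0 / fact k"] allI)
  qed
qed

text \<open>One coefficient family serves all orders n. This is what later makes the matrices of the
  different jet orders nested.\<close>

lemma taylor_polynomial:
  fixes h :: "complex ^ 'd \<Rightarrow> complex"
  assumes h: "line_holomorphic h (ball 0 R)" and R: "R > 0"
    and M: "\<And>x. norm x < R \<Longrightarrow> cmod (h x) \<le> M"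
  shows "\<exists>c. \<forall>n x. (\<Sum>l\<le>n. taylor_term h l x) = (\<Sum>a | mdeg a \<le> n. c a * monomial_fun a x)"
proof -
  obtain c where c: "\<And>l x. taylor_term h l x = (\<Sum>a | mdeg a = l. c l a * monomial_fun a x)"
    using taylor_term_polynomial[OF assms] by metis
  show ?thesis
  proof (intro exI allI)
    fix n x
    have "(\<Sum>a | mdeg a \<le> n. c (mdeg a) a * monomial_fun a x) =
      (\<Sum>l\<le>n. \<Sum>a\<in>{a\<in>{a. mdeg a \<le> n}. mdeg a = l}. c (mdeg a) a * monomial_fun a x)"
      by (rule sum.group[symmetric]) (use card_multiindices(1) in auto)
    also have "\<dots> = (\<Sum>l\<le>n. taylor_term h l x)"
      unfolding c by (intro sum.cong refl) auto
    finally show "(\<Sum>l\<le>n. taylor_term h l x) = (\<Sum>a | mdeg a \<le> n. c (mdeg a) a * monomial_fun a x)" ..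
  qed
qed


section \<open>Matrices depending on parameters\<close>

lemma index_mult_mat_sum:
  "A \<in> carrier_mat n m \<Longrightarrow> B \<in> carrier_mat m k \<Longrightarrow> i < n \<Longrightarrow> j < k \<Longrightarrow>
    (A * B) $$ (i, j) = (\<Sum>l<m. A $$ (i, l) * B $$ (l, j))"
  by (auto simp: scalar_prod_def lessThan_atLeast0 intro!: sum.cong)

lemma mat_inverse_det:
  fixes A :: "'a :: field mat"
  assumes A: "A \<in> carrier_mat r r" and d: "Determinant.det A \<noteq> 0"
  shows "the (mat_inverse A) \<in> carrier_mat r r" "A * the (mat_inverse A) = 1\<^sub>m r"
    "the (mat_inverse A) * A = 1\<^sub>m r"
proof -
  obtain B where "mat_inverse A = Some B"
    using mat_inverse(1)[OF A, where b = "()"] det_non_zero_imp_unit[OF A d, where b = "()"]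
    by (cases "mat_inverse A") auto
  with mat_inverse(2)[OF A] show "the (mat_inverse A) \<in> carrier_mat r r"
    "A * the (mat_inverse A) = 1\<^sub>m r" "the (mat_inverse A) * A = 1\<^sub>m r" by auto
qed

lemma mat_left_inverse_unique:
  fixes A :: "'a :: field mat"
  assumes "A \<in> carrier_mat r r" "B \<in> carrier_mat r r" "C \<in> carrier_mat r r" "B * A = 1\<^sub>m r" "A * C = 1\<^sub>m r"
  shows "B = C"
proof -
  have "B = B * (A * C)" using assms by simp
  also have "\<dots> = (B * A) * C" by (rule assoc_mult_mat[symmetric]) (use assms in auto)
  finally show ?thesis using assms by simp
qed

text \<open>Continuity is stated entrywise, as matrices of all sizes share one type.\<close>

definition mat_continuous_on :: "nat \<Rightarrow> 'a::topological_space set \<Rightarrow> ('a \<Rightarrow> complex mat) \<Rightarrow> bool" where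
  "mat_continuous_on r S F \<longleftrightarrow> (\<forall>s\<in>S. F s \<in> carrier_mat r r) \<and>
     (\<forall>i<r. \<forall>j<r. continuous_on S (\<lambda>s. F s $$ (i, j)))"

lemma mat_continuous_on_const: "A \<in> carrier_mat r r \<Longrightarrow> mat_continuous_on r S (\<lambda>s. A)"
  by (simp add: mat_continuous_on_def)

lemma mat_continuous_on_mult:
  assumes "mat_continuous_on r S F" "mat_continuous_on r S G"
  shows "mat_continuous_on r S (\<lambda>s. F s * G s)"
  unfolding mat_continuous_on_def
proof (intro conjI ballI allI impI)
  fix i j assume ij: "i < r" "j < r"
  have "continuous_on S (\<lambda>s. \<Sum>l<r. F s $$ (i, l) * G s $$ (l, j))"
    using assms ij unfolding mat_continuous_on_def by (intro continuous_intros) auto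
  then show "continuous_on S (\<lambda>s. (F s * G s) $$ (i, j))"
    by (rule continuous_on_eq)
       (use assms ij in \<open>auto simp: mat_continuous_on_def simp del: index_mult_mat intro!: index_mult_mat_sum[symmetric]\<close>)
qed (use assms in \<open>auto simp: mat_continuous_on_def intro!: mult_carrier_mat\<close>)

lemma mat_continuous_on_add:
  assumes "mat_continuous_on r S F" "mat_continuous_on r S G"
  shows "mat_continuous_on r S (\<lambda>s. F s + G s)"
  unfolding mat_continuous_on_def
proof (intro conjI ballI allI impI)
  fix i j assume ij: "i < r" "j < r"
  have "continuous_on S (\<lambda>s. F s $$ (i, j) + G s $$ (i, j))"
    using assms ij unfolding mat_continuous_on_def by (intro continuous_intros) auto
  then show "continuous_on S (\<lambda>s. (F s + G s) $$ (i, j))"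
    by (rule continuous_on_eq) (use assms ij in \<open>auto simp: mat_continuous_on_def\<close>)
qed (use assms in \<open>auto simp: mat_continuous_on_def\<close>)

lemma mat_continuous_on_diff:
  assumes "mat_continuous_on r S F" "mat_continuous_on r S G"
  shows "mat_continuous_on r S (\<lambda>s. F s - G s)"
  unfolding mat_continuous_on_def
proof (intro conjI ballI allI impI)
  fix i j assume ij: "i < r" "j < r"
  have "continuous_on S (\<lambda>s. F s $$ (i, j) - G s $$ (i, j))"
    using assms ij unfolding mat_continuous_on_def by (intro continuous_intros) auto
  then show "continuous_on S (\<lambda>s. (F s - G s) $$ (i, j))"
    by (rule continuous_on_eq) (use assms ij in \<open>auto simp: mat_continuous_on_def\<close>)
qed (use assms in \<open>auto simp: mat_continuous_on_def intro!: minus_carrier_mat\<close>)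

lemma mat_continuous_on_smult:
  assumes "continuous_on S c" "mat_continuous_on r S F"
  shows "mat_continuous_on r S (\<lambda>s. c s \<cdot>\<^sub>m F s)"
  unfolding mat_continuous_on_def
proof (intro conjI ballI allI impI)
  fix i j assume ij: "i < r" "j < r"
  have "continuous_on S (\<lambda>s. c s * F s $$ (i, j))"
    using assms ij unfolding mat_continuous_on_def by (intro continuous_intros) auto
  then show "continuous_on S (\<lambda>s. (c s \<cdot>\<^sub>m F s) $$ (i, j))"
    by (rule continuous_on_eq) (use assms ij in \<open>auto simp: mat_continuous_on_def\<close>)
qed (use assms in \<open>auto simp: mat_continuous_on_def\<close>)

lemma mat_continuous_on_compose:
  assumes "mat_continuous_on r T F" "continuous_on S g" "g ` S \<subseteq> T"
  shows "mat_continuous_on r S (\<lambda>s. F (g s))"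
  using assms unfolding mat_continuous_on_def
  by (auto intro: continuous_on_compose2[of T])

lemma continuous_on_mat_det:
  assumes "mat_continuous_on r S F"
  shows "continuous_on S (\<lambda>s. Determinant.det (F s))"
proof -
  have "continuous_on S (\<lambda>s. \<Sum>p\<in>{p. p permutes {0..<r}}. signof p * (\<Prod>i = 0..<r. F s $$ (i, p i)))"
  proof (intro continuous_intros)
    fix p i assume "p \<in> {p. p permutes {0..<r}}" "i \<in> {0..<r}"
    then have "i < r" "p i < r" using permutes_in_image[of p "{0..<r}" i] by auto
    then show "continuous_on S (\<lambda>s. F s $$ (i, p i))"
      using assms unfolding mat_continuous_on_def by blast
  qed
  then show ?thesis
    by (rule continuous_on_eq) (use assms in \<open>auto simp: mat_continuous_on_def Determinant.det_def\<close>)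
qed

text \<open>Cramer's rule: the entries of the inverse are cofactors divided by the determinant, and
  both are polynomials in the entries of \<open>F s\<close>.\<close>

lemma mat_continuous_on_inverse:
  assumes F: "mat_continuous_on r S F" and R: "\<And>s. s \<in> S \<Longrightarrow> R s \<in> carrier_mat r r"
    and inv: "\<And>s. s \<in> S \<Longrightarrow> R s * F s = 1\<^sub>m r"
  shows "mat_continuous_on r S R"
  unfolding mat_continuous_on_def
proof (intro conjI ballI allI impI R)
  fix i j assume ij: "i < r" "j < r"
  have det: "Determinant.det (F s) \<noteq> 0" if "s \<in> S" for s
  proof
    assume "Determinant.det (F s) = 0"
    moreover have "Determinant.det (R s * F s) = Determinant.det (R s) * Determinant.det (F s)"
      by (rule Determinant.det_mult) (use R F that in \<open>auto simp: mat_continuous_on_def\<close>)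
    ultimately show False using inv[OF that] by simp
  qed
  have entry: "R s $$ (i, j) = cofactor (F s) j i / Determinant.det (F s)" if s: "s \<in> S" for s
  proof -
    have Fs: "F s \<in> carrier_mat r r" using F s by (simp add: mat_continuous_on_def)
    note adj = adj_mat[OF Fs]
    have "adj_mat (F s) = (R s * F s) * adj_mat (F s)" using inv[OF s] adj(1) by simp
    also have "\<dots> = R s * (F s * adj_mat (F s))"
      by (rule assoc_mult_mat[OF R[OF s] Fs adj(1)])
    also have "\<dots> = Determinant.det (F s) \<cdot>\<^sub>m R s"
      using R[OF s] by (simp add: adj(2) mult_smult_distrib[of _ r r _ r])
    finally have "adj_mat (F s) $$ (i, j) = Determinant.det (F s) * R s $$ (i, j)"
      using R[OF s] ij by simp
    then show ?thesis using det[OF s] Fs ij by (simp add: adj_mat_def field_simps)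
  qed
  have "mat_continuous_on (r - 1) S (\<lambda>s. mat_delete (F s) j i)"
    unfolding mat_continuous_on_def
  proof (intro conjI ballI allI impI)
    fix i' j' assume ij': "i' < r - 1" "j' < r - 1"
    then have "insert_index j i' < r" "insert_index i j' < r" by (auto simp: insert_index_def)
    then have "continuous_on S (\<lambda>s. F s $$ (insert_index j i', insert_index i j'))"
      using F unfolding mat_continuous_on_def by blast
    then show "continuous_on S (\<lambda>s. mat_delete (F s) j i $$ (i', j'))"
      by (rule continuous_on_eq)
         (use F ij ij' in \<open>auto simp: mat_continuous_on_def mat_delete_def insert_index_def\<close>)
  qed (use F in \<open>auto simp: mat_continuous_on_def mat_delete_def\<close>)
  then have "continuous_on S (\<lambda>s. cofactor (F s) j i / Determinant.det (F s))"
    unfolding cofactor_def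
    by (intro continuous_intros continuous_on_mat_det continuous_on_mat_det[OF F]) (use det in auto)
  then show "continuous_on S (\<lambda>s. R s $$ (i, j))"
    by (rule continuous_on_eq) (use entry in auto)
qed

lemma has_vector_derivative_iff_quotient:
  fixes f :: "real \<Rightarrow> 'a :: real_normed_vector"
  shows "(f has_vector_derivative D) (at x within S) \<longleftrightarrow>
    ((\<lambda>y. (f y - f x) /\<^sub>R (y - x)) \<longlongrightarrow> D) (at x within S)"
proof -
  have "norm (f y - f x - (y - x) *\<^sub>R D) / norm (y - x) = norm ((f y - f x) /\<^sub>R (y - x) - D)"
    if "y \<noteq> x" for y
  proof -
    have "(f y - f x) /\<^sub>R (y - x) - D = inverse (y - x) *\<^sub>R (f y - f x - (y - x) *\<^sub>R D)"
      using that by (simp add: scaleR_diff_right)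
    then show ?thesis by (simp add: divide_inverse mult.commute)
  qed
  then have "((\<lambda>y. norm (f y - f x - (y - x) *\<^sub>R D) / norm (y - x)) \<longlongrightarrow> 0) (at x within S) \<longleftrightarrow>
      ((\<lambda>y. norm ((f y - f x) /\<^sub>R (y - x) - D)) \<longlongrightarrow> 0) (at x within S)"
    by (intro Lim_cong_within) auto
  then show ?thesis
    unfolding has_vector_derivative_def has_derivative_iff_norm
    by (simp add: bounded_linear_scaleR_left tendsto_norm_zero_iff LIM_zero_iff)
qed

text \<open>Difference quotients of resolvents are products of this shape, by the resolvent identity.\<close>

lemma mat_sandwich_derivative:
  fixes G :: "real \<Rightarrow> complex mat"
  assumes P: "\<And>y. y \<in> S \<Longrightarrow> P y - P x = A y * (G y - G x) * B"
    and c: "\<And>y. y \<in> S \<Longrightarrow> P y \<in> carrier_mat r r" "\<And>y. y \<in> S \<Longrightarrow> A y \<in> carrier_mat r r"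
      "\<And>y. y \<in> S \<Longrightarrow> G y \<in> carrier_mat r r" "B \<in> carrier_mat r r" "D \<in> carrier_mat r r"
    and A: "\<And>i j. i < r \<Longrightarrow> j < r \<Longrightarrow> continuous (at x within S) (\<lambda>y. A y $$ (i, j))"
    and G: "\<And>i j. i < r \<Longrightarrow> j < r \<Longrightarrow>
      ((\<lambda>y. G y $$ (i, j)) has_vector_derivative D $$ (i, j)) (at x within S)"
    and x: "x \<in> S" and ij: "i < r" "j < r"
  shows "((\<lambda>y. P y $$ (i, j)) has_vector_derivative (A x * D * B) $$ (i, j)) (at x within S)"
  unfolding has_vector_derivative_iff_quotient
proof -
  have ev: "\<forall>\<^sub>F y in at x within S. y \<in> S" by (simp add: eventually_at_filter)
  have expand: "(X * Y * B) $$ (i, j) = (\<Sum>l<r. (\<Sum>k<r. X $$ (i, k) * Y $$ (k, l)) * B $$ (l, j))"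
    if "X \<in> carrier_mat r r" "Y \<in> carrier_mat r r" for X Y
    using that c(4) ij
    by (subst index_mult_mat_sum[of _ r r _ r], simp_all del: index_mult_mat add: mult_carrier_mat[of _ r r _ r])
       (auto intro!: sum.cong simp: index_mult_mat_sum[of _ r r _ r] simp del: index_mult_mat)
  have "((\<lambda>y. \<Sum>l<r. (\<Sum>k<r. A y $$ (i, k) * ((G y $$ (k, l) - G x $$ (k, l)) /\<^sub>R (y - x))) * B $$ (l, j))
      \<longlongrightarrow> (\<Sum>l<r. (\<Sum>k<r. A x $$ (i, k) * D $$ (k, l)) * B $$ (l, j))) (at x within S)"
    using A G ij unfolding has_vector_derivative_iff_quotient continuous_within
    by (intro tendsto_intros) auto
  also have "(\<Sum>l<r. (\<Sum>k<r. A x $$ (i, k) * D $$ (k, l)) * B $$ (l, j)) = (A x * D * B) $$ (i, j)"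
    by (rule expand[symmetric]) (use c x in auto)
  finally show "((\<lambda>y. (P y $$ (i, j) - P x $$ (i, j)) /\<^sub>R (y - x)) \<longlongrightarrow> (A x * D * B) $$ (i, j)) (at x within S)"
  proof (rule Lim_transform_eventually)
    show "\<forall>\<^sub>F y in at x within S.
       (\<Sum>l<r. (\<Sum>k<r. A y $$ (i, k) * ((G y $$ (k, l) - G x $$ (k, l)) /\<^sub>R (y - x))) * B $$ (l, j)) =
       (P y $$ (i, j) - P x $$ (i, j)) /\<^sub>R (y - x)"
      using ev
    proof eventually_elim
      case (elim y)
      have "P y $$ (i, j) - P x $$ (i, j) = (P y - P x) $$ (i, j)"
        using c(1)[OF elim] c(1)[OF x] ij by simp
      also have "\<dots> = (\<Sum>l<r. (\<Sum>k<r. A y $$ (i, k) * (G y - G x) $$ (k, l)) * B $$ (l, j))"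
        unfolding P[OF elim]
        by (rule expand) (use c elim x in \<open>auto intro!: minus_carrier_mat\<close>)
      also have "\<dots> = (\<Sum>l<r. (\<Sum>k<r. A y $$ (i, k) * (G y $$ (k, l) - G x $$ (k, l))) * B $$ (l, j))"
        using c(3)[OF elim] c(3)[OF x] by (intro sum.cong arg_cong2[of _ _ _ _ "(*)"] refl) auto
      finally show ?case
        by (simp add: scaleR_conv_of_real sum_distrib_left sum_distrib_right mult_ac)
    qed
  qed
qed

section \<open>The matrix exponential\<close>

text \<open>This is exp(sA), with one scalar power series per entry so that termwise differentiation
  is available.\<close>

definition mat_exp :: "complex mat \<Rightarrow> real \<Rightarrow> complex mat" where
  "mat_exp A s = Matrix.mat (dim_row A) (dim_row A)
     (\<lambda>(i, j). \<Sum>n. ((A ^\<^sub>m n) $$ (i, j) / fact n) * complex_of_real s ^ n)"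

lemma mat_exp_carrier: "A \<in> carrier_mat r r \<Longrightarrow> mat_exp A s \<in> carrier_mat r r"
  by (simp add: mat_exp_def)

lemma mat_exp_dim [simp]: "dim_row (mat_exp A s) = dim_row A" "dim_col (mat_exp A s) = dim_row A"
  by (simp_all add: mat_exp_def)

lemma mat_exp_index:
  "A \<in> carrier_mat r r \<Longrightarrow> i < r \<Longrightarrow> j < r \<Longrightarrow>
    mat_exp A s $$ (i, j) = (\<Sum>n. ((A ^\<^sub>m n) $$ (i, j) / fact n) * complex_of_real s ^ n)"
  by (simp add: mat_exp_def)

lemma pow_mat_Suc_left:
  fixes A :: "complex mat"
  assumes "A \<in> carrier_mat r r" shows "A ^\<^sub>m Suc n = A * A ^\<^sub>m n"
proof (induction n)
  case 0
  then show ?case using assms by simp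
next
  case (Suc n)
  have "A ^\<^sub>m Suc (Suc n) = (A * A ^\<^sub>m n) * A" using Suc by simp
  also have "\<dots> = A * A ^\<^sub>m Suc n"
    using assms by (simp add: assoc_mult_mat[of _ r r _ r _ r] pow_carrier_mat)
  finally show ?case .
qed

lemma pow_mat_entry_bound:
  fixes A :: "complex mat"
  assumes A: "A \<in> carrier_mat r r"
  obtains \<beta> where "\<And>n i j. i < r \<Longrightarrow> j < r \<Longrightarrow> cmod ((A ^\<^sub>m n) $$ (i, j)) \<le> \<beta> ^ n"
proof -
  define b where "b = (\<Sum>i<r. \<Sum>j<r. cmod (A $$ (i, j)))"
  define \<beta> where "\<beta> = real r * b + 1"
  have b0: "b \<ge> 0" unfolding b_def by (intro sum_nonneg) auto
  have b: "cmod (A $$ (i, j)) \<le> b" if "i < r" "j < r" for i j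
  proof -
    have "cmod (A $$ (i, j)) \<le> (\<Sum>j<r. cmod (A $$ (i, j)))"
      by (rule member_le_sum) (use that in auto)
    also have "\<dots> \<le> b" unfolding b_def
      by (rule member_le_sum[where f = "\<lambda>i. \<Sum>j<r. cmod (A $$ (i, j))"]) (use that in \<open>auto intro!: sum_nonneg\<close>)
    finally show ?thesis .
  qed
  have \<beta>: "\<beta> \<ge> 1" using b0 by (simp add: \<beta>_def)
  have "cmod ((A ^\<^sub>m n) $$ (i, j)) \<le> \<beta> ^ n" if "i < r" "j < r" for n i j
    using that
  proof (induction n arbitrary: i j)
    case 0
    then show ?case using A by (cases "i = j") auto
  next
    case (Suc n)
    have "cmod ((A ^\<^sub>m Suc n) $$ (i, j)) = cmod (\<Sum>l<r. (A ^\<^sub>m n) $$ (i, l) * A $$ (l, j))"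
      using A Suc.prems by (simp add: index_mult_mat_sum[of _ r r _ r] pow_carrier_mat del: index_mult_mat)
    also have "\<dots> \<le> (\<Sum>l<r. \<beta> ^ n * b)"
      by (rule sum_norm_le) (use Suc b b0 \<beta> in \<open>auto simp: norm_mult intro!: mult_mono\<close>)
    also have "\<dots> = (real r * b) * \<beta> ^ n" by simp
    also have "\<dots> \<le> \<beta> * \<beta> ^ n" using \<beta> by (intro mult_right_mono) (auto simp: \<beta>_def)
    finally show ?case by simp
  qed
  then show thesis using that by blast
qed

lemma summable_mat_exp:
  fixes A :: "complex mat" and x :: complex
  assumes A: "A \<in> carrier_mat r r" "i < r" "j < r"
  shows "summable (\<lambda>n. ((A ^\<^sub>m n) $$ (i, j) / fact n) * x ^ n)"
proof -
  obtain \<beta> where \<beta>: "\<And>n i j. i < r \<Longrightarrow> j < r \<Longrightarrow> cmod ((A ^\<^sub>m n) $$ (i, j)) \<le> \<beta> ^ n"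
    using pow_mat_entry_bound[OF A(1)] by blast
  show ?thesis
  proof (rule summable_comparison_test')
    show "summable (\<lambda>n. (\<beta> * cmod x) ^ n /\<^sub>R fact n)" by (rule summable_exp_generic)
    fix n
    have "cmod (((A ^\<^sub>m n) $$ (i, j) / fact n) * x ^ n) = cmod ((A ^\<^sub>m n) $$ (i, j)) * cmod x ^ n / fact n"
      by (simp add: norm_mult norm_divide norm_power)
    also have "\<dots> \<le> \<beta> ^ n * cmod x ^ n / fact n"
      using \<beta>[OF A(2,3)] by (intro divide_right_mono mult_right_mono) auto
    finally show "cmod (((A ^\<^sub>m n) $$ (i, j) / fact n) * x ^ n) \<le> (\<beta> * cmod x) ^ n /\<^sub>R fact n"
      by (simp add: power_mult_distrib divide_inverse mult.commute)
  qed
qed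

lemma mat_exp_0: "A \<in> carrier_mat r r \<Longrightarrow> mat_exp A 0 = 1\<^sub>m r"
proof (rule eq_matI)
  fix i j assume A: "A \<in> carrier_mat r r" and "i < dim_row (1\<^sub>m r)" "j < dim_col (1\<^sub>m r)"
  then have ij: "i < r" "j < r" by auto
  show "mat_exp A 0 $$ (i, j) = 1\<^sub>m r $$ (i, j)"
    unfolding mat_exp_index[OF A ij] of_real_0 powser_zero using A ij by simp
qed auto

text \<open>Multiplying by A on either side gives the same series, which is also the termwise
  derivative in s; commutation and the differential equation of \<open>mat_exp\<close> are read off
  from it.\<close>

lemma mat_exp_mult_index:
  assumes A: "A \<in> carrier_mat r r" and ij: "i < r" "j < r"
  shows "(A * mat_exp A s) $$ (i, j) = (\<Sum>n. ((A ^\<^sub>m Suc n) $$ (i, j) / fact n) * complex_of_real s ^ n)"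
    and "(mat_exp A s * A) $$ (i, j) = (\<Sum>n. ((A ^\<^sub>m Suc n) $$ (i, j) / fact n) * complex_of_real s ^ n)"
proof -
  let ?c = "\<lambda>i j n. ((A ^\<^sub>m n) $$ (i, j) / fact n) * complex_of_real s ^ n"
  have "(A * mat_exp A s) $$ (i, j) = (\<Sum>l<r. A $$ (i, l) * (\<Sum>n. ?c l j n))"
    using A ij by (subst index_mult_mat_sum[OF A mat_exp_carrier[OF A] ij]) (auto simp: mat_exp_index[of _ r])
  also have "\<dots> = (\<Sum>l<r. \<Sum>n. A $$ (i, l) * ?c l j n)"
    by (intro sum.cong refl suminf_mult[symmetric] summable_mat_exp[OF A]) (use ij in auto)
  also have "\<dots> = (\<Sum>n. \<Sum>l<r. A $$ (i, l) * ?c l j n)"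
    by (intro suminf_sum[symmetric] summable_mult summable_mat_exp[OF A]) (use ij in auto)
  also have "\<dots> = (\<Sum>n. ((A ^\<^sub>m Suc n) $$ (i, j) / fact n) * complex_of_real s ^ n)"
  proof (rule suminf_cong)
    fix n
    have "(A ^\<^sub>m Suc n) $$ (i, j) = (\<Sum>l<r. A $$ (i, l) * (A ^\<^sub>m n) $$ (l, j))"
      unfolding pow_mat_Suc_left[OF A]
      by (rule index_mult_mat_sum) (use A ij in \<open>auto intro: pow_carrier_mat\<close>)
    then show "(\<Sum>l<r. A $$ (i, l) * ?c l j n) = ((A ^\<^sub>m Suc n) $$ (i, j) / fact n) * complex_of_real s ^ n"
      by (simp only: sum_distrib_right sum_divide_distrib) (auto intro!: sum.cong simp: field_simps)
  qed
  finally show "(A * mat_exp A s) $$ (i, j) = (\<Sum>n. ((A ^\<^sub>m Suc n) $$ (i, j) / fact n) * complex_of_real s ^ n)" .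
  have "(mat_exp A s * A) $$ (i, j) = (\<Sum>l<r. (\<Sum>n. ?c i l n) * A $$ (l, j))"
    using A ij by (subst index_mult_mat_sum[OF mat_exp_carrier[OF A] A ij]) (auto simp: mat_exp_index[of _ r])
  also have "\<dots> = (\<Sum>l<r. \<Sum>n. ?c i l n * A $$ (l, j))"
    by (intro sum.cong refl suminf_mult2 summable_mat_exp[OF A]) (use ij in auto)
  also have "\<dots> = (\<Sum>n. \<Sum>l<r. ?c i l n * A $$ (l, j))"
    by (intro suminf_sum[symmetric] summable_mult2 summable_mat_exp[OF A]) (use ij in auto)
  also have "\<dots> = (\<Sum>n. ((A ^\<^sub>m Suc n) $$ (i, j) / fact n) * complex_of_real s ^ n)"
  proof (rule suminf_cong)
    fix n
    have "(A ^\<^sub>m Suc n) $$ (i, j) = (\<Sum>l<r. (A ^\<^sub>m n) $$ (i, l) * A $$ (l, j))"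
      unfolding pow_mat.simps
      by (rule index_mult_mat_sum) (use A ij in \<open>auto intro: pow_carrier_mat\<close>)
    then show "(\<Sum>l<r. ?c i l n * A $$ (l, j)) = ((A ^\<^sub>m Suc n) $$ (i, j) / fact n) * complex_of_real s ^ n"
      by (simp only: sum_distrib_right sum_divide_distrib) (auto intro!: sum.cong simp: field_simps)
  qed
  finally show "(mat_exp A s * A) $$ (i, j) = (\<Sum>n. ((A ^\<^sub>m Suc n) $$ (i, j) / fact n) * complex_of_real s ^ n)" .
qed

lemma mat_exp_commute:
  assumes A: "A \<in> carrier_mat r r" shows "A * mat_exp A s = mat_exp A s * A"
  by (rule eq_matI) (use A in \<open>simp_all add: mat_exp_mult_index[OF A] del: index_mult_mat(1) pow_mat.simps\<close>)

lemma mat_exp_derivative: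
  assumes A: "A \<in> carrier_mat r r" and ij: "i < r" "j < r"
  shows "((\<lambda>s. mat_exp A s $$ (i, j)) has_vector_derivative (A * mat_exp A s) $$ (i, j)) (at s within S)"
proof -
  let ?c = "\<lambda>n. (A ^\<^sub>m n) $$ (i, j) / fact n"
  have "((\<lambda>x. \<Sum>n. ?c n * x ^ n) has_field_derivative (\<Sum>n. diffs ?c n * of_real s ^ n)) (at (of_real s))"
    by (rule termdiffs_strong_converges_everywhere) (rule summable_mat_exp[OF A ij])
  also have "(\<lambda>n. diffs ?c n * of_real s ^ n) = (\<lambda>n. ((A ^\<^sub>m Suc n) $$ (i, j) / fact n) * of_real s ^ n)"
    by (simp add: diffs_def fun_eq_iff fact_Suc del: of_nat_Suc pow_mat.simps)
  finally show ?thesis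
    using has_vector_derivative_real_field[of "\<lambda>x. \<Sum>n. ?c n * x ^ n" _ s S]
    unfolding mat_exp_mult_index[OF A ij] mat_exp_index[OF A ij] by blast
qed

lemma mat_exp_continuous:
  assumes A: "A \<in> carrier_mat r r"
  shows "mat_continuous_on r S (mat_exp A)"
  unfolding mat_continuous_on_def continuous_on_eq_continuous_within
proof (intro conjI ballI allI impI mat_exp_carrier A)
  fix i j s assume ij: "i < r" "j < r"
  show "continuous (at s within S) (\<lambda>s. mat_exp A s $$ (i, j))"
    by (rule has_vector_derivative_continuous[OF mat_exp_derivative[OF A ij]])
qed


lemma mat_exp_sums:
  assumes "A \<in> carrier_mat r r" "i < r" "j < r"
  shows "(\<lambda>n. ((A ^\<^sub>m n) $$ (i, j) / fact n) * complex_of_real s ^ n) sums (mat_exp A s $$ (i, j))"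
  unfolding mat_exp_index[OF assms] by (rule summable_sums[OF summable_mat_exp[OF assms]])

lemma mat_exp_eqI:
  assumes "A \<in> carrier_mat r r" "M \<in> carrier_mat r r"
    and "\<And>i j. i < r \<Longrightarrow> j < r \<Longrightarrow> (\<lambda>n. ((A ^\<^sub>m n) $$ (i, j) / fact n) * complex_of_real s ^ n) sums (M $$ (i, j))"
  shows "mat_exp A s = M"
proof (rule eq_matI)
  fix i j assume "i < dim_row M" "j < dim_col M"
  then have ij: "i < r" "j < r" using assms(2) by auto
  show "mat_exp A s $$ (i, j) = M $$ (i, j)"
    by (rule sums_unique2[OF mat_exp_sums[OF assms(1) ij] assms(3)[OF ij]])
qed (use assms in auto)

lemma index_mult3_mat_sum:
  fixes X :: "complex mat"
  assumes "X \<in> carrier_mat r r" "Y \<in> carrier_mat r r" "Z \<in> carrier_mat r r" "i < r" "j < r"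
  shows "(X * Y * Z) $$ (i, j) = (\<Sum>l<r. (\<Sum>k<r. X $$ (i, k) * Y $$ (k, l)) * Z $$ (l, j))"
  using assms
  by (subst index_mult_mat_sum[of _ r r _ r], simp_all del: index_mult_mat add: mult_carrier_mat[of _ r r _ r])
     (auto intro!: sum.cong simp: index_mult_mat_sum[of _ r r _ r] simp del: index_mult_mat)

lemma mat_exp_similar:
  assumes wit: "similar_mat_wit A B P Q" and A: "A \<in> carrier_mat r r"
  shows "mat_exp A s = P * mat_exp B s * Q"
proof -
  note w = similar_mat_witD2[OF A wit]
  show ?thesis
  proof (rule mat_exp_eqI[OF A])
    show "P * mat_exp B s * Q \<in> carrier_mat r r"
      using w mat_exp_carrier by (auto intro!: mult_carrier_mat)
    fix i j assume ij: "i < r" "j < r"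
    have "(\<lambda>n. \<Sum>l<r. (\<Sum>k<r. P $$ (i, k) * (((B ^\<^sub>m n) $$ (k, l) / fact n) * complex_of_real s ^ n)) * Q $$ (l, j))
      sums (\<Sum>l<r. (\<Sum>k<r. P $$ (i, k) * mat_exp B s $$ (k, l)) * Q $$ (l, j))"
      by (intro sums_sum sums_mult sums_mult2 mat_exp_sums[OF w(5)]) auto
    also have "(\<Sum>l<r. (\<Sum>k<r. P $$ (i, k) * mat_exp B s $$ (k, l)) * Q $$ (l, j)) = (P * mat_exp B s * Q) $$ (i, j)"
      by (rule index_mult3_mat_sum[symmetric]) (use w ij mat_exp_carrier in auto)
    also have "(\<lambda>n. \<Sum>l<r. (\<Sum>k<r. P $$ (i, k) * (((B ^\<^sub>m n) $$ (k, l) / fact n) * complex_of_real s ^ n)) * Q $$ (l, j))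
      = (\<lambda>n. ((A ^\<^sub>m n) $$ (i, j) / fact n) * complex_of_real s ^ n)"
    proof
      fix n
      have "(A ^\<^sub>m n) $$ (i, j) = (\<Sum>l<r. (\<Sum>k<r. P $$ (i, k) * (B ^\<^sub>m n) $$ (k, l)) * Q $$ (l, j))"
        unfolding similar_mat_wit_pow_id[OF wit]
        by (rule index_mult3_mat_sum) (use w ij in \<open>auto intro: pow_carrier_mat\<close>)
      then show "(\<Sum>l<r. (\<Sum>k<r. P $$ (i, k) * (((B ^\<^sub>m n) $$ (k, l) / fact n) * complex_of_real s ^ n)) * Q $$ (l, j))
        = ((A ^\<^sub>m n) $$ (i, j) / fact n) * complex_of_real s ^ n"
        by (simp add: sum_distrib_left sum_distrib_right sum_divide_distrib mult_ac)
    qed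
    finally show "(\<lambda>n. ((A ^\<^sub>m n) $$ (i, j) / fact n) * complex_of_real s ^ n) sums ((P * mat_exp B s * Q) $$ (i, j))" .
  qed
qed

lemma pow_mat_upper_triangular:
  fixes B :: "complex mat"
  assumes B: "B \<in> carrier_mat r r" and ut: "upper_triangular B" and ij: "j \<le> i" "i < r"
  shows "(B ^\<^sub>m n) $$ (i, j) = (if i = j then (B $$ (i, i)) ^ n else 0)"
  using ij
proof (induction n arbitrary: i j)
  case 0
  then show ?case using B by simp
next
  case (Suc n)
  have "(B ^\<^sub>m Suc n) $$ (i, j) = (\<Sum>l<r. (B ^\<^sub>m n) $$ (i, l) * B $$ (l, j))"
    unfolding pow_mat.simps
    by (rule index_mult_mat_sum) (use B Suc.prems in \<open>auto intro: pow_carrier_mat\<close>)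
  also have "\<dots> = (\<Sum>l<r. if l = i then (if i = j then (B $$ (i, i)) ^ n * B $$ (i, i) else 0) else 0)"
  proof (rule sum.cong[OF refl])
    fix l assume "l \<in> {..<r}"
    then have l: "l < r" by simp
    show "(B ^\<^sub>m n) $$ (i, l) * B $$ (l, j) = (if l = i then (if i = j then (B $$ (i, i)) ^ n * B $$ (i, i) else 0) else 0)"
    proof (cases "l \<le> i")
      case True
      have "B $$ (i, j) = 0" if "i \<noteq> j" using upper_triangularD[OF ut, of j i] that Suc.prems B by auto
      then show ?thesis using Suc.IH[OF True Suc.prems(2)] by auto
    next
      case False
      then have "B $$ (l, j) = 0" using upper_triangularD[OF ut, of j l] Suc.prems B l by auto
      then show ?thesis using False by auto
    qed
  qed
  also have "\<dots> = (if i = j then (B $$ (i, i)) ^ Suc n else 0)" using Suc.prems by simp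
  finally show ?case .
qed

lemma mat_exp_upper_triangular:
  assumes B: "B \<in> carrier_mat r r" and ut: "upper_triangular B" and ij: "j \<le> i" "i < r"
  shows "mat_exp B s $$ (i, j) = (if i = j then exp (of_real s * B $$ (i, i)) else 0)"
proof -
  have "(\<lambda>n. ((B ^\<^sub>m n) $$ (i, j) / fact n) * complex_of_real s ^ n) sums
      (if i = j then exp (of_real s * B $$ (i, i)) else 0)"
  proof (cases "i = j")
    case True
    have "((B ^\<^sub>m n) $$ (i, j) / fact n) * complex_of_real s ^ n = (of_real s * B $$ (i, i)) ^ n /\<^sub>R fact n" for n
      by (subst pow_mat_upper_triangular[OF B ut ij])
         (simp add: True scaleR_conv_of_real power_mult_distrib divide_inverse mult_ac)
    then show ?thesis using exp_converges[of "of_real s * B $$ (i, i)"] True by simp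
  next
    case False
    have "(B ^\<^sub>m n) $$ (i, j) = 0" for n
      using pow_mat_upper_triangular[OF B ut ij] False by simp
    then show ?thesis using False by simp
  qed
  moreover have "(\<lambda>n. ((B ^\<^sub>m n) $$ (i, j) / fact n) * complex_of_real s ^ n) sums (mat_exp B s $$ (i, j))"
    by (rule mat_exp_sums[OF B]) (use ij in auto)
  ultimately show ?thesis by (rule sums_unique2[symmetric])
qed

section \<open>The principal logarithm of a matrix exponential\<close>

text \<open>The segment from the identity to \<open>C\<close>: exactly the matrices that are
  inverted in the integral of \<open>principal_log\<close>.\<close>

definition mat_segment :: "complex mat \<Rightarrow> real \<Rightarrow> complex mat" where
  "mat_segment C t = 1\<^sub>m (dim_row C) + of_real t \<cdot>\<^sub>m (C - 1\<^sub>m (dim_row C))"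

lemma mat_segment_carrier: "C \<in> carrier_mat r r \<Longrightarrow> mat_segment C t \<in> carrier_mat r r"
  by (rule carrier_matI) (simp_all add: mat_segment_def)

lemma mat_segment_index:
  "C \<in> carrier_mat r r \<Longrightarrow> i < r \<Longrightarrow> j < r \<Longrightarrow>
    mat_segment C t $$ (i, j) = (1 - of_real t) * (if i = j then 1 else 0) + of_real t * C $$ (i, j)"
  by (cases "i = j") (simp_all add: mat_segment_def ring_distribs)

lemma mat_segment_similar:
  assumes wit: "similar_mat_wit C D P Q" and C: "C \<in> carrier_mat r r"
  shows "similar_mat_wit (mat_segment C t) (mat_segment D t) P Q"
proof -
  note w = similar_mat_witD2[OF C wit]
  have "mat_segment C t = P * mat_segment D t * Q"
  proof (rule eq_matI)
    fix i j assume "i < dim_row (P * mat_segment D t * Q)" "j < dim_col (P * mat_segment D t * Q)"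
    then have ij: "i < r" "j < r" using w by auto
    have one: "(\<Sum>l<r. (\<Sum>k<r. P $$ (i, k) * (if k = l then 1 else 0)) * Q $$ (l, j)) = (if i = j then 1 else 0)"
    proof -
      have "(\<Sum>l<r. (\<Sum>k<r. P $$ (i, k) * (if k = l then 1 else 0)) * Q $$ (l, j)) = (\<Sum>l<r. P $$ (i, l) * Q $$ (l, j))"
        by (intro sum.cong refl) (simp add: if_distrib cong: if_cong)
      also have "\<dots> = (P * Q) $$ (i, j)" using w ij by (intro index_mult_mat_sum[symmetric]) auto
      finally show ?thesis using w ij by simp
    qed
    have "(P * mat_segment D t * Q) $$ (i, j) =
        (\<Sum>l<r. (\<Sum>k<r. P $$ (i, k) * mat_segment D t $$ (k, l)) * Q $$ (l, j))"
      by (rule index_mult3_mat_sum) (use w ij mat_segment_carrier in auto)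
    also have "\<dots> = (\<Sum>l<r. (\<Sum>k<r. P $$ (i, k) * ((1 - of_real t) * (if k = l then 1 else 0) + of_real t * D $$ (k, l))) * Q $$ (l, j))"
      using mat_segment_index[OF w(5)] by (intro sum.cong refl arg_cong2[of _ _ _ _ "(*)"]) auto
    also have "\<dots> = (1 - of_real t) * (\<Sum>l<r. (\<Sum>k<r. P $$ (i, k) * (if k = l then 1 else 0)) * Q $$ (l, j))
        + of_real t * (\<Sum>l<r. (\<Sum>k<r. P $$ (i, k) * D $$ (k, l)) * Q $$ (l, j))"
      unfolding sum_distrib_left sum_distrib_right sum.distrib[symmetric]
      by (intro sum.cong refl) (simp add: ring_distribs)
    also have "(\<Sum>l<r. (\<Sum>k<r. P $$ (i, k) * D $$ (k, l)) * Q $$ (l, j)) = C $$ (i, j)"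
      unfolding w(3) by (rule index_mult3_mat_sum[symmetric]) (use w ij in auto)
    finally show "mat_segment C t $$ (i, j) = (P * mat_segment D t * Q) $$ (i, j)"
      using mat_segment_index[OF C ij] one by simp
  qed (use w mat_segment_carrier[OF C, of t] in auto)
  then show ?thesis
    by (intro similar_mat_witI[of _ _ r]) (use w mat_segment_carrier[OF C] mat_segment_carrier[OF w(5)] in auto)
qed

text \<open>By Schur, A is similar to an upper triangular B with real diagonal b_i. The same
  similarity makes the segment from the identity to exp(sA) triangular, with diagonal entries (1 -
  t) + t exp(s b_i) > 0.\<close>

lemma mat_exp_segment_det:
  assumes A: "A \<in> carrier_mat r r" and ev: "\<And>k. eigenvalue A k \<Longrightarrow> k \<in> \<real>" and t: "t \<in> {0..1}"
  shows "Determinant.det (mat_segment (mat_exp A s) t) \<noteq> 0"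
proof -
  obtain es where "char_poly A = (\<Prod>a\<leftarrow>es. [:- a, 1:])" using char_poly_factorized[OF A] by blast
  then obtain B where B: "B \<in> carrier_mat r r" "upper_triangular B" "similar_mat A B"
    using schur_decomposition_exists[OF A] by blast
  then obtain P Q where wit: "similar_mat_wit A B P Q" unfolding similar_mat_def by blast
  note w = similar_mat_witD2[OF A wit]
  have real: "B $$ (i, i) \<in> \<real>" if i: "i < r" for i
  proof (rule ev)
    have "B $$ (i, i) \<in> set (diag_mat B)" using B(1) i by (auto simp: diag_mat_def)
    moreover have "poly (\<Prod>a\<leftarrow>as. [:- a, 1:]) x = 0" if "x \<in> set as" for x :: complex and as
      using that by (induction as) auto
    ultimately have "poly (char_poly B) (B $$ (i, i)) = 0"
      unfolding char_poly_upper_triangular[OF B(1,2)] by blast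
    then show "eigenvalue A (B $$ (i, i))"
      using eigenvalue_root_char_poly[OF A] char_poly_similar[OF B(3)] by simp
  qed
  have "similar_mat_wit (mat_exp A s) (mat_exp B s) P Q"
    by (intro similar_mat_witI[of _ _ r] mat_exp_similar[OF wit A])
       (use w mat_exp_carrier[OF A] mat_exp_carrier[OF B(1)] in auto)
  then have "similar_mat_wit (mat_segment (mat_exp A s) t) (mat_segment (mat_exp B s) t) P Q"
    by (rule mat_segment_similar) (rule mat_exp_carrier[OF A])
  then have "Determinant.det (mat_segment (mat_exp A s) t) = Determinant.det (mat_segment (mat_exp B s) t)"
    using det_similar unfolding similar_mat_def by blast
  also have "\<dots> = prod_list (diag_mat (mat_segment (mat_exp B s) t))"
  proof (rule det_upper_triangular)
    show "mat_segment (mat_exp B s) t \<in> carrier_mat r r"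
      by (rule mat_segment_carrier[OF mat_exp_carrier[OF B(1)]])
    show "upper_triangular (mat_segment (mat_exp B s) t)"
    proof
      fix i j assume "j < i" "i < dim_row (mat_segment (mat_exp B s) t)"
      then show "mat_segment (mat_exp B s) t $$ (i, j) = 0"
        using B(1) mat_segment_carrier[OF mat_exp_carrier[OF B(1)], of s t]
          mat_exp_upper_triangular[OF B(1,2), of j i s]
        by (subst mat_segment_index[OF mat_exp_carrier[OF B(1)]]) auto
    qed
  qed
  also have "\<dots> \<noteq> 0"
  proof -
    have "mat_segment (mat_exp B s) t $$ (i, i) \<noteq> 0" if i: "i < r" for i
    proof -
      obtain b where b: "B $$ (i, i) = complex_of_real b" using real[OF i] Reals_cases by blast
      have "(1 - t) + t * exp (s * b) > 0"
        using t by (cases "t = 0") (auto intro!: add_nonneg_pos)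
      moreover have "mat_segment (mat_exp B s) t $$ (i, i) = of_real ((1 - t) + t * exp (s * b))"
        using i mat_exp_upper_triangular[OF B(1,2) order_refl i, of s]
        by (simp add: mat_segment_index[OF mat_exp_carrier[OF B(1)] i i] b exp_of_real[symmetric])
      ultimately show ?thesis by (metis less_irrefl of_real_eq_0_iff)
    qed
    then show ?thesis
      using mat_segment_carrier[OF mat_exp_carrier[OF B(1)], of s t]
      by (auto simp: prod_list_zero_iff diag_mat_def)
  qed
  finally show ?thesis .
qed

text \<open>All the resolvent identities below are instances of this one.\<close>

lemma resolvent_identity:
  fixes R R' :: "complex mat"
  assumes c: "R \<in> carrier_mat r r" "R' \<in> carrier_mat r r" "Y \<in> carrier_mat r r" "Y' \<in> carrier_mat r r"
      "M \<in> carrier_mat r r" "N \<in> carrier_mat r r"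
    and inv: "R' * Y' = 1\<^sub>m r" "Y * R = 1\<^sub>m r"
  shows "R' * (M * Y - Y' * N) * R = R' * M - N * R"
proof -
  have "R' * (M * Y - Y' * N) * R = (R' * (M * Y) - R' * (Y' * N)) * R"
    using c by (subst mult_minus_distrib_mat[of _ r r _ r]) (auto intro!: mult_carrier_mat)
  also have "\<dots> = R' * (M * Y) * R - R' * (Y' * N) * R"
    using c by (subst minus_mult_distrib_mat[of _ r r _ _ r]) (auto intro!: mult_carrier_mat)
  also have "R' * (M * Y) * R = R' * (M * (Y * R))"
    using c by (simp add: assoc_mult_mat[of _ r r _ r _ r] mult_carrier_mat[of _ r r _ r])
  also have "\<dots> = R' * M" using c inv by simp
  also have "R' * (Y' * N) * R = (R' * Y') * (N * R)"
    using c by (simp add: assoc_mult_mat[of _ r r _ r _ r] mult_carrier_mat[of _ r r _ r])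
  also have "\<dots> = N * R" using c inv by (simp add: mult_carrier_mat[of _ r r _ r])
  finally show ?thesis .
qed

text \<open>The resolvent identity with both free factors equal to \<open>X\<close>: its middle
  factor X Y - Y X vanishes.\<close>

lemma inverse_commute:
  fixes R :: "complex mat"
  assumes c: "R \<in> carrier_mat r r" "Y \<in> carrier_mat r r" "X \<in> carrier_mat r r"
    and inv: "R * Y = 1\<^sub>m r" "Y * R = 1\<^sub>m r" and comm: "X * Y = Y * X"
  shows "R * X = X * R"
proof -
  have "X * Y - Y * X = 0\<^sub>m r r" unfolding comm using c by (intro minus_r_inv_mat) (auto intro!: mult_carrier_mat)
  then have "R * X - X * R = R * 0\<^sub>m r r * R" using resolvent_identity[OF c(1,1,2,2,3,3) inv] by simp
  also have "\<dots> = 0\<^sub>m r r" using c by simp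
  finally have z: "R * X - X * R = 0\<^sub>m r r" .
  show ?thesis
  proof (rule eq_matI)
    fix i j assume "i < dim_row (X * R)" "j < dim_col (X * R)"
    then have ij: "i < r" "j < r" using c by auto
    then have "(R * X - X * R) $$ (i, j) = 0" unfolding z by simp
    then show "(R * X) $$ (i, j) = (X * R) $$ (i, j)" using ij c by simp
  qed (use c in auto)
qed

definition segment_inverse :: "complex mat \<Rightarrow> real \<Rightarrow> complex mat" where
  "segment_inverse C t = the (mat_inverse (mat_segment C t))"

lemma segment_inverse:
  assumes "C \<in> carrier_mat r r" "Determinant.det (mat_segment C t) \<noteq> 0"
  shows "segment_inverse C t \<in> carrier_mat r r" "mat_segment C t * segment_inverse C t = 1\<^sub>m r"
    "segment_inverse C t * mat_segment C t = 1\<^sub>m r"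
  unfolding segment_inverse_def using mat_inverse_det[OF mat_segment_carrier[OF assms(1)] assms(2)] by auto

lemma mat_segment_continuous:
  assumes F: "mat_continuous_on r S F" and \<tau>: "continuous_on S \<tau>"
  shows "mat_continuous_on r S (\<lambda>z. mat_segment (F z) (\<tau> z))"
proof -
  have "mat_continuous_on r S (\<lambda>z. 1\<^sub>m r + complex_of_real (\<tau> z) \<cdot>\<^sub>m (F z - 1\<^sub>m r))"
    by (intro mat_continuous_on_add mat_continuous_on_smult mat_continuous_on_diff
        mat_continuous_on_const F continuous_intros \<tau>) auto
  moreover have "mat_segment (F z) (\<tau> z) = 1\<^sub>m r + complex_of_real (\<tau> z) \<cdot>\<^sub>m (F z - 1\<^sub>m r)" if "z \<in> S" for z
    using F that by (auto simp: mat_continuous_on_def mat_segment_def)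
  ultimately show ?thesis unfolding mat_continuous_on_def
    by (auto intro: continuous_on_eq)
qed

lemma segment_inverse_continuous:
  assumes F: "mat_continuous_on r S F" and \<tau>: "continuous_on S \<tau>"
    and det: "\<And>z. z \<in> S \<Longrightarrow> Determinant.det (mat_segment (F z) (\<tau> z)) \<noteq> 0"
  shows "mat_continuous_on r S (\<lambda>z. segment_inverse (F z) (\<tau> z))"
  by (rule mat_continuous_on_inverse[OF mat_segment_continuous[OF F \<tau>]])
     (use F segment_inverse det in \<open>auto simp: mat_continuous_on_def\<close>)

text \<open>The constant factor C - I is moved under the integral, because the integrand (C - I)(I +
  t(C - I))^(-1) has the simple difference identity proved next.\<close>

lemma principal_log_index:
  assumes C: "C \<in> carrier_mat r r" and det: "\<And>t. t \<in> {0..1} \<Longrightarrow> Determinant.det (mat_segment C t) \<noteq> 0"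
    and ij: "i < r" "j < r"
  shows "principal_log C \<in> carrier_mat r r"
    "principal_log C $$ (i, j) = integral {0..1} (\<lambda>t. ((C - 1\<^sub>m r) * segment_inverse C t) $$ (i, j))"
proof -
  let ?R = "segment_inverse C"
  let ?I = "Matrix.mat r r (\<lambda>(i, j). integral {0..1::real} (\<lambda>t. ?R t $$ (i, j)))"
  have B: "C - 1\<^sub>m r \<in> carrier_mat r r" using C by (auto intro!: minus_carrier_mat)
  have log: "principal_log C = (C - 1\<^sub>m r) * ?I"
    using C by (simp add: principal_log_def Let_def segment_inverse_def mat_segment_def)
  then show "principal_log C \<in> carrier_mat r r" using B by (auto intro!: mult_carrier_mat)
  have cont: "continuous_on {0..1} (\<lambda>t. ?R t $$ (i, j))" if "i < r" "j < r" for i j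
    using segment_inverse_continuous[OF mat_continuous_on_const[OF C], of "{0..1}" "\<lambda>t. t"] det that
    unfolding mat_continuous_on_def by (auto intro!: continuous_intros)
  have "principal_log C $$ (i, j) = (\<Sum>l<r. (C - 1\<^sub>m r) $$ (i, l) * integral {0..1} (\<lambda>t. ?R t $$ (l, j)))"
    unfolding log by (subst index_mult_mat_sum[OF B _ ij]) (use ij in auto)
  also have "\<dots> = integral {0..1} (\<lambda>t. \<Sum>l<r. (C - 1\<^sub>m r) $$ (i, l) * ?R t $$ (l, j))"
    by (subst integral_sum)
       (auto intro!: integrable_continuous_interval continuous_intros cont ij sum.cong)
  also have "\<dots> = integral {0..1} (\<lambda>t. ((C - 1\<^sub>m r) * segment_inverse C t) $$ (i, j))"
    by (intro Henstock_Kurzweil_Integration.integral_cong index_mult_mat_sum[OF B segment_inverse(1)[OF C det] ij, symmetric])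
  finally show "principal_log C $$ (i, j) = integral {0..1} (\<lambda>t. ((C - 1\<^sub>m r) * segment_inverse C t) $$ (i, j))" .
qed

text \<open>With X = C - I and Y = I + tX one has X' Y - Y' X = X' - X = C' - C, as the terms in t
  cancel. Insert this into the resolvent identity and use that X' commutes with the inverse of
  Y'.\<close>

lemma log_integrand_difference:
  assumes C: "C \<in> carrier_mat r r" "C' \<in> carrier_mat r r"
    and det: "Determinant.det (mat_segment C t) \<noteq> 0" "Determinant.det (mat_segment C' t) \<noteq> 0"
  shows "(C' - 1\<^sub>m r) * segment_inverse C' t - (C - 1\<^sub>m r) * segment_inverse C t =
    segment_inverse C' t * (C' - C) * segment_inverse C t"
proof -
  let ?X = "C - 1\<^sub>m r" and ?X' = "C' - 1\<^sub>m r"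
  let ?Y = "mat_segment C t" and ?Y' = "mat_segment C' t"
  have X: "?X \<in> carrier_mat r r" "?X' \<in> carrier_mat r r" using C by (auto intro!: minus_carrier_mat)
  have Y: "?Y = 1\<^sub>m r + of_real t \<cdot>\<^sub>m ?X" "?Y' = 1\<^sub>m r + of_real t \<cdot>\<^sub>m ?X'"
    using C by (auto simp: mat_segment_def)
  note inv = segment_inverse[OF C(1) det(1)] segment_inverse[OF C(2) det(2)]
  have XY: "M * (1\<^sub>m r + of_real t \<cdot>\<^sub>m N) = M + of_real t \<cdot>\<^sub>m (M * N)"
    "(1\<^sub>m r + of_real t \<cdot>\<^sub>m M) * N = N + of_real t \<cdot>\<^sub>m (M * N)"
    if "M \<in> carrier_mat r r" "N \<in> carrier_mat r r" for M N :: "complex mat"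
    using that by (simp_all add: mult_add_distrib_mat[of _ r r _ r] add_mult_distrib_mat[of _ r r _ _ r]
      mult_smult_distrib[of _ r r _ r] mult_smult_assoc_mat[of _ r r _ r])
  have eq: "?X' * ?Y - ?Y' * ?X = C' - C"
    unfolding Y XY[OF X(2,1)] using X C by (intro eq_matI) auto
  have comm: "segment_inverse C' t * ?X' = ?X' * segment_inverse C' t"
    by (rule inverse_commute[OF inv(4) mat_segment_carrier[OF C(2)] X(2) inv(6,5)])
       (simp add: Y XY[OF X(2,2)])
  show ?thesis
    using resolvent_identity[OF inv(1,4) mat_segment_carrier[OF C(1)] mat_segment_carrier[OF C(2)] X(2,1) inv(6,2)]
    unfolding eq comm by simp
qed

text \<open>For the inverse R_t of I + t(C - I) this says that t R_t has difference quotients R_t'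
  R_t in t, so t R_t is an antiderivative of R_t^2.\<close>

lemma segment_inverse_difference:
  assumes C: "C \<in> carrier_mat r r"
    and det: "Determinant.det (mat_segment C t) \<noteq> 0" "Determinant.det (mat_segment C t') \<noteq> 0"
  shows "of_real t' \<cdot>\<^sub>m segment_inverse C t' - of_real t \<cdot>\<^sub>m segment_inverse C t =
    segment_inverse C t' * (of_real t' \<cdot>\<^sub>m 1\<^sub>m r - of_real t \<cdot>\<^sub>m 1\<^sub>m r) * segment_inverse C t"
proof -
  note inv = segment_inverse[OF C det(1)] segment_inverse[OF C det(2)]
  have one: "of_real s \<cdot>\<^sub>m 1\<^sub>m r * M = of_real s \<cdot>\<^sub>m M" "M * (of_real s \<cdot>\<^sub>m 1\<^sub>m r) = of_real s \<cdot>\<^sub>m M"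
    if "M \<in> carrier_mat r r" for s and M :: "complex mat"
    using that by (simp_all add: mult_smult_assoc_mat[of _ r r _ r] mult_smult_distrib[of _ r r _ r])
  have eq: "of_real t' \<cdot>\<^sub>m 1\<^sub>m r * mat_segment C t - mat_segment C t' * (of_real t \<cdot>\<^sub>m 1\<^sub>m r) =
      complex_of_real t' \<cdot>\<^sub>m 1\<^sub>m r - of_real t \<cdot>\<^sub>m 1\<^sub>m r"
    unfolding one[OF mat_segment_carrier[OF C]]
    by (intro eq_matI) (auto simp: mat_segment_index[OF C] carrier_matD[OF mat_segment_carrier[OF C]] ring_distribs)
  have "segment_inverse C t' * (of_real t' \<cdot>\<^sub>m 1\<^sub>m r * mat_segment C t - mat_segment C t' * (of_real t \<cdot>\<^sub>m 1\<^sub>m r)) * segment_inverse C t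
    = segment_inverse C t' * (of_real t' \<cdot>\<^sub>m 1\<^sub>m r) - of_real t \<cdot>\<^sub>m 1\<^sub>m r * segment_inverse C t"
    by (rule resolvent_identity[OF inv(1,4) mat_segment_carrier[OF C] mat_segment_carrier[OF C] _ _ inv(6,2)]) auto
  then show ?thesis unfolding eq one[OF inv(1)] one[OF inv(4)] by simp
qed


text \<open>Differentiate under the integral. With E = exp(sA) and R_t the inverse of I + t(E - I),
  \<open>log_integrand_difference\<close> gives the new integrand R_t (A E) R_t, which equals R_t^2
  A E since the factors commute. Its antiderivative in t is t R_t A E, which is 0 at t = 0 and, as
  R_1 inverts E, equals A at t = 1.\<close>

lemma mat_exp_log_derivative:
  assumes A: "A \<in> carrier_mat r r" and ev: "\<And>k. eigenvalue A k \<Longrightarrow> k \<in> \<real>"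
    and ij: "i < r" "j < r" and s: "s \<in> {0..T}"
  shows "((\<lambda>s. integral {0..1} (\<lambda>t. ((mat_exp A s - 1\<^sub>m r) * segment_inverse (mat_exp A s) t) $$ (i, j)))
    has_vector_derivative A $$ (i, j)) (at s within {0..T})"
proof -
  let ?E = "mat_exp A"
  let ?R = "\<lambda>s t. segment_inverse (?E s) t"
  let ?P = "\<lambda>s t. (?E s - 1\<^sub>m r) * ?R s t"
  let ?f = "\<lambda>s t. ?R s t * (A * ?E s) * ?R s t"
  have E: "?E s \<in> carrier_mat r r" for s by (rule mat_exp_carrier[OF A])
  have AE: "A * ?E s \<in> carrier_mat r r" for s by (rule mult_carrier_mat[OF A E])
  have X: "?E s - 1\<^sub>m r \<in> carrier_mat r r" for s by (rule minus_carrier_mat) simp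
  have det: "Determinant.det (mat_segment (?E s) t) \<noteq> 0" if "t \<in> {0..1}" for s t
    by (rule mat_exp_segment_det[OF A ev that])
  note inv = segment_inverse[OF E det]
  have contE: "mat_continuous_on r S ?E" for S by (rule mat_exp_continuous[OF A])
  have contR: "mat_continuous_on r ({0..T} \<times> {0..1}) (\<lambda>z. ?R (fst z) (snd z))"
    by (rule segment_inverse_continuous[OF mat_continuous_on_compose[OF contE[of UNIV]]])
       (auto intro!: continuous_intros det)
  have contRt: "mat_continuous_on r {0..1} (\<lambda>t. ?R s t)" for s
    by (rule segment_inverse_continuous[OF mat_continuous_on_const[OF E]])
       (auto intro!: continuous_intros det)
  have contRs: "mat_continuous_on r {0..T} (\<lambda>s. ?R s t)" if "t \<in> {0..1}" for t
    by (rule segment_inverse_continuous[OF contE]) (use that in \<open>auto intro!: continuous_intros det\<close>)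
  have comm: "?R s t * (A * ?E s) = (A * ?E s) * ?R s t" if "t \<in> {0..1}" for s t
  proof (rule inverse_commute[OF inv(1)[OF that] mat_segment_carrier[OF E] AE inv(3)[OF that] inv(2)[OF that]])
    have EAE: "?E s * (A * ?E s) = (A * ?E s) * ?E s"
      by (simp add: mat_exp_commute[OF A] assoc_mult_mat[OF E A E])
    have seg: "mat_segment (?E s) t = (1 - of_real t) \<cdot>\<^sub>m 1\<^sub>m r + of_real t \<cdot>\<^sub>m ?E s"
      by (rule eq_matI) (use A mat_segment_carrier[OF E, of s t] in \<open>auto simp: mat_segment_index[OF E]\<close>)
    show "A * ?E s * mat_segment (?E s) t = mat_segment (?E s) t * (A * ?E s)"
      unfolding seg using E[of s] AE[of s]
      by (simp add: mult_add_distrib_mat[of _ r r _ r] add_mult_distrib_mat[of _ r r _ _ r]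
        mult_smult_distrib[of _ r r _ r] mult_smult_assoc_mat[of _ r r _ r] EAE
        right_mult_one_mat[OF AE] left_mult_one_mat[OF AE])
  qed
  have "((\<lambda>s. integral (cbox 0 1) (\<lambda>t. ?P s t $$ (i, j))) has_vector_derivative
      integral (cbox 0 1) (\<lambda>t. ?f s t $$ (i, j))) (at s within {0..T})"
  proof (rule leibniz_rule_vector_derivative)
    fix x t :: real assume xt: "x \<in> {0..T}" "t \<in> cbox 0 1"
    then have t: "t \<in> {0..1}" by simp
    show "((\<lambda>x. ?P x t $$ (i, j)) has_vector_derivative ?f x t $$ (i, j)) (at x within {0..T})"
    proof (rule mat_sandwich_derivative)
      show "?P y t - ?P x t = ?R y t * (?E y - ?E x) * ?R x t" for y
        by (rule log_integrand_difference[OF E E det[OF t] det[OF t]])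
      show "((\<lambda>y. ?E y $$ (i, j)) has_vector_derivative (A * ?E x) $$ (i, j)) (at x within {0..T})"
        if "i < r" "j < r" for i j by (rule mat_exp_derivative[OF A that])
      show "continuous (at x within {0..T}) (\<lambda>y. ?R y t $$ (i, j))" if "i < r" "j < r" for i j
        using contRs[OF t] that xt(1) unfolding mat_continuous_on_def continuous_on_eq_continuous_within by blast
    qed (use E AE X inv(1)[OF t] xt ij in \<open>auto intro!: mult_carrier_mat\<close>)
  next
    fix x assume "x \<in> {0..T}"
    have "mat_continuous_on r {0..1} (\<lambda>t. ?P x t)"
      by (intro mat_continuous_on_mult mat_continuous_on_const X contRt)
    then show "(\<lambda>t. ?P x t $$ (i, j)) integrable_on cbox 0 1"
      using ij unfolding mat_continuous_on_def by (auto intro!: integrable_continuous_interval)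
  next
    have "mat_continuous_on r ({0..T} \<times> {0..1}) (\<lambda>z. ?f (fst z) (snd z))"
      by (intro mat_continuous_on_mult contR mat_continuous_on_const A
          mat_continuous_on_compose[OF contE[of UNIV]] continuous_intros) auto
    then show "continuous_on ({0..T} \<times> cbox 0 1) (\<lambda>(x, t). ?f x t $$ (i, j))"
      using ij unfolding mat_continuous_on_def by (auto simp: case_prod_beta)
  qed (use s in auto)
  moreover have "integral (cbox 0 1) (\<lambda>t. ?f s t $$ (i, j)) = A $$ (i, j)"
  proof (rule integral_unique)
    let ?Q = "\<lambda>t. complex_of_real t \<cdot>\<^sub>m ?R s t"
    have der: "((\<lambda>t. ?Q t $$ (k, l)) has_vector_derivative (?R s t * 1\<^sub>m r * ?R s t) $$ (k, l)) (at t within {0..1})"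
      if kl: "k < r" "l < r" and t: "t \<in> {0..1}" for k l t
    proof (rule mat_sandwich_derivative)
      show "?Q y - ?Q t = ?R s y * (complex_of_real y \<cdot>\<^sub>m 1\<^sub>m r - of_real t \<cdot>\<^sub>m 1\<^sub>m r) * ?R s t"
        if "y \<in> {0..1}" for y
        by (rule segment_inverse_difference[OF E det[OF t] det[OF that]])
      show "continuous (at t within {0..1}) (\<lambda>y. ?R s y $$ (i, j))" if "i < r" "j < r" for i j
        using contRt[of s] that t unfolding mat_continuous_on_def continuous_on_eq_continuous_within by blast
      show "((\<lambda>y. (complex_of_real y \<cdot>\<^sub>m 1\<^sub>m r) $$ (i, j)) has_vector_derivative 1\<^sub>m r $$ (i, j)) (at t within {0..1})"
        if "i < r" "j < r" for i j
      proof (cases "i = j")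
        case True
        have "((\<lambda>y. complex_of_real y) has_vector_derivative 1) (at t within {0..1})"
          by (rule has_vector_derivative_of_real[OF DERIV_ident, simplified])
        then show ?thesis using that True by simp
      qed (use that in simp)
    qed (use inv(1) t kl in auto)
    have "((\<lambda>t. (\<Sum>l<r. (?R s t * 1\<^sub>m r * ?R s t) $$ (i, l) * (A * ?E s) $$ (l, j))) has_integral
       (\<Sum>l<r. ?Q 1 $$ (i, l) * (A * ?E s) $$ (l, j)) - (\<Sum>l<r. ?Q 0 $$ (i, l) * (A * ?E s) $$ (l, j))) {0..1}"
      by (rule fundamental_theorem_of_calculus)
         (auto intro!: has_vector_derivative_sum has_vector_derivative_mult_left der ij)
    also have "(\<Sum>l<r. ?Q 0 $$ (i, l) * (A * ?E s) $$ (l, j)) = 0"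
      by (intro sum.neutral ballI) (use inv(1)[of 0 s] ij in auto)
    also have "(\<Sum>l<r. ?Q 1 $$ (i, l) * (A * ?E s) $$ (l, j)) = (?R s 1 * (A * ?E s)) $$ (i, j)"
      using inv(1)[of 1 s] ij
      by (subst index_mult_mat_sum[OF inv(1) AE ij]) (auto intro!: sum.cong)
    also have "?R s 1 * (A * ?E s) = A"
    proof -
      have seg1: "mat_segment (?E s) 1 = ?E s"
        by (rule eq_matI) (use A mat_segment_carrier[OF E, of s 1] in \<open>auto simp: mat_segment_index[OF E]\<close>)
      have "?R s 1 * (A * ?E s) = (A * ?E s) * ?R s 1" by (rule comm) simp
      also have "\<dots> = A * (?E s * ?R s 1)" by (rule assoc_mult_mat[OF A E inv(1)]) simp
      also have "\<dots> = A" using inv(2)[of 1 s] A by (simp add: seg1)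
      finally show ?thesis .
    qed
    finally have "((\<lambda>t. (\<Sum>l<r. (?R s t * 1\<^sub>m r * ?R s t) $$ (i, l) * (A * ?E s) $$ (l, j)))
        has_integral A $$ (i, j)) (cbox 0 1)" by simp
    moreover have "(\<Sum>l<r. (?R s t * 1\<^sub>m r * ?R s t) $$ (i, l) * (A * ?E s) $$ (l, j)) = ?f s t $$ (i, j)"
      if t: "t \<in> cbox 0 1" for t
    proof -
      have t': "t \<in> {0..1}" using t by simp
      note R = inv(1)[OF t', of s]
      have "?f s t = ?R s t * ((A * ?E s) * ?R s t)" by (rule assoc_mult_mat[OF R AE R])
      also have "\<dots> = ?R s t * (?R s t * (A * ?E s))" by (simp only: comm[OF t'])
      also have "\<dots> = (?R s t * 1\<^sub>m r * ?R s t) * (A * ?E s)"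
        using R AE[of s] by (simp add: assoc_mult_mat[OF R R AE])
      finally show ?thesis
        by (simp only:) (rule index_mult_mat_sum[symmetric], use R AE[of s] ij in \<open>auto intro!: mult_carrier_mat\<close>)
    qed
    ultimately show "((\<lambda>t. ?f s t $$ (i, j)) has_integral A $$ (i, j)) (cbox 0 1)"
      by (rule has_integral_eq[rotated])
  qed
  ultimately show ?thesis by simp
qed

lemma principal_log_carrier: "C \<in> carrier_mat r r \<Longrightarrow> principal_log C \<in> carrier_mat r r"
  by (rule carrier_matI) (simp_all add: principal_log_def Let_def)

text \<open>Integrate the constant derivative A over s from 0 to T; at s = 0 the exponential is the
  identity, whose logarithm is 0.\<close>

lemma principal_log_mat_exp:
  assumes A: "A \<in> carrier_mat r r" and ev: "\<And>k. eigenvalue A k \<Longrightarrow> k \<in> \<real>" and T: "T \<ge> 0"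
  shows "principal_log (mat_exp A T) = of_real T \<cdot>\<^sub>m A"
proof (rule eq_matI)
  note E = mat_exp_carrier[OF A]
  fix i j assume "i < dim_row (of_real T \<cdot>\<^sub>m A)" "j < dim_col (of_real T \<cdot>\<^sub>m A)"
  then have ij: "i < r" "j < r" using A by auto
  have log: "principal_log (mat_exp A T) $$ (i, j) =
      integral {0..1} (\<lambda>t. ((mat_exp A T - 1\<^sub>m r) * segment_inverse (mat_exp A T) t) $$ (i, j))"
    by (rule principal_log_index(2)[OF E _ ij]) (rule mat_exp_segment_det[OF A ev])
  let ?L = "\<lambda>s. integral {0..1} (\<lambda>t. ((mat_exp A s - 1\<^sub>m r) * segment_inverse (mat_exp A s) t) $$ (i, j))"
  have "((\<lambda>s. A $$ (i, j)) has_integral ?L T - ?L 0) {0..T}"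
    by (rule fundamental_theorem_of_calculus[OF T]) (rule mat_exp_log_derivative[OF A ev ij])
  moreover have "((\<lambda>s. A $$ (i, j)) has_integral T *\<^sub>R A $$ (i, j)) {0..T}"
    using has_integral_const_real[of "A $$ (i, j)" 0 T] T by simp
  ultimately have "?L T - ?L 0 = T *\<^sub>R A $$ (i, j)" by (rule has_integral_unique)
  moreover have "?L 0 = 0"
  proof -
    have "?L 0 = integral {0..1} (\<lambda>t::real. 0)"
    proof (rule Henstock_Kurzweil_Integration.integral_cong)
      fix t :: real assume t: "t \<in> {0..1}"
      have "mat_exp A 0 - 1\<^sub>m r = 0\<^sub>m r r" using mat_exp_0[OF A] by (simp add: minus_r_inv_mat[of _ r r])
      then show "((mat_exp A 0 - 1\<^sub>m r) * segment_inverse (mat_exp A 0) t) $$ (i, j) = 0"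
        using left_mult_zero_mat[OF segment_inverse(1)[OF E mat_exp_segment_det[OF A ev t]], of r 0] ij by simp
    qed
    then show ?thesis by simp
  qed
  ultimately show "principal_log (mat_exp A T) $$ (i, j) = (of_real T \<cdot>\<^sub>m A) $$ (i, j)"
    using A ij log by (simp add: scaleR_conv_of_real)
next
  note E = mat_exp_carrier[OF A]
  have "principal_log (mat_exp A T) \<in> carrier_mat r r"
    by (rule principal_log_carrier[OF E])
  then show "dim_row (principal_log (mat_exp A T)) = dim_row (of_real T \<cdot>\<^sub>m A)"
    "dim_col (principal_log (mat_exp A T)) = dim_col (of_real T \<cdot>\<^sub>m A)" using A by auto
qed

text \<open>For a real eigenvalue k <= 0 and t = 1 / (1 - k), which lies in (0, 1], the matrix I +
  t(C - I) equals t(C - k I) and is singular.\<close>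

lemma no_nonpos_real_eigenvalue_segment:
  assumes C: "C \<in> carrier_mat r r"
    and det: "\<And>t. t \<in> {0..1} \<Longrightarrow> Determinant.det (mat_segment C t) \<noteq> 0"
  shows "no_nonpos_real_eigenvalue C"
  unfolding no_nonpos_real_eigenvalue_def
proof (intro allI impI notI)
  fix k assume "eigenvalue C k" and k: "k \<in> \<real> \<and> Re k \<le> 0"
  then have ch: "Determinant.det (char_matrix C k) = 0" using eigenvalue_det[OF C] by simp
  define t where "t = 1 / (1 - Re k)"
  have t: "t \<in> {0..1}" and kt: "1 - of_real t = - (of_real t * k)"
    using k by (auto simp: t_def field_simps complex_is_Real_iff complex_eq_iff)
  have "mat_segment C t = of_real t \<cdot>\<^sub>m char_matrix C k"
    by (rule eq_matI)
       (use C in \<open>auto simp: mat_segment_index[OF C] char_matrix_def carrier_matD[OF mat_segment_carrier[OF C]] kt ring_distribs\<close>)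
  then have "Determinant.det (mat_segment C t) = 0" using ch by simp
  then show False using det[OF t] by contradiction
qed


section \<open>Perturbation of inverses and of the logarithm\<close>

lemma mat_entry_sum_bound:
  fixes X Y :: "complex mat"
  assumes "X \<in> carrier_mat r r" "Y \<in> carrier_mat r r" "i < r" "j < r"
    and "\<And>i j. i < r \<Longrightarrow> j < r \<Longrightarrow> cmod (X $$ (i, j)) \<le> a" "\<And>i j. i < r \<Longrightarrow> j < r \<Longrightarrow> cmod (Y $$ (i, j)) \<le> b"
  shows "cmod ((X * Y) $$ (i, j)) \<le> real r * (a * b)"
proof -
  have "a \<ge> 0" using assms(5)[OF assms(3,4)] norm_ge_zero order_trans by blast
  have "cmod ((X * Y) $$ (i, j)) = cmod (\<Sum>l<r. X $$ (i, l) * Y $$ (l, j))"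
    by (subst index_mult_mat_sum[OF assms(1-4)]) simp
  also have "\<dots> \<le> (\<Sum>l<r. a * b)"
    by (rule sum_norm_le) (use assms \<open>a \<ge> 0\<close> in \<open>auto simp: norm_mult intro!: mult_mono\<close>)
  finally show ?thesis by simp
qed

lemma index_mult_mat_vec_sum:
  "M \<in> carrier_mat n r \<Longrightarrow> v \<in> carrier_vec r \<Longrightarrow> i < n \<Longrightarrow>
    vec_index (M *\<^sub>v v) i = (\<Sum>j<r. M $$ (i, j) * vec_index v j)"
  by (auto simp: scalar_prod_def lessThan_atLeast0 intro!: sum.cong)

text \<open>A vector v in the kernel of \<open>Y'\<close> satisfies R (Y - Y') v = v, but R (Y - Y')
  at least halves the maximum norm.\<close>

lemma det_nonzero_if_close:
  fixes Y Y' R :: "complex mat"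
  assumes c: "Y \<in> carrier_mat r r" "Y' \<in> carrier_mat r r" "R \<in> carrier_mat r r" and inv: "R * Y = 1\<^sub>m r"
    and b: "\<And>i j. i < r \<Longrightarrow> j < r \<Longrightarrow> cmod (R $$ (i, j)) \<le> b"
    and e: "\<And>i j. i < r \<Longrightarrow> j < r \<Longrightarrow> cmod ((Y - Y') $$ (i, j)) \<le> \<epsilon>"
    and small: "real r * (real r * (b * \<epsilon>)) \<le> 1 / 2"
  shows "Determinant.det Y' \<noteq> 0"
proof
  assume "Determinant.det Y' = 0"
  then obtain v where v: "v \<in> carrier_vec r" "v \<noteq> 0\<^sub>v r" "Y' *\<^sub>v v = 0\<^sub>v r"
    using det_0_iff_vec_prod_zero[OF c(2)] by blast
  have D: "Y - Y' \<in> carrier_mat r r" using c by (intro minus_carrier_mat)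
  have "R *\<^sub>v (Y *\<^sub>v v) = v" using c v(1) inv by (simp add: assoc_mult_mat_vec[symmetric, of _ r r _ r])
  moreover have "(Y - Y') *\<^sub>v v = Y *\<^sub>v v"
    using c v(1) by (simp add: minus_mult_distrib_mat_vec[of _ r r] v(3))
  ultimately have fix': "(R * (Y - Y')) *\<^sub>v v = v"
    using c v(1) D by (simp add: assoc_mult_mat_vec[of _ r r _ r])
  define m where "m = Max ((\<lambda>i. cmod (vec_index v i)) ` {..<r})"
  have r: "r > 0" using v(1,2) by (cases r) auto
  have m: "cmod (vec_index v i) \<le> m" if "i < r" for i
    unfolding m_def by (rule Max_ge) (use that in auto)
  have "m \<le> 1 / 2 * m"
  proof -
    have "m \<in> (\<lambda>i. cmod (vec_index v i)) ` {..<r}" unfolding m_def by (rule Max_in) (use r in auto)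
    then obtain i where i: "i < r" "m = cmod (vec_index v i)" by auto
    have m0: "m \<ge> 0" using i by simp
    have "vec_index v i = vec_index ((R * (Y - Y')) *\<^sub>v v) i" by (simp only: fix')
    also have "\<dots> = (\<Sum>j<r. (R * (Y - Y')) $$ (i, j) * vec_index v j)"
      by (rule index_mult_mat_vec_sum[OF mult_carrier_mat[OF c(3) D] v(1) i(1)])
    finally have "m = cmod (\<Sum>j<r. (R * (Y - Y')) $$ (i, j) * vec_index v j)"
      unfolding i(2) by (rule arg_cong)
    also have "\<dots> \<le> (\<Sum>j<r. (real r * (b * \<epsilon>)) * m)"
    proof (rule sum_norm_le)
      fix j assume "j \<in> {..<r}"
      then have j: "j < r" by simp
      have "cmod ((R * (Y - Y')) $$ (i, j)) \<le> real r * (b * \<epsilon>)"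
        by (rule mat_entry_sum_bound[OF c(3) D i(1) j b e])
      then show "cmod ((R * (Y - Y')) $$ (i, j) * vec_index v j) \<le> (real r * (b * \<epsilon>)) * m"
        unfolding norm_mult using m[OF j] by (intro mult_mono) (auto intro: order_trans[OF norm_ge_zero])
    qed
    also have "\<dots> = real r * (real r * (b * \<epsilon>)) * m" by simp
    also have "\<dots> \<le> 1 / 2 * m" using small m0 by (rule mult_right_mono)
    finally show "m \<le> 1 / 2 * m" .
  qed
  then have "m \<le> 0" by simp
  then have "vec_index v i = 0" if "i < r" for i using m[OF that] norm_le_zero_iff order_trans by blast
  then have "v = 0\<^sub>v r" using v(1) by (intro eq_vecI) auto
  then show False using v(2) by contradiction
qed

text \<open>In R' = R + R' D R the entries of the last term are at most half of the largest entry of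
  R', so this term can be absorbed on the left.\<close>

lemma inverse_entry_bound:
  fixes R R' :: "complex mat"
  assumes c: "R \<in> carrier_mat r r" "R' \<in> carrier_mat r r" "D \<in> carrier_mat r r"
    and eq: "R' - R = R' * D * R"
    and b: "\<And>i j. i < r \<Longrightarrow> j < r \<Longrightarrow> cmod (R $$ (i, j)) \<le> b"
    and e: "\<And>i j. i < r \<Longrightarrow> j < r \<Longrightarrow> cmod (D $$ (i, j)) \<le> \<epsilon>"
    and small: "real r * (real r * (b * \<epsilon>)) \<le> 1 / 2" and ij: "i < r" "j < r"
  shows "cmod (R' $$ (i, j)) \<le> 2 * b"
proof -
  define S where "S = (\<lambda>(i, j). cmod (R' $$ (i, j))) ` ({..<r} \<times> {..<r})"
  have S: "finite S" "S \<noteq> {}" using ij by (auto simp: S_def)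
  have m: "cmod (R' $$ (i, j)) \<le> Max S" if "i < r" "j < r" for i j
    by (rule Max_ge[OF S(1)]) (use that in \<open>auto simp: S_def\<close>)
  obtain k l where kl: "k < r" "l < r" "Max S = cmod (R' $$ (k, l))"
    using Max_in[OF S] by (auto simp: S_def)
  have m0: "Max S \<ge> 0" using kl by simp
  have "R' $$ (k, l) = R $$ (k, l) + (R' * D * R) $$ (k, l)"
    unfolding eq[symmetric] using c kl by simp
  then have "Max S \<le> cmod (R $$ (k, l)) + cmod ((R' * D * R) $$ (k, l))"
    using kl(3) norm_triangle_ineq by simp
  also have "cmod ((R' * D * R) $$ (k, l)) \<le> real r * ((real r * (Max S * \<epsilon>)) * b)"
    by (rule mat_entry_sum_bound[OF mult_carrier_mat[OF c(2,3)] c(1) kl(1,2) mat_entry_sum_bound[OF c(2,3)] b])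
       (use m e in auto)
  also have "\<dots> = real r * (real r * (b * \<epsilon>)) * Max S" by simp
  also have "\<dots> \<le> 1 / 2 * Max S" using small m0 by (rule mult_right_mono)
  finally have "Max S \<le> 2 * cmod (R $$ (k, l))" by simp
  then show ?thesis using m[OF ij] b[OF kl(1,2)] by linarith
qed

lemma mat_segment_diff_index:
  assumes "C \<in> carrier_mat r r" "C' \<in> carrier_mat r r" "i < r" "j < r"
  shows "(mat_segment C t - mat_segment C' t) $$ (i, j) = of_real t * (C $$ (i, j) - C' $$ (i, j))"
  using assms by (simp add: mat_segment_index[of _ r] carrier_matD[OF mat_segment_carrier[OF assms(2)]]
    carrier_matD[OF mat_segment_carrier[OF assms(1)]] ring_distribs)

text \<open>On the compact segment from the identity to \<open>C\<close> the inverses are bounded by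
  some b. By the two preceding lemmas the segment to a nearby \<open>M\<close> is again invertible,
  with inverses bounded by 2b, and \<open>log_integrand_difference\<close> bounds the difference of
  the integrands. Invertibility along the segment also excludes non-positive real eigenvalues of
  \<open>M\<close>.\<close>

lemma principal_log_lipschitz:
  assumes C: "C \<in> carrier_mat r r"
    and det: "\<And>t. t \<in> {0..1} \<Longrightarrow> Determinant.det (mat_segment C t) \<noteq> 0"
  shows "\<exists>\<delta>>0. \<exists>c\<ge>0. \<forall>M\<in>carrier_mat r r. \<forall>\<epsilon>. \<epsilon> \<le> \<delta> \<longrightarrow>
    (\<forall>i<r. \<forall>j<r. cmod (M $$ (i, j) - C $$ (i, j)) \<le> \<epsilon>) \<longrightarrow>
    no_nonpos_real_eigenvalue M \<and>
    (\<forall>i<r. \<forall>j<r. cmod (principal_log M $$ (i, j) - principal_log C $$ (i, j)) \<le> c * \<epsilon>)"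
proof -
  let ?R = "segment_inverse C"
  have "\<exists>b. \<forall>t\<in>{0..1}. cmod (?R t $$ (i, j)) \<le> b" if "i < r" "j < r" for i j
  proof -
    have "mat_continuous_on r {0..1} (\<lambda>t. ?R t)"
      by (rule segment_inverse_continuous[OF mat_continuous_on_const[OF C]])
         (auto intro!: continuous_intros det)
    then have "continuous_on {0..1} (\<lambda>t. ?R t $$ (i, j))" using that unfolding mat_continuous_on_def by blast
    then have "bounded ((\<lambda>t. ?R t $$ (i, j)) ` {0..1})"
      by (intro compact_imp_bounded compact_continuous_image) auto
    then show ?thesis unfolding bounded_iff by auto
  qed
  then obtain B where B: "\<And>i j t. i < r \<Longrightarrow> j < r \<Longrightarrow> t \<in> {0..1} \<Longrightarrow> cmod (?R t $$ (i, j)) \<le> B i j"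
    by metis
  define b where "b = 1 + (\<Sum>i<r. \<Sum>j<r. \<bar>B i j\<bar>)"
  have b1: "b \<ge> 1" unfolding b_def by (auto intro!: sum_nonneg)
  have b: "cmod (?R t $$ (i, j)) \<le> b" if "i < r" "j < r" "t \<in> {0..1}" for i j t
  proof -
    have "cmod (?R t $$ (i, j)) \<le> \<bar>B i j\<bar>" using B[OF that] by linarith
    also have "\<dots> \<le> (\<Sum>j<r. \<bar>B i j\<bar>)" by (rule member_le_sum) (use that in auto)
    also have "\<dots> \<le> (\<Sum>i<r. \<Sum>j<r. \<bar>B i j\<bar>)"
      by (rule member_le_sum[where f = "\<lambda>i. \<Sum>j<r. \<bar>B i j\<bar>"]) (use that in \<open>auto intro!: sum_nonneg\<close>)
    finally show ?thesis by (simp add: b_def)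
  qed
  \<comment> \<open>Chosen so that r (r (b \<delta>)) <= 1 / 2, the smallness that both perturbation
    lemmas ask for.\<close>
  define \<delta> where "\<delta> = 1 / (2 * (real r * real r * b + 1))"
  define c where "c = real r * ((real r * (2 * b)) * b)"
  have den: "real r * real r * b + 1 > 0" using b1 by (auto intro!: add_nonneg_pos)
  then have \<delta>: "\<delta> > 0" by (simp add: \<delta>_def)
  have "no_nonpos_real_eigenvalue M \<and>
      (\<forall>i<r. \<forall>j<r. cmod (principal_log M $$ (i, j) - principal_log C $$ (i, j)) \<le> c * \<epsilon>)"
    if M: "M \<in> carrier_mat r r" and \<epsilon>: "\<epsilon> \<le> \<delta>" and e: "\<forall>i<r. \<forall>j<r. cmod (M $$ (i, j) - C $$ (i, j)) \<le> \<epsilon>"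
    for M \<epsilon>
  proof -
    have "real r * (real r * (b * \<epsilon>)) \<le> real r * (real r * (b * \<delta>))"
      using \<epsilon> b1 by (intro mult_left_mono) auto
    also have "\<dots> \<le> 1 / 2" using den by (simp add: \<delta>_def field_simps)
    finally have small: "real r * (real r * (b * \<epsilon>)) \<le> 1 / 2" .
    have D: "cmod ((mat_segment C t - mat_segment M t) $$ (i, j)) \<le> \<epsilon>" if "i < r" "j < r" "t \<in> {0..1}" for i j t
    proof -
      have "t * cmod (C $$ (i, j) - M $$ (i, j)) \<le> 1 * cmod (C $$ (i, j) - M $$ (i, j))"
        using that(3) by (intro mult_right_mono) auto
      then show ?thesis unfolding mat_segment_diff_index[OF C M that(1,2)] norm_mult
        using e that by (auto simp: norm_minus_commute intro: order_trans)
    qed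
    have detM: "Determinant.det (mat_segment M t) \<noteq> 0" if t: "t \<in> {0..1}" for t
      by (rule det_nonzero_if_close[OF mat_segment_carrier[OF C] mat_segment_carrier[OF M]
          segment_inverse(1,3)[OF C det[OF t]] b D small]) (use t in auto)
    have inv: "cmod (segment_inverse M t $$ (i, j)) \<le> 2 * b" if ij: "i < r" "j < r" and t: "t \<in> {0..1}" for i j t
    proof (rule inverse_entry_bound[OF segment_inverse(1)[OF C det[OF t]] segment_inverse(1)[OF M detM[OF t]] _ _ _ _ small ij])
      show "mat_segment C t - mat_segment M t \<in> carrier_mat r r"
        by (rule minus_carrier_mat[OF mat_segment_carrier[OF M]])
      have "segment_inverse M t * (1\<^sub>m r * mat_segment C t - mat_segment M t * 1\<^sub>m r) * segment_inverse C t
          = segment_inverse M t * 1\<^sub>m r - 1\<^sub>m r * segment_inverse C t"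
        by (rule resolvent_identity[OF segment_inverse(1)[OF C det[OF t]] segment_inverse(1)[OF M detM[OF t]]
          mat_segment_carrier[OF C] mat_segment_carrier[OF M] _ _ segment_inverse(3)[OF M detM[OF t]]
          segment_inverse(2)[OF C det[OF t]]]) auto
      then show "segment_inverse M t - segment_inverse C t =
          segment_inverse M t * (mat_segment C t - mat_segment M t) * segment_inverse C t"
        using segment_inverse(1)[OF C det[OF t]] segment_inverse(1)[OF M detM[OF t]]
          mat_segment_carrier[OF C, of t] mat_segment_carrier[OF M, of t] by simp
    qed (use b D t in auto)
    have "cmod (principal_log M $$ (i, j) - principal_log C $$ (i, j)) \<le> c * \<epsilon>" if ij: "i < r" "j < r" for i j
    proof -
      let ?f = "\<lambda>C t. ((C - 1\<^sub>m r) * segment_inverse C t) $$ (i, j)"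
      have cont: "continuous_on {0..1} (?f C)"
        if C: "C \<in> carrier_mat r r" and det: "\<And>t. t \<in> {0..1} \<Longrightarrow> Determinant.det (mat_segment C t) \<noteq> 0" for C
      proof -
        have "mat_continuous_on r {0..1} (\<lambda>t. (C - 1\<^sub>m r) * segment_inverse C t)"
          by (intro mat_continuous_on_mult mat_continuous_on_const minus_carrier_mat one_carrier_mat
            segment_inverse_continuous[OF mat_continuous_on_const[OF C]] det continuous_intros) auto
        then show ?thesis using ij unfolding mat_continuous_on_def by blast
      qed
      have log: "principal_log M $$ (i, j) = integral {0..1} (?f M)"
        by (rule principal_log_index(2)[OF M _ ij]) (rule detM)
      have log': "principal_log C $$ (i, j) = integral {0..1} (?f C)"
        by (rule principal_log_index(2)[OF C _ ij]) (rule det)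
      have "principal_log M $$ (i, j) - principal_log C $$ (i, j) = integral {0..1} (\<lambda>t. ?f M t - ?f C t)"
        unfolding log log'
        by (intro Henstock_Kurzweil_Integration.integral_diff[symmetric] integrable_continuous_interval cont M C detM det)
      also have "cmod \<dots> \<le> c * \<epsilon> * (1 - 0)"
      proof (rule integral_bound)
        show "continuous_on {0..1} (\<lambda>t. ?f M t - ?f C t)"
          by (intro continuous_on_diff cont M C detM det)
        fix t :: real assume t: "t \<in> {0..1}"
        note R = segment_inverse(1)[OF C det[OF t]] segment_inverse(1)[OF M detM[OF t]]
        have MC: "M - C \<in> carrier_mat r r" by (rule minus_carrier_mat[OF C])
        have "?f M t - ?f C t = ((M - 1\<^sub>m r) * segment_inverse M t - (C - 1\<^sub>m r) * segment_inverse C t) $$ (i, j)"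
          using R C M ij by simp
        also have "\<dots> = (segment_inverse M t * (M - C) * segment_inverse C t) $$ (i, j)"
          by (simp only: log_integrand_difference[OF C M det[OF t] detM[OF t]])
        finally have eq: "?f M t - ?f C t = (segment_inverse M t * (M - C) * segment_inverse C t) $$ (i, j)" .
        have "cmod ((segment_inverse M t * (M - C) * segment_inverse C t) $$ (i, j))
          \<le> real r * ((real r * ((2 * b) * \<epsilon>)) * b)"
          by (rule mat_entry_sum_bound[OF mult_carrier_mat[OF R(2) MC] R(1) ij mat_entry_sum_bound[OF R(2) MC]])
             (use inv[OF _ _ t] b[OF _ _ t] e M C in auto)
        then show "cmod (?f M t - ?f C t) \<le> c * \<epsilon>" unfolding eq by (simp add: c_def mult_ac)
      qed simp
      finally show ?thesis by simp
    qed
    then show ?thesis using no_nonpos_real_eigenvalue_segment[OF M detM] by blast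
  qed
  moreover have "c \<ge> 0" using b1 by (simp add: c_def)
  ultimately show ?thesis using \<delta> by blast
qed


section \<open>Adjoints, the Moore-Penrose inverse, Hermitian forms and least squares\<close>

lemma mat_adjoint_carrier: "A \<in> carrier_mat n m \<Longrightarrow> mat_adjoint A \<in> carrier_mat m n"
  for A :: "complex mat"
  by (rule carrier_matI) (auto simp: mat_adjoint_def)

lemma mat_adjoint_dim [simp]:
  "dim_row (mat_adjoint A) = dim_col A" "dim_col (mat_adjoint A) = dim_row A" for A :: "complex mat"
  by (auto simp: mat_adjoint_def)

lemma mat_adjoint_index [simp]:
  "i < dim_col A \<Longrightarrow> j < dim_row A \<Longrightarrow> mat_adjoint A $$ (i, j) = cnj (A $$ (j, i))" for A :: "complex mat"
  by (simp add: mat_adjoint_def mat_of_rows_index conjugate_complex_def)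

lemma mat_adjoint_adjoint: "mat_adjoint (mat_adjoint A) = A" for A :: "complex mat"
  by (rule eq_matI) auto

lemma mat_adjoint_mult:
  fixes A B :: "complex mat"
  assumes "A \<in> carrier_mat n m" "B \<in> carrier_mat m k"
  shows "mat_adjoint (A * B) = mat_adjoint B * mat_adjoint A"
proof (rule eq_matI)
  fix i j assume "i < dim_row (mat_adjoint B * mat_adjoint A)" "j < dim_col (mat_adjoint B * mat_adjoint A)"
  then have ij: "i < k" "j < n" using assms by auto
  have "mat_adjoint (A * B) $$ (i, j) = cnj ((A * B) $$ (j, i))"
    using assms ij by (subst mat_adjoint_index) auto
  also have "\<dots> = (\<Sum>l<m. cnj (A $$ (j, l)) * cnj (B $$ (l, i)))"
    by (subst index_mult_mat_sum[OF assms ij(2,1)]) simp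
  also have "\<dots> = (mat_adjoint B * mat_adjoint A) $$ (i, j)"
    by (subst index_mult_mat_sum[OF mat_adjoint_carrier[OF assms(2)] mat_adjoint_carrier[OF assms(1)] ij])
       (use assms ij in \<open>auto intro!: sum.cong\<close>)
  finally show "mat_adjoint (A * B) $$ (i, j) = (mat_adjoint B * mat_adjoint A) $$ (i, j)" .
qed (use assms in auto)

lemma mat_adjoint_one [simp]: "mat_adjoint (1\<^sub>m r) = (1\<^sub>m r :: complex mat)"
  by (rule eq_matI) auto

lemma mat_adjoint_pow:
  fixes A :: "complex mat"
  assumes A: "A \<in> carrier_mat r r"
  shows "mat_adjoint A ^\<^sub>m n = mat_adjoint (A ^\<^sub>m n)"
proof (induction n)
  case 0
  then show ?case using A by simp
next
  case (Suc n)
  have "mat_adjoint A ^\<^sub>m Suc n = mat_adjoint (A ^\<^sub>m n) * mat_adjoint A" using Suc by simp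
  also have "\<dots> = mat_adjoint (A * A ^\<^sub>m n)"
    by (rule mat_adjoint_mult[symmetric]) (use A in \<open>auto intro: pow_carrier_mat\<close>)
  also have "\<dots> = mat_adjoint (A ^\<^sub>m Suc n)" by (simp only: pow_mat_Suc_left[OF A])
  finally show ?case .
qed

lemma mat_exp_adjoint:
  assumes A: "A \<in> carrier_mat r r"
  shows "mat_exp (mat_adjoint A) s = mat_adjoint (mat_exp A s)"
proof (rule mat_exp_eqI[OF mat_adjoint_carrier[OF A] mat_adjoint_carrier[OF mat_exp_carrier[OF A]]])
  fix i j assume ij: "i < r" "j < r"
  have "(\<lambda>n. cnj (((A ^\<^sub>m n) $$ (j, i) / fact n) * complex_of_real s ^ n)) sums cnj (mat_exp A s $$ (j, i))"
    unfolding sums_cnj by (rule mat_exp_sums[OF A ij(2,1)])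
  then show "(\<lambda>n. ((mat_adjoint A ^\<^sub>m n) $$ (i, j) / fact n) * complex_of_real s ^ n)
      sums (mat_adjoint (mat_exp A s) $$ (i, j))"
    using A ij pow_carrier_mat[OF A] by (simp add: mat_adjoint_pow[OF A] carrier_matD[OF pow_carrier_mat[OF A]])
qed

lemma det_mat_adjoint:
  fixes A :: "complex mat"
  assumes A: "A \<in> carrier_mat r r"
  shows "Determinant.det (mat_adjoint A) = cnj (Determinant.det A)"
proof -
  have T: "mat_adjoint A = map_mat cnj (transpose_mat A)"
    by (rule eq_matI) (use A in auto)
  have "Determinant.det (map_mat cnj B) = cnj (Determinant.det B)" if B: "B \<in> carrier_mat r r" for B
  proof -
    have "(\<Prod>i = 0..<r. map_mat cnj B $$ (i, p i)) = (\<Prod>i = 0..<r. cnj (B $$ (i, p i)))"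
      if "p permutes {0..<r}" for p
      using that permutes_in_image[OF that] B by (intro prod.cong) auto
    moreover have "cnj (signof p) = signof p" for p :: "nat \<Rightarrow> nat" by (simp add: sign_def)
    ultimately show ?thesis using B by (simp add: Determinant.det_def)
  qed
  from this[of "transpose_mat A"] show ?thesis
    unfolding T using A by (simp add: Determinant.det_transpose[OF A])
qed

lemma eigenvalue_mat_adjoint:
  fixes A :: "complex mat"
  assumes A: "A \<in> carrier_mat r r" and k: "eigenvalue (mat_adjoint A) k"
  shows "eigenvalue A (cnj k)"
proof -
  have "char_matrix (mat_adjoint A) k = mat_adjoint (char_matrix A (cnj k))"
    by (rule eq_matI) (use A in \<open>auto simp: char_matrix_def\<close>)
  then have "cnj (Determinant.det (char_matrix A (cnj k))) = 0"
    using k det_mat_adjoint[of "char_matrix A (cnj k)" r] A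
    by (simp add: eigenvalue_det[OF mat_adjoint_carrier[OF A]] char_matrix_def)
  then show ?thesis by (simp add: eigenvalue_det[OF A])
qed

text \<open>Names the predicate under the description operator in \<open>moore_penrose\<close>, so
  that its uniqueness can be stated.\<close>

definition penrose_inverse :: "complex mat \<Rightarrow> complex mat \<Rightarrow> bool" where
  "penrose_inverse A X \<longleftrightarrow> X \<in> carrier_mat (dim_col A) (dim_row A) \<and>
     A * X * A = A \<and> X * A * X = X \<and>
     mat_adjoint (A * X) = A * X \<and> mat_adjoint (X * A) = X * A"

lemma penrose_inverse_unique:
  assumes "penrose_inverse A X" "penrose_inverse A Y"
  shows "X = Y"
proof -
  obtain n m where A: "A \<in> carrier_mat n m" by blast
  then have X: "X \<in> carrier_mat m n" and Y: "Y \<in> carrier_mat m n"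
    using assms unfolding penrose_inverse_def by auto
  have AX: "A * X \<in> carrier_mat n n" "A * Y \<in> carrier_mat n n" "X * A \<in> carrier_mat m m" "Y * A \<in> carrier_mat m m"
    using A X Y by auto
  note x = assms(1)[unfolded penrose_inverse_def] and y = assms(2)[unfolded penrose_inverse_def]
  have "A * X = A * Y * A * X" using y by simp
  also have "\<dots> = (A * Y) * (A * X)" by (rule assoc_mult_mat[OF AX(2) A X])
  finally have 1: "A * X = (A * Y) * (A * X)" .
  have "A * X = mat_adjoint (A * X)" using x by simp
  also have "\<dots> = mat_adjoint (A * X) * mat_adjoint (A * Y)"
    by (subst 1) (rule mat_adjoint_mult[OF AX(2,1)])
  also have "\<dots> = (A * X) * (A * Y)" using x y by simp
  also have "\<dots> = A * X * A * Y" by (rule assoc_mult_mat[OF AX(1) A Y, symmetric])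
  also have "\<dots> = A * Y" using x by simp
  finally have eq1: "A * X = A * Y" .
  have "X * A = X * (A * Y * A)" using y by simp
  also have "A * Y * A = A * (Y * A)" by (rule assoc_mult_mat[OF A Y A])
  also have "X * (A * (Y * A)) = (X * A) * (Y * A)" by (rule assoc_mult_mat[OF X A AX(4), symmetric])
  finally have 2: "X * A = (X * A) * (Y * A)" .
  have "X * A = mat_adjoint (X * A)" using x by simp
  also have "\<dots> = mat_adjoint (Y * A) * mat_adjoint (X * A)"
    by (subst 2) (rule mat_adjoint_mult[OF AX(3,4)])
  also have "\<dots> = (Y * A) * (X * A)" using x y by simp
  also have "\<dots> = Y * (A * (X * A))" by (rule assoc_mult_mat[OF Y A AX(3)])
  also have "A * (X * A) = A * X * A" by (rule assoc_mult_mat[OF A X A, symmetric])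
  also have "\<dots> = A" using x by simp
  finally have eq2: "X * A = Y * A" .
  have "X = X * A * X" using x by simp
  also have "\<dots> = Y * A * X" by (simp only: eq2)
  also have "\<dots> = Y * (A * X)" by (rule assoc_mult_mat[OF Y A X])
  also have "\<dots> = Y * (A * Y)" by (simp only: eq1)
  also have "\<dots> = Y * A * Y" by (rule assoc_mult_mat[OF Y A Y, symmetric])
  also have "\<dots> = Y" using y by simp
  finally show ?thesis .
qed

text \<open>The adjoint of A times the inverse of the Gram matrix satisfies the four Penrose
  equations, hence is the pseudo-inverse. The second conclusion is the form that yields the normal
  equations.\<close>

lemma moore_penrose_full_row_rank:
  assumes A: "A \<in> carrier_mat n m" and det: "Determinant.det (A * mat_adjoint A) \<noteq> 0"
  shows "moore_penrose A \<in> carrier_mat m n"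
    "moore_penrose A * (A * mat_adjoint A) = mat_adjoint A"
proof -
  note A' = mat_adjoint_carrier[OF A]
  let ?G = "A * mat_adjoint A"
  let ?W = "the (mat_inverse ?G)"
  have G: "?G \<in> carrier_mat n n" using A A' by (rule mult_carrier_mat)
  note W = mat_inverse_det[OF G det]
  let ?X = "mat_adjoint A * ?W"
  have X: "?X \<in> carrier_mat m n" using A' W(1) by (rule mult_carrier_mat)
  have AX: "A * ?X = 1\<^sub>m n" using W(2) assoc_mult_mat[OF A A' W(1)] by simp
  have adjW: "mat_adjoint ?W = ?W"
  proof (rule mat_left_inverse_unique[OF G mat_adjoint_carrier[OF W(1)] W(1) _ W(2)])
    have "mat_adjoint ?W * ?G = mat_adjoint ?W * mat_adjoint ?G"
      by (simp add: mat_adjoint_mult[OF A A'] mat_adjoint_adjoint)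
    also have "\<dots> = mat_adjoint (?G * ?W)" by (rule mat_adjoint_mult[OF G W(1), symmetric])
    finally show "mat_adjoint ?W * ?G = 1\<^sub>m n" using W(2) by simp
  qed
  have XA: "mat_adjoint (?X * A) = ?X * A"
  proof -
    have "mat_adjoint (?X * A) = mat_adjoint A * mat_adjoint ?X" by (rule mat_adjoint_mult[OF X A])
    also have "mat_adjoint ?X = ?W * A"
      by (simp add: mat_adjoint_mult[OF A' W(1)] adjW mat_adjoint_adjoint)
    also have "mat_adjoint A * (?W * A) = ?X * A" by (rule assoc_mult_mat[OF A' W(1) A, symmetric])
    finally show ?thesis .
  qed
  have "?X * A * ?X = ?X * (A * ?X)" by (rule assoc_mult_mat[OF X A X])
  then have p: "penrose_inverse A ?X"
    unfolding penrose_inverse_def using A X AX XA right_mult_one_mat[OF X] by simp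
  have "moore_penrose A = ?X"
    unfolding moore_penrose_def penrose_inverse_def[symmetric]
    by (rule the_equality, rule p, rule penrose_inverse_unique[OF _ p])
  moreover have "?X * ?G = mat_adjoint A" using W(3) assoc_mult_mat[OF A' W(1) G] right_mult_one_mat[OF A'] by simp
  ultimately show "moore_penrose A \<in> carrier_mat m n"
    "moore_penrose A * (A * mat_adjoint A) = mat_adjoint A" using X by simp_all
qed

definition hermitian_form :: "nat \<Rightarrow> (nat \<Rightarrow> nat \<Rightarrow> complex) \<Rightarrow> (nat \<Rightarrow> complex) \<Rightarrow> real" where
  "hermitian_form r D v = Re (\<Sum>i<r. \<Sum>j<r. cnj (v i) * D i j * v j)"

lemma norm_double_sum_le:
  fixes D :: "nat \<Rightarrow> nat \<Rightarrow> complex"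
  shows "cmod (\<Sum>i<r. \<Sum>j<r. cnj (v i) * D i j * v j) \<le> (\<Sum>i<r. \<Sum>j<r. cmod (D i j)) * (\<Sum>i<r. (cmod (v i))\<^sup>2)"
proof -
  let ?n = "\<Sum>i<r. (cmod (v i))\<^sup>2"
  have "cmod (v i) * cmod (v j) \<le> ?n" if "i < r" "j < r" for i j
  proof -
    have "(cmod (v k))\<^sup>2 \<le> ?n" if "k < r" for k
      by (rule member_le_sum[where f = "\<lambda>i. (cmod (v i))\<^sup>2"]) (use that in auto)
    moreover have "2 * (cmod (v i) * cmod (v j)) \<le> (cmod (v i))\<^sup>2 + (cmod (v j))\<^sup>2"
      using sum_squares_bound[of "cmod (v i)" "cmod (v j)"] by simp
    ultimately show ?thesis using that by (smt (verit))
  qed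
  then have "cmod (cnj (v i) * D i j * v j) \<le> cmod (D i j) * ?n" if "i < r" "j < r" for i j
    using that mult_left_mono[of "cmod (v i) * cmod (v j)" ?n "cmod (D i j)"] by (simp add: norm_mult mult_ac)
  then show ?thesis unfolding sum_distrib_right by (intro sum_norm_le) auto
qed

text \<open>Test positivity on v - w / B with w = D v, where B bounds the form. It gives 0 <= q(v) -
  (2 / B) |w|^2 + q(w) / B^2, and q(w) <= B |w|^2 leaves q(v) >= |w|^2 / B. The inverse of D bounds
  |v|^2 by S |w|^2.\<close>

lemma hermitian_form_positive_gap:
  assumes D: "D \<in> carrier_mat r r" and herm: "\<And>i j. i < r \<Longrightarrow> j < r \<Longrightarrow> D $$ (j, i) = cnj (D $$ (i, j))"
    and psd: "\<And>v. hermitian_form r (\<lambda>i j. D $$ (i, j)) v \<ge> 0" and det: "Determinant.det D \<noteq> 0"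
  shows "\<exists>c>0. \<forall>v. c * (\<Sum>i<r. (cmod (v i))\<^sup>2) \<le> hermitian_form r (\<lambda>i j. D $$ (i, j)) v"
proof -
  let ?q = "hermitian_form r (\<lambda>i j. D $$ (i, j))"
  let ?R = "the (mat_inverse D)"
  note R = mat_inverse_det[OF D det]
  define B where "B = 1 + (\<Sum>i<r. \<Sum>j<r. cmod (D $$ (i, j)))"
  define S where "S = 1 + (\<Sum>i<r. (\<Sum>j<r. (cmod (?R $$ (i, j)))\<^sup>2))"
  have B: "B \<ge> 1" and S: "S \<ge> 1" by (auto simp: B_def S_def intro!: sum_nonneg)
  have "1 / (B * S) * (\<Sum>i<r. (cmod (v i))\<^sup>2) \<le> ?q v" for v
  proof -
    define w where "w i = (\<Sum>j<r. D $$ (i, j) * v j)" for i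
    define nw where "nw = (\<Sum>i<r. (cmod (w i))\<^sup>2)"
    have nw: "complex_of_real nw = (\<Sum>i<r. cnj (w i) * w i)"
      unfolding nw_def of_real_sum complex_norm_square by (intro sum.cong refl mult.commute)
    have q1: "(\<Sum>i<r. \<Sum>j<r. cnj (a i) * D $$ (i, j) * v j) = (\<Sum>i<r. cnj (a i) * w i)" for a
      by (simp add: w_def sum_distrib_left mult.assoc)
    have q2: "(\<Sum>i<r. \<Sum>j<r. cnj (v i) * D $$ (i, j) * b j) = (\<Sum>j<r. cnj (w j) * b j)" for b
    proof -
      have "(\<Sum>i<r. \<Sum>j<r. cnj (v i) * D $$ (i, j) * b j) = (\<Sum>j<r. \<Sum>i<r. cnj (v i) * D $$ (i, j) * b j)"
        by (rule sum.swap)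
      also have "\<dots> = (\<Sum>j<r. cnj (w j) * b j)"
        unfolding w_def cnj_sum sum_distrib_right
      proof (intro sum.cong refl)
        fix j i assume "j \<in> {..<r}" "i \<in> {..<r}"
        then have "cnj (D $$ (j, i)) = D $$ (i, j)" using herm[of i j] by simp
        then show "cnj (v i) * D $$ (i, j) * b j = cnj (D $$ (j, i) * v i) * b j" by simp
      qed
      finally show ?thesis .
    qed
    define s where "s = complex_of_real (1 / B)"
    have cs: "cnj s = s" by (simp add: s_def)
    let ?u = "\<lambda>i. v i - s * w i"
    have "(\<Sum>i<r. \<Sum>j<r. cnj (?u i) * D $$ (i, j) * ?u j) =
        (\<Sum>i<r. \<Sum>j<r. cnj (v i) * D $$ (i, j) * v j)
        - s * (\<Sum>i<r. \<Sum>j<r. cnj (w i) * D $$ (i, j) * v j)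
        - s * (\<Sum>i<r. \<Sum>j<r. cnj (v i) * D $$ (i, j) * w j)
        + s * s * (\<Sum>i<r. \<Sum>j<r. cnj (w i) * D $$ (i, j) * w j)"
      unfolding sum_distrib_left sum_subtractf[symmetric] sum.distrib[symmetric]
      by (intro sum.cong refl) (simp add: cs algebra_simps)
    also have "\<dots> = (\<Sum>i<r. \<Sum>j<r. cnj (v i) * D $$ (i, j) * v j) - of_real (2 / B * nw)
        + of_real (1 / B * (1 / B)) * (\<Sum>i<r. \<Sum>j<r. cnj (w i) * D $$ (i, j) * w j)"
      unfolding q1[of w] q2[of w] nw[symmetric] by (simp add: s_def algebra_simps)
    finally have "?q ?u = ?q v - 2 / B * nw + 1 / B * (1 / B) * ?q w"
      by (simp add: hermitian_form_def del: of_real_mult of_real_divide)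
    moreover have "?q w \<le> B * nw"
    proof -
      have "?q w \<le> cmod (\<Sum>i<r. \<Sum>j<r. cnj (w i) * D $$ (i, j) * w j)"
        unfolding hermitian_form_def by (rule complex_Re_le_cmod)
      also have "\<dots> \<le> (\<Sum>i<r. \<Sum>j<r. cmod (D $$ (i, j))) * nw" unfolding nw_def by (rule norm_double_sum_le)
      also have "\<dots> \<le> B * nw" by (intro mult_right_mono) (auto simp: B_def nw_def intro!: sum_nonneg)
      finally show ?thesis .
    qed
    then have "1 / B * (1 / B) * ?q w \<le> 1 / B * nw" using B by (simp add: field_simps)
    moreover have "2 / B * nw = 2 * (nw / B)" "1 / B * nw = nw / B" by simp_all
    ultimately have "nw / B \<le> ?q v" using psd[of ?u] by linarith
    moreover have "(\<Sum>i<r. (cmod (v i))\<^sup>2) \<le> S * nw"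
    proof -
      have vi: "v i = (\<Sum>j<r. ?R $$ (i, j) * w j)" if i: "i < r" for i
      proof -
        have "(\<Sum>j<r. ?R $$ (i, j) * w j) = (\<Sum>k<r. (\<Sum>j<r. ?R $$ (i, j) * D $$ (j, k)) * v k)"
          unfolding w_def sum_distrib_left sum_distrib_right by (subst sum.swap) (simp add: mult.assoc)
        also have "\<dots> = (\<Sum>k<r. (?R * D) $$ (i, k) * v k)"
          using index_mult_mat_sum[OF R(1) D i] by (intro sum.cong refl) auto
        also have "\<dots> = (\<Sum>k<r. if k = i then v i else 0)" unfolding R(3) using i by (intro sum.cong) auto
        finally show ?thesis using i by simp
      qed
      have "(cmod (v i))\<^sup>2 \<le> (\<Sum>j<r. (cmod (?R $$ (i, j)))\<^sup>2) * nw" if i: "i < r" for i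
      proof -
        have "cmod (v i) \<le> (\<Sum>j<r. cmod (?R $$ (i, j)) * cmod (w j))"
          unfolding vi[OF i] by (rule sum_norm_le) (simp add: norm_mult)
        also have "\<dots> \<le> L2_set (\<lambda>j. cmod (?R $$ (i, j))) {..<r} * L2_set (\<lambda>j. cmod (w j)) {..<r}"
          using L2_set_mult_ineq[of "\<lambda>j. cmod (?R $$ (i, j))" "\<lambda>j. cmod (w j)" "{..<r}"] by simp
        finally have "(cmod (v i))\<^sup>2 \<le> (L2_set (\<lambda>j. cmod (?R $$ (i, j))) {..<r} * L2_set (\<lambda>j. cmod (w j)) {..<r})\<^sup>2"
          by (rule power_mono) simp
        then show ?thesis by (simp add: power_mult_distrib L2_set_def nw_def sum_nonneg)
      qed
      then have "(\<Sum>i<r. (cmod (v i))\<^sup>2) \<le> (\<Sum>i<r. (\<Sum>j<r. (cmod (?R $$ (i, j)))\<^sup>2) * nw)"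
        by (intro sum_mono) auto
      also have "\<dots> \<le> S * nw" unfolding sum_distrib_right[symmetric]
        by (intro mult_right_mono) (auto simp: S_def nw_def intro!: sum_nonneg)
      finally show ?thesis .
    qed
    then have "1 / (B * S) * (\<Sum>i<r. (cmod (v i))\<^sup>2) \<le> 1 / (B * S) * (S * nw)"
      using B S by (intro mult_left_mono) auto
    then have "1 / (B * S) * (\<Sum>i<r. (cmod (v i))\<^sup>2) \<le> nw / B" using S by simp
    ultimately show ?thesis by linarith
  qed
  moreover have "1 / (B * S) > 0" using B S by simp
  ultimately show ?thesis by blast
qed

text \<open>Let t0 be the largest t with q(v) >= t |v|^2 for all v. If D - t0 I were invertible, the
  gap lemma would allow a larger t; so t0 is an eigenvalue and the smallest eigenvalue is at most
  t0. This replaces the spectral theorem.\<close>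

lemma smallest_eigenvalue_hermitian:
  assumes D: "D \<in> carrier_mat r r" and r: "r > 0"
    and herm: "\<And>i j. i < r \<Longrightarrow> j < r \<Longrightarrow> D $$ (j, i) = cnj (D $$ (i, j))"
  shows "smallest_eigenvalue D * (\<Sum>i<r. (cmod (v i))\<^sup>2) \<le> hermitian_form r (\<lambda>i j. D $$ (i, j)) v"
    and "(\<And>v. hermitian_form r (\<lambda>i j. D $$ (i, j)) v \<ge> 0) \<Longrightarrow> smallest_eigenvalue D \<ge> 0"
proof -
  let ?q = "hermitian_form r (\<lambda>i j. D $$ (i, j))"
  let ?n = "\<lambda>v. \<Sum>i<r. (cmod (v i))\<^sup>2"
  define S where "S = {t. \<forall>v. t * ?n v \<le> ?q v}"
  define t0 where "t0 = Sup S"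
  let ?B = "\<Sum>i<r. \<Sum>j<r. cmod (D $$ (i, j))"
  have n0: "?n v \<ge> 0" for v :: "nat \<Rightarrow> complex" by (intro sum_nonneg) auto
  have "- ?B * ?n v \<le> ?q v" for v
  proof -
    have "\<bar>?q v\<bar> \<le> cmod (\<Sum>i<r. \<Sum>j<r. cnj (v i) * D $$ (i, j) * v j)"
      unfolding hermitian_form_def by (rule abs_Re_le_cmod)
    then show ?thesis using norm_double_sum_le[where r = r and v = v and D = "\<lambda>i j. D $$ (i, j)"] by simp
  qed
  then have "- ?B \<in> S" unfolding S_def by blast
  then have ne: "S \<noteq> {}" by blast
  let ?e = "\<lambda>i::nat. if i = 0 then 1 else 0 :: complex"
  have SD: "t * ?n v \<le> ?q v" if "t \<in> S" for t v
    by (rule spec[OF that[unfolded S_def mem_Collect_eq]])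
  have ne1: "?n ?e = 1"
  proof -
    have "?n ?e = (\<Sum>i<r. if i = 0 then 1 else 0)" by (intro sum.cong) auto
    then show ?thesis using r by simp
  qed
  have bdd: "bdd_above S"
  proof (rule bdd_aboveI)
    fix t assume "t \<in> S"
    from SD[OF this, of ?e] show "t \<le> ?q ?e" by (simp only: ne1 mult_1_right)
  qed
  have t0: "t0 * ?n v \<le> ?q v" for v
  proof (cases "?n v = 0")
    case True
    then show ?thesis using SD[OF \<open>- ?B \<in> S\<close>, of v] by simp
  next
    case False
    then have pos: "?n v > 0" using n0[of v] by simp
    have "t \<le> ?q v / ?n v" if "t \<in> S" for t
      using SD[OF that, of v] pos by (simp add: pos_le_divide_eq)
    then have "t0 \<le> ?q v / ?n v" unfolding t0_def using ne by (intro cSup_least) auto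
    then show ?thesis using pos by (simp add: pos_le_divide_eq)
  qed
  define M where "M = D - of_real t0 \<cdot>\<^sub>m 1\<^sub>m r"
  have M: "M \<in> carrier_mat r r" unfolding M_def by (rule minus_carrier_mat) simp
  have qM: "hermitian_form r (\<lambda>i j. M $$ (i, j)) v = ?q v - t0 * ?n v" for v
  proof -
    have "(\<Sum>i<r. \<Sum>j<r. cnj (v i) * M $$ (i, j) * v j) =
        (\<Sum>i<r. \<Sum>j<r. cnj (v i) * D $$ (i, j) * v j - (if i = j then of_real (t0 * (cmod (v i))\<^sup>2) else 0))"
      using D by (intro sum.cong refl) (auto simp: M_def algebra_simps complex_norm_square[symmetric] simp del: of_real_power)
    also have "\<dots> = (\<Sum>i<r. \<Sum>j<r. cnj (v i) * D $$ (i, j) * v j) - of_real (t0 * ?n v)"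
      by (simp add: sum_subtractf sum_distrib_left)
    finally show ?thesis by (simp add: hermitian_form_def del: of_real_mult)
  qed
  have "Determinant.det M = 0"
  proof (rule ccontr)
    assume "Determinant.det M \<noteq> 0"
    moreover have "M $$ (j, i) = cnj (M $$ (i, j))" if "i < r" "j < r" for i j
      using that D herm[OF that] by (auto simp: M_def)
    ultimately obtain c where c: "c > 0" "\<And>v. c * ?n v \<le> hermitian_form r (\<lambda>i j. M $$ (i, j)) v"
      using hermitian_form_positive_gap[OF M] t0 unfolding qM by (metis diff_ge_0_iff_ge)
    have "(t0 + c) * ?n v \<le> ?q v" for v using c(2)[of v] unfolding qM by (simp add: algebra_simps)
    then have "t0 + c \<in> S" unfolding S_def by blast
    then have "t0 + c \<le> t0" unfolding t0_def using bdd by (intro cSup_upper)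
    then show False using c(1) by simp
  qed
  moreover have "M = char_matrix D (of_real t0)"
    by (rule eq_matI) (use D in \<open>auto simp: M_def char_matrix_def\<close>)
  ultimately have ev: "eigenvalue D (of_real t0)" using eigenvalue_det[OF D] by simp
  let ?Ev = "{l. eigenvalue D (complex_of_real l)}"
  have "char_poly D \<noteq> 0" using degree_monic_char_poly[OF D] by auto
  then have "finite {k. eigenvalue D k}"
    unfolding eigenvalue_root_char_poly[OF D] by (rule poly_roots_finite)
  then have "finite (of_real -` {k. eigenvalue D k} :: real set)"
    by (rule finite_vimageI) (simp add: inj_of_real)
  then have fin: "finite ?Ev" by (simp add: vimage_def)
  have "smallest_eigenvalue D \<le> t0" unfolding smallest_eigenvalue_def using fin ev by (intro Min_le) auto
  then have "smallest_eigenvalue D * ?n v \<le> t0 * ?n v" using n0 by (rule mult_right_mono)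
  then show "smallest_eigenvalue D * ?n v \<le> ?q v" using t0[of v] by linarith
  assume psd: "\<And>v. ?q v \<ge> 0"
  have "smallest_eigenvalue D \<in> ?Ev" unfolding smallest_eigenvalue_def using fin ev by (intro Min_in) auto
  then obtain v where v: "v \<in> carrier_vec r" "v \<noteq> 0\<^sub>v r" "D *\<^sub>v v = of_real (smallest_eigenvalue D) \<cdot>\<^sub>v v"
    using D unfolding eigenvalue_def eigenvector_def by auto
  let ?v = "vec_index v"
  let ?l = "smallest_eigenvalue D"
  have Dv: "(\<Sum>j<r. D $$ (i, j) * ?v j) = of_real ?l * ?v i" if "i < r" for i
    using index_mult_mat_vec_sum[OF D v(1) that] v(1) that unfolding v(3) by simp
  have "(\<Sum>i<r. \<Sum>j<r. cnj (?v i) * D $$ (i, j) * ?v j) = (\<Sum>i<r. cnj (?v i) * (of_real ?l * ?v i))"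
    by (simp add: mult.assoc sum_distrib_left[symmetric] Dv)
  also have "\<dots> = of_real (?l * ?n ?v)"
    unfolding of_real_mult of_real_sum complex_norm_square sum_distrib_left
    by (intro sum.cong refl) (simp add: mult_ac)
  finally have "?q ?v = ?l * ?n ?v" by (simp add: hermitian_form_def del: of_real_mult)
  moreover have "?n ?v > 0"
  proof -
    obtain i where "i < r" "?v i \<noteq> 0" using v(1,2) by (metis eq_vecI carrier_vecD index_zero_vec)
    then show ?thesis by (intro sum_pos2[of _ i]) auto
  qed
  ultimately show "?l \<ge> 0" using psd[of ?v] by (simp add: zero_le_mult_iff)
qed

text \<open>For t = U a the normal equations give |t|^2 = <t, \<rho>>, and 2 |t_s| |\<rho>_s| <=
  |t_s|^2 + \<epsilon>^2 turns this into |t|^2 <= N \<epsilon>^2. The lower bound \<open>low\<close>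
  converts it into a bound for the coefficients, in which N cancels.\<close>

lemma least_squares_error:
  fixes U :: "nat \<Rightarrow> nat \<Rightarrow> complex"
  assumes normal: "\<And>i. i < r \<Longrightarrow> (\<Sum>s<N. cnj (U s i) * (\<Sum>k<r. U s k * a k)) = (\<Sum>s<N. cnj (U s i) * \<rho> s)"
    and rem: "\<And>s. s < N \<Longrightarrow> cmod (\<rho> s) \<le> \<epsilon>"
    and low: "real N * l * (\<Sum>k<r. (cmod (a k))\<^sup>2) \<le> (\<Sum>s<N. (cmod (\<Sum>k<r. U s k * a k))\<^sup>2)"
    and pos: "N > 0" "l > 0" and k: "k < r"
  shows "cmod (a k) \<le> \<epsilon> / sqrt l"
proof -
  have e0: "\<epsilon> \<ge> 0" using rem[of 0] pos(1) norm_ge_zero order_trans by blast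
  let ?t = "\<lambda>s. \<Sum>k<r. U s k * a k"
  let ?T = "\<Sum>s<N. (cmod (?t s))\<^sup>2"
  have cnj_t: "cnj (?t s) = (\<Sum>i<r. cnj (U s i) * cnj (a i))" for s by simp
  have "complex_of_real ?T = (\<Sum>s<N. cnj (?t s) * ?t s)"
    unfolding of_real_sum complex_norm_square by (intro sum.cong refl mult.commute)
  also have "\<dots> = (\<Sum>s<N. \<Sum>i<r. cnj (a i) * (cnj (U s i) * ?t s))"
    unfolding cnj_t sum_distrib_right by (intro sum.cong refl) (simp add: mult_ac)
  also have "\<dots> = (\<Sum>i<r. cnj (a i) * (\<Sum>s<N. cnj (U s i) * ?t s))"
    by (subst sum.swap) (simp add: sum_distrib_left)
  also have "\<dots> = (\<Sum>i<r. cnj (a i) * (\<Sum>s<N. cnj (U s i) * \<rho> s))" by (simp add: normal)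
  also have "\<dots> = (\<Sum>s<N. \<Sum>i<r. cnj (a i) * (cnj (U s i) * \<rho> s))"
    unfolding sum_distrib_left by (rule sum.swap)
  also have "\<dots> = (\<Sum>s<N. cnj (?t s) * \<rho> s)"
    unfolding cnj_t sum_distrib_right by (intro sum.cong refl) (simp add: mult_ac)
  finally have eq: "complex_of_real ?T = (\<Sum>s<N. cnj (?t s) * \<rho> s)" .
  have "?T \<le> cmod (complex_of_real ?T)" by (simp only: norm_of_real abs_ge_self)
  also have "\<dots> = cmod (\<Sum>s<N. cnj (?t s) * \<rho> s)" by (simp only: eq)
  also have "\<dots> \<le> (\<Sum>s<N. ((cmod (?t s))\<^sup>2 + \<epsilon>\<^sup>2) / 2)"
  proof (rule sum_norm_le)
    fix s assume "s \<in> {..<N}"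
    then have "cmod (?t s) * cmod (\<rho> s) \<le> cmod (?t s) * \<epsilon>" using rem by (intro mult_left_mono) auto
    also have "\<dots> \<le> ((cmod (?t s))\<^sup>2 + \<epsilon>\<^sup>2) / 2"
      using sum_squares_bound[of "cmod (?t s)" \<epsilon>] by simp
    finally show "cmod (cnj (?t s) * \<rho> s) \<le> ((cmod (?t s))\<^sup>2 + \<epsilon>\<^sup>2) / 2"
      by (simp only: norm_mult complex_mod_cnj)
  qed
  also have "\<dots> = (?T + real N * \<epsilon>\<^sup>2) / 2"
    by (simp add: sum_divide_distrib[symmetric] sum.distrib)
  finally have "?T \<le> real N * \<epsilon>\<^sup>2" by simp
  with low have "real N * l * (\<Sum>k<r. (cmod (a k))\<^sup>2) \<le> real N * \<epsilon>\<^sup>2" by linarith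
  then have "l * (\<Sum>k<r. (cmod (a k))\<^sup>2) \<le> \<epsilon>\<^sup>2" using pos(1) by (simp add: mult.assoc)
  moreover have "(cmod (a k))\<^sup>2 \<le> (\<Sum>k<r. (cmod (a k))\<^sup>2)"
    by (rule member_le_sum[where f = "\<lambda>k. (cmod (a k))\<^sup>2"]) (use k in auto)
  ultimately have "l * (cmod (a k))\<^sup>2 \<le> \<epsilon>\<^sup>2" using pos(2) by (meson mult_left_mono less_imp_le order_trans)
  then have "(sqrt l * cmod (a k))\<^sup>2 \<le> \<epsilon>\<^sup>2" using pos(2) by (simp add: power_mult_distrib)
  then have "sqrt l * cmod (a k) \<le> \<epsilon>" using e0 by (rule power2_le_imp_le)
  then show ?thesis using pos(2) by (simp add: field_simps)
qed


section \<open>The basis functions in the coordinates x = z - p, and jets at p\<close>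

text \<open>Since degrees are monotone along the numbering, the indices of degree at most n form an
  initial segment starting at 1, and counting multi-indices determines its length. Matrix columns
  start at 0, hence the shift by one.\<close>

lemma bij_betw_graded_numbering:
  fixes \<alpha> :: "nat \<Rightarrow> nat ^ 'd"
  assumes "graded_numbering e \<alpha>"
  shows "bij_betw (\<lambda>i. \<alpha> (i + 1)) {..<jet_dim TYPE('d) n} {a. mdeg a \<le> n}"
proof -
  have bij: "bij_betw \<alpha> {1..} UNIV" and zero: "\<alpha> 1 = 0"
    and mono: "\<And>i j. 1 \<le> i \<Longrightarrow> i \<le> j \<Longrightarrow> mdeg (\<alpha> i) \<le> mdeg (\<alpha> j)"
    using assms unfolding graded_numbering_def mdeg_def by auto
  define S where "S = {i \<in> {1..}. mdeg (\<alpha> i) \<le> n}"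
  have img: "\<alpha> ` S = {a. mdeg a \<le> n}"
  proof (intro equalityI subsetI)
    fix a :: "nat ^ 'd" assume "a \<in> {a. mdeg a \<le> n}"
    moreover have "a \<in> \<alpha> ` {1..}" using bij_betw_imp_surj_on[OF bij] by simp
    then obtain i where "i \<in> {1..}" "a = \<alpha> i" by blast
    ultimately show "a \<in> \<alpha> ` S" unfolding S_def by blast
  qed (auto simp: S_def)
  have inj: "inj_on \<alpha> S" by (rule inj_on_subset[OF bij_betw_imp_inj_on[OF bij]]) (auto simp: S_def)
  have fin: "finite S" by (rule finite_imageD[OF _ inj]) (simp add: img card_multiindices(1))
  have "1 \<in> S" unfolding S_def using zero by (simp add: mdeg_def)
  define m where "m = Max S"
  have "S = {1..m}"
  proof
    show "S \<subseteq> {1..m}" unfolding m_def using fin by (auto simp: S_def)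
    have "m \<in> S" unfolding m_def using fin \<open>1 \<in> S\<close> by (intro Max_in) auto
    then have m: "mdeg (\<alpha> m) \<le> n" by (simp add: S_def)
    show "{1..m} \<subseteq> S"
    proof
      fix i assume i: "i \<in> {1..m}"
      then have "mdeg (\<alpha> i) \<le> mdeg (\<alpha> m)" by (intro mono) auto
      then show "i \<in> S" using i m by (simp add: S_def)
    qed
  qed
  moreover have "card S = jet_dim TYPE('d) n"
    using card_image[OF inj] card_multiindices(2)[where ?'d = 'd, of n] unfolding img jet_dim_def by simp
  ultimately have S: "S = {1..jet_dim TYPE('d) n}" by simp
  have *: "bij_betw \<alpha> S {a. mdeg a \<le> n}" using img inj unfolding bij_betw_def by blast
  have "bij_betw Suc {..<jet_dim TYPE('d) n} S" unfolding S
    by (auto simp: bij_betw_def image_Suc_lessThan)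
  from bij_betw_trans[OF this *] show ?thesis by (simp add: o_def)
qed

lemma sum_multiindices_numbering:
  fixes \<alpha> :: "nat \<Rightarrow> nat ^ 'd"
  assumes "graded_numbering e \<alpha>"
  shows "(\<Sum>a | mdeg a \<le> n. F a) = (\<Sum>i<jet_dim TYPE('d) n. F (\<alpha> (i + 1)))"
  by (rule sum.reindex_bij_betw[OF bij_betw_graded_numbering[OF assms], symmetric])

lemma mdeg_numbering_le:
  fixes \<alpha> :: "nat \<Rightarrow> nat ^ 'd"
  assumes "graded_numbering e \<alpha>" "i < jet_dim TYPE('d) n"
  shows "mdeg (\<alpha> (i + 1)) \<le> n"
  using bij_betw_apply[OF bij_betw_graded_numbering[OF assms(1)], of i n] assms(2) by simp

lemma jet_dim_mono: "m \<le> n \<Longrightarrow> jet_dim TYPE('d::finite) m \<le> jet_dim TYPE('d) n"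
  unfolding jet_dim_def card_multiindices(2)[symmetric]
  by (rule card_mono[OF card_multiindices(1)]) auto

lemma jet_dim_pos: "jet_dim TYPE('d::finite) n > 0"
  unfolding jet_dim_def by simp

text \<open>The exponential factor common to all the u_i. It has no zeros, and dividing by it turns
  combinations of basis functions into polynomials.\<close>

definition jet_weight :: "complex ^ 'd \<Rightarrow> complex ^ 'd \<Rightarrow> complex" where
  "jet_weight p x = exp (\<Sum>k\<in>UNIV. cnj (p $ k) * (p + x) $ k)"

definition jet_scale :: "(nat \<Rightarrow> nat ^ 'd) \<Rightarrow> complex ^ 'd \<Rightarrow> nat \<Rightarrow> complex" where
  "jet_scale \<alpha> p i = complex_of_real (exp (- (norm p)\<^sup>2 / 2) / sqrt (\<Prod>k\<in>UNIV. fact (\<alpha> (i + 1) $ k)))"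

text \<open>The function \<open>u\<^bsub>p,i+1\<^esub>\<close> in the coordinates \<open>x = z - p\<close>.\<close>

definition jet_basis :: "(nat \<Rightarrow> nat ^ 'd) \<Rightarrow> complex ^ 'd \<Rightarrow> nat \<Rightarrow> complex ^ 'd \<Rightarrow> complex" where
  "jet_basis \<alpha> p i x = u_fun \<alpha> p (i + 1) (p + x)"

lemma jet_basis_eq:
  "jet_basis \<alpha> p i x = jet_scale \<alpha> p i * monomial_fun (\<alpha> (i + 1)) x * jet_weight p x"
  by (simp add: jet_basis_def u_fun_def jet_scale_def jet_weight_def)

lemma jet_scale_nonzero: "jet_scale \<alpha> p i \<noteq> 0"
  by (simp add: jet_scale_def)

lemma jet_weight_nonzero: "jet_weight p x \<noteq> 0"
  by (simp add: jet_weight_def)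

lemma line_holomorphic_monomial_fun: "line_holomorphic (monomial_fun a) W"
  unfolding monomial_fun_def[abs_def]
  by (intro line_holomorphic_prod line_holomorphic_power line_holomorphic_component)

lemma line_holomorphic_jet_weight: "line_holomorphic (jet_weight p) W"
  unfolding jet_weight_def[abs_def] vector_add_component
  by (intro line_holomorphic_exp line_holomorphic_sum line_holomorphic_mult line_holomorphic_add
      line_holomorphic_const line_holomorphic_component)

lemma line_holomorphic_divide:
  "line_holomorphic f W \<Longrightarrow> line_holomorphic g W \<Longrightarrow> (\<And>x. g x \<noteq> 0) \<Longrightarrow> line_holomorphic (\<lambda>x. f x / g x) W"
  unfolding line_holomorphic_def by (auto intro!: continuous_intros holomorphic_intros)

lemma continuous_jet_weight: "continuous_on S (jet_weight p)"
  using line_holomorphic_jet_weight[of p S] unfolding line_holomorphic_def by blast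

lemma jet_weight_inverse_bounded:
  fixes p :: "complex ^ 'd"
  shows "\<exists>B. \<forall>x. norm x \<le> R \<longrightarrow> cmod (1 / jet_weight p x) \<le> B"
proof -
  have "compact ((\<lambda>x. 1 / jet_weight p x) ` cball 0 R)"
    by (intro compact_continuous_image continuous_intros continuous_jet_weight) (auto simp: jet_weight_nonzero)
  then have "bounded ((\<lambda>x. 1 / jet_weight p x) ` cball 0 R)" by (rule compact_imp_bounded)
  then obtain B where B: "\<forall>y\<in>(\<lambda>x. 1 / jet_weight p x) ` cball 0 R. norm y \<le> B"
    unfolding bounded_iff by blast
  show ?thesis
  proof (rule exI[of _ B], intro allI impI)
    fix x :: "complex ^ 'd" assume "norm x \<le> R"
    then have "x \<in> cball 0 R" by simp
    then show "cmod (1 / jet_weight p x) \<le> B" by (rule B[rule_format, OF imageI])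
  qed
qed

text \<open>\<open>c\<close> lists the coordinates of the n-jet of \<open>h\<close> at 0. The jet is
  described by an O(|x|^(n+1)) bound instead of derivatives, so that jets of flows and of
  derivatives along V follow from plain estimates.\<close>

definition jet_approx ::
  "(nat \<Rightarrow> nat ^ 'd) \<Rightarrow> complex ^ 'd \<Rightarrow> nat \<Rightarrow> (complex ^ 'd \<Rightarrow> complex) \<Rightarrow> (nat \<Rightarrow> complex) \<Rightarrow> bool" where
  "jet_approx \<alpha> p n h c \<longleftrightarrow> (\<exists>B. \<exists>r>0. \<forall>x. norm x < r \<longrightarrow>
     cmod (h x - (\<Sum>i<jet_dim TYPE('d) n. c i * jet_basis \<alpha> p i x)) \<le> B * norm x ^ Suc n)"

text \<open>Take the Taylor polynomials of \<open>h\<close> divided by the weight and multiply the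
  weight back.\<close>

lemma jet_expansion:
  fixes h :: "complex ^ 'd \<Rightarrow> complex"
  assumes num: "graded_numbering e \<alpha>" and h: "line_holomorphic h (ball 0 R)" and R: "R > 0"
    and M: "\<And>x. norm x < R \<Longrightarrow> cmod (h x) \<le> M"
  shows "\<exists>c. \<forall>n x. (\<Sum>l\<le>n. taylor_term (\<lambda>x. h x / jet_weight p x) l x) * jet_weight p x =
    (\<Sum>i<jet_dim TYPE('d) n. c i * jet_basis \<alpha> p i x)"
proof -
  let ?g = "\<lambda>x. h x / jet_weight p x"
  have lh: "line_holomorphic ?g (ball 0 R)"
    by (intro line_holomorphic_divide h line_holomorphic_jet_weight jet_weight_nonzero)
  obtain B where B: "\<And>x. norm x \<le> R \<Longrightarrow> cmod (1 / jet_weight p x) \<le> B"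
    using jet_weight_inverse_bounded by blast
  have gM: "cmod (?g x) \<le> M * B" if "norm x < R" for x
  proof -
    have "cmod (h x) * cmod (1 / jet_weight p x) \<le> M * B"
      using M[OF that] B[of x] that by (intro mult_mono) (auto intro: order_trans[OF norm_ge_zero])
    then show ?thesis by (simp add: norm_divide)
  qed
  have "\<exists>c. \<forall>n x. (\<Sum>l\<le>n. taylor_term ?g l x) = (\<Sum>a | mdeg a \<le> n. c a * monomial_fun a x)"
    by (rule taylor_polynomial[OF lh R]) (rule gM)
  then obtain c where c: "\<And>n x. (\<Sum>l\<le>n. taylor_term ?g l x) = (\<Sum>a | mdeg a \<le> n. c a * monomial_fun a x)"
    by blast
  show ?thesis
  proof (intro exI allI)
    fix n x
    show "(\<Sum>l\<le>n. taylor_term ?g l x) * jet_weight p x =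
      (\<Sum>i<jet_dim TYPE('d) n. (c (\<alpha> (i + 1)) / jet_scale \<alpha> p i) * jet_basis \<alpha> p i x)"
      unfolding c sum_multiindices_numbering[OF num] sum_distrib_right
      by (intro sum.cong refl) (simp add: jet_basis_eq jet_scale_nonzero)
  qed
qed

text \<open>The constant coefficient is the limit at 0 and vanishes; then divide by t and
  induct.\<close>

lemma polyfun_small_eq_0:
  fixes c :: "nat \<Rightarrow> complex"
  assumes "r > 0" "\<And>t. 0 < t \<Longrightarrow> t < r \<Longrightarrow> cmod (\<Sum>l\<le>n. c l * of_real t ^ l) \<le> B * t ^ Suc n" "l \<le> n"
  shows "c l = 0"
  using assms(2,3)
proof (induction n arbitrary: c l)
  case 0
  have "((\<lambda>t. B * t) \<longlongrightarrow> B * 0) (at_right 0)" by (intro tendsto_intros)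
  moreover have "\<forall>\<^sub>F t in at_right 0. cmod (c 0) \<le> B * t"
    using eventually_at_right_real[OF assms(1)] by eventually_elim (use "0.prems"(1) in auto)
  ultimately have "cmod (c 0) \<le> B * 0" by (rule tendsto_lowerbound) simp
  then show ?case using "0.prems" by simp
next
  case (Suc n)
  have c0: "c 0 = 0"
  proof -
    have "((\<lambda>t. \<Sum>l\<le>Suc n. c l * of_real t ^ l) \<longlongrightarrow> (\<Sum>l\<le>Suc n. c l * of_real 0 ^ l)) (at_right 0)"
      by (intro tendsto_intros)
    moreover have "((\<lambda>t. \<Sum>l\<le>Suc n. c l * of_real t ^ l) \<longlongrightarrow> 0) (at_right 0)"
    proof (rule Lim_null_comparison)
      show "\<forall>\<^sub>F t in at_right 0. cmod (\<Sum>l\<le>Suc n. c l * of_real t ^ l) \<le> B * t ^ Suc (Suc n)"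
        using eventually_at_right_real[OF assms(1)] by eventually_elim (use Suc.prems(1) in auto)
      have "((\<lambda>t. B * t ^ Suc (Suc n)) \<longlongrightarrow> B * 0 ^ Suc (Suc n)) (at_right 0)" by (intro tendsto_intros)
      then show "((\<lambda>t. B * t ^ Suc (Suc n)) \<longlongrightarrow> 0) (at_right 0)" by simp
    qed
    ultimately have "(\<Sum>l\<le>Suc n. c l * of_real 0 ^ l) = 0" by (rule tendsto_unique[rotated]) simp
    also have "(\<Sum>l\<le>Suc n. c l * complex_of_real 0 ^ l) = c 0"
      by (subst sum.atMost_Suc_shift) simp
    finally show ?thesis .
  qed
  have *: "c (Suc l) = 0" if "l \<le> n" for l
  proof (rule Suc.IH[of "\<lambda>l. c (Suc l)", OF _ that])
    fix t :: real assume t: "0 < t" "t < r"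
    have "(\<Sum>l\<le>Suc n. c l * of_real t ^ l) = of_real t * (\<Sum>l\<le>n. c (Suc l) * of_real t ^ l)"
      by (subst sum.atMost_Suc_shift) (simp add: c0 sum_distrib_left mult_ac)
    then have "t * cmod (\<Sum>l\<le>n. c (Suc l) * of_real t ^ l) \<le> t * (B * t ^ Suc n)"
      using Suc.prems(1)[OF t] t by (simp add: norm_mult mult_ac)
    then show "cmod (\<Sum>l\<le>n. c (Suc l) * of_real t ^ l) \<le> B * t ^ Suc n" using t by simp
  qed
  show ?case using c0 * Suc.prems(2) by (cases l) auto
qed

text \<open>Divided by the weight, the difference of two expansions is a polynomial of degree at
  most n that is O(|x|^(n+1)). On every ray its homogeneous parts are the coefficients in t and must
  vanish; then the monomials are independent.\<close>

lemma jet_approx_unique: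
  fixes h :: "complex ^ 'd \<Rightarrow> complex"
  assumes num: "graded_numbering e \<alpha>" and c: "jet_approx \<alpha> p n h c" and d: "jet_approx \<alpha> p n h d"
    and i: "i < jet_dim TYPE('d) n"
  shows "c i = d i"
proof -
  let ?r = "jet_dim TYPE('d) n"
  obtain B1 r1 B2 r2 where 1: "r1 > 0" "\<And>x. norm x < r1 \<Longrightarrow> cmod (h x - (\<Sum>i<?r. c i * jet_basis \<alpha> p i x)) \<le> B1 * norm x ^ Suc n"
    and 2: "r2 > 0" "\<And>x. norm x < r2 \<Longrightarrow> cmod (h x - (\<Sum>i<?r. d i * jet_basis \<alpha> p i x)) \<le> B2 * norm x ^ Suc n"
    using c d unfolding jet_approx_def by blast
  define q where "q x = (\<Sum>i<?r. (c i - d i) * jet_scale \<alpha> p i * monomial_fun (\<alpha> (i + 1)) x)" for x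
  obtain B where B: "\<And>x. norm x \<le> 1 \<Longrightarrow> cmod (1 / jet_weight p x) \<le> B"
    using jet_weight_inverse_bounded by blast
  define r where "r = min 1 (min r1 r2)"
  have r: "r > 0" using 1 2 by (simp add: r_def)
  have small: "cmod (q x) \<le> (B1 + B2) * B * norm x ^ Suc n" if x: "norm x < r" for x
  proof -
    have eq: "q x * jet_weight p x = (h x - (\<Sum>i<?r. d i * jet_basis \<alpha> p i x)) - (h x - (\<Sum>i<?r. c i * jet_basis \<alpha> p i x))"
      unfolding q_def jet_basis_eq sum_distrib_right
      by (simp add: sum_subtractf[symmetric]) (intro sum.cong refl, simp add: algebra_simps)
    have xr: "norm x < r1" "norm x < r2" "norm x \<le> 1" using x by (auto simp: r_def)
    have le: "cmod (q x * jet_weight p x) \<le> B2 * norm x ^ Suc n + B1 * norm x ^ Suc n"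
      unfolding eq by (intro order_trans[OF norm_triangle_ineq4] add_mono 1(2) 2(2) xr)
    have nn: "0 \<le> B2 * norm x ^ Suc n + B1 * norm x ^ Suc n" by (rule order_trans[OF norm_ge_zero le])
    have "cmod (q x) = cmod (q x * jet_weight p x) * cmod (1 / jet_weight p x)"
      using jet_weight_nonzero[of p x] by (simp add: norm_mult norm_divide)
    also have "\<dots> \<le> (B2 * norm x ^ Suc n + B1 * norm x ^ Suc n) * B"
      by (intro mult_mono le B xr nn norm_ge_zero)
    finally show ?thesis by (simp add: algebra_simps)
  qed
  have hom: "(\<Sum>i\<in>{i\<in>{..<?r}. mdeg (\<alpha> (i + 1)) = l}. (c i - d i) * jet_scale \<alpha> p i * monomial_fun (\<alpha> (i + 1)) x) = 0"
    if l: "l \<le> n" for l x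
  proof (rule polyfun_small_eq_0[where n = n and r = "r / (norm x + 1)" and B = "(B1 + B2) * B * norm x ^ Suc n"])
    show "r / (norm x + 1) > 0" using r by (simp add: add_nonneg_pos)
    fix t :: real assume t: "0 < t" "t < r / (norm x + 1)"
    have "t * (norm x + 1) < r" using t(2) by (simp add: pos_less_divide_eq add_nonneg_pos)
    then have nr: "norm (complex_of_real t *s x) < r" using t(1) by (simp add: norm_vector_scalar_mult algebra_simps)
    have "q (complex_of_real t *s x) = (\<Sum>i<?r. (c i - d i) * jet_scale \<alpha> p i * monomial_fun (\<alpha> (i + 1)) x * of_real t ^ mdeg (\<alpha> (i + 1)))"
      by (simp add: q_def monomial_fun_scale mult_ac)
    also have "\<dots> = (\<Sum>l\<le>n. \<Sum>i\<in>{i\<in>{..<?r}. mdeg (\<alpha> (i + 1)) = l}.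
        (c i - d i) * jet_scale \<alpha> p i * monomial_fun (\<alpha> (i + 1)) x * of_real t ^ mdeg (\<alpha> (i + 1)))"
      by (rule sum.group[symmetric]) (use mdeg_numbering_le[OF num] in auto)
    also have "\<dots> = (\<Sum>l\<le>n. (\<Sum>i\<in>{i\<in>{..<?r}. mdeg (\<alpha> (i + 1)) = l}.
        (c i - d i) * jet_scale \<alpha> p i * monomial_fun (\<alpha> (i + 1)) x) * of_real t ^ l)"
      unfolding sum_distrib_right by (intro sum.cong refl) auto
    finally show "cmod (\<Sum>l\<le>n. (\<Sum>i\<in>{i\<in>{..<?r}. mdeg (\<alpha> (i + 1)) = l}.
        (c i - d i) * jet_scale \<alpha> p i * monomial_fun (\<alpha> (i + 1)) x) * of_real t ^ l) \<le> (B1 + B2) * B * norm x ^ Suc n * t ^ Suc n"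
      using small[OF nr] t(1) by (simp add: norm_vector_scalar_mult power_mult_distrib mult_ac)
  qed (rule l)
  have q0: "q x = 0" for x
  proof -
    have "q x = (\<Sum>l\<le>n. \<Sum>i\<in>{i\<in>{..<?r}. mdeg (\<alpha> (i + 1)) = l}.
        (c i - d i) * jet_scale \<alpha> p i * monomial_fun (\<alpha> (i + 1)) x)"
      unfolding q_def by (rule sum.group[symmetric]) (use mdeg_numbering_le[OF num] in auto)
    also have "\<dots> = 0" by (intro sum.neutral ballI hom) simp
    finally show ?thesis .
  qed
  note bij = bij_betw_graded_numbering[OF num, of n]
  let ?inv = "inv_into {..<?r} (\<lambda>i. \<alpha> (i + 1))"
  have inv: "?inv (\<alpha> (j + 1)) = j" if "j < ?r" for j
    using bij_betw_inv_into_left[OF bij, of j] that by simp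
  have "(c (?inv (\<alpha> (i + 1))) - d (?inv (\<alpha> (i + 1)))) * jet_scale \<alpha> p (?inv (\<alpha> (i + 1))) = 0"
  proof (rule monomial_fun_independent[where F = "{a. mdeg a \<le> n}"])
    fix x
    have "(\<Sum>a | mdeg a \<le> n. (c (?inv a) - d (?inv a)) * jet_scale \<alpha> p (?inv a) * monomial_fun a x) = q x"
      unfolding sum_multiindices_numbering[OF num] q_def by (intro sum.cong refl) (use inv in auto)
    then show "(\<Sum>a | mdeg a \<le> n. (c (?inv a) - d (?inv a)) * jet_scale \<alpha> p (?inv a) * monomial_fun a x) = 0"
      using q0 by simp
  qed (use card_multiindices(1) mdeg_numbering_le[OF num i] in auto)
  then show ?thesis using inv[OF i] jet_scale_nonzero by auto
qed

lemma jet_approx_add: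
  fixes f g :: "complex ^ 'd \<Rightarrow> complex"
  assumes "jet_approx \<alpha> p n f c" "jet_approx \<alpha> p n g d"
  shows "jet_approx \<alpha> p n (\<lambda>x. f x + g x) (\<lambda>i. c i + d i)"
proof -
  obtain B1 r1 B2 r2 where 1: "r1 > 0" "\<And>x. norm x < r1 \<Longrightarrow> cmod (f x - (\<Sum>i<jet_dim TYPE('d) n. c i * jet_basis \<alpha> p i x)) \<le> B1 * norm x ^ Suc n"
    and 2: "r2 > 0" "\<And>x. norm x < r2 \<Longrightarrow> cmod (g x - (\<Sum>i<jet_dim TYPE('d) n. d i * jet_basis \<alpha> p i x)) \<le> B2 * norm x ^ Suc n"
    using assms unfolding jet_approx_def by blast
  show ?thesis unfolding jet_approx_def
  proof (intro exI conjI allI impI)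
    show "min r1 r2 > 0" using 1 2 by simp
    fix x :: "complex ^ 'd" assume x: "norm x < min r1 r2"
    have "f x + g x - (\<Sum>i<jet_dim TYPE('d) n. (c i + d i) * jet_basis \<alpha> p i x) =
      (f x - (\<Sum>i<jet_dim TYPE('d) n. c i * jet_basis \<alpha> p i x)) + (g x - (\<Sum>i<jet_dim TYPE('d) n. d i * jet_basis \<alpha> p i x))"
      by (simp add: algebra_simps sum.distrib)
    also have "cmod \<dots> \<le> B1 * norm x ^ Suc n + B2 * norm x ^ Suc n"
      using x by (intro order_trans[OF norm_triangle_ineq] add_mono 1 2) auto
    finally show "cmod (f x + g x - (\<Sum>i<jet_dim TYPE('d) n. (c i + d i) * jet_basis \<alpha> p i x)) \<le> (B1 + B2) * norm x ^ Suc n"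
      by (simp add: algebra_simps)
  qed
qed

lemma jet_approx_mult_left:
  fixes f :: "complex ^ 'd \<Rightarrow> complex"
  assumes "jet_approx \<alpha> p n f c"
  shows "jet_approx \<alpha> p n (\<lambda>x. b * f x) (\<lambda>i. b * c i)"
proof -
  obtain B r where 1: "r > 0" "\<And>x. norm x < r \<Longrightarrow> cmod (f x - (\<Sum>i<jet_dim TYPE('d) n. c i * jet_basis \<alpha> p i x)) \<le> B * norm x ^ Suc n"
    using assms unfolding jet_approx_def by blast
  show ?thesis unfolding jet_approx_def
  proof (intro exI conjI allI impI, rule 1(1))
    fix x :: "complex ^ 'd" assume x: "norm x < r"
    have "b * f x - (\<Sum>i<jet_dim TYPE('d) n. b * c i * jet_basis \<alpha> p i x) = b * (f x - (\<Sum>i<jet_dim TYPE('d) n. c i * jet_basis \<alpha> p i x))"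
      by (simp add: algebra_simps sum_distrib_left)
    then show "cmod (b * f x - (\<Sum>i<jet_dim TYPE('d) n. b * c i * jet_basis \<alpha> p i x)) \<le> (cmod b * B) * norm x ^ Suc n"
      using mult_left_mono[OF 1(2)[OF x], of "cmod b"] by (simp add: norm_mult mult.assoc)
  qed
qed

lemma jet_approx_sum:
  fixes f :: "'j \<Rightarrow> complex ^ 'd \<Rightarrow> complex"
  assumes "\<And>j. j \<in> J \<Longrightarrow> jet_approx \<alpha> p n (f j) (c j)"
  shows "jet_approx \<alpha> p n (\<lambda>x. \<Sum>j\<in>J. f j x) (\<lambda>i. \<Sum>j\<in>J. c j i)"
proof -
  have "jet_approx \<alpha> p n (\<lambda>x. 0) (\<lambda>i. 0)" unfolding jet_approx_def
    by (intro exI[of _ 0] exI[of _ 1]) auto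
  then show ?thesis using assms
    by (induction J rule: infinite_finite_induct) (auto intro: jet_approx_add)
qed


section \<open>Derivatives of the basis functions and the reproducing kernel\<close>

text \<open>If \<open>a $ k = 0\<close> the truncated exponent \<open>a $ k - 1\<close> is harmless,
  because the leading factor is 0.\<close>

definition monomial_deriv :: "'d \<Rightarrow> nat ^ 'd \<Rightarrow> complex ^ 'd \<Rightarrow> complex" where
  "monomial_deriv k a x = of_nat (a $ k) * (x $ k) ^ (a $ k - 1) * (\<Prod>j\<in>UNIV - {k}. (x $ j) ^ (a $ j))"

lemma monomial_fun_has_derivative:
  "(monomial_fun a has_derivative (\<lambda>v. \<Sum>k\<in>UNIV. v $ k * monomial_deriv k a x)) (at x)"
proof -
  have "((\<lambda>x. (x $ k) ^ (a $ k)) has_derivative (\<lambda>v. of_nat (a $ k) * v $ k * (x $ k) ^ (a $ k - 1))) (at x)" for k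
    by (rule has_derivative_power[OF bounded_linear_imp_has_derivative[OF bounded_linear_vec_nth]])
  then have "((\<lambda>x. \<Prod>k\<in>UNIV. (x $ k) ^ (a $ k)) has_derivative
      (\<lambda>v. \<Sum>k\<in>UNIV. (of_nat (a $ k) * v $ k * (x $ k) ^ (a $ k - 1)) * (\<Prod>j\<in>UNIV - {k}. (x $ j) ^ (a $ j)))) (at x)"
    by (rule has_derivative_prod)
  then show ?thesis
    by (simp add: monomial_fun_def[abs_def] monomial_deriv_def mult_ac)
qed

text \<open>Homogeneity of degree \<open>mdeg a - 1\<close>, multiplied by t to avoid the
  subtraction.\<close>

lemma monomial_deriv_scale:
  "t * monomial_deriv k a (t *s x) = t ^ mdeg a * monomial_deriv k a x"
proof (cases "a $ k")
  case 0
  then show ?thesis by (simp add: monomial_deriv_def)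
next
  case (Suc n)
  have "mdeg a = Suc n + (\<Sum>j\<in>UNIV - {k}. a $ j)"
    unfolding mdeg_def using Suc by (subst sum.remove[of _ k]) auto
  then show ?thesis
    by (simp add: monomial_deriv_def Suc power_mult_distrib prod.distrib power_add power_sum mult_ac)
qed

lemma line_holomorphic_monomial_deriv: "line_holomorphic (monomial_deriv k a) W"
  unfolding monomial_deriv_def[abs_def]
  by (intro line_holomorphic_mult line_holomorphic_prod line_holomorphic_power line_holomorphic_component line_holomorphic_const)

lemma jet_weight_has_derivative:
  "(jet_weight p has_derivative (\<lambda>v. (\<Sum>k\<in>UNIV. v $ k * cnj (p $ k)) * jet_weight p x)) (at x)"
proof -
  have lin: "((\<lambda>x. x $ k) has_derivative (\<lambda>v. v $ k)) (at x)" for k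
    by (rule bounded_linear_imp_has_derivative[OF bounded_linear_vec_nth])
  have "((\<lambda>x. cnj (p $ k) * (p $ k + x $ k)) has_derivative (\<lambda>v. cnj (p $ k) * (0 + v $ k))) (at x)" for k
    by (intro has_derivative_mult_right has_derivative_add has_derivative_const lin)
  then have 1: "((\<lambda>x. \<Sum>k\<in>UNIV. cnj (p $ k) * (p $ k + x $ k)) has_derivative (\<lambda>v. \<Sum>k\<in>UNIV. cnj (p $ k) * (0 + v $ k))) (at x)"
    by (intro has_derivative_sum)
  have 2: "(exp has_derivative (\<lambda>h. jet_weight p x * h)) (at (\<Sum>k\<in>UNIV. cnj (p $ k) * (p $ k + x $ k)))"
    using DERIV_exp[of "\<Sum>k\<in>UNIV. cnj (p $ k) * (p $ k + x $ k)"]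
    by (simp add: has_field_derivative_def jet_weight_def)
  from diff_chain_at[OF 1 2] show ?thesis
    by (simp add: jet_weight_def[abs_def] o_def mult_ac)
qed

text \<open>The k-th partial derivative of \<open>jet_basis\<close> in closed form; the second
  summand in the bracket comes from differentiating the weight.\<close>

definition jet_grad :: "(nat \<Rightarrow> nat ^ 'd) \<Rightarrow> complex ^ 'd \<Rightarrow> nat \<Rightarrow> 'd \<Rightarrow> complex ^ 'd \<Rightarrow> complex" where
  "jet_grad \<alpha> p i k x = jet_scale \<alpha> p i *
     (monomial_deriv k (\<alpha> (i + 1)) x + cnj (p $ k) * monomial_fun (\<alpha> (i + 1)) x) * jet_weight p x"

lemma jet_basis_has_derivative:
  "(jet_basis \<alpha> p i has_derivative (\<lambda>v. \<Sum>k\<in>UNIV. v $ k * jet_grad \<alpha> p i k x)) (at x)"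
proof -
  have "((\<lambda>x. jet_scale \<alpha> p i * (monomial_fun (\<alpha> (i + 1)) x * jet_weight p x)) has_derivative
    (\<lambda>v. jet_scale \<alpha> p i * (monomial_fun (\<alpha> (i + 1)) x * ((\<Sum>k\<in>UNIV. v $ k * cnj (p $ k)) * jet_weight p x) +
      (\<Sum>k\<in>UNIV. v $ k * monomial_deriv k (\<alpha> (i + 1)) x) * jet_weight p x))) (at x)"
    by (intro has_derivative_mult_right has_derivative_mult monomial_fun_has_derivative jet_weight_has_derivative)
  moreover have "jet_scale \<alpha> p i * (monomial_fun (\<alpha> (i + 1)) x * ((\<Sum>k\<in>UNIV. v $ k * cnj (p $ k)) * jet_weight p x) +
      (\<Sum>k\<in>UNIV. v $ k * monomial_deriv k (\<alpha> (i + 1)) x) * jet_weight p x) = (\<Sum>k\<in>UNIV. v $ k * jet_grad \<alpha> p i k x)" for v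
    unfolding jet_grad_def sum_distrib_right sum_distrib_left sum.distrib[symmetric]
    by (intro sum.cong refl) (simp add: ring_distribs)
  ultimately show ?thesis
    unfolding jet_basis_eq[abs_def] by (simp add: mult.assoc)
qed

lemma line_holomorphic_jet_basis: "line_holomorphic (jet_basis \<alpha> p i) W"
  unfolding jet_basis_eq[abs_def]
  by (intro line_holomorphic_mult line_holomorphic_const line_holomorphic_monomial_fun line_holomorphic_jet_weight)

lemma line_holomorphic_jet_grad: "line_holomorphic (jet_grad \<alpha> p i k) W"
  unfolding jet_grad_def[abs_def]
  by (intro line_holomorphic_mult line_holomorphic_add line_holomorphic_const line_holomorphic_monomial_fun
      line_holomorphic_monomial_deriv line_holomorphic_jet_weight)

lemma has_field_derivative_along_line:
  fixes h :: "complex ^ 'd \<Rightarrow> complex"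
  assumes "(h has_derivative (\<lambda>v. \<Sum>k\<in>UNIV. v $ k * G k)) (at (x + t *s v))"
  shows "((\<lambda>t. h (x + t *s v)) has_field_derivative (\<Sum>k\<in>UNIV. v $ k * G k)) (at t)"
proof -
  have 1: "((\<lambda>t. x + t *s v) has_derivative (\<lambda>t. t *s v)) (at t)"
    using has_derivative_add[OF has_derivative_const
        bounded_linear_imp_has_derivative[OF bounded_linear_vector_scalar_mult_left]] by simp
  have "((\<lambda>t. h (x + t *s v)) has_derivative (\<lambda>t. \<Sum>k\<in>UNIV. (t *s v) $ k * G k)) (at t)"
    using diff_chain_at[OF 1 assms] by (simp add: o_def)
  then show ?thesis
    unfolding has_field_derivative_def
    by (rule has_derivative_eq_rhs) (simp add: fun_eq_iff sum_distrib_left mult_ac)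
qed

lemma has_vector_derivative_along_curve:
  fixes h :: "complex ^ 'd \<Rightarrow> complex"
  assumes "(h has_derivative (\<lambda>v. \<Sum>k\<in>UNIV. v $ k * G k)) (at (z s))"
    and "(z has_vector_derivative z') (at s within S)"
  shows "((\<lambda>s. h (z s)) has_vector_derivative (\<Sum>k\<in>UNIV. z' $ k * G k)) (at s within S)"
  using vector_derivative_diff_chain_within[OF assms(2) has_derivative_at_withinI[OF assms(1)]] by (simp add: o_def)

text \<open>The estimator differentiates at z = 0, which is x = -p in the coordinates used
  here.\<close>

lemma jet_gradient_at_origin:
  fixes p :: "complex ^ 'd"
  shows "deriv (\<lambda>t. u_fun \<alpha> p (j + 1) (0 + axis k t)) 0 = jet_grad \<alpha> p j k (- p)"
proof -
  have ax: "axis k t = t *s (axis k 1 :: complex ^ 'd)" for k :: 'd and t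
    by (simp add: Finite_Cartesian_Product.vec_eq_iff axis_def)
  have eq: "(\<lambda>t. u_fun \<alpha> p (j + 1) (0 + axis k t)) = (\<lambda>t. jet_basis \<alpha> p j (- p + t *s axis k 1))"
    by (rule ext, subst ax) (simp add: jet_basis_def)
  have "((\<lambda>t. jet_basis \<alpha> p j (- p + t *s axis k 1)) has_field_derivative
      (\<Sum>l\<in>UNIV. axis k 1 $ l * jet_grad \<alpha> p j l (- p + 0 *s axis k 1))) (at 0)"
    by (rule has_field_derivative_along_line[OF jet_basis_has_derivative])
  also have "(\<Sum>l\<in>UNIV. axis k 1 $ l * jet_grad \<alpha> p j l (- p + 0 *s axis k 1)) =
      (\<Sum>l\<in>UNIV. if l = k then jet_grad \<alpha> p j k (- p) else 0)"
    by (intro sum.cong refl) (auto simp: axis_def)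
  finally show ?thesis unfolding eq by (simp add: DERIV_imp_deriv)
qed

text \<open>The multinomial theorem in exponential form. Each induction step splits off the exponent
  of one new variable by the binomial theorem.\<close>

lemma multinomial_exp:
  fixes z :: "'d::finite \<Rightarrow> complex"
  assumes "finite S"
  shows "(\<Sum>k\<in>S. z k) ^ l /\<^sub>R fact l =
    (\<Sum>a | (\<forall>k. k \<notin> S \<longrightarrow> a $ k = 0) \<and> mdeg a = l. \<Prod>k\<in>S. z k ^ (a $ k) /\<^sub>R fact (a $ k))"
  using assms
proof (induction S arbitrary: l rule: finite_induct)
  case empty
  have "{a :: nat ^ 'd. (\<forall>k. k \<notin> {} \<longrightarrow> a $ k = 0) \<and> mdeg a = l} = (if l = 0 then {0} else {})"
    by (auto simp: Finite_Cartesian_Product.vec_eq_iff mdeg_def)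
  then show ?case by (simp only:) (cases l, auto)
next
  case (insert k S)
  let ?A = "\<lambda>S l. {a :: nat ^ 'd. (\<forall>k. k \<notin> S \<longrightarrow> a $ k = 0) \<and> mdeg a = l}"
  let ?t = "\<lambda>S a. \<Prod>k\<in>S. z k ^ (a $ k) /\<^sub>R fact (a $ k)"
  let ?upd = "\<lambda>i a. (\<chi> j. if j = k then i else a $ j) :: nat ^ 'd"
  have fin: "finite (?A S l)" for l
    by (rule finite_subset[OF _ card_multiindices(1)[of l]]) auto
  have upd: "mdeg (?upd i a) = i + (\<Sum>j\<in>UNIV - {k}. a $ j)" for i a
    unfolding mdeg_def by (subst sum.remove[of _ k]) (auto intro!: sum.cong)
  have deg: "mdeg a = a $ k + (\<Sum>j\<in>UNIV - {k}. a $ j)" for a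
    unfolding mdeg_def by (subst sum.remove[of _ k]) auto
  have "(\<Sum>k\<in>insert k S. z k) ^ l /\<^sub>R fact l =
      (\<Sum>i\<le>l. (z k ^ i /\<^sub>R fact i) * ((\<Sum>k\<in>S. z k) ^ (l - i) /\<^sub>R fact (l - i)))"
    using exp_series_add_commuting[of "z k" "\<Sum>k\<in>S. z k" l] insert.hyps by (simp add: mult.commute)
  also have "\<dots> = (\<Sum>i\<le>l. \<Sum>a\<in>?A S (l - i). (z k ^ i /\<^sub>R fact i) * ?t S a)"
    unfolding insert.IH sum_distrib_left ..
  also have "\<dots> = (\<Sum>(i, a)\<in>Sigma {..l} (\<lambda>i. ?A S (l - i)). (z k ^ i /\<^sub>R fact i) * ?t S a)"
    by (rule sum.Sigma) (use fin in auto)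
  also have "\<dots> = (\<Sum>a\<in>?A (insert k S) l. ?t (insert k S) a)"
  proof (rule sum.reindex_bij_witness[where i = "\<lambda>b. (b $ k, ?upd 0 b)" and j = "\<lambda>(i, a). ?upd i a"])
    fix ia assume "ia \<in> Sigma {..l} (\<lambda>i. ?A S (l - i))"
    then obtain i a where ia: "ia = (i, a)" "i \<le> l" "\<forall>k. k \<notin> S \<longrightarrow> a $ k = 0" "mdeg a = l - i" by auto
    have ak: "a $ k = 0" using ia(3) insert.hyps by simp
    show "(\<lambda>b. (b $ k, ?upd 0 b)) ((\<lambda>(i, a). ?upd i a) ia) = ia"
      using ak by (simp add: ia(1) Finite_Cartesian_Product.vec_eq_iff)
    have "mdeg (?upd i a) = l" using upd[of i a] deg[of a] ak ia by simp
    then show "(\<lambda>(i, a). ?upd i a) ia \<in> ?A (insert k S) l" using ia by simp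
    have "?t S (?upd i a) = ?t S a" using insert.hyps by (intro prod.cong) auto
    then show "?t (insert k S) ((\<lambda>(i, a). ?upd i a) ia) = (\<lambda>(i, a). (z k ^ i /\<^sub>R fact i) * ?t S a) ia"
      using insert.hyps by (simp add: ia(1))
  next
    fix b assume b: "b \<in> ?A (insert k S) l"
    show "(\<lambda>(i, a). ?upd i a) (b $ k, ?upd 0 b) = b"
      by (simp add: Finite_Cartesian_Product.vec_eq_iff)
    have "mdeg (?upd 0 b) = l - b $ k" "b $ k \<le> l" using upd[of 0 b] deg[of b] b by auto
    then show "(b $ k, ?upd 0 b) \<in> Sigma {..l} (\<lambda>i. ?A S (l - i))" using b by auto
  qed
  finally show ?case .
qed

definition multi_fact :: "nat ^ 'd \<Rightarrow> complex" where
  "multi_fact a = (\<Prod>k\<in>UNIV. fact (a $ k))"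

lemma multi_fact_nonzero: "multi_fact a \<noteq> 0"
  by (simp add: multi_fact_def)

lemma exp_bilinear_taylor:
  fixes x y :: "complex ^ 'd"
  shows "(\<Sum>l\<le>m. (\<Sum>k\<in>UNIV. x $ k * y $ k) ^ l / fact l) =
    (\<Sum>a | mdeg a \<le> m. monomial_fun a y * monomial_fun a x / multi_fact a)"
proof -
  have "(\<Sum>k\<in>UNIV. x $ k * y $ k) ^ l / fact l = (\<Sum>a\<in>{a\<in>{a. mdeg a \<le> m}. mdeg a = l}. monomial_fun a y * monomial_fun a x / multi_fact a)"
    if "l \<le> m" for l
  proof -
    have "(\<Sum>k\<in>UNIV. x $ k * y $ k) ^ l / fact l = (\<Sum>k\<in>UNIV. x $ k * y $ k) ^ l /\<^sub>R fact l"
      by (simp add: scaleR_conv_of_real divide_inverse mult.commute)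
    also have "\<dots> = (\<Sum>a | mdeg a = l. \<Prod>k\<in>UNIV. (x $ k * y $ k) ^ (a $ k) /\<^sub>R fact (a $ k))"
      using multinomial_exp[where S = "UNIV :: 'd set" and z = "\<lambda>k. x $ k * y $ k" and l = l] by simp
    also have "\<dots> = (\<Sum>a\<in>{a\<in>{a. mdeg a \<le> m}. mdeg a = l}. monomial_fun a y * monomial_fun a x / multi_fact a)"
      using that
      by (intro sum.cong) (auto simp: monomial_fun_def multi_fact_def power_mult_distrib scaleR_conv_of_real
        divide_inverse prod.distrib prod_inversef[symmetric] o_def mult_ac)
    finally show ?thesis .
  qed
  then have "(\<Sum>l\<le>m. (\<Sum>k\<in>UNIV. x $ k * y $ k) ^ l / fact l) =
    (\<Sum>l\<le>m. \<Sum>a\<in>{a\<in>{a. mdeg a \<le> m}. mdeg a = l}. monomial_fun a y * monomial_fun a x / multi_fact a)"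
    by (intro sum.cong) auto
  also have "\<dots> = (\<Sum>a | mdeg a \<le> m. monomial_fun a y * monomial_fun a x / multi_fact a)"
    by (rule sum.group) (use card_multiindices(1) in auto)
  finally show ?thesis .
qed

lemma exp_bilinear_remainder:
  fixes y :: "complex ^ 'd"
  shows "\<exists>B\<ge>0. \<forall>x. norm x \<le> 1 \<longrightarrow> cmod (exp (\<Sum>k\<in>UNIV. x $ k * y $ k) -
    (\<Sum>a | mdeg a \<le> m. monomial_fun a y * monomial_fun a x / multi_fact a)) \<le> B * norm x ^ Suc m"
proof -
  define Y where "Y = (\<Sum>k\<in>UNIV. cmod (y $ k))"
  have Y: "Y \<ge> 0" by (simp add: Y_def sum_nonneg)
  show ?thesis
  proof (rule exI[of _ "exp Y * Y ^ Suc m"], intro conjI allI impI)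
    fix x :: "complex ^ 'd" assume x: "norm x \<le> 1"
    let ?z = "\<Sum>k\<in>UNIV. x $ k * y $ k"
    have z: "cmod ?z \<le> norm x * Y"
      unfolding Y_def sum_distrib_left by (rule sum_norm_le) (simp add: norm_mult mult_right_mono component_le_norm)
    also have "\<dots> \<le> 1 * Y" using x Y by (intro mult_right_mono) auto
    finally have zY: "\<bar>Re ?z\<bar> \<le> Y" using abs_Re_le_cmod[of ?z] by linarith
    have "cmod (exp ?z - (\<Sum>l\<le>m. ?z ^ l / fact l)) \<le> exp \<bar>Re ?z\<bar> * cmod ?z ^ Suc m / fact m"
      by (rule Taylor_exp)
    also have "\<dots> \<le> exp Y * (norm x * Y) ^ Suc m / 1"
      using z zY by (intro frac_le mult_mono power_mono) (auto simp: fact_ge_1)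
    finally show "cmod (exp ?z - (\<Sum>a | mdeg a \<le> m. monomial_fun a y * monomial_fun a x / multi_fact a))
        \<le> exp Y * Y ^ Suc m * norm x ^ Suc m"
      unfolding exp_bilinear_taylor by (simp add: power_mult_distrib mult_ac)
  qed (use Y in auto)
qed

text \<open>Differentiating the truncated series of exp(x . y) in y_k multiplies it by x_k and
  lowers its order by one; in the sum this is the shift of the index by
  \<open>axis k 1\<close>.\<close>

lemma sum_monomial_deriv:
  fixes y :: "complex ^ 'd"
  shows "(\<Sum>a | mdeg a \<le> Suc m. monomial_deriv k a y * monomial_fun a x / multi_fact a) =
    x $ k * (\<Sum>a | mdeg a \<le> m. monomial_fun a y * monomial_fun a x / multi_fact a)"
proof -
  have "(\<Sum>a | mdeg a \<le> Suc m. monomial_deriv k a y * monomial_fun a x / multi_fact a) =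
      (\<Sum>a\<in>{a. mdeg a \<le> Suc m \<and> a $ k \<noteq> 0}. monomial_deriv k a y * monomial_fun a x / multi_fact a)"
    by (rule sum.mono_neutral_right) (use card_multiindices(1) in \<open>auto simp: monomial_deriv_def\<close>)
  also have "\<dots> = (\<Sum>a | mdeg a \<le> m. x $ k * (monomial_fun a y * monomial_fun a x / multi_fact a))"
  proof (rule sum.reindex_bij_witness[where i = "\<lambda>b. b + axis k 1" and j = "\<lambda>a. a - axis k 1"])
    have dax: "mdeg (axis k 1 :: nat ^ 'd) = 1" by (simp add: mdeg_def axis_def)
    fix a :: "nat ^ 'd" assume "a \<in> {a. mdeg a \<le> Suc m \<and> a $ k \<noteq> 0}"
    then have a: "mdeg a \<le> Suc m" "a $ k \<noteq> 0" by auto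
    show inv: "a - axis k 1 + axis k 1 = a"
      using a(2) by (auto simp: Finite_Cartesian_Product.vec_eq_iff axis_def)
    define b where "b = a - axis k 1"
    have ab: "a = b + axis k 1" using inv by (simp add: b_def)
    show "a - axis k 1 \<in> {a. mdeg a \<le> m}"
      using a(1) unfolding b_def[symmetric] by (simp add: ab mdeg_add dax[simplified])
    have bj: "a $ j = b $ j" if "j \<noteq> k" for j using that by (simp add: ab axis_def)
    have bk: "a $ k = Suc (b $ k)" by (simp add: ab axis_def)
    have "multi_fact a = fact (a $ k) * (\<Prod>j\<in>UNIV - {k}. fact (a $ j))"
      unfolding multi_fact_def by (subst prod.remove[of _ k]) auto
    also have "(\<Prod>j\<in>UNIV - {k}. fact (a $ j)) = (\<Prod>j\<in>UNIV - {k}. fact (b $ j) :: complex)"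
      using bj by (intro prod.cong) auto
    also have "fact (a $ k) * (\<Prod>j\<in>UNIV - {k}. fact (b $ j) :: complex) = of_nat (a $ k) * multi_fact b"
      unfolding multi_fact_def bk by (subst (2) prod.remove[of _ k]) (auto simp: mult_ac)
    finally have f: "multi_fact a = of_nat (a $ k) * multi_fact b" .
    have "monomial_deriv k a y = of_nat (a $ k) * ((y $ k) ^ (b $ k) * (\<Prod>j\<in>UNIV - {k}. (y $ j) ^ (b $ j)))"
    proof -
      have "(\<Prod>j\<in>UNIV - {k}. (y $ j) ^ (a $ j)) = (\<Prod>j\<in>UNIV - {k}. (y $ j) ^ (b $ j))"
        using bj by (intro prod.cong) auto
      then show ?thesis unfolding monomial_deriv_def bk by (simp add: mult.assoc)
    qed
    also have "(y $ k) ^ (b $ k) * (\<Prod>j\<in>UNIV - {k}. (y $ j) ^ (b $ j)) = monomial_fun b y"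
      unfolding monomial_fun_def by (subst (2) prod.remove[of _ k]) auto
    finally have d: "monomial_deriv k a y = of_nat (a $ k) * monomial_fun b y" .
    have mx: "monomial_fun a x = monomial_fun b x * x $ k"
      unfolding ab monomial_fun_add monomial_fun_axis ..
    show "x $ k * (monomial_fun (a - axis k 1) y * monomial_fun (a - axis k 1) x / multi_fact (a - axis k 1)) =
        monomial_deriv k a y * monomial_fun a x / multi_fact a"
      unfolding b_def[symmetric] f d mx using a(2) by simp
  next
    have dax: "mdeg (axis k 1 :: nat ^ 'd) = 1" by (simp add: mdeg_def axis_def)
    fix b :: "nat ^ 'd" assume "b \<in> {a. mdeg a \<le> m}"
    then show "b + axis k 1 \<in> {a. mdeg a \<le> Suc m \<and> a $ k \<noteq> 0}"
      by (simp add: mdeg_add dax[simplified])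
    show "b + axis k 1 - axis k 1 = b"
      by (simp add: Finite_Cartesian_Product.vec_eq_iff axis_def)
  qed
  finally show ?thesis by (simp add: sum_distrib_left)
qed

text \<open>The reproducing property of the kernel \<open>exp (w\<^sup>* z)\<close>, differentiated at \<open>w = 0\<close> and truncated.\<close>

lemma jet_reproducing:
  fixes \<alpha> :: "nat \<Rightarrow> nat ^ 'd"
  assumes num: "graded_numbering e \<alpha>"
  shows "\<exists>B. \<forall>x. norm x \<le> 1 \<longrightarrow>
    cmod ((\<Sum>j<jet_dim TYPE('d) m. cnj (jet_grad \<alpha> p j k (- p)) * jet_basis \<alpha> p j x) - (p $ k + x $ k)) \<le> B * norm x ^ Suc m"
proof -
  \<comment> \<open>The conjugate of -p, the point z = 0 in the coordinates x; conjugating a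
    monomial at -p evaluates it at \<open>y\<close>.\<close>
  define y :: "complex ^ 'd" where "y = (\<chi> k. - cnj (p $ k))"
  define S where "S m x = (\<Sum>a | mdeg a \<le> m. monomial_fun a y * monomial_fun a x / multi_fact a)" for m and x :: "complex ^ 'd"
  define S' where "S' x = (\<Sum>a | mdeg a \<le> m. monomial_deriv k a y * monomial_fun a x / multi_fact a)" for x :: "complex ^ 'd"
  define z where "z x = (\<Sum>k\<in>UNIV. x $ k * y $ k)" for x :: "complex ^ 'd"
  have norm_p: "(\<Sum>k\<in>UNIV. cnj (p $ k) * p $ k) = complex_of_real ((norm p)\<^sup>2)"
    unfolding norm_vec_def L2_set_def
    by (simp add: sum_nonneg complex_norm_square mult.commute del: of_real_power)
  \<comment> \<open>Up to the factor exp(-|p|^2) from the scales, the weight is exp(-x . y), which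
    cancels the full kernel exp(x . y).\<close>
  have weight: "complex_of_real (exp (- (norm p)\<^sup>2)) * jet_weight p x = exp (- z x)" for x
  proof -
    have "(\<Sum>k\<in>UNIV. cnj (p $ k) * (p + x) $ k) = complex_of_real ((norm p)\<^sup>2) - z x"
      unfolding norm_p[symmetric] z_def y_def sum_subtractf[symmetric]
      by (intro sum.cong refl) (simp add: algebra_simps)
    then show ?thesis unfolding jet_weight_def exp_of_real[symmetric] exp_add[symmetric]
      by (simp del: of_real_power)
  qed
  have w1: "jet_weight p (- p) = 1" by (simp add: jet_weight_def)
  have scale: "jet_scale \<alpha> p j * jet_scale \<alpha> p j = complex_of_real (exp (- (norm p)\<^sup>2)) / multi_fact (\<alpha> (j + 1))" for j
  proof -
    have "exp (- (norm p)\<^sup>2 / 2) * exp (- (norm p)\<^sup>2 / 2) = exp (- (norm p)\<^sup>2)"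
      by (simp add: exp_add[symmetric])
    moreover have "sqrt (\<Prod>k\<in>UNIV. fact (\<alpha> (j + 1) $ k)) * sqrt (\<Prod>k\<in>UNIV. fact (\<alpha> (j + 1) $ k)) =
        (\<Prod>k\<in>UNIV. fact (\<alpha> (j + 1) $ k))"
      by (simp add: prod_nonneg)
    ultimately have "(exp (- (norm p)\<^sup>2 / 2) / sqrt (\<Prod>k\<in>UNIV. fact (\<alpha> (j + 1) $ k))) *
        (exp (- (norm p)\<^sup>2 / 2) / sqrt (\<Prod>k\<in>UNIV. fact (\<alpha> (j + 1) $ k))) = exp (- (norm p)\<^sup>2) / (\<Prod>k\<in>UNIV. fact (\<alpha> (j + 1) $ k))"
      by (simp only: times_divide_times_eq)
    then show ?thesis unfolding jet_scale_def of_real_mult[symmetric]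
      by (simp only: of_real_divide multi_fact_def of_real_prod of_real_fact)
  qed
  have cm: "cnj (monomial_fun a (- p)) = monomial_fun a y" "cnj (monomial_deriv k a (- p)) = monomial_deriv k a y" for a
    by (simp_all add: monomial_fun_def monomial_deriv_def y_def)
  have cg: "cnj (jet_grad \<alpha> p j k (- p)) * jet_basis \<alpha> p j x =
      exp (- z x) * ((monomial_deriv k (\<alpha> (j + 1)) y + p $ k * monomial_fun (\<alpha> (j + 1)) y) * monomial_fun (\<alpha> (j + 1)) x / multi_fact (\<alpha> (j + 1)))" for j x
  proof -
    have "cnj (jet_scale \<alpha> p j) = jet_scale \<alpha> p j" by (simp add: jet_scale_def)
    then have "cnj (jet_grad \<alpha> p j k (- p)) * jet_basis \<alpha> p j x =
      (jet_scale \<alpha> p j * jet_scale \<alpha> p j) * jet_weight p x * ((monomial_deriv k (\<alpha> (j + 1)) y + p $ k * monomial_fun (\<alpha> (j + 1)) y) * monomial_fun (\<alpha> (j + 1)) x)"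
      unfolding jet_grad_def jet_basis_eq w1 complex_cnj_mult complex_cnj_add cm by simp
    then show ?thesis unfolding scale weight[symmetric] by simp
  qed
  \<comment> \<open>\<open>S\<close> truncates exp(x . y) and \<open>S'\<close> its derivative in
    y_k, that is x_k exp(x . y). Hence the sum should be compared with exp(-x . y) (x_k + p_k) exp(x
    . y), which is the coordinate of p + x.\<close>
  have total: "(\<Sum>j<jet_dim TYPE('d) m. cnj (jet_grad \<alpha> p j k (- p)) * jet_basis \<alpha> p j x) = exp (- z x) * (S' x + p $ k * S m x)" for x
    unfolding cg S_def S'_def sum_distrib_left sum.distrib[symmetric] sum_multiindices_numbering[OF num]
    by (intro sum.cong refl) (simp add: ring_distribs add_divide_distrib)
  obtain B where B: "B \<ge> 0" "\<And>x. norm x \<le> 1 \<Longrightarrow> cmod (exp (z x) - S m x) \<le> B * norm x ^ Suc m"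
    using exp_bilinear_remainder[of y m] unfolding S_def z_def by blast
  define Y where "Y = (\<Sum>k\<in>UNIV. cmod (y $ k))"
  have expz: "cmod (exp (z x)) \<le> exp Y" "cmod (exp (- z x)) \<le> exp Y" if "norm x \<le> 1" for x
  proof -
    have "cmod (z x) \<le> Y" unfolding z_def Y_def
    proof (rule sum_norm_le)
      fix k
      have "cmod (x $ k) \<le> 1" using component_le_norm[of x k] that by linarith
      then show "cmod (x $ k * y $ k) \<le> cmod (y $ k)" by (simp add: norm_mult mult_left_le_one_le)
    qed
    then have "\<bar>Re (z x)\<bar> \<le> Y" using abs_Re_le_cmod[of "z x"] by linarith
    then show "cmod (exp (z x)) \<le> exp Y" "cmod (exp (- z x)) \<le> exp Y" by auto
  qed
  have "\<exists>B'\<ge>0. \<forall>x. norm x \<le> 1 \<longrightarrow> cmod (x $ k * exp (z x) - S' x) \<le> B' * norm x ^ Suc m"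
  proof (cases m)
    case 0
    have "{a :: nat ^ 'd. mdeg a \<le> 0} = {0}" by (auto simp: mdeg_def Finite_Cartesian_Product.vec_eq_iff)
    then have S'0: "S' x = 0" for x unfolding S'_def 0 by (simp add: monomial_deriv_def)
    show ?thesis
    proof (rule exI[of _ "exp Y"], intro conjI allI impI)
      fix x :: "complex ^ 'd" assume x: "norm x \<le> 1"
      have "cmod (x $ k) * cmod (exp (z x)) \<le> norm x * exp Y"
        by (intro mult_mono component_le_norm expz x) auto
      then show "cmod (x $ k * exp (z x) - S' x) \<le> exp Y * norm x ^ Suc m"
        unfolding S'0 0 by (simp add: norm_mult mult.commute del: norm_exp_eq_Re)
    qed simp
  next
    case (Suc m')
    obtain B where B: "B \<ge> 0" "\<And>x. norm x \<le> 1 \<Longrightarrow> cmod (exp (z x) - S m' x) \<le> B * norm x ^ Suc m'"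
      using exp_bilinear_remainder[of y m'] unfolding S_def z_def by blast
    have S'x: "S' x = x $ k * S m' x" for x unfolding S'_def S_def Suc by (rule sum_monomial_deriv)
    show ?thesis
    proof (rule exI[of _ B], intro conjI allI impI B(1))
      fix x :: "complex ^ 'd" assume x: "norm x \<le> 1"
      have "cmod (x $ k) * cmod (exp (z x) - S m' x) \<le> norm x * (B * norm x ^ Suc m')"
        by (intro mult_mono component_le_norm B(2) x) auto
      then show "cmod (x $ k * exp (z x) - S' x) \<le> B * norm x ^ Suc m"
        unfolding S'x Suc right_diff_distrib[symmetric] norm_mult by (simp add: mult_ac)
    qed
  qed
  then obtain B' where B': "B' \<ge> 0" "\<And>x. norm x \<le> 1 \<Longrightarrow> cmod (x $ k * exp (z x) - S' x) \<le> B' * norm x ^ Suc m" by blast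
  show ?thesis
  proof (rule exI[of _ "exp Y * (B' + cmod (p $ k) * B)"], intro allI impI)
    fix x :: "complex ^ 'd" assume x: "norm x \<le> 1"
    have "exp (- z x) * exp (z x) = 1" by (simp add: exp_minus)
    then have "exp (- z x) * (S' x + p $ k * S m x) - (p $ k + x $ k) =
        - (exp (- z x) * ((x $ k * exp (z x) - S' x) + p $ k * (exp (z x) - S m x)))"
      by (simp add: algebra_simps)
    then have "cmod (exp (- z x) * (S' x + p $ k * S m x) - (p $ k + x $ k)) =
        cmod (exp (- z x)) * cmod ((x $ k * exp (z x) - S' x) + p $ k * (exp (z x) - S m x))"
      by (simp only: norm_minus_cancel norm_mult)
    also have "\<dots> \<le> exp Y * (B' * norm x ^ Suc m + cmod (p $ k) * (B * norm x ^ Suc m))"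
    proof (intro mult_mono expz x)
      show "cmod ((x $ k * exp (z x) - S' x) + p $ k * (exp (z x) - S m x)) \<le> B' * norm x ^ Suc m + cmod (p $ k) * (B * norm x ^ Suc m)"
        by (intro order_trans[OF norm_triangle_ineq] add_mono B'(2)[OF x])
           (simp only: norm_mult, intro mult_left_mono B(2)[OF x] norm_ge_zero)
    qed auto
    finally show "cmod ((\<Sum>j<jet_dim TYPE('d) m. cnj (jet_grad \<alpha> p j k (- p)) * jet_basis \<alpha> p j x) - (p $ k + x $ k))
        \<le> exp Y * (B' + cmod (p $ k) * B) * norm x ^ Suc m"
      unfolding total by (simp add: algebra_simps)
  qed
qed


section \<open>The spectrum of the generator on jets is real\<close>

text \<open>A factored polynomial in \<open>D\<close> applied to a vector: the product of the D - k
  over the list. An annihilating product of this kind replaces the decomposition of a vector into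
  generalised eigenvectors.\<close>

fun shift_prod :: "(complex ^ 'd \<Rightarrow> complex ^ 'd) \<Rightarrow> complex list \<Rightarrow> complex ^ 'd \<Rightarrow> complex ^ 'd" where
  "shift_prod D [] x = x"
| "shift_prod D (k # ks) x = shift_prod D ks (D x - k *s x)"

definition complex_linear :: "(complex ^ 'd \<Rightarrow> complex ^ 'd) \<Rightarrow> bool" where
  "complex_linear D \<longleftrightarrow> bounded_linear D \<and> (\<forall>c v. D (c *s v) = c *s D v)"

lemma complex_linearD:
  assumes "complex_linear D"
  shows "bounded_linear D" "D (x + y) = D x + D y" "D (x - y) = D x - D y" "D (c *s x) = c *s D x" "D 0 = 0"
  using assms bounded_linear.linear[of D] linear_add[of D] linear_diff[of D] linear_0[of D]
  unfolding complex_linear_def by auto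

lemma shift_prod_zero: "complex_linear D \<Longrightarrow> shift_prod D ks 0 = 0"
  by (induction ks) (simp_all add: complex_linearD)

lemma shift_prod_commute:
  assumes D: "complex_linear D"
  shows "shift_prod D ks (D x - a *s x) = D (shift_prod D ks x) - a *s shift_prod D ks x"
proof (induction ks arbitrary: x)
  case (Cons k ks)
  have "D (D x - a *s x) - k *s (D x - a *s x) = D (D x - k *s x) - a *s (D x - k *s x)"
    by (simp add: complex_linearD[OF D] vec.scale_right_diff_distrib mult.commute)
  then show ?case using Cons[of "D x - k *s x"] by simp
qed simp

lemma funpow_complex_linear:
  assumes D: "complex_linear D"
  shows "(D ^^ i) (x - c *s y) = (D ^^ i) x - c *s (D ^^ i) y"
  by (induction i) (simp_all add: complex_linearD[OF D])

lemma degree_linear_factors_le: "degree (\<Prod>a\<leftarrow>as. [:- a, 1:] :: complex poly) \<le> length as"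
proof (induction as)
  case (Cons a as)
  have "degree ([:- a, 1:] * (\<Prod>a\<leftarrow>as. [:- a, 1:])) \<le> degree [:- a, 1:] + degree (\<Prod>a\<leftarrow>as. [:- a, 1:])"
    by (rule degree_mult_le)
  then show ?case using Cons by simp
qed simp

lemma shift_prod_eq_polynomial:
  assumes D: "complex_linear D"
  shows "(\<Sum>i\<le>length as. coeff (\<Prod>a\<leftarrow>as. [:- a, 1:]) i *s (D ^^ i) x) = shift_prod D as x"
proof (induction as arbitrary: x)
  case (Cons a as)
  let ?Q = "\<Prod>a\<leftarrow>as. [:- a, 1:] :: complex poly"
  let ?n = "length as"
  have top: "coeff ?Q (Suc ?n) = 0" by (rule coeff_eq_0) (use degree_linear_factors_le[of as] in simp)
  have c: "coeff (\<Prod>a\<leftarrow>a # as. [:- a, 1:]) i = coeff (pCons 0 ?Q) i - a * coeff ?Q i" for i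
    by simp
  have "(\<Sum>i\<le>length (a # as). coeff (\<Prod>a\<leftarrow>a # as. [:- a, 1:]) i *s (D ^^ i) x) =
      (\<Sum>i\<le>Suc ?n. coeff (pCons 0 ?Q) i *s (D ^^ i) x) - (\<Sum>i\<le>Suc ?n. (a * coeff ?Q i) *s (D ^^ i) x)"
    unfolding c by (simp only: vec.scale_left_diff_distrib sum_subtractf list.size add_0_right add_Suc_right)
  also have "(\<Sum>i\<le>Suc ?n. coeff (pCons 0 ?Q) i *s (D ^^ i) x) = (\<Sum>i\<le>?n. coeff ?Q i *s (D ^^ i) (D x))"
    by (subst sum.atMost_Suc_shift) (simp add: funpow_swap1)
  also have "(\<Sum>i\<le>Suc ?n. (a * coeff ?Q i) *s (D ^^ i) x) = (\<Sum>i\<le>?n. (a * coeff ?Q i) *s (D ^^ i) x)"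
    by (simp add: top)
  also have "(\<Sum>i\<le>?n. coeff ?Q i *s (D ^^ i) (D x)) - (\<Sum>i\<le>?n. (a * coeff ?Q i) *s (D ^^ i) x) =
      (\<Sum>i\<le>?n. coeff ?Q i *s (D ^^ i) (D x - a *s x))"
    unfolding sum_subtractf[symmetric]
    by (intro sum.cong refl) (simp add: funpow_complex_linear[OF D] vec.scale_right_diff_distrib mult.commute)
  also have "\<dots> = shift_prod D (a # as) x" using Cons[of "D x - a *s x"] by simp
  finally show ?case .
qed simp

lemma orbit_dependent:
  fixes x :: "complex ^ 'd" and D :: "complex ^ 'd \<Rightarrow> complex ^ 'd"
  shows "\<exists>c :: nat \<Rightarrow> real. \<exists>N. (\<exists>i\<le>N. c i \<noteq> 0) \<and> (\<Sum>i\<le>N. c i *\<^sub>R (D ^^ i) x) = 0"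
proof -
  define N where "N = DIM(complex ^ 'd)"
  let ?f = "\<lambda>i. (D ^^ i) x"
  show ?thesis
  proof (cases "inj_on ?f {..N}")
    case True
    have "card (?f ` {..N}) = Suc N" by (simp add: card_image[OF True])
    then have "dependent (?f ` {..N})" by (intro dependent_biggerset) (simp add: N_def)
    then obtain u where u: "\<exists>v\<in>?f ` {..N}. u v \<noteq> 0" "(\<Sum>v\<in>?f ` {..N}. u v *\<^sub>R v) = 0"
      unfolding dependent_finite[OF finite_imageI[OF finite_atMost]] by blast
    have "(\<Sum>i\<le>N. u (?f i) *\<^sub>R ?f i) = 0" using u(2) by (simp add: sum.reindex[OF True])
    then show ?thesis using u(1) by (intro exI[of _ "\<lambda>i. u (?f i)"] exI[of _ N]) auto
  next
    case False
    then obtain i j where ij: "i \<le> N" "j \<le> N" "i \<noteq> j" "?f i = ?f j" unfolding inj_on_def by auto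
    let ?c = "\<lambda>l. (if l = i then 1 else 0) - (if l = j then 1 else 0) :: real"
    have "(\<Sum>l\<le>N. ?c l *\<^sub>R ?f l) = (\<Sum>l\<le>N. (if l = i then ?f i else 0) - (if l = j then ?f j else 0))"
      by (intro sum.cong refl) (auto simp: scaleR_diff_left)
    also have "\<dots> = 0" using ij by (simp add: sum_subtractf)
    finally show ?thesis using ij by (intro exI[of _ ?c] exI[of _ N]) auto
  qed
qed

lemma shift_prod_exists:
  assumes D: "complex_linear D"
  shows "\<exists>as. shift_prod D as x = 0"
proof -
  obtain c N i0 where c: "i0 \<le> N" "c i0 \<noteq> 0" "(\<Sum>i\<le>N. c i *\<^sub>R (D ^^ i) x) = 0"
    using orbit_dependent[of D x] by blast
  define P where "P = (\<Sum>i\<le>N. monom (complex_of_real (c i)) i)"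
  have coeffP: "coeff P i = (if i \<le> N then of_real (c i) else 0)" for i
    unfolding P_def coeff_sum by simp
  have "coeff P i0 \<noteq> 0" using c by (simp add: coeffP)
  then have P0: "P \<noteq> 0" by auto
  have degP: "degree P \<le> N" by (rule degree_le) (simp add: coeffP)
  obtain as where as: "Polynomial.smult (coeff P (degree P)) (\<Prod>a\<leftarrow>as. [:- a, 1:]) = P" "length as = degree P"
    using fundamental_theorem_algebra_factorized[of P] by blast
  let ?Q = "\<Prod>a\<leftarrow>as. [:- a, 1:]"
  have PQ: "coeff P i = coeff P (degree P) * coeff ?Q i" for i using arg_cong[OF as(1), of "\<lambda>p. coeff p i"] by simp
  have "0 = (\<Sum>i\<le>N. coeff P i *s (D ^^ i) x)"
    unfolding c(3)[symmetric]
    by (intro sum.cong refl) (simp add: coeffP Finite_Cartesian_Product.vec_eq_iff scaleR_conv_of_real[where 'a = complex])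
  also have "\<dots> = (\<Sum>i\<le>length as. coeff P i *s (D ^^ i) x)"
    by (rule sum.mono_neutral_right) (use degP as(2) in \<open>auto simp: coeff_eq_0\<close>)
  also have "\<dots> = (\<Sum>i\<le>length as. coeff P (degree P) *s (coeff ?Q i *s (D ^^ i) x))"
  proof (intro sum.cong refl)
    fix i
    show "coeff P i *s (D ^^ i) x = coeff P (degree P) *s (coeff ?Q i *s (D ^^ i) x)"
      by (subst PQ) simp
  qed
  also have "\<dots> = coeff P (degree P) *s shift_prod D as x"
    unfolding shift_prod_eq_polynomial[OF D, symmetric] by (simp only: vec.scale_sum_right)
  finally have "coeff P (degree P) *s shift_prod D as x = 0" by simp
  then show ?thesis using P0 by (metis vec.scale_eq_0_iff leading_coeff_0_iff)
qed

lemma shift_prod_real_exists: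
  assumes D: "complex_linear D" and ev: "\<And>c v. v \<noteq> 0 \<Longrightarrow> D v = c *s v \<Longrightarrow> c \<in> \<real>"
  shows "\<exists>ks. set ks \<subseteq> \<real> \<and> shift_prod D ks x = 0"
proof -
  have "\<exists>ks. set ks \<subseteq> \<real> \<and> shift_prod D ks x = 0" if "shift_prod D as x = 0" for as
    using that
  proof (induction as arbitrary: x)
    case Nil
    then show ?case by (intro exI[of _ "[]"]) simp
  next
    case (Cons a as)
    then obtain ks where ks: "set ks \<subseteq> \<real>" "shift_prod D ks (D x - a *s x) = 0" by auto
    show ?case
    proof (cases "a \<in> \<real>")
      case True
      then show ?thesis using ks by (intro exI[of _ "a # ks"]) simp
    next
      case False
      have "D (shift_prod D ks x) = a *s shift_prod D ks x"
        using ks(2) unfolding shift_prod_commute[OF D] by simp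
      then have "shift_prod D ks x = 0" using ev False by blast
      then show ?thesis using ks by blast
    qed
  qed
  then show ?thesis using shift_prod_exists[OF D, of x] by blast
qed

lemma bounded_bilinear_vector_scalar_mult: "bounded_bilinear (\<lambda>c v. c *s (v :: complex ^ 'd))"
proof
  show "\<exists>K. \<forall>(a::complex) (b::complex^'d). norm (a *s b) \<le> norm a * norm b * K"
    by (intro exI[of _ 1]) (simp add: norm_vector_scalar_mult)
qed (simp_all add: vector_sadd_rdistrib vector_add_ldistrib scaleR_vector_scalar_mult scaleR_conv_of_real[where 'a = complex])

text \<open>Here c is i or -i, so exp(c k s) has modulus one for real k, and each factor D - k of
  the annihilating product costs only one power of 1 + s. The solution through \<open>x\<close> is
  built by variation of constants from the solution \<open>y1\<close> through (D - k) x.\<close>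

lemma linear_ode_polynomial_growth:
  fixes x :: "complex ^ 'd"
  assumes D: "complex_linear D" and c: "Re c = 0" "cmod c = 1"
    and ks: "set ks \<subseteq> \<real>" "shift_prod D ks x = 0"
  shows "\<exists>C\<ge>0. \<exists>N. \<forall>T\<ge>0. \<exists>y. y 0 = x \<and>
    (\<forall>s\<in>{0..T}. (y has_vector_derivative c *s D (y s)) (at s within {0..T}) \<and> norm (y s) \<le> C * (1 + s) ^ N)"
  using ks
proof (induction ks arbitrary: x)
  case Nil
  have "\<forall>s\<in>{0..T}. ((\<lambda>s. 0) has_vector_derivative c *s D 0) (at s within {0..T}) \<and> norm (0 :: complex ^ 'd) \<le> 0 * (1 + s) ^ 0" for T :: real
    by (auto simp: complex_linearD(5)[OF D])
  moreover have "x = 0" using Nil by simp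
  ultimately show ?case by (intro exI[of _ 0] conjI allI impI exI[of _ "\<lambda>s. 0"]) auto
next
  case (Cons k ks)
  have "\<exists>C\<ge>0. \<exists>N. \<forall>T\<ge>0. \<exists>y. y 0 = D x - k *s x \<and>
    (\<forall>s\<in>{0..T}. (y has_vector_derivative c *s D (y s)) (at s within {0..T}) \<and> norm (y s) \<le> C * (1 + s) ^ N)"
    by (rule Cons.IH) (use Cons.prems in auto)
  then obtain C N where C: "C \<ge> 0" and CN: "\<And>T. T \<ge> 0 \<Longrightarrow> \<exists>y. y 0 = D x - k *s x \<and>
    (\<forall>s\<in>{0..T}. (y has_vector_derivative c *s D (y s)) (at s within {0..T}) \<and> norm (y s) \<le> C * (1 + s) ^ N)"
    by blast
  have k: "k \<in> \<real>" using Cons.prems(1) by simp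
  then have rek: "Re (c * k * of_real s) = 0" for s using c(1) by (auto simp: complex_is_Real_iff)
  have "\<exists>y. y 0 = x \<and> (\<forall>s\<in>{0..T}. (y has_vector_derivative c *s D (y s)) (at s within {0..T}) \<and>
      norm (y s) \<le> (norm x + C) * (1 + s) ^ Suc N)" if T: "T \<ge> 0" for T
  proof -
    obtain y1 where y1: "y1 0 = D x - k *s x"
      "\<And>s. s \<in> {0..T} \<Longrightarrow> (y1 has_vector_derivative c *s D (y1 s)) (at s within {0..T})"
      "\<And>s. s \<in> {0..T} \<Longrightarrow> norm (y1 s) \<le> C * (1 + s) ^ N"
      using CN[OF T] by blast
    have y1c: "continuous_on {0..T} y1"
      unfolding continuous_on_eq_continuous_within using has_vector_derivative_continuous[OF y1(2)] by blast
    define E where "E s = exp (c * k * complex_of_real s)" for s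
    have E1: "cmod (E s) = 1" for s unfolding E_def norm_exp_eq_Re rek by simp
    have Ed: "(E has_vector_derivative c * k * E s) (at s within S)" for s S
    proof -
      have "((\<lambda>z. exp (c * k * z)) has_field_derivative c * k * exp (c * k * of_real s)) (at (of_real s))"
        by (auto intro!: derivative_eq_intros)
      then show ?thesis unfolding E_def by (rule has_vector_derivative_real_field)
    qed
    define g where "g s = exp (- (c * k * complex_of_real s)) *s y1 s" for s
    have gc: "continuous_on {0..T} g" unfolding g_def by (intro continuous_intros y1c)
    define G where "G s = integral {0..s} g" for s
    have Gd: "(G has_vector_derivative g s) (at s within {0..T})" if "s \<in> {0..T}" for s
      unfolding G_def by (rule integral_has_vector_derivative[OF gc that])
    have G0: "G 0 = 0" by (simp add: G_def)
    define y where "y s = E s *s (x + c *s G s)" for s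
    have Eg: "E s *s g s = y1 s" for s
      by (simp add: E_def g_def exp_minus)
    have yd: "(y has_vector_derivative (c * k) *s y s + c *s y1 s) (at s within {0..T})" if s: "s \<in> {0..T}" for s
    proof -
      have "((\<lambda>s. c *s G s) has_vector_derivative c *s g s) (at s within {0..T})"
        by (rule bounded_linear.has_vector_derivative[OF bounded_bilinear.bounded_linear_right[OF bounded_bilinear_vector_scalar_mult] Gd[OF s]])
      then have "((\<lambda>s. x + c *s G s) has_vector_derivative 0 + c *s g s) (at s within {0..T})"
        by (intro has_vector_derivative_add has_vector_derivative_const)
      then have "(y has_vector_derivative E s *s (0 + c *s g s) + (c * k * E s) *s (x + c *s G s)) (at s within {0..T})"
        unfolding y_def by (intro bounded_bilinear.has_vector_derivative[OF bounded_bilinear_vector_scalar_mult] Ed)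
      moreover have "E s *s (0 + c *s g s) = c *s y1 s" by (simp add: Eg[symmetric] mult.commute)
      moreover have "(c * k * E s) *s (x + c *s G s) = (c * k) *s y s" by (simp add: y_def)
      ultimately show ?thesis by (simp add: add.commute)
    qed
    \<comment> \<open>By construction y' = c k y + c y1. This equals c D y exactly when w = 0, which
      holds because w' = c k w and w(0) = 0.\<close>
    define w where "w s = D (y s) - k *s y s - y1 s" for s
    have wd: "(w has_vector_derivative (c * k) *s w s) (at s within {0..T})" if s: "s \<in> {0..T}" for s
    proof -
      have "(w has_vector_derivative D ((c * k) *s y s + c *s y1 s) - k *s ((c * k) *s y s + c *s y1 s) - c *s D (y1 s)) (at s within {0..T})"
        unfolding w_def
        by (intro has_vector_derivative_diff y1(2)[OF s]
            bounded_linear.has_vector_derivative[OF complex_linearD(1)[OF D] yd[OF s]]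
            bounded_linear.has_vector_derivative[OF bounded_bilinear.bounded_linear_right[OF bounded_bilinear_vector_scalar_mult] yd[OF s]])
      moreover have "D ((c * k) *s y s + c *s y1 s) - k *s ((c * k) *s y s + c *s y1 s) - c *s D (y1 s) = (c * k) *s w s"
        unfolding w_def complex_linearD(2,4)[OF D]
        by (simp add: Finite_Cartesian_Product.vec_eq_iff algebra_simps)
      ultimately show ?thesis by simp
    qed
    have w0: "w 0 = 0" by (simp add: w_def y_def E_def G0 y1(1))
    have "w s = 0" if s: "s \<in> {0..T}" for s
    proof -
      have "norm (w s) \<le> norm (w 0) * exp (cmod (c * k) * s)"
        by (rule gronwall_local[OF wd, where \<delta> = 1]) (use s w0 in \<open>auto simp: norm_vector_scalar_mult\<close>)
      then show ?thesis by (simp add: w0)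
    qed
    then have Dy: "c *s D (y s) = (c * k) *s y s + c *s y1 s" if "s \<in> {0..T}" for s
    proof -
      have "D (y s) = k *s y s + y1 s" using \<open>\<And>s. s \<in> {0..T} \<Longrightarrow> w s = 0\<close>[OF that] by (simp add: w_def algebra_simps)
      then show ?thesis by (simp add: vector_add_ldistrib)
    qed
    have bound: "norm (y s) \<le> (norm x + C) * (1 + s) ^ Suc N" if s: "s \<in> {0..T}" for s
    proof -
      have "norm (G s) \<le> C * (1 + s) ^ N * (s - 0)"
        unfolding G_def
      proof (rule integral_bound)
        show "continuous_on {0..s} g" by (rule continuous_on_subset[OF gc]) (use s in auto)
        fix t assume t: "t \<in> {0..s}"
        have "norm (g t) = norm (y1 t)"
          unfolding g_def norm_vector_scalar_mult norm_exp_eq_Re uminus_complex.sel rek by simp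
        also have "\<dots> \<le> C * (1 + t) ^ N" using y1(3)[of t] t s by simp
        also have "\<dots> \<le> C * (1 + s) ^ N" using t C by (intro mult_left_mono power_mono) auto
        finally show "norm (g t) \<le> C * (1 + s) ^ N" .
      qed (use s in auto)
      moreover have "norm (y s) \<le> norm x + norm (G s)"
        unfolding y_def norm_vector_scalar_mult E1
        using norm_triangle_ineq[of x "c *s G s"] by (simp add: norm_vector_scalar_mult c(2))
      moreover have "norm x * 1 \<le> norm x * (1 + s) ^ Suc N"
        using s by (intro mult_left_mono one_le_power) auto
      moreover have "C * (1 + s) ^ N * s \<le> C * (1 + s) ^ N * (1 + s)"
        using s C by (intro mult_left_mono) auto
      ultimately show ?thesis by (simp add: algebra_simps)
    qed
    have "y 0 = x" by (simp add: y_def E_def G0)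
    then show ?thesis using yd Dy bound by (intro exI[of _ y]) auto
  qed
  then show ?case using C by (intro exI[of _ "norm x + C"] conjI exI[of _ "Suc N"] allI impI) auto
qed

lemma polynomial_dominates_exp:
  fixes \<mu> q K :: real
  assumes "\<And>T. T \<ge> 0 \<Longrightarrow> exp (\<mu> * T) * q \<le> K * (1 + T) ^ M" and "q > 0"
  shows "\<mu> \<le> 0"
proof (rule ccontr)
  assume "\<not> \<mu> \<le> 0"
  then have \<mu>: "\<mu> > 0" by simp
  have "((\<lambda>z::real. z ^ M / exp z) \<longlongrightarrow> 0) at_top" by (rule tendsto_power_div_exp_0)
  then have "((\<lambda>z. (\<bar>K\<bar> / \<mu> ^ M * exp \<mu>) * (z ^ M / exp z)) \<longlongrightarrow> (\<bar>K\<bar> / \<mu> ^ M * exp \<mu>) * 0) at_top"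
    by (intro tendsto_intros)
  then have "\<forall>\<^sub>F z in at_top. (\<bar>K\<bar> / \<mu> ^ M * exp \<mu>) * (z ^ M / exp z) < q"
    using assms(2) by (intro order_tendstoD(2)[of _ 0]) auto
  then obtain z where z: "z \<ge> \<mu>" "(\<bar>K\<bar> / \<mu> ^ M * exp \<mu>) * (z ^ M / exp z) < q"
    using eventually_ge_at_top[of \<mu>] by (metis (mono_tags, lifting) eventually_at_top_linorder linear order.trans)
  define T where "T = z / \<mu> - 1"
  have T: "T \<ge> 0" "1 + T = z / \<mu>" "\<mu> * T = z - \<mu>" using z(1) \<mu> by (auto simp: T_def field_simps)
  have "exp (z - \<mu>) * q \<le> K * (z / \<mu>) ^ M" using assms(1)[OF T(1)] unfolding T(2,3) .
  also have "\<dots> \<le> \<bar>K\<bar> * (z / \<mu>) ^ M" using z \<mu> by (intro mult_right_mono) auto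
  finally have "exp z / exp \<mu> * q \<le> \<bar>K\<bar> * (z ^ M / \<mu> ^ M)" by (simp add: exp_diff power_divide)
  then have "q \<le> (\<bar>K\<bar> / \<mu> ^ M * exp \<mu>) * (z ^ M / exp z)" using \<mu> by (simp add: field_simps)
  then show False using z(2) by simp
qed

text \<open>Along a solution of y' = c D y the polynomial q is multiplied exactly by exp(c \<nu> s),
  yet it is bounded by a power of 1 + s because y is. So Re (c \<nu>) <= 0 for both c = i and c =
  -i, which forces Im \<nu> = 0.\<close>

lemma homogeneous_eigenfunction_real:
  fixes D :: "complex ^ 'd \<Rightarrow> complex ^ 'd"
  assumes D: "complex_linear D" and ev: "\<And>c v. v \<noteq> 0 \<Longrightarrow> D v = c *s v \<Longrightarrow> c \<in> \<real>"
    and J: "finite J" "\<And>j. j \<in> J \<Longrightarrow> mdeg (a j) = l"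
    and eq: "\<And>x. (\<Sum>j\<in>J. d j * (\<Sum>k\<in>UNIV. D x $ k * monomial_deriv k (a j) x)) = \<nu> * (\<Sum>j\<in>J. d j * monomial_fun (a j) x)"
    and x0: "(\<Sum>j\<in>J. d j * monomial_fun (a j) x0) \<noteq> 0"
  shows "\<nu> \<in> \<real>"
proof -
  define q where "q x = (\<Sum>j\<in>J. d j * monomial_fun (a j) x)" for x
  have main: "Re (c * \<nu>) \<le> 0" if c: "Re c = 0" "cmod c = 1" for c
  proof -
    have "\<exists>ks. set ks \<subseteq> \<real> \<and> shift_prod D ks x0 = 0" by (rule shift_prod_real_exists[OF D ev])
    then obtain ks where ks: "set ks \<subseteq> \<real>" "shift_prod D ks x0 = 0" by blast
    obtain C N where C: "C \<ge> 0" and CN: "\<And>T. T \<ge> 0 \<Longrightarrow> \<exists>y. y 0 = x0 \<and>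
      (\<forall>s\<in>{0..T}. (y has_vector_derivative c *s D (y s)) (at s within {0..T}) \<and> norm (y s) \<le> C * (1 + s) ^ N)"
      using linear_ode_polynomial_growth[OF D c ks] by blast
    define B where "B = (\<Sum>j\<in>J. cmod (d j))"
    have "exp (Re (c * \<nu>) * T) * cmod (q x0) \<le> (B * C ^ l) * (1 + T) ^ (N * l)" if T: "T \<ge> 0" for T
    proof -
      obtain y where y: "y 0 = x0"
        "\<And>s. s \<in> {0..T} \<Longrightarrow> (y has_vector_derivative c *s D (y s)) (at s within {0..T})"
        "\<And>s. s \<in> {0..T} \<Longrightarrow> norm (y s) \<le> C * (1 + s) ^ N"
        using CN[OF T] by blast
      have qd: "((\<lambda>s. q (y s)) has_vector_derivative c * \<nu> * q (y s)) (at s within {0..T})" if s: "s \<in> {0..T}" for s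
      proof -
        have "((\<lambda>s. monomial_fun (a j) (y s)) has_vector_derivative (\<Sum>k\<in>UNIV. (c *s D (y s)) $ k * monomial_deriv k (a j) (y s))) (at s within {0..T})" for j
          by (rule has_vector_derivative_along_curve[OF monomial_fun_has_derivative y(2)[OF s]])
        then have "((\<lambda>s. q (y s)) has_vector_derivative (\<Sum>j\<in>J. d j * (\<Sum>k\<in>UNIV. (c *s D (y s)) $ k * monomial_deriv k (a j) (y s)))) (at s within {0..T})"
          unfolding q_def by (intro has_vector_derivative_sum has_vector_derivative_mult_right)
        moreover have "(\<Sum>j\<in>J. d j * (\<Sum>k\<in>UNIV. (c *s D (y s)) $ k * monomial_deriv k (a j) (y s))) =
            c * (\<Sum>j\<in>J. d j * (\<Sum>k\<in>UNIV. D (y s) $ k * monomial_deriv k (a j) (y s)))"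
          by (simp add: sum_distrib_left mult_ac)
        ultimately show ?thesis unfolding eq q_def by (simp only: mult.assoc)
      qed
      define u where "u s = exp (- (c * \<nu> * complex_of_real s)) * q (y s)" for s
      have "(u has_vector_derivative 0) (at s within {0..T})" if s: "s \<in> {0..T}" for s
      proof -
        have "((\<lambda>z. exp (- (c * \<nu> * z))) has_field_derivative - (c * \<nu>) * exp (- (c * \<nu> * of_real s))) (at (of_real s))"
          by (auto intro!: derivative_eq_intros)
        then have "((\<lambda>s. exp (- (c * \<nu> * complex_of_real s))) has_vector_derivative - (c * \<nu>) * exp (- (c * \<nu> * of_real s))) (at s within {0..T})"
          by (rule has_vector_derivative_real_field)
        from has_vector_derivative_mult[OF this qd[OF s]] show ?thesis
          unfolding u_def by (simp add: mult_ac)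
      qed
      then obtain u0 where u0: "\<And>s. s \<in> {0..T} \<Longrightarrow> u s = u0"
        using has_vector_derivative_zero_constant[of "{0..T}" u] by (auto simp: convex_closed_interval)
      have "u T = q x0" using u0[of T] u0[of 0] T y(1) by (simp add: u_def)
      then have "cmod (exp (- (c * \<nu> * complex_of_real T))) * cmod (q (y T)) = cmod (q x0)"
        unfolding u_def norm_mult[symmetric] by simp
      then have "exp (- (Re (c * \<nu>) * T)) * cmod (q (y T)) = cmod (q x0)" by simp
      then have "exp (Re (c * \<nu>) * T) * cmod (q x0) = cmod (q (y T))"
        by (metis exp_minus_inverse mult.assoc mult_1)
      also have "\<dots> \<le> B * norm (y T) ^ l"
        unfolding q_def B_def sum_distrib_right
      proof (rule sum_norm_le)
        fix j assume "j \<in> J"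
        then have "cmod (monomial_fun (a j) (y T)) \<le> norm (y T) ^ l" using norm_monomial_fun_le[of "a j" "y T"] J(2) by simp
        then show "cmod (d j * monomial_fun (a j) (y T)) \<le> cmod (d j) * norm (y T) ^ l"
          unfolding norm_mult by (intro mult_left_mono) auto
      qed
      also have "\<dots> \<le> B * (C * (1 + T) ^ N) ^ l"
        using y(3)[of T] T by (intro mult_left_mono power_mono) (auto simp: B_def sum_nonneg)
      finally show ?thesis by (simp add: power_mult_distrib power_mult)
    qed
    then show ?thesis using x0 by (intro polynomial_dominates_exp[where q = "cmod (q x0)"]) (auto simp: q_def)
  qed
  from main[of \<i>] main[of "- \<i>"] have "Im \<nu> = 0" by simp
  then show ?thesis by (simp add: complex_is_Real_iff)
qed

text \<open>The Koopman generator, differentiation along V, applied to the j-th basis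
  function.\<close>

definition field_jet ::
  "(nat \<Rightarrow> nat ^ 'd) \<Rightarrow> complex ^ 'd \<Rightarrow> (complex ^ 'd \<Rightarrow> complex ^ 'd) \<Rightarrow> nat \<Rightarrow> complex ^ 'd \<Rightarrow> complex" where
  "field_jet \<alpha> p V j x = (\<Sum>k\<in>UNIV. V (p + x) $ k * jet_grad \<alpha> p j k x)"

text \<open>An eigenvector of A gives a function h that satisfies V . grad h = \<nu> h up to order
  m+1. Let q be its homogeneous part of lowest degree l. Evaluating at \<epsilon> x, dividing by
  \<epsilon>^l and letting \<epsilon> tend to 0 replaces V by its linear part and h by q, so dq(Dx)
  = \<nu> q and \<open>homogeneous_eigenfunction_real\<close> applies.\<close>

lemma field_jet_matrix_eigenvalue_real:
  fixes \<alpha> :: "nat \<Rightarrow> nat ^ 'd"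
  assumes num: "graded_numbering e \<alpha>"
    and V: "(V has_derivative D) (at p)" "V p = 0" and D: "complex_linear D"
    and ev: "\<And>c v. v \<noteq> 0 \<Longrightarrow> D v = c *s v \<Longrightarrow> c \<in> \<real>"
    and A: "A \<in> carrier_mat (jet_dim TYPE('d) m) (jet_dim TYPE('d) m)"
    and jet: "\<And>j. j < jet_dim TYPE('d) m \<Longrightarrow> jet_approx \<alpha> p m (field_jet \<alpha> p V j) (\<lambda>i. A $$ (i, j))"
    and l: "eigenvalue A \<nu>"
  shows "\<nu> \<in> \<real>"
proof -
  let ?r = "jet_dim TYPE('d) m"
  let ?a = "\<lambda>j. \<alpha> (j + 1)"
  obtain w where w: "w \<in> carrier_vec ?r" "w \<noteq> 0\<^sub>v ?r" "A *\<^sub>v w = \<nu> \<cdot>\<^sub>v w"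
    using l A unfolding eigenvalue_def eigenvector_def by auto
  let ?v = "vec_index w"
  have Av: "(\<Sum>j<?r. A $$ (i, j) * ?v j) = \<nu> * ?v i" if "i < ?r" for i
    using index_mult_mat_vec_sum[OF A w(1) that] w(1) that unfolding w(3) by simp
  define d where "d j = ?v j * jet_scale \<alpha> p j" for j
  obtain i0 where i0: "i0 < ?r" "?v i0 \<noteq> 0" using w(1,2) by (metis eq_vecI carrier_vecD index_zero_vec)
  define S where "S = {mdeg (?a j) | j. j < ?r \<and> ?v j \<noteq> 0}"
  have S: "finite S" "S \<noteq> {}" using i0 by (auto simp: S_def)
  define l where "l = Min S"
  have lmin: "l \<le> mdeg (?a j)" if "j < ?r" "d j \<noteq> 0" for j
    unfolding l_def by (rule Min_le[OF S(1)]) (use that in \<open>auto simp: S_def d_def\<close>)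
  obtain j0 where j0: "j0 < ?r" "?v j0 \<noteq> 0" "mdeg (?a j0) = l"
    using Min_in[OF S] unfolding l_def[symmetric] by (auto simp: S_def)
  have lm: "l \<le> m" using mdeg_numbering_le[OF num j0(1)] j0(3) by simp
  define J where "J = {j\<in>{..<?r}. mdeg (?a j) = l}"
  have J: "finite J" by (simp add: J_def)
  have "jet_approx \<alpha> p m (\<lambda>x. \<Sum>j<?r. ?v j * field_jet \<alpha> p V j x) (\<lambda>i. \<Sum>j<?r. ?v j * A $$ (i, j))"
    by (intro jet_approx_sum jet_approx_mult_left jet) simp
  then obtain B r where B: "r > 0" "\<And>x. norm x < r \<Longrightarrow> cmod ((\<Sum>j<?r. ?v j * field_jet \<alpha> p V j x) -
      (\<Sum>i<?r. (\<Sum>j<?r. ?v j * A $$ (i, j)) * jet_basis \<alpha> p i x)) \<le> B * norm x ^ Suc m"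
    unfolding jet_approx_def by blast
  have key: "(\<Sum>j\<in>J. d j * (\<Sum>k\<in>UNIV. D x $ k * monomial_deriv k (?a j) x)) = \<nu> * (\<Sum>j\<in>J. d j * monomial_fun (?a j) x)" for x
  proof -
    let ?V = "\<lambda>\<epsilon>. V (p + complex_of_real \<epsilon> *s x)"
    \<comment> \<open>\<open>F\<close> and \<open>H\<close> are the generator image and the function
      itself at \<epsilon> x, divided by \<epsilon>^l and by the weight. The subtraction
      \<open>mdeg (?a j) - l\<close> truncates only for terms with \<open>d j = 0\<close>.\<close>
    define F where "F \<epsilon> = (\<Sum>j<?r. d j * of_real \<epsilon> ^ (mdeg (?a j) - l) * (\<Sum>k\<in>UNIV. (?V \<epsilon> $ k / of_real \<epsilon>) * monomial_deriv k (?a j) x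
        + ?V \<epsilon> $ k * (cnj (p $ k) * monomial_fun (?a j) x)))" for \<epsilon> :: real
    define H where "H \<epsilon> = (\<Sum>j<?r. d j * of_real \<epsilon> ^ (mdeg (?a j) - l) * monomial_fun (?a j) x)" for \<epsilon> :: real
    have line: "((\<lambda>t. V (p + t *s x) $ k) has_field_derivative D x $ k) (at 0)" for k
      by (rule holomorphic_map_line_derivative) (use V D in \<open>auto simp: complex_linear_def\<close>)
    have of0: "filterlim complex_of_real (at 0) (at_right 0)"
      unfolding filterlim_at
      by (auto intro!: tendsto_eq_intros simp: eventually_at_filter)
    have lim1: "((\<lambda>\<epsilon>. ?V \<epsilon> $ k / of_real \<epsilon>) \<longlongrightarrow> D x $ k) (at_right 0)" for k
    proof -
      have "((\<lambda>t. V (p + t *s x) $ k / t) \<longlongrightarrow> D x $ k) (at 0)"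
        using line[of k] unfolding has_field_derivative_iff by (simp add: V(2))
      from filterlim_compose[OF this of0] show ?thesis .
    qed
    have lim0: "((\<lambda>\<epsilon>. ?V \<epsilon> $ k) \<longlongrightarrow> 0) (at_right 0)" for k
    proof -
      have "((\<lambda>t. V (p + t *s x) $ k) \<longlongrightarrow> 0) (at 0)"
        using DERIV_isCont[OF line[of k]] by (simp add: isCont_def V(2))
      from filterlim_compose[OF this of0] show ?thesis .
    qed
    have pw: "((\<lambda>\<epsilon>. complex_of_real \<epsilon> ^ n) \<longlongrightarrow> (if n = 0 then 1 else 0)) (at_right 0)" for n
    proof -
      have "((\<lambda>\<epsilon>. complex_of_real \<epsilon> ^ n) \<longlongrightarrow> complex_of_real 0 ^ n) (at_right 0)" by (intro tendsto_intros)
      then show ?thesis by (cases n) auto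
    qed
    have restrict: "(\<Sum>j<?r. d j * (if mdeg (?a j) - l = 0 then 1 else 0) * G j) = (\<Sum>j\<in>J. d j * G j)" for G
    proof -
      have "(\<Sum>j<?r. d j * (if mdeg (?a j) - l = 0 then 1 else 0) * G j) = (\<Sum>j<?r. if mdeg (?a j) = l then d j * G j else 0)"
        using lmin by (intro sum.cong refl) force
      then show ?thesis unfolding J_def sum.inter_filter[OF finite_lessThan] .
    qed
    have limF: "(F \<longlongrightarrow> (\<Sum>j\<in>J. d j * (\<Sum>k\<in>UNIV. D x $ k * monomial_deriv k (?a j) x + 0 * (cnj (p $ k) * monomial_fun (?a j) x)))) (at_right 0)"
      unfolding F_def restrict[symmetric] by (intro tendsto_intros lim0 lim1 pw)
    have limH: "(H \<longlongrightarrow> (\<Sum>j\<in>J. d j * monomial_fun (?a j) x)) (at_right 0)"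
      unfolding H_def restrict[symmetric] by (intro tendsto_intros pw)
    obtain Bw where Bw: "\<And>x. norm x \<le> 1 \<Longrightarrow> cmod (1 / jet_weight p x) \<le> Bw"
      using jet_weight_inverse_bounded[of 1 p] by blast
    define \<epsilon>0 where "\<epsilon>0 = min 1 r / (norm x + 1)"
    have \<epsilon>0: "\<epsilon>0 > 0" using B(1) by (simp add: \<epsilon>0_def add_nonneg_pos)
    have "((\<lambda>\<epsilon>. F \<epsilon> - \<nu> * H \<epsilon>) \<longlongrightarrow> 0) (at_right 0)"
    proof (rule Lim_null_comparison)
      show "\<forall>\<^sub>F \<epsilon> in at_right 0. cmod (F \<epsilon> - \<nu> * H \<epsilon>) \<le> \<bar>B\<bar> * norm x ^ Suc m * Bw * \<epsilon> ^ (Suc m - l)"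
        using eventually_at_right_real[OF \<epsilon>0]
      proof eventually_elim
        case (elim \<epsilon>)
        then have \<epsilon>: "\<epsilon> > 0" "\<epsilon> < \<epsilon>0" by auto
        let ?e = "complex_of_real \<epsilon>"
        have "\<epsilon> * (norm x + 1) < min 1 r" using \<epsilon> by (simp add: \<epsilon>0_def pos_less_divide_eq add_nonneg_pos)
        then have nx: "norm (?e *s x) < r" "norm (?e *s x) \<le> 1" using \<epsilon> by (auto simp: norm_vector_scalar_mult algebra_simps)
        have pe: "?e ^ l * (d j * ?e ^ (mdeg (?a j) - l)) = d j * ?e ^ mdeg (?a j)" if "j < ?r" for j
          using lmin[OF that] by (cases "d j = 0") (auto simp: power_add[symmetric] mult_ac)
        have md: "monomial_deriv k a (?e *s x) = ?e ^ mdeg a * (monomial_deriv k a x / ?e)" for k a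
          using monomial_deriv_scale[of ?e k a x] \<epsilon> by (simp add: field_simps)
        have FW: "?e ^ l * F \<epsilon> * jet_weight p (?e *s x) = (\<Sum>j<?r. ?v j * field_jet \<alpha> p V j (?e *s x))"
          unfolding F_def sum_distrib_left[of _ _ "{..<?r}"] sum_distrib_right[of _ "{..<?r}"]
        proof (intro sum.cong refl)
          fix j assume "j \<in> {..<?r}"
          then have "j < ?r" by simp
          let ?S = "\<Sum>k\<in>UNIV. (?V \<epsilon> $ k / ?e) * monomial_deriv k (?a j) x + ?V \<epsilon> $ k * (cnj (p $ k) * monomial_fun (?a j) x)"
          have "?e ^ l * (d j * ?e ^ (mdeg (?a j) - l) * ?S) * jet_weight p (?e *s x) =
            ?e ^ l * (d j * ?e ^ (mdeg (?a j) - l)) * ?S * jet_weight p (?e *s x)"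
            by (simp only: mult.assoc)
          also have "\<dots> = d j * ?e ^ mdeg (?a j) * ?S * jet_weight p (?e *s x)"
            by (simp only: pe[OF \<open>j < ?r\<close>])
          also have "\<dots> = ?v j * field_jet \<alpha> p V j (?e *s x)"
            unfolding field_jet_def jet_grad_def d_def md monomial_fun_scale sum_distrib_left sum_distrib_right
            by (intro sum.cong refl) (simp add: algebra_simps)
          finally show "?e ^ l * (d j * ?e ^ (mdeg (?a j) - l) * (\<Sum>k\<in>UNIV. (?V \<epsilon> $ k / ?e) * monomial_deriv k (?a j) x
            + ?V \<epsilon> $ k * (cnj (p $ k) * monomial_fun (?a j) x))) * jet_weight p (?e *s x) = ?v j * field_jet \<alpha> p V j (?e *s x)" .
        qed
        have HW: "?e ^ l * (\<nu> * H \<epsilon>) * jet_weight p (?e *s x) = (\<Sum>i<?r. (\<Sum>j<?r. ?v j * A $$ (i, j)) * jet_basis \<alpha> p i (?e *s x))"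
          unfolding H_def sum_distrib_left[of _ _ "{..<?r}"] sum_distrib_right[of _ "{..<?r}" "jet_weight p (?e *s x)"]
        proof (intro sum.cong refl)
          fix i assume "i \<in> {..<?r}"
          then have i: "i < ?r" by simp
          have "?e ^ l * (\<nu> * (d i * ?e ^ (mdeg (?a i) - l) * monomial_fun (?a i) x)) * jet_weight p (?e *s x) =
            \<nu> * (?e ^ l * (d i * ?e ^ (mdeg (?a i) - l))) * monomial_fun (?a i) x * jet_weight p (?e *s x)"
            by (simp only: mult_ac)
          also have "\<dots> = (\<nu> * ?v i) * jet_basis \<alpha> p i (?e *s x)"
            unfolding pe[OF i] unfolding jet_basis_eq monomial_fun_scale d_def by (simp only: mult_ac)
          also have "\<nu> * ?v i = (\<Sum>j<?r. ?v j * A $$ (i, j))" using Av[OF i] by (simp add: mult.commute)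
          finally show "?e ^ l * (\<nu> * (d i * ?e ^ (mdeg (?a i) - l) * monomial_fun (?a i) x)) * jet_weight p (?e *s x) =
            (\<Sum>j<?r. ?v j * A $$ (i, j)) * jet_basis \<alpha> p i (?e *s x)" .
        qed
        have "cmod (?e ^ l * (F \<epsilon> - \<nu> * H \<epsilon>) * jet_weight p (?e *s x)) \<le> B * norm (?e *s x) ^ Suc m"
          using B(2)[OF nx(1)] unfolding FW[symmetric] HW[symmetric] by (simp add: algebra_simps)
        also have "\<dots> \<le> \<bar>B\<bar> * norm (?e *s x) ^ Suc m" by (intro mult_right_mono) auto
        finally have "cmod (?e ^ l * (F \<epsilon> - \<nu> * H \<epsilon>) * jet_weight p (?e *s x)) * cmod (1 / jet_weight p (?e *s x))
            \<le> \<bar>B\<bar> * norm (?e *s x) ^ Suc m * Bw"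
          by (intro mult_mono Bw nx) auto
        then have "\<epsilon> ^ l * cmod (F \<epsilon> - \<nu> * H \<epsilon>) \<le> \<bar>B\<bar> * norm (?e *s x) ^ Suc m * Bw"
          using jet_weight_nonzero[of p "?e *s x"] \<epsilon> by (simp add: norm_mult norm_divide norm_power)
        also have "\<dots> = \<epsilon> ^ l * (\<bar>B\<bar> * norm x ^ Suc m * Bw * \<epsilon> ^ (Suc m - l))"
        proof -
          have "\<epsilon> ^ Suc m = \<epsilon> ^ l * \<epsilon> ^ (Suc m - l)" using lm by (simp add: power_add[symmetric])
          then have "norm (?e *s x) ^ Suc m = \<epsilon> ^ l * \<epsilon> ^ (Suc m - l) * norm x ^ Suc m"
            using \<epsilon> by (simp only: norm_vector_scalar_mult power_mult_distrib norm_of_real abs_of_pos)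
          then show ?thesis by (simp only: mult_ac)
        qed
        finally show ?case using \<epsilon> by (simp only: mult_le_cancel_left_pos zero_less_power)
      qed
      have "((\<lambda>\<epsilon>. \<bar>B\<bar> * norm x ^ Suc m * Bw * \<epsilon> ^ (Suc m - l)) \<longlongrightarrow> \<bar>B\<bar> * norm x ^ Suc m * Bw * 0 ^ (Suc m - l)) (at_right 0)"
        by (intro tendsto_intros)
      then show "((\<lambda>\<epsilon>. \<bar>B\<bar> * norm x ^ Suc m * Bw * \<epsilon> ^ (Suc m - l)) \<longlongrightarrow> 0) (at_right 0)" using lm by (simp add: zero_power)
    qed
    moreover have "((\<lambda>\<epsilon>. F \<epsilon> - \<nu> * H \<epsilon>) \<longlongrightarrow> (\<Sum>j\<in>J. d j * (\<Sum>k\<in>UNIV. D x $ k * monomial_deriv k (?a j) x + 0 * (cnj (p $ k) * monomial_fun (?a j) x)))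
      - \<nu> * (\<Sum>j\<in>J. d j * monomial_fun (?a j) x)) (at_right 0)"
      by (intro tendsto_intros limF limH)
    ultimately have "0 = (\<Sum>j\<in>J. d j * (\<Sum>k\<in>UNIV. D x $ k * monomial_deriv k (?a j) x + 0 * (cnj (p $ k) * monomial_fun (?a j) x)))
      - \<nu> * (\<Sum>j\<in>J. d j * monomial_fun (?a j) x)"
      by (rule tendsto_unique[rotated]) simp
    then show ?thesis by simp
  qed
  have "\<exists>x0. (\<Sum>j\<in>J. d j * monomial_fun (?a j) x0) \<noteq> 0"
  proof (rule ccontr)
    assume "\<not> ?thesis"
    then have z: "(\<Sum>j\<in>J. d j * monomial_fun (?a j) x) = 0" for x by blast
    have inj: "inj_on ?a J"
      using bij_betw_imp_inj_on[OF bij_betw_graded_numbering[OF num, of m]] by (rule inj_on_subset) (auto simp: J_def)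
    have jJ: "j0 \<in> J" using j0 by (simp add: J_def)
    have "d (inv_into J ?a (?a j0)) = 0"
    proof (rule monomial_fun_independent[where F = "?a ` J" and c = "\<lambda>b. d (inv_into J ?a b)"])
      fix x
      show "(\<Sum>b\<in>?a ` J. d (inv_into J ?a b) * monomial_fun b x) = 0"
        unfolding sum.reindex[OF inj] o_def z[of x, symmetric]
        by (intro sum.cong refl) (simp add: inv_into_f_f[OF inj, simplified])
    qed (use J jJ in auto)
    then show False using inv_into_f_f[OF inj jJ] j0(2) jet_scale_nonzero[of \<alpha> p j0] by (simp add: d_def)
  qed
  then obtain x0 where x0: "(\<Sum>j\<in>J. d j * monomial_fun (?a j) x0) \<noteq> 0" by blast
  show ?thesis
    by (rule homogeneous_eigenfunction_real[OF D ev J _ key x0]) (auto simp: J_def)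
qed


section \<open>The gauge of K0\<close>

lemma minkowski_set_nonempty:
  fixes K0 :: "(complex ^ 'd) set"
  assumes "0 \<in> interior K0"
  shows "\<exists>t>0. z \<in> (\<lambda>w. t *\<^sub>R w) ` K0"
proof -
  obtain e where e: "e > 0" "ball 0 e \<subseteq> K0" using assms mem_interior by blast
  define t where "t = (norm z + 1) / e"
  have t: "t > 0" using e(1) by (simp add: t_def add_nonneg_pos)
  have "norm (z /\<^sub>R t) = norm z / t" using t by (simp add: divide_inverse mult.commute)
  also have "\<dots> = e * (norm z / (norm z + 1))" by (simp add: t_def)
  also have "\<dots> < e * 1" using e(1) by (intro mult_strict_left_mono) (auto simp: pos_divide_less_eq add_nonneg_pos)
  finally have "z /\<^sub>R t \<in> K0" using e(2) by auto
  moreover have "z = t *\<^sub>R (z /\<^sub>R t)" using t by simp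
  ultimately show ?thesis using t by blast
qed

lemma minkowski_norm_lessD:
  fixes K0 :: "(complex ^ 'd) set"
  assumes "0 \<in> interior K0" "minkowski_norm K0 z < t"
  shows "\<exists>s>0. s < t \<and> z \<in> (\<lambda>w. s *\<^sub>R w) ` K0"
proof -
  have "\<exists>s\<in>{t. t > 0 \<and> z \<in> (\<lambda>w. t *\<^sub>R w) ` K0}. s < t"
    using assms(2) minkowski_set_nonempty[OF assms(1), of z] unfolding minkowski_norm_def
    by (intro cInf_lessD) auto
  then show ?thesis by blast
qed

lemma minkowski_norm_le:
  assumes "t > 0" "z \<in> (\<lambda>w. t *\<^sub>R w) ` K0"
  shows "minkowski_norm K0 z \<le> t"
  unfolding minkowski_norm_def by (rule cInf_lower) (use assms in \<open>auto intro!: bdd_belowI[of _ 0]\<close>)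

lemma minkowski_norm_nonneg:
  fixes K0 :: "(complex ^ 'd) set"
  assumes "0 \<in> interior K0" shows "minkowski_norm K0 z \<ge> 0"
  unfolding minkowski_norm_def
  by (rule cInf_greatest) (use minkowski_set_nonempty[OF assms, of z] in auto)

lemma minkowski_norm_pos:
  fixes K0 :: "(complex ^ 'd) set"
  assumes K0: "compact K0" "0 \<in> interior K0" and z: "z \<noteq> 0"
  shows "minkowski_norm K0 z > 0"
proof -
  obtain M where M: "M > 0" "\<And>w. w \<in> K0 \<Longrightarrow> norm w \<le> M"
    using compact_imp_bounded[OF K0(1)] unfolding bounded_pos by blast
  have "norm z / M \<le> minkowski_norm K0 z"
    unfolding minkowski_norm_def
  proof (rule cInf_greatest)
    show "{t. t > 0 \<and> z \<in> (\<lambda>w. t *\<^sub>R w) ` K0} \<noteq> {}" using minkowski_set_nonempty[OF K0(2), of z] by auto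
    fix t assume "t \<in> {t. t > 0 \<and> z \<in> (\<lambda>w. t *\<^sub>R w) ` K0}"
    then obtain w where w: "t > 0" "w \<in> K0" "z = t *\<^sub>R w" by auto
    then have "norm z \<le> t * M" using M(2)[OF w(2)] by simp
    then show "norm z / M \<le> t" using M(1) by (simp add: pos_divide_le_eq)
  qed
  then show ?thesis using M(1) z by (smt (verit) divide_pos_pos zero_less_norm_iff)
qed

text \<open>Let e be the radius of a ball around 0 inside K0. Points near c w have the form c w + (1
  - |c|) u with |u| < e, and absolute convexity puts them into K0.\<close>

lemma scaled_in_interior:
  fixes K0 :: "(complex ^ 'd) set"
  assumes ac: "absolutely_convex K0" and int: "0 \<in> interior K0" and w: "w \<in> K0" and c: "cmod c < 1"
  shows "c *s w \<in> interior K0"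
proof -
  obtain e where e: "e > 0" "ball 0 e \<subseteq> K0" using int mem_interior by blast
  define q where "q = 1 - cmod c"
  have q: "q > 0" using c by (simp add: q_def)
  have "ball (c *s w) (q * e) \<subseteq> K0"
  proof
    fix y assume "y \<in> ball (c *s w) (q * e)"
    then have "norm (y - c *s w) < q * e" by (simp add: dist_norm norm_minus_commute)
    then have "norm (y - c *s w) / q < e" using q by (simp add: pos_divide_less_eq mult.commute)
    moreover have "norm (u /\<^sub>R q) = norm u / q" for u :: "complex ^ 'd" using q by (simp add: divide_inverse mult.commute)
    ultimately have "norm ((y - c *s w) /\<^sub>R q) < e" by simp
    then have "(y - c *s w) /\<^sub>R q \<in> K0" using e(2) by auto
    moreover have "cmod c + cmod (complex_of_real q) \<le> 1"
      unfolding norm_of_real using c by (simp add: q_def)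
    ultimately have "c *s w + complex_of_real q *s ((y - c *s w) /\<^sub>R q) \<in> K0"
      using ac w unfolding absolutely_convex_def by blast
    moreover have "complex_of_real q *s ((y - c *s w) /\<^sub>R q) = y - c *s w"
      using q by (simp add: scaleR_vector_scalar_mult)
    ultimately show "y \<in> K0" by simp
  qed
  moreover have "q * e > 0" using q e by simp
  ultimately show ?thesis unfolding mem_interior by blast
qed

text \<open>Provides the disc of radius 1 / r in the parameter t on which Taylor remainders along
  the ray through \<open>z\<close> are estimated.\<close>

lemma ray_in_interior:
  fixes K0 :: "(complex ^ 'd) set"
  assumes ac: "absolutely_convex K0" and int: "0 \<in> interior K0"
    and z: "minkowski_norm K0 z < r" and t: "cmod t * r \<le> 1"
  shows "t *s z \<in> interior K0"
proof -
  obtain s w where s: "s > 0" "s < r" "w \<in> K0" "z = s *\<^sub>R w"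
    using minkowski_norm_lessD[OF int z] by blast
  have "cmod (t * of_real s) < 1"
  proof (cases "t = 0")
    case False
    then have "cmod t * s < cmod t * r" using s by (intro mult_strict_left_mono) auto
    then show ?thesis using t s by (simp add: norm_mult)
  qed simp
  from scaled_in_interior[OF ac int s(3) this] show ?thesis
    by (simp add: s(4) scaleR_vector_scalar_mult mult.commute)
qed

text \<open>Compactness gives one factor 1 + \<delta> by which every point of K1 can be stretched
  without leaving K0, so all gauges are at most 1 / (1 + \<delta>).\<close>

lemma gauge_radius_compact_subset:
  fixes K0 :: "(complex ^ 'd) set"
  assumes int: "0 \<in> interior K0" and K1: "compact K1" "K1 \<subseteq> interior K0" "K1 \<noteq> {}"
  shows "gauge_radius K0 K1 < 1" "gauge_radius K0 K1 \<ge> 0" "\<And>z. z \<in> K1 \<Longrightarrow> minkowski_norm K0 z \<le> gauge_radius K0 K1"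
proof -
  obtain e where e: "e > 0" "(\<Union>x\<in>K1. cball x e) \<subseteq> interior K0"
    using compact_subset_open_imp_cball_epsilon_subset[OF K1(1) open_interior K1(2)] by blast
  obtain M where M: "M > 0" "\<And>w. w \<in> K1 \<Longrightarrow> norm w \<le> M"
    using compact_imp_bounded[OF K1(1)] unfolding bounded_pos by blast
  define \<delta> where "\<delta> = e / M"
  have \<delta>: "\<delta> > 0" using e M by (simp add: \<delta>_def)
  have le: "minkowski_norm K0 z \<le> 1 / (1 + \<delta>)" if z: "z \<in> K1" for z
  proof (rule minkowski_norm_le)
    have "norm (\<delta> *\<^sub>R z) \<le> \<delta> * M" using M(2)[OF z] \<delta> by simp
    then have "(1 + \<delta>) *\<^sub>R z \<in> cball z e" using M by (simp add: dist_norm scaleR_add_left \<delta>_def)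
    then have "(1 + \<delta>) *\<^sub>R z \<in> interior K0" using e(2) z by blast
    then have "(1 + \<delta>) *\<^sub>R z \<in> K0" using interior_subset by blast
    moreover have "z = (1 / (1 + \<delta>)) *\<^sub>R ((1 + \<delta>) *\<^sub>R z)" using \<delta> by simp
    ultimately show "z \<in> (\<lambda>w. (1 / (1 + \<delta>)) *\<^sub>R w) ` K0" by blast
  qed (use \<delta> in simp)
  have "gauge_radius K0 K1 \<le> 1 / (1 + \<delta>)" unfolding gauge_radius_def by (rule cSUP_least[OF K1(3) le])
  also have "\<dots> < 1" using \<delta> by simp
  finally show "gauge_radius K0 K1 < 1" .
  show up: "minkowski_norm K0 z \<le> gauge_radius K0 K1" if "z \<in> K1" for z
    unfolding gauge_radius_def by (rule cSUP_upper[OF that bdd_aboveI2[OF le]])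
  show "gauge_radius K0 K1 \<ge> 0" using K1(3) up minkowski_norm_nonneg[OF int] order_trans by blast
qed

lemma minkowski_norm_le_gauge_radius:
  fixes K0 :: "(complex ^ 'd) set"
  assumes S: "S \<subseteq> K0" "z \<in> S"
  shows "minkowski_norm K0 z \<le> gauge_radius K0 S"
  unfolding gauge_radius_def
proof (rule cSUP_upper[OF S(2)])
  have "minkowski_norm K0 z \<le> 1" if "z \<in> K0" for z
    by (rule minkowski_norm_le) (use that in auto)
  then show "bdd_above (minkowski_norm K0 ` S)" using S(1) by (intro bdd_aboveI2[of _ _ 1]) auto
qed

section \<open>Support, empirical measures and moment matrices\<close>

lemma measure_support_subset_closed:
  assumes C: "closed C" and \<mu>: "sets \<mu> = sets borel" "prob_space \<mu>" and K: "emeasure \<mu> (C \<inter> B) = 1" "B \<in> sets borel"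
  shows "measure_support \<mu> \<subseteq> C" "AE z in \<mu>. z \<in> C"
proof -
  interpret prob_space \<mu> by fact
  have Cm: "C \<in> sets \<mu>" "C \<inter> B \<in> sets \<mu>" using C K(2) by (auto simp: \<mu>(1))
  have "1 \<le> emeasure \<mu> C" unfolding K(1)[symmetric] by (rule emeasure_mono[OF _ Cm(1)]) auto
  then have 1: "emeasure \<mu> C = 1" using emeasure_le_1[of C] by (rule order.antisym[rotated])
  have "emeasure \<mu> (space \<mu> - C) = 0"
    using emeasure_compl[OF Cm(1)] 1 emeasure_space_1 by simp
  then have z: "emeasure \<mu> (- C) = 0" using sets_eq_imp_space_eq[OF \<mu>(1)] by (simp add: Compl_eq_Diff_UNIV)
  show "measure_support \<mu> \<subseteq> C"
  proof (rule ccontr)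
    assume "\<not> measure_support \<mu> \<subseteq> C"
    then obtain x where "x \<in> measure_support \<mu>" "x \<in> - C" by blast
    then have "emeasure \<mu> (- C) > 0" using C unfolding measure_support_def by (simp add: open_Compl)
    then show False using z by simp
  qed
  show "AE z in \<mu>. z \<in> C"
    by (rule AE_I[of _ _ "- C"]) (use z Cm(1) sets_eq_imp_space_eq[OF \<mu>(1)] \<mu>(1) C in \<open>auto simp: borel_open open_Compl\<close>)
qed

text \<open>The complement of the support is the union of all open null sets, and by Lindelof
  countably many of them suffice.\<close>

lemma emeasure_complement_support:
  fixes \<mu> :: "'a :: second_countable_topology measure"
  assumes \<mu>: "sets \<mu> = sets borel"
  shows "- measure_support \<mu> \<in> null_sets \<mu>"
proof -
  define F where "F = {U. open U \<and> emeasure \<mu> U = 0}"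
  have eq: "- measure_support \<mu> = \<Union>F"
    unfolding measure_support_def F_def by (auto simp: zero_less_iff_neq_zero)
  obtain F' where F': "F' \<subseteq> F" "countable F'" "\<Union>F' = \<Union>F"
    using Lindelof[of F] unfolding F_def by blast
  have "\<Union>F' \<in> null_sets \<mu>"
  proof -
    have "(\<Union>U\<in>F'. U) \<in> null_sets \<mu>"
      by (rule null_sets_UN'[OF F'(2)]) (use F'(1) in \<open>auto simp: F_def null_sets_def \<mu>\<close>)
    then show ?thesis by simp
  qed
  then show ?thesis by (simp add: eq F'(3))
qed

lemma real_lebesgue_on_zero:
  fixes K0 :: "(complex ^ 'd) set"
  assumes K0: "closed K0"
  shows "{0} \<in> null_sets (real_lebesgue_on K0)"
proof -
  have cont: "continuous_on UNIV (of_real_vec :: real ^ 'd \<Rightarrow> complex ^ 'd)"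
    unfolding of_real_vec_def by (intro continuous_on_vec_lambda continuous_intros continuous_on_component)
  have meas: "(of_real_vec :: real ^ 'd \<Rightarrow> complex ^ 'd) \<in> borel_measurable (restrict_space lborel A)" for A
    by (rule measurable_restrict_space1) (use borel_measurable_continuous_onI[OF cont] in simp)
  have A: "(of_real_vec :: real ^ 'd \<Rightarrow> complex ^ 'd) -` K0 \<in> sets lborel"
    using continuous_closed_vimage[OF K0, of of_real_vec] cont
    by (simp add: continuous_on_eq_continuous_at borel_closed)
  have "emeasure (real_lebesgue_on K0) {0} = 0"
  proof -
    let ?B = "(of_real_vec -` {0::complex ^ 'd}) \<inter> space (restrict_space lborel (of_real_vec -` K0))"
    have B: "?B \<subseteq> {0} \<inter> of_real_vec -` K0"
      by (auto simp: of_real_vec_def Finite_Cartesian_Product.vec_eq_iff space_restrict_space)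
    have "emeasure (real_lebesgue_on K0) {0} = emeasure (restrict_space lborel (of_real_vec -` K0)) ?B"
      unfolding real_lebesgue_on_def by (rule emeasure_distr[OF meas]) simp
    also have "\<dots> = emeasure lborel ?B"
      by (rule emeasure_restrict_space) (use A B in auto)
    also have "\<dots> \<le> emeasure lborel ({0} :: (real ^ 'd) set)" by (rule emeasure_mono) (use B in auto)
    finally show ?thesis by simp
  qed
  then show ?thesis by (simp add: null_sets_def real_lebesgue_on_def)
qed

text \<open>Absolute continuity excludes that \<mu> is concentrated at 0, so the support has a
  nonzero point, whose gauge is positive as K0 is bounded. With R_mu > 0 the quotient in the growth
  hypothesis is infinite if the liminf is 0, so that case is excluded.\<close>

lemma gauge_radius_support_pos:
  fixes K0 :: "(complex ^ 'd) set"
  assumes K0: "compact K0" "0 \<in> interior K0"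
    and \<mu>: "sets \<mu> = sets borel" "prob_space \<mu>" "emeasure \<mu> (K0 \<inter> B) = 1" "B \<in> sets borel"
    and ac: "absolutely_continuous (real_lebesgue_on K0) \<mu>"
  shows "gauge_radius K0 (measure_support \<mu>) > 0"
proof -
  interpret prob_space \<mu> by fact
  have sub: "measure_support \<mu> \<subseteq> K0"
    by (rule measure_support_subset_closed(1)[OF compact_imp_closed[OF K0(1)] \<mu>])
  have "\<not> measure_support \<mu> \<subseteq> {0}"
  proof
    assume s: "measure_support \<mu> \<subseteq> {0}"
    have "{0} \<in> null_sets \<mu>"
      using ac real_lebesgue_on_zero[OF compact_imp_closed[OF K0(1)]] unfolding absolutely_continuous_def by blast
    then have "{0} \<union> - measure_support \<mu> \<in> null_sets \<mu>" by (intro null_sets.Un emeasure_complement_support \<mu>)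
    moreover have "{0} \<union> - measure_support \<mu> = space \<mu>" using s sets_eq_imp_space_eq[OF \<mu>(1)] by auto
    ultimately show False using emeasure_space_1 by (auto simp: null_sets_def)
  qed
  then obtain z where z: "z \<in> measure_support \<mu>" "z \<noteq> 0" by blast
  have "0 < minkowski_norm K0 z" by (rule minkowski_norm_pos[OF K0 z(2)])
  also have "\<dots> \<le> gauge_radius K0 (measure_support \<mu>)" by (rule minkowski_norm_le_gauge_radius[OF sub z(1)])
  finally show ?thesis .
qed

lemma integral_empirical_measure:
  fixes g :: "'a :: topological_space \<Rightarrow> real"
  assumes "continuous_on UNIV g" "N > 0"
  shows "(\<integral>z. g z \<partial>empirical_measure N x) = (\<Sum>i=1..N. g (x i)) / real N"
proof -
  have "x \<in> measurable (uniform_count_measure {1..N}) borel"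
    by (simp add: measurable_def space_uniform_count_measure sets_uniform_count_measure)
  then have "(\<integral>z. g z \<partial>empirical_measure N x) = (\<integral>i. g (x i) \<partial>uniform_count_measure {1..N})"
    unfolding empirical_measure_def
    by (rule integral_distr[OF _ borel_measurable_continuous_onI[OF assms(1)]])
  also have "\<dots> = (\<Sum>i=1..N. g (x i)) / real N"
    by (subst integral_uniform_count_measure) (use assms in auto)
  finally show ?thesis .
qed

text \<open>Weak convergence tests bounded real functions on the whole space. Tietze's theorem
  replaces \<phi> by a bounded continuous function that agrees with it on K0, where \<mu> and all
  samples live; real and imaginary parts are treated separately.\<close>

lemma empirical_mean_tendsto:
  fixes \<phi> :: "complex ^ 'd \<Rightarrow> complex"
  assumes K0: "compact K0" and \<mu>: "sets \<mu> = sets borel" "prob_space \<mu>" and AE: "AE z in \<mu>. z \<in> K0"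
    and x: "\<And>i. i \<ge> 1 \<Longrightarrow> x i \<in> K0" and weak: "weakly_converges (\<lambda>N. empirical_measure N x) \<mu>"
    and \<phi>: "continuous_on UNIV \<phi>"
  shows "(\<lambda>N. (\<Sum>i=1..N. \<phi> (x i)) / of_nat N) \<longlonglongrightarrow> (\<integral>z. \<phi> z \<partial>\<mu>)"
proof -
  interpret prob_space \<mu> by fact
  have "bounded (\<phi> ` K0)"
    by (intro compact_imp_bounded compact_continuous_image continuous_on_subset[OF \<phi>] K0) auto
  then obtain B where B: "B > 0" "\<And>z. z \<in> K0 \<Longrightarrow> norm (\<phi> z) \<le> B" unfolding bounded_pos by auto
  have cK: "closedin (top_of_set UNIV) K0" using compact_imp_closed[OF K0] by simp
  have \<phi>K: "continuous_on K0 \<phi>" by (rule continuous_on_subset[OF \<phi>]) simp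
  obtain g where g: "continuous_on UNIV g" "\<And>z. z \<in> K0 \<Longrightarrow> g z = \<phi> z" "\<And>z. z \<in> UNIV \<Longrightarrow> norm (g z) \<le> B"
    using Tietze[OF \<phi>K cK less_imp_le[OF B(1)] B(2)] by metis
  have gm: "g \<in> borel_measurable \<mu>" "\<phi> \<in> borel_measurable \<mu>"
    using borel_measurable_continuous_onI[OF g(1)] borel_measurable_continuous_onI[OF \<phi>] measurable_cong_sets[OF \<mu>(1) refl] by auto
  have gi: "integrable \<mu> g" by (rule integrable_const_bound[of _ B]) (use g gm in auto)
  have part: "(\<lambda>N. (\<Sum>i=1..N. L (g (x i))) / real N) \<longlonglongrightarrow> (\<integral>z. L (g z) \<partial>\<mu>)"
    if L: "bounded_linear L" "\<And>z. \<bar>L z\<bar> \<le> cmod z" for L :: "complex \<Rightarrow> real"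
  proof -
    have c: "continuous_on UNIV (\<lambda>z. L (g z))" by (rule bounded_linear.continuous_on[OF L(1) g(1)])
    have "bounded (range (\<lambda>z. L (g z)))"
      unfolding bounded_iff using order_trans[OF L(2) g(3)] by auto
    then have "(\<lambda>N. \<integral>z. L (g z) \<partial>empirical_measure N x) \<longlonglongrightarrow> (\<integral>z. L (g z) \<partial>\<mu>)"
      using weak c unfolding weakly_converges_def by blast
    then show ?thesis
    proof (rule Lim_transform_eventually)
      show "\<forall>\<^sub>F N in sequentially. (\<integral>z. L (g z) \<partial>empirical_measure N x) = (\<Sum>i=1..N. L (g (x i))) / real N"
        using eventually_gt_at_top[of 0] by eventually_elim (rule integral_empirical_measure[OF c])
    qed
  qed
  have "(\<lambda>N. Complex ((\<Sum>i=1..N. Re (g (x i))) / real N) ((\<Sum>i=1..N. Im (g (x i))) / real N))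
      \<longlonglongrightarrow> Complex (\<integral>z. Re (g z) \<partial>\<mu>) (\<integral>z. Im (g z) \<partial>\<mu>)"
    by (intro tendsto_Complex part bounded_linear_Re bounded_linear_Im abs_Re_le_cmod abs_Im_le_cmod)
  also have "Complex (\<integral>z. Re (g z) \<partial>\<mu>) (\<integral>z. Im (g z) \<partial>\<mu>) = (\<integral>z. g z \<partial>\<mu>)"
    using gi by (simp add: complex_eq_iff integral_bounded_linear[OF bounded_linear_Re] integral_bounded_linear[OF bounded_linear_Im])
  also have "(\<integral>z. g z \<partial>\<mu>) = (\<integral>z. \<phi> z \<partial>\<mu>)"
    using AE by (intro integral_cong_AE gm) (auto elim!: eventually_mono simp: g(2))
  also have "(\<lambda>N. Complex ((\<Sum>i=1..N. Re (g (x i))) / real N) ((\<Sum>i=1..N. Im (g (x i))) / real N)) =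
      (\<lambda>N. (\<Sum>i=1..N. \<phi> (x i)) / of_nat N)"
  proof
    fix N
    have "(\<Sum>i=1..N. \<phi> (x i)) = (\<Sum>i=1..N. g (x i))" by (intro sum.cong refl) (simp add: g(2) x)
    then show "Complex ((\<Sum>i=1..N. Re (g (x i))) / real N) ((\<Sum>i=1..N. Im (g (x i))) / real N) = (\<Sum>i=1..N. \<phi> (x i)) / of_nat N"
      by (simp add: complex_eq_iff)
  qed
  finally show ?thesis .
qed

lemma hermitian_form_empirical:
  fixes N :: nat and M :: "nat \<Rightarrow> nat \<Rightarrow> complex"
  shows "hermitian_form r (\<lambda>i j. (\<Sum>s=1..N. cnj (M s i) * M s j) / of_nat N) v = (\<Sum>s=1..N. (cmod (\<Sum>k<r. M s k * v k))\<^sup>2) / real N"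
proof -
  have "(\<Sum>i<r. \<Sum>j<r. cnj (v i) * ((\<Sum>s=1..N. cnj (M s i) * M s j) / of_nat N) * v j) =
      (\<Sum>i<r. \<Sum>j<r. \<Sum>s=1..N. (cnj (M s i) * cnj (v i)) * (M s j * v j) / of_nat N)"
    unfolding sum_divide_distrib sum_distrib_left sum_distrib_right by (intro sum.cong refl) simp
  also have "\<dots> = (\<Sum>i<r. \<Sum>s=1..N. \<Sum>j<r. (cnj (M s i) * cnj (v i)) * (M s j * v j) / of_nat N)"
    by (intro sum.cong refl sum.swap)
  also have "\<dots> = (\<Sum>s=1..N. \<Sum>i<r. \<Sum>j<r. (cnj (M s i) * cnj (v i)) * (M s j * v j) / of_nat N)"
    by (rule sum.swap)
  also have "\<dots> = (\<Sum>s=1..N. cnj (\<Sum>k<r. M s k * v k) * (\<Sum>k<r. M s k * v k) / of_nat N)"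
    by (intro sum.cong refl) (simp add: sum_product sum_divide_distrib)
  also have "\<dots> = (\<Sum>s=1..N. complex_of_real ((cmod (\<Sum>k<r. M s k * v k))\<^sup>2) / of_nat N)"
    unfolding complex_norm_square by (intro sum.cong refl) (simp add: mult.commute)
  also have "\<dots> = complex_of_real ((\<Sum>s=1..N. (cmod (\<Sum>k<r. M s k * v k))\<^sup>2) / real N)"
    unfolding of_real_divide of_real_sum sum_divide_distrib by simp
  finally show ?thesis unfolding hermitian_form_def by (simp del: of_real_divide of_real_sum)
qed

text \<open>The empirical moment matrices have forms that are means of squares and converge
  entrywise to the moment matrix, which is therefore Hermitian and positive semidefinite. Once they
  are Lambda_n / 2 close, half of the spectral lower bound survives for the samples. The bound by 1
  comes from testing the form on the constant monomial.\<close>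

lemma moment_matrix_bounds:
  fixes K0 :: "(complex ^ 'd) set" and \<alpha> :: "nat \<Rightarrow> nat ^ 'd"
  assumes num: "graded_numbering e \<alpha>" and K0: "compact K0" and \<mu>: "sets \<mu> = sets borel" "prob_space \<mu>"
    and AE: "AE z in \<mu>. z \<in> K0" and x: "\<And>i. i \<ge> 1 \<Longrightarrow> x i \<in> K0"
    and weak: "weakly_converges (\<lambda>N. empirical_measure N x) \<mu>"
  shows "Lambda_eig \<alpha> n \<mu> \<ge> 0" "Lambda_eig \<alpha> n \<mu> \<le> 1"
    and "Lambda_eig \<alpha> n \<mu> > 0 \<Longrightarrow> \<forall>\<^sub>F N in sequentially. \<forall>v.
      real N * (Lambda_eig \<alpha> n \<mu> / 2) * (\<Sum>k<jet_dim TYPE('d) n. (cmod (v k))\<^sup>2)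
        \<le> (\<Sum>s=1..N. (cmod (\<Sum>k<jet_dim TYPE('d) n. monomial_fun (\<alpha> (k + 1)) (x s) * v k))\<^sup>2)"
proof -
  interpret prob_space \<mu> by fact
  let ?r = "jet_dim TYPE('d) n"
  let ?m = "\<lambda>k z. monomial_fun (\<alpha> (k + 1)) z"
  let ?D = "moment_matrix \<alpha> n \<mu>"
  let ?L = "Lambda_eig \<alpha> n \<mu>"
  define E where "E N i j = (\<Sum>s=1..N. cnj (?m i (x s)) * ?m j (x s)) / of_nat N" for N i j
  have D: "?D \<in> carrier_mat ?r ?r" by (simp add: moment_matrix_def)
  have Dij: "?D $$ (i, j) = (\<integral>z. cnj (?m i z) * ?m j z \<partial>\<mu>)" if "i < ?r" "j < ?r" for i j
    using that by (simp add: moment_matrix_def)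
  have lim: "(\<lambda>N. E N i j) \<longlonglongrightarrow> ?D $$ (i, j)" if "i < ?r" "j < ?r" for i j
    unfolding Dij[OF that] E_def
    by (rule empirical_mean_tendsto[OF K0 \<mu> AE x weak]) (auto intro!: continuous_intros)
  have herm: "?D $$ (j, i) = cnj (?D $$ (i, j))" if ij: "i < ?r" "j < ?r" for i j
  proof -
    have "E N j i = cnj (E N i j)" for N by (simp add: E_def mult.commute)
    then have "(\<lambda>N. E N j i) \<longlonglongrightarrow> cnj (?D $$ (i, j))" using tendsto_cnj[OF lim[OF ij]] by simp
    then show ?thesis using lim[OF ij(2,1)] LIMSEQ_unique by blast
  qed
  have hfE: "hermitian_form ?r (E N) v = (\<Sum>s=1..N. (cmod (\<Sum>k<?r. ?m k (x s) * v k))\<^sup>2) / real N" for N v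
    using hermitian_form_empirical[where r = ?r and N = N and M = "\<lambda>s k. ?m k (x s)" and v = v] unfolding E_def .
  have psd: "hermitian_form ?r (\<lambda>i j. ?D $$ (i, j)) v \<ge> 0" for v
  proof -
    have "(\<lambda>N. hermitian_form ?r (E N) v) \<longlonglongrightarrow> hermitian_form ?r (\<lambda>i j. ?D $$ (i, j)) v"
      unfolding hermitian_form_def by (intro tendsto_intros lim) auto
    moreover have "hermitian_form ?r (E N) v \<ge> 0" for N unfolding hfE by (simp add: sum_nonneg)
    ultimately show ?thesis by (intro LIMSEQ_le_const) auto
  qed
  note small = smallest_eigenvalue_hermitian[OF D jet_dim_pos herm]
  show "?L \<ge> 0" unfolding Lambda_eig_def by (rule small(2)[OF _ _ psd])
  show "?L \<le> 1"
  proof -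
    let ?e = "\<lambda>i::nat. if i = 0 then 1 else 0 :: complex"
    have n1: "(\<Sum>i<?r. (cmod (?e i))\<^sup>2) = 1"
    proof -
      have "(\<Sum>i<?r. (cmod (?e i))\<^sup>2) = (\<Sum>i<?r. if i = 0 then 1 else 0)" by (intro sum.cong) auto
      then show ?thesis using jet_dim_pos[where ?'d = 'd, of n] by simp
    qed
    have "(\<Sum>i<?r. \<Sum>j<?r. cnj (?e i) * ?D $$ (i, j) * ?e j) = (\<Sum>i<?r. if i = 0 then (\<Sum>j<?r. if j = 0 then ?D $$ (0, 0) else 0) else 0)"
      by (intro sum.cong refl) (auto simp: mult_delta_right)
    also have "\<dots> = ?D $$ (0, 0)" using jet_dim_pos[where ?'d = 'd, of n] by simp
    also have "\<dots> = (\<integral>z. 1 \<partial>\<mu>)"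
      using num jet_dim_pos[where ?'d = 'd, of n] by (subst Dij) (auto simp: graded_numbering_def)
    also have "\<dots> = 1" by (simp add: prob_space)
    finally have "Re (\<Sum>i<?r. \<Sum>j<?r. cnj (?e i) * ?D $$ (i, j) * ?e j) = Re 1" by (rule arg_cong)
    then have "hermitian_form ?r (\<lambda>i j. ?D $$ (i, j)) ?e = 1" unfolding hermitian_form_def one_complex.sel .
    then show ?thesis using small(1)[of ?e] unfolding n1 Lambda_eig_def by simp
  qed
  assume L: "?L > 0"
  have "(\<lambda>N. \<Sum>i<?r. \<Sum>j<?r. cmod (?D $$ (i, j) - E N i j)) \<longlonglongrightarrow> (\<Sum>i<?r. \<Sum>j<?r. cmod (?D $$ (i, j) - ?D $$ (i, j)))"
    by (intro tendsto_intros lim) auto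
  then have "\<forall>\<^sub>F N in sequentially. (\<Sum>i<?r. \<Sum>j<?r. cmod (?D $$ (i, j) - E N i j)) < ?L / 2"
    using L by (intro order_tendstoD(2)) auto
  then show "\<forall>\<^sub>F N in sequentially. \<forall>v. real N * (?L / 2) * (\<Sum>k<?r. (cmod (v k))\<^sup>2) \<le> (\<Sum>s=1..N. (cmod (\<Sum>k<?r. ?m k (x s) * v k))\<^sup>2)"
    using eventually_gt_at_top[of 0]
  proof eventually_elim
    case (elim N)
    show ?case
    proof
      fix v :: "nat \<Rightarrow> complex"
      let ?n = "\<Sum>k<?r. (cmod (v k))\<^sup>2"
      have n0: "?n \<ge> 0" by (intro sum_nonneg) auto
      have "hermitian_form ?r (\<lambda>i j. ?D $$ (i, j)) v - hermitian_form ?r (E N) v =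
          Re (\<Sum>i<?r. \<Sum>j<?r. cnj (v i) * (?D $$ (i, j) - E N i j) * v j)"
        unfolding hermitian_form_def minus_complex.sel(1)[symmetric] sum_subtractf[symmetric]
        by (intro arg_cong[where f = Re] sum.cong refl) (simp add: algebra_simps)
      also have "\<dots> \<le> cmod (\<Sum>i<?r. \<Sum>j<?r. cnj (v i) * (?D $$ (i, j) - E N i j) * v j)" by (rule complex_Re_le_cmod)
      also have "\<dots> \<le> (\<Sum>i<?r. \<Sum>j<?r. cmod (?D $$ (i, j) - E N i j)) * ?n" by (rule norm_double_sum_le)
      also have "\<dots> \<le> ?L / 2 * ?n" using elim(1) n0 by (intro mult_right_mono) auto
      finally have "?L * ?n - ?L / 2 * ?n \<le> hermitian_form ?r (E N) v"
        using small(1)[of v] unfolding Lambda_eig_def by linarith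
      then have "real N * (?L / 2 * ?n) \<le> real N * hermitian_form ?r (E N) v"
        by (intro mult_left_mono) (auto simp: field_simps)
      then show "real N * (?L / 2) * ?n \<le> (\<Sum>s=1..N. (cmod (\<Sum>k<?r. ?m k (x s) * v k))\<^sup>2)"
        unfolding hfE using elim(2) by (simp add: mult.assoc)
    qed
  qed
qed

text \<open>The liminf l lies in [0, 1]. From R / l < \<rho> follow l > 0 and R < \<rho> l <=
  \<rho>; moreover R / \<rho> < \<Lambda>_n^(1/(2n)) eventually, and its n-th power is the second
  claim.\<close>

lemma eigenvalue_root_liminf:
  fixes \<Lambda> :: "nat \<Rightarrow> real"
  assumes \<Lambda>: "\<And>n. \<Lambda> n \<ge> 0" "\<And>n. \<Lambda> n \<le> 1" and R: "R > 0" and \<rho>: "0 < \<rho>"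
    and less: "ereal R / liminf (\<lambda>n. ereal (\<Lambda> n powr (1 / (2 * real n)))) < ereal \<rho>"
  shows "R < \<rho>" "\<forall>\<^sub>F n in sequentially. \<Lambda> n > 0 \<and> R ^ n \<le> \<rho> ^ n * sqrt (\<Lambda> n)"
proof -
  let ?f = "\<lambda>n. ereal (\<Lambda> n powr (1 / (2 * real n)))"
  have "liminf ?f \<ge> 0" by (rule Liminf_bounded) auto
  moreover have "limsup ?f \<le> 1" by (rule Limsup_bounded) (use \<Lambda> in \<open>auto simp: powr_le1\<close>)
  then have "liminf ?f \<le> 1" using Liminf_le_Limsup[of sequentially ?f] by (auto intro: order_trans)
  ultimately obtain l where l: "liminf ?f = ereal l" "0 \<le> l" "l \<le> 1" by (cases "liminf ?f") auto
  have "l \<noteq> 0" using less R unfolding l(1) by (auto simp: zero_ereal_def[symmetric] divide_ereal_def)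
  then have lpos: "l > 0" using l by simp
  have "R / l < \<rho>" using less lpos unfolding l(1) by simp
  then have Rl: "R < \<rho> * l" using lpos by (simp add: pos_divide_less_eq)
  also have "\<dots> \<le> \<rho> * 1" using \<rho> l by (intro mult_left_mono) auto
  finally show "R < \<rho>" by simp
  have "ereal (R / \<rho>) < liminf ?f" unfolding l(1) using Rl \<rho> by (simp add: pos_divide_less_eq mult.commute)
  then have "\<forall>\<^sub>F n in sequentially. ereal (R / \<rho>) < ?f n" by (rule less_LiminfD)
  then show "\<forall>\<^sub>F n in sequentially. \<Lambda> n > 0 \<and> R ^ n \<le> \<rho> ^ n * sqrt (\<Lambda> n)"
    using eventually_gt_at_top[of 0]
  proof eventually_elim
    case (elim n)
    have q: "R / \<rho> < \<Lambda> n powr (1 / (2 * real n))" "R / \<rho> > 0" using elim R \<rho> by auto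
    then have pos: "\<Lambda> n > 0" using \<Lambda>(1)[of n] by (cases "\<Lambda> n = 0") auto
    have "(R / \<rho>) ^ n \<le> (\<Lambda> n powr (1 / (2 * real n))) ^ n" using q by (intro power_mono) auto
    also have "\<dots> = \<Lambda> n powr (1 / 2)"
      using pos elim(2) by (simp add: powr_realpow[symmetric] powr_powr)
    also have "\<dots> = sqrt (\<Lambda> n)" using pos by (simp add: powr_half_sqrt)
    finally have "R ^ n \<le> \<rho> ^ n * sqrt (\<Lambda> n)" using \<rho> by (simp add: power_divide pos_divide_le_eq mult.commute)
    with pos show ?case by simp
  qed
qed


section \<open>Expansions of functions on K0, and jets of the vector field and of the flow\<close>

lemma jet_weight_bounds:
  fixes S :: "(complex ^ 'd) set"
  assumes "bounded S"
  shows "\<exists>B\<ge>1. \<forall>x\<in>S. cmod (jet_weight p x) \<le> B \<and> cmod (1 / jet_weight p x) \<le> B"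
proof -
  obtain R where R: "\<And>x. x \<in> S \<Longrightarrow> norm x \<le> R" using assms unfolding bounded_iff by blast
  obtain B1 where B1: "\<And>x. norm x \<le> R \<Longrightarrow> cmod (1 / jet_weight p x) \<le> B1"
    using jet_weight_inverse_bounded[of R p] by blast
  have "bounded (jet_weight p ` cball 0 R)"
    by (intro compact_imp_bounded compact_continuous_image continuous_jet_weight) simp
  then obtain B2 where "\<forall>y\<in>jet_weight p ` cball 0 R. cmod y \<le> B2" unfolding bounded_iff by blast
  then have B2: "norm x \<le> R \<Longrightarrow> cmod (jet_weight p x) \<le> B2" for x by simp
  show ?thesis
  proof (intro exI[of _ "max 1 (max B1 B2)"] conjI ballI)
    fix x assume "x \<in> S"
    then show "cmod (jet_weight p x) \<le> max 1 (max B1 B2)" "cmod (1 / jet_weight p x) \<le> max 1 (max B1 B2)"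
      using B1[OF R, of x] B2[OF R, of x] by linarith+
  qed simp
qed

text \<open>If the gauge of x is below s < 1, the ray through x stays in the interior of K0 for |t|
  < 1 / s, so the Taylor remainder of h divided by the weight is O(s^(n+1) / (1 - s)); then s
  decreases to q. The same coefficients, for all n at once, give the jets at 0.\<close>

lemma global_jet_expansion:
  fixes h :: "complex ^ 'd \<Rightarrow> complex"
  assumes num: "graded_numbering e \<alpha>" and ac: "absolutely_convex K0" and int: "0 \<in> interior K0"
    and h: "line_holomorphic h (interior K0)" and M: "\<And>x. x \<in> interior K0 \<Longrightarrow> cmod (h x) \<le> M"
    and w: "\<And>x. x \<in> K0 \<Longrightarrow> cmod (jet_weight p x) \<le> Bw \<and> cmod (1 / jet_weight p x) \<le> Bw"
  shows "\<exists>c. (\<forall>n. jet_approx \<alpha> p n h c) \<and> (\<forall>n x q. minkowski_norm K0 x \<le> q \<longrightarrow> q < 1 \<longrightarrow>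
    cmod (h x - (\<Sum>i<jet_dim TYPE('d) n. c i * jet_basis \<alpha> p i x)) \<le> M * Bw * Bw * q ^ Suc n / (1 - q))"
proof -
  obtain R where R: "R > 0" "ball 0 R \<subseteq> interior K0" using int open_interior openE by blast
  define g where "g = (\<lambda>x. h x / jet_weight p x)"
  have g: "line_holomorphic g (interior K0)"
    unfolding g_def by (rule line_holomorphic_divide[OF h line_holomorphic_jet_weight jet_weight_nonzero])
  have hR: "cmod (h x) \<le> M" if "norm x < R" for x
  proof -
    have "x \<in> ball 0 R" using that by simp
    then show ?thesis using R(2) M by blast
  qed
  obtain c where c: "\<And>n x. (\<Sum>l\<le>n. taylor_term g l x) * jet_weight p x = (\<Sum>i<jet_dim TYPE('d) n. c i * jet_basis \<alpha> p i x)"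
    using jet_expansion[OF num line_holomorphic_subset[OF h R(2)] R(1) hR, of p] unfolding g_def by blast
  have K: "x \<in> interior K0 \<Longrightarrow> x \<in> K0" for x using interior_subset by blast
  have M0: "M \<ge> 0" using M[OF int] norm_ge_zero order_trans by blast
  have Bw: "Bw \<ge> 0" using w[OF K[OF int]] norm_ge_zero order_trans by blast
  have gb: "cmod (g x) \<le> M * Bw" if x: "x \<in> interior K0" for x
  proof -
    have "cmod (g x) = cmod (h x) * cmod (1 / jet_weight p x)" by (simp add: g_def norm_divide)
    also have "\<dots> \<le> M * Bw" using M[OF x] w[OF K[OF x]] M0 by (intro mult_mono) auto
    finally show ?thesis .
  qed
  have rem: "cmod (h x - (\<Sum>i<jet_dim TYPE('d) n. c i * jet_basis \<alpha> p i x)) \<le> M * Bw * Bw * (s ^ Suc n / (1 - s))"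
    if x: "minkowski_norm K0 x < s" and s: "s < 1" for x s n
  proof -
    have s0: "s > 0" using x minkowski_norm_nonneg[OF int, of x] by linarith
    have ray: "t *s x \<in> interior K0 \<and> cmod (g (t *s x)) \<le> M * Bw" if "cmod t < 1 / s" for t
    proof -
      have "cmod t * s \<le> 1" using that s0 by (simp add: pos_less_divide_eq)
      from ray_in_interior[OF ac int x this] gb show ?thesis by blast
    qed
    have "cmod (g x - (\<Sum>l\<le>n. taylor_term g l x)) \<le> M * Bw * (1 / (1 / s)) ^ Suc n / (1 - 1 / (1 / s))"
      by (rule taylor_remainder_le[OF g _ ray]) (use s s0 in auto)
    then have 1: "cmod (g x - (\<Sum>l\<le>n. taylor_term g l x)) \<le> M * Bw * s ^ Suc n / (1 - s)" by simp
    have "x \<in> K0" using ray[of 1] s s0 K by simp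
    then have 2: "cmod (jet_weight p x) \<le> Bw" using w by blast
    have "h x - (\<Sum>i<jet_dim TYPE('d) n. c i * jet_basis \<alpha> p i x) = (g x - (\<Sum>l\<le>n. taylor_term g l x)) * jet_weight p x"
      unfolding c[symmetric] left_diff_distrib by (simp add: g_def jet_weight_nonzero)
    then have "cmod (h x - (\<Sum>i<jet_dim TYPE('d) n. c i * jet_basis \<alpha> p i x)) =
        cmod (g x - (\<Sum>l\<le>n. taylor_term g l x)) * cmod (jet_weight p x)" by (simp add: norm_mult)
    also have "\<dots> \<le> (M * Bw * s ^ Suc n / (1 - s)) * Bw"
      using 1 2 norm_ge_zero order_trans[OF norm_ge_zero 1] by (intro mult_mono) auto
    finally show ?thesis by (simp add: mult_ac)
  qed
  have lim: "cmod (h x - (\<Sum>i<jet_dim TYPE('d) n. c i * jet_basis \<alpha> p i x)) \<le> M * Bw * Bw * q ^ Suc n / (1 - q)"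
    if x: "minkowski_norm K0 x \<le> q" and q: "q < 1" for x q n
  proof -
    have "((\<lambda>s. M * Bw * Bw * (s ^ Suc n / (1 - s))) \<longlongrightarrow> M * Bw * Bw * (q ^ Suc n / (1 - q))) (at_right q)"
      using q by (intro tendsto_intros) auto
    moreover have "\<forall>\<^sub>F s in at_right q. cmod (h x - (\<Sum>i<jet_dim TYPE('d) n. c i * jet_basis \<alpha> p i x)) \<le> M * Bw * Bw * (s ^ Suc n / (1 - s))"
      using eventually_at_right_real[OF q] by eventually_elim (rule rem, use x in auto)
    ultimately have "cmod (h x - (\<Sum>i<jet_dim TYPE('d) n. c i * jet_basis \<alpha> p i x)) \<le> M * Bw * Bw * (q ^ Suc n / (1 - q))"
      by (intro tendsto_lowerbound) auto
    then show ?thesis by simp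
  qed
  have "jet_approx \<alpha> p n h c" for n
    unfolding jet_approx_def
  proof (rule exI[of _ "M * Bw * Bw * (2 / R) ^ Suc n * 2"], rule exI[of _ "R / 4"], intro conjI allI impI)
    fix x :: "complex ^ 'd" assume x: "norm x < R / 4"
    \<comment> \<open>A ball inside K0 bounds the gauge by a multiple of the norm. With q this
      multiple, the remainder estimate becomes the O(|x|^(n+1)) bound required for a jet.\<close>
    have "minkowski_norm K0 x \<le> (2 / R) * norm x + d" if d: "d > 0" for d
    proof -
      define \<tau> where "\<tau> = (2 / R) * norm x + d"
      have t: "\<tau> > 0" using d R by (simp add: \<tau>_def add_nonneg_pos)
      have "norm x < R * \<tau>" using R d by (simp add: \<tau>_def distrib_left add_strict_increasing2)
      then have "norm x / \<tau> < R" using t by (simp add: pos_divide_less_eq)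
      moreover have "norm ((1 / \<tau>) *\<^sub>R x) = norm x / \<tau>" using t by simp
      ultimately have "(1 / \<tau>) *\<^sub>R x \<in> ball 0 R" by (simp only: mem_ball_0)
      then have "(1 / \<tau>) *\<^sub>R x \<in> K0" using R(2) K by blast
      moreover have "x = \<tau> *\<^sub>R ((1 / \<tau>) *\<^sub>R x)" using t by simp
      ultimately have "x \<in> (\<lambda>w. \<tau> *\<^sub>R w) ` K0" by blast
      from minkowski_norm_le[OF t this] show ?thesis by (simp only: \<tau>_def)
    qed
    then have le: "minkowski_norm K0 x \<le> (2 / R) * norm x" by (rule field_le_epsilon)
    have half: "(2 / R) * norm x \<le> 1 / 2" using x R by (simp add: field_simps)
    have "cmod (h x - (\<Sum>i<jet_dim TYPE('d) n. c i * jet_basis \<alpha> p i x)) \<le> M * Bw * Bw * ((2 / R) * norm x) ^ Suc n / (1 - (2 / R) * norm x)"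
      by (rule lim[OF le]) (use half in simp)
    also have "\<dots> \<le> M * Bw * Bw * ((2 / R) * norm x) ^ Suc n / (1 / 2)"
      using half M0 Bw R by (intro divide_left_mono mult_nonneg_nonneg) auto
    also have "\<dots> = M * Bw * Bw * (2 / R) ^ Suc n * 2 * norm x ^ Suc n" unfolding power_mult_distrib by simp
    finally show "cmod (h x - (\<Sum>i<jet_dim TYPE('d) n. c i * jet_basis \<alpha> p i x)) \<le> M * Bw * Bw * (2 / R) ^ Suc n * 2 * norm x ^ Suc n" .
  qed (use R in simp)
  with lim show ?thesis by blast
qed

lemma absolutely_convex_cball: "absolutely_convex (cball (0 :: complex ^ 'd) R)"
  unfolding absolutely_convex_def
proof (intro ballI allI impI)
  fix x y :: "complex ^ 'd" and a b :: complex
  assume xy: "x \<in> cball 0 R" "y \<in> cball 0 R" and ab: "cmod a + cmod b \<le> 1"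
  have "norm x \<le> R" using xy(1) by simp
  then have R: "R \<ge> 0" using norm_ge_zero order_trans by blast
  have "norm (a *s x + b *s y) \<le> cmod a * norm x + cmod b * norm y"
    using norm_triangle_ineq[of "a *s x" "b *s y"] by (simp add: norm_vector_scalar_mult)
  also have "\<dots> \<le> cmod a * R + cmod b * R" using xy by (intro add_mono mult_left_mono) auto
  also have "\<dots> \<le> R" using mult_right_mono[OF ab R] by (simp add: distrib_right)
  finally show "a *s x + b *s y \<in> cball 0 R" by simp
qed

text \<open>The global expansion with the closed ball of radius R / 2 in the place of K0; halving
  the radius makes \<open>h\<close> bounded.\<close>

lemma local_jet_exists:
  fixes h :: "complex ^ 'd \<Rightarrow> complex"
  assumes num: "graded_numbering e \<alpha>" and h: "line_holomorphic h (ball 0 R)" and R: "R > 0"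
  shows "\<exists>c. \<forall>n. jet_approx \<alpha> p n h c"
proof -
  have sub: "cball 0 (R / 2) \<subseteq> ball (0 :: complex ^ 'd) R" using R by auto
  have "continuous_on (cball 0 (R / 2)) h"
    using h sub unfolding line_holomorphic_def by (blast intro: continuous_on_subset)
  then have "bounded (h ` cball 0 (R / 2))" by (intro compact_imp_bounded compact_continuous_image) simp_all
  then obtain M where M: "\<And>x. x \<in> cball 0 (R / 2) \<Longrightarrow> cmod (h x) \<le> M" unfolding bounded_iff by blast
  obtain Bw where Bw: "\<And>x. x \<in> cball 0 (R / 2) \<Longrightarrow> cmod (jet_weight p x) \<le> Bw \<and> cmod (1 / jet_weight p x) \<le> Bw"
    using jet_weight_bounds[OF bounded_cball, of 0 "R / 2" p] by blast
  have int: "interior (cball (0 :: complex ^ 'd) (R / 2)) \<subseteq> cball 0 (R / 2)" by (rule interior_subset)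
  have hl: "line_holomorphic h (interior (cball 0 (R / 2)))"
    by (rule line_holomorphic_subset[OF h]) (use int sub in blast)
  have "0 \<in> interior (cball (0 :: complex ^ 'd) (R / 2))" using R by (simp add: interior_cball)
  from global_jet_expansion[OF num absolutely_convex_cball this hl _ Bw] M int show ?thesis by blast
qed

text \<open>Column j consists of the coefficients of a single expansion of \<open>field_jet\<close>
  for j, so one infinite matrix serves all orders m and the finite matrices are its leading
  blocks.\<close>

lemma field_jet_matrix_exists:
  fixes V :: "complex ^ 'd \<Rightarrow> complex ^ 'd"
  assumes num: "graded_numbering e \<alpha>" and hol: "holomorphic_map_on V U" "open U" and p: "p \<in> U"
  shows "\<exists>A. \<forall>m j. jet_approx \<alpha> p m (field_jet \<alpha> p V j) (\<lambda>i. A i j)"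
proof -
  obtain R where R: "R > 0" "ball p R \<subseteq> U" using hol(2) p openE by blast
  have "\<exists>c. \<forall>m. jet_approx \<alpha> p m (field_jet \<alpha> p V j) c" for j
  proof (rule local_jet_exists[OF num _ R(1)])
    have "line_holomorphic (\<lambda>x. V (p + 1 *s x) $ k) (ball 0 R)" for k
      by (rule line_holomorphic_affine[OF holomorphic_map_imp_line_holomorphic[OF hol, of k]])
        (use R(2) in \<open>auto simp: dist_norm subset_iff\<close>)
    then show "line_holomorphic (field_jet \<alpha> p V j) (ball 0 R)"
      unfolding field_jet_def by (intro line_holomorphic_sum line_holomorphic_mult line_holomorphic_jet_grad) simp
  qed
  then have "\<exists>c. \<forall>j m. jet_approx \<alpha> p m (field_jet \<alpha> p V j) (c j)" by (intro choice allI)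
  then obtain c where "\<And>j m. jet_approx \<alpha> p m (field_jet \<alpha> p V j) (c j)" by blast
  then show ?thesis by (intro exI[of _ "\<lambda>i j. c j i"]) simp
qed

lemma jet_approx_transfer:
  fixes h h' :: "complex ^ 'd \<Rightarrow> complex"
  assumes h: "jet_approx \<alpha> p n h c" and r: "r > 0"
    and close: "\<And>x. norm x < r \<Longrightarrow> cmod (h' x - h x) \<le> B * norm x ^ Suc n"
  shows "jet_approx \<alpha> p n h' c"
proof -
  obtain B' r' where B': "r' > 0"
      "\<And>x. norm x < r' \<Longrightarrow> cmod (h x - (\<Sum>i<jet_dim TYPE('d) n. c i * jet_basis \<alpha> p i x)) \<le> B' * norm x ^ Suc n"
    using h unfolding jet_approx_def by blast
  show ?thesis
    unfolding jet_approx_def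
  proof (rule exI[of _ "B + B'"], rule exI[of _ "min r r'"], intro conjI allI impI)
    fix x :: "complex ^ 'd" assume x: "norm x < min r r'"
    have "cmod (h' x - (\<Sum>i<jet_dim TYPE('d) n. c i * jet_basis \<alpha> p i x)) \<le> B * norm x ^ Suc n + B' * norm x ^ Suc n"
      by (rule norm_diff_triangle_le[OF close B'(2)]) (use x in auto)
    then show "cmod (h' x - (\<Sum>i<jet_dim TYPE('d) n. c i * jet_basis \<alpha> p i x)) \<le> (B + B') * norm x ^ Suc n"
      by (simp only: distrib_right)
  qed (use r B' in simp)
qed

text \<open>The matrix \<open>A\<close> of the Koopman generator determines \<open>V\<close>, since the coordinate functions are
  combinations of the basis functions up to order \<open>m + 1\<close>; the derivative of the remainder in the
  direction \<open>V\<close> is controlled by Cauchy's estimate on a disc of radius \<open>norm x / norm (V (p + x))\<close>.\<close>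

lemma field_component_jet:
  fixes V :: "complex ^ 'd \<Rightarrow> complex ^ 'd"
  assumes num: "graded_numbering e \<alpha>" and hol: "holomorphic_map_on V U" "open U" and p: "p \<in> U" "V p = 0"
    and A: "\<And>j. j < jet_dim TYPE('d) m \<Longrightarrow> jet_approx \<alpha> p m (field_jet \<alpha> p V j) (\<lambda>i. A i j)"
  shows "jet_approx \<alpha> p m (\<lambda>x. V (p + x) $ k) (\<lambda>i. \<Sum>j<jet_dim TYPE('d) m. cnj (jet_grad \<alpha> p j k (- p)) * A i j)"
proof -
  let ?r = "jet_dim TYPE('d) m"
  define \<gamma> where "\<gamma> j = cnj (jet_grad \<alpha> p j k (- p))" for j
  define Q where "Q x = (\<Sum>j<?r. \<gamma> j * jet_basis \<alpha> p j x) - (p $ k + x $ k)" for x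
  obtain B where B: "\<And>x. norm x \<le> 1 \<Longrightarrow> cmod (Q x) \<le> B * norm x ^ Suc m"
    using jet_reproducing[where m = m and p = p and k = k, OF num] unfolding Q_def \<gamma>_def by blast
  have B0: "B \<ge> 0"
  proof -
    obtain b :: "complex ^ 'd" where "norm b = 1" using vector_choose_size[of 1] by auto
    then show ?thesis using order_trans[OF norm_ge_zero B[of b]] by simp
  qed
  have Qh: "line_holomorphic Q UNIV"
    unfolding Q_def by (intro line_holomorphic_diff line_holomorphic_sum line_holomorphic_mult line_holomorphic_add
        line_holomorphic_const line_holomorphic_jet_basis line_holomorphic_component)
  obtain \<delta> M L where tube: "lipschitz_tube V U {p} \<delta> M L"
    using lipschitz_tube_exists[OF hol, of "{p}"] p by auto
  have L: "\<delta> > 0" "L > 0" "\<And>x. norm x \<le> \<delta> \<Longrightarrow> norm (V (p + x)) \<le> L * norm x"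
  proof -
    show d: "\<delta> > 0" "L > 0" using tube unfolding lipschitz_tube_def by blast+
    fix x :: "complex ^ 'd" assume "norm x \<le> \<delta>"
    moreover have "\<forall>a. norm (a - p) \<le> \<delta> \<longrightarrow> (\<forall>b. norm (b - a) \<le> \<delta> \<longrightarrow> norm (V b - V a) \<le> L * norm (b - a))"
      using tube unfolding lipschitz_tube_def by blast
    then have "\<forall>b. norm (b - p) \<le> \<delta> \<longrightarrow> norm (V b - V p) \<le> L * norm (b - p)"
      using d(1) by (elim allE[of _ p]) simp
    then have "norm (p + x - p) \<le> \<delta> \<longrightarrow> norm (V (p + x) - V p) \<le> L * norm (p + x - p)" ..
    ultimately have "norm (V (p + x) - V p) \<le> L * norm (p + x - p)" by simp
    then show "norm (V (p + x)) \<le> L * norm x" by (simp add: p)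
  qed
  have main: "cmod (V (p + x) $ k - (\<Sum>j<?r. \<gamma> j * field_jet \<alpha> p V j x)) \<le> (B * 2 ^ Suc m * L) * norm x ^ Suc m"
    if x: "norm x < min \<delta> (1 / 2)" for x
  proof (cases "V (p + x) = 0")
    case True
    then show ?thesis using B0 L(2) by (simp add: field_jet_def)
  next
    case False
    define v where "v = V (p + x)"
    have v: "v \<noteq> 0" "norm v \<le> L * norm x" using False x L(3) by (auto simp: v_def)
    have xpos: "norm x > 0" using v p by (auto simp: v_def)
    define \<rho> where "\<rho> = norm x / norm v"
    have \<rho>: "\<rho> > 0" using v xpos by (simp add: \<rho>_def)
    have "(\<lambda>t. Q (x + t *s v)) holomorphic_on ball 0 \<rho>"
      using Qh unfolding line_holomorphic_def by (auto intro: holomorphic_on_subset)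
    moreover have "cmod (Q (x + t *s v)) \<le> B * (2 * norm x) ^ Suc m" if t: "cmod t < \<rho>" for t
    proof -
      have "cmod t * norm v \<le> norm x" using t v by (simp add: \<rho>_def pos_less_divide_eq)
      then have n: "norm (x + t *s v) \<le> 2 * norm x"
        using norm_triangle_ineq[of x "t *s v"] by (simp add: norm_vector_scalar_mult)
      have "cmod (Q (x + t *s v)) \<le> B * norm (x + t *s v) ^ Suc m" by (rule B) (use n x in simp)
      also have "\<dots> \<le> B * (2 * norm x) ^ Suc m" by (intro mult_left_mono power_mono n B0) simp
      finally show ?thesis .
    qed
    ultimately have "cmod ((deriv ^^ 1) (\<lambda>t. Q (x + t *s v)) 0 / fact 1) \<le> B * (2 * norm x) ^ Suc m / \<rho> ^ 1"
      using \<rho> by (intro power_series_coefficient_le)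
    then have d: "cmod (deriv (\<lambda>t. Q (x + t *s v)) 0) \<le> B * (2 * norm x) ^ Suc m / \<rho>" by simp
    have "((\<lambda>t. jet_basis \<alpha> p j (x + t *s v)) has_field_derivative (\<Sum>l\<in>UNIV. v $ l * jet_grad \<alpha> p j l (x + 0 *s v))) (at 0)" for j
      by (rule has_field_derivative_along_line[OF jet_basis_has_derivative])
    then have b: "((\<lambda>t. jet_basis \<alpha> p j (x + t *s v)) has_field_derivative field_jet \<alpha> p V j x) (at 0)" for j
      by (simp add: field_jet_def v_def)
    have "((\<lambda>t. Q (x + t *s v)) has_field_derivative (\<Sum>j<?r. \<gamma> j * field_jet \<alpha> p V j x) - v $ k) (at 0)"
      unfolding Q_def by (auto intro!: derivative_eq_intros b simp: mult.commute)
    then have e: "deriv (\<lambda>t. Q (x + t *s v)) 0 = (\<Sum>j<?r. \<gamma> j * field_jet \<alpha> p V j x) - v $ k" by (rule DERIV_imp_deriv)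
    have "cmod (V (p + x) $ k - (\<Sum>j<?r. \<gamma> j * field_jet \<alpha> p V j x)) \<le> B * (2 * norm x) ^ Suc m / \<rho>"
      using d unfolding e unfolding v_def by (simp add: norm_minus_commute)
    also have "\<dots> = B * 2 ^ Suc m * norm x ^ m * norm v" using xpos by (simp add: \<rho>_def power_mult_distrib field_simps)
    also have "\<dots> \<le> B * 2 ^ Suc m * norm x ^ m * (L * norm x)" by (intro mult_left_mono v) (use B0 in auto)
    finally show ?thesis by (simp add: mult_ac)
  qed
  have "jet_approx \<alpha> p m (\<lambda>x. \<Sum>j<?r. \<gamma> j * field_jet \<alpha> p V j x) (\<lambda>i. \<Sum>j<?r. \<gamma> j * A i j)"
    by (intro jet_approx_sum jet_approx_mult_left A) simp
  then show ?thesis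
    unfolding \<gamma>_def[symmetric] by (rule jet_approx_transfer[where r = "min \<delta> (1 / 2)", OF _ _ main]) (use L in auto)
qed

lemma vector_derivative_difference_le:
  fixes G :: "real \<Rightarrow> complex"
  assumes "T \<ge> 0" and "\<And>s. s \<in> {0..T} \<Longrightarrow> (G has_vector_derivative G' s) (at s within {0..T})"
    and "\<And>s. s \<in> {0..T} \<Longrightarrow> cmod (G' s) \<le> B"
  shows "cmod (G T - G 0) \<le> B * T"
proof -
  have "norm (G T - G 0) \<le> B * norm (T - 0)"
  proof (rule differentiable_bound[where S = "{0..T}" and f' = "\<lambda>s h. h *\<^sub>R G' s"])
    show "onorm (\<lambda>h. h *\<^sub>R G' s) \<le> B" if "s \<in> {0..T}" for s
      by (rule onorm_le) (use assms(3)[OF that] in \<open>simp add: mult.commute[of B] mult_left_mono\<close>)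
  qed (use assms in \<open>auto simp: has_vector_derivative_def\<close>)
  then show ?thesis using assms(1) by simp
qed

text \<open>Along the flow the row of the basis functions satisfies \<open>y' = y A\<close> up to order \<open>m + 1\<close>, so
  \<open>y (s) exp ((T - s) A)\<close> is constant up to that order.\<close>

lemma flow_pullback_jet:
  fixes V :: "complex ^ 'd \<Rightarrow> complex ^ 'd"
  assumes hol: "holomorphic_map_on V U" "open U" and p: "p \<in> U" "V p = 0" and T: "T \<ge> 0"
    and r0: "r0 > 0" and sol: "\<And>x. norm x < r0 \<Longrightarrow> \<exists>z. ode_solution V U T (p + x) z"
    and A: "A \<in> carrier_mat (jet_dim TYPE('d) m) (jet_dim TYPE('d) m)"
    and jet: "\<And>j. j < jet_dim TYPE('d) m \<Longrightarrow> jet_approx \<alpha> p m (field_jet \<alpha> p V j) (\<lambda>i. A $$ (i, j))"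
    and j: "j < jet_dim TYPE('d) m"
  shows "jet_approx \<alpha> p m (\<lambda>x. jet_basis \<alpha> p j (flow_map V U T (p + x) - p)) (\<lambda>i. mat_exp A T $$ (i, j))"
proof -
  let ?r = "jet_dim TYPE('d) m"
  define E where "E s = mat_exp A (T - s)" for s
  have Ec: "E s \<in> carrier_mat ?r ?r" for s unfolding E_def by (rule mat_exp_carrier[OF A])
  have dE: "((\<lambda>s. E s $$ (i, j)) has_vector_derivative - (A * E s) $$ (i, j)) (at s within {0..T})" if i: "i < ?r" for i s
  proof -
    have "((\<lambda>s. T - s) has_vector_derivative (- 1)) (at s within {0..T})"
      by (auto intro!: derivative_eq_intros)
    from vector_diff_chain_within[OF this mat_exp_derivative[OF A i j]] show ?thesis
      by (simp add: o_def E_def)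
  qed
  have "bounded ((\<lambda>s. E s $$ (i, j)) ` {0..T})" if i: "i < ?r" for i
    by (intro compact_imp_bounded compact_continuous_image)
      (auto simp: continuous_on_eq_continuous_within intro!: has_vector_derivative_continuous[OF dE[OF i]])
  then have "\<forall>i\<in>{..<?r}. \<exists>b. \<forall>s\<in>{0..T}. cmod (E s $$ (i, j)) \<le> b" unfolding bounded_iff by simp
  from bchoice[OF this] obtain b where b: "\<And>i s. i < ?r \<Longrightarrow> s \<in> {0..T} \<Longrightarrow> cmod (E s $$ (i, j)) \<le> b i" by blast
  have "\<forall>i\<in>{..<?r}. \<exists>B. \<exists>r>0. \<forall>x. norm x < r \<longrightarrow>
      cmod (field_jet \<alpha> p V i x - (\<Sum>l<?r. A $$ (l, i) * jet_basis \<alpha> p l x)) \<le> B * norm x ^ Suc m"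
    using jet unfolding jet_approx_def by blast
  from bchoice[OF this] obtain B where "\<forall>i\<in>{..<?r}. \<exists>r>0. \<forall>x. norm x < r \<longrightarrow>
      cmod (field_jet \<alpha> p V i x - (\<Sum>l<?r. A $$ (l, i) * jet_basis \<alpha> p l x)) \<le> B i * norm x ^ Suc m" ..
  from bchoice[OF this] obtain r where "\<forall>i\<in>{..<?r}. r i > 0 \<and> (\<forall>x. norm x < r i \<longrightarrow>
      cmod (field_jet \<alpha> p V i x - (\<Sum>l<?r. A $$ (l, i) * jet_basis \<alpha> p l x)) \<le> B i * norm x ^ Suc m)" ..
  then have B: "\<And>i. i < ?r \<Longrightarrow> r i > 0" "\<And>i x. i < ?r \<Longrightarrow> norm x < r i \<Longrightarrow>
      cmod (field_jet \<alpha> p V i x - (\<Sum>l<?r. A $$ (l, i) * jet_basis \<alpha> p l x)) \<le> B i * norm x ^ Suc m"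
    by blast+
  define r1 where "r1 = Min (r ` {..<?r})"
  have "{..<?r} \<noteq> {}" using j by auto
  then have r1: "r1 > 0" "\<And>i. i < ?r \<Longrightarrow> r1 \<le> r i" using B(1) by (auto simp: r1_def)
  have sol0: "ode_solution V U T p (\<lambda>_. p)" using p by (simp add: ode_solution_def)
  obtain \<delta> M L where tube: "lipschitz_tube V U ((\<lambda>_. p) ` {0..T}) \<delta> M L"
    using ode_lipschitz_tube[OF hol sol0] by blast
  note tD = lipschitz_tubeD(1-3)[OF tube]
  \<comment> \<open>Solutions starting at p + x stay within \<eta> |x| of p up to time T, so an
    error of order |x|^(m+1) keeps this order along the whole trajectory.\<close>
  define \<eta> where "\<eta> = exp (L * T)"
  have \<eta>: "\<eta> > 0" by (simp add: \<eta>_def)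
  define \<kappa> where "\<kappa> = (\<Sum>i<?r. \<bar>B i\<bar> * \<eta> ^ Suc m * b i)"
  have main: "cmod (jet_basis \<alpha> p j (flow_map V U T (p + x) - p) - (\<Sum>i<?r. mat_exp A T $$ (i, j) * jet_basis \<alpha> p i x))
      \<le> (\<kappa> * T) * norm x ^ Suc m" if x: "norm x < min r0 (min (\<delta> / \<eta>) (r1 / \<eta>))" for x
  proof -
    obtain z where z: "ode_solution V U T (p + x) z" using sol x by auto
    define Y where "Y s = z s - p" for s
    have small: "norm x * \<eta> < \<delta>" "norm x * \<eta> < r1" using x \<eta> by (simp_all add: pos_less_divide_eq)
    have Yn: "norm (Y s) \<le> norm x * \<eta>" if s: "s \<in> {0..T}" for s
    proof -
      have "norm (z s - p) \<le> norm (p + x - p) * exp (L * s)"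
        by (rule ode_dependence[OF tube sol0 z _ s]) (use small in \<open>simp add: \<eta>_def\<close>)
      also have "\<dots> \<le> norm x * \<eta>" unfolding \<eta>_def using s tD by (intro mult_mono) auto
      finally show ?thesis by (simp add: Y_def)
    qed
    define y where "y i s = jet_basis \<alpha> p i (Y s)" for i s
    have dY: "(Y has_vector_derivative V (p + Y s)) (at s within {0..T})" if s: "s \<in> {0..T}" for s
    proof -
      have "(z has_vector_derivative V (z s)) (at s within {0..T})" using z s unfolding ode_solution_def by blast
      then have "((\<lambda>s. z s - p) has_vector_derivative V (z s) - 0) (at s within {0..T})"
        by (intro has_vector_derivative_diff has_vector_derivative_const)
      then show ?thesis by (simp add: Y_def[abs_def])
    qed
    have dy: "(y i has_vector_derivative field_jet \<alpha> p V i (Y s)) (at s within {0..T})" if s: "s \<in> {0..T}" for i s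
      using has_vector_derivative_along_curve[OF jet_basis_has_derivative dY[OF s]] unfolding y_def[abs_def] field_jet_def .
    define G where "G s = (\<Sum>i<?r. y i s * E s $$ (i, j))" for s
    define G' where "G' s = (\<Sum>i<?r. (field_jet \<alpha> p V i (Y s) - (\<Sum>l<?r. A $$ (l, i) * y l s)) * E s $$ (i, j))" for s
    have dG: "(G has_vector_derivative G' s) (at s within {0..T})" if s: "s \<in> {0..T}" for s
    proof -
      have "(G has_vector_derivative (\<Sum>i<?r. y i s * - (A * E s) $$ (i, j) + field_jet \<alpha> p V i (Y s) * E s $$ (i, j))) (at s within {0..T})"
        unfolding G_def[abs_def] by (intro has_vector_derivative_sum has_vector_derivative_mult dy[OF s] dE) simp
      moreover have "(\<Sum>i<?r. y i s * (A * E s) $$ (i, j)) = (\<Sum>i<?r. (\<Sum>l<?r. A $$ (l, i) * y l s) * E s $$ (i, j))"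
      proof -
        have "(\<Sum>i<?r. y i s * (A * E s) $$ (i, j)) = (\<Sum>i<?r. \<Sum>l<?r. y i s * (A $$ (i, l) * E s $$ (l, j)))"
          by (intro sum.cong refl) (simp add: index_mult_mat_sum[OF A Ec _ j] sum_distrib_left)
        also have "\<dots> = (\<Sum>l<?r. \<Sum>i<?r. y i s * (A $$ (i, l) * E s $$ (l, j)))" by (rule sum.swap)
        also have "\<dots> = (\<Sum>l<?r. (\<Sum>i<?r. A $$ (i, l) * y i s) * E s $$ (l, j))"
          unfolding sum_distrib_right by (intro sum.cong refl) simp
        finally show ?thesis .
      qed
      then have "(\<Sum>i<?r. y i s * - (A * E s) $$ (i, j) + field_jet \<alpha> p V i (Y s) * E s $$ (i, j)) = G' s"
        unfolding G'_def left_diff_distrib sum_subtractf sum.distrib mult_minus_right sum_negf by simp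
      ultimately show ?thesis by simp
    qed
    have G'b: "cmod (G' s) \<le> \<kappa> * norm x ^ Suc m" if s: "s \<in> {0..T}" for s
    proof -
      have "cmod (G' s) \<le> (\<Sum>i<?r. (\<bar>B i\<bar> * \<eta> ^ Suc m * b i) * norm x ^ Suc m)"
        unfolding G'_def
      proof (rule order_trans[OF norm_sum sum_mono])
        fix i assume "i \<in> {..<?r}"
        then have i: "i < ?r" by simp
        have "cmod (field_jet \<alpha> p V i (Y s) - (\<Sum>l<?r. A $$ (l, i) * y l s)) \<le> B i * norm (Y s) ^ Suc m"
          unfolding y_def by (rule B(2)[OF i]) (use Yn[OF s] small r1(2)[OF i] in linarith)
        also have "\<dots> \<le> \<bar>B i\<bar> * (norm x * \<eta>) ^ Suc m"
          using Yn[OF s] by (intro mult_mono power_mono) auto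
        finally have 1: "cmod (field_jet \<alpha> p V i (Y s) - (\<Sum>l<?r. A $$ (l, i) * y l s)) \<le> \<bar>B i\<bar> * (norm x * \<eta>) ^ Suc m" .
        have "cmod ((field_jet \<alpha> p V i (Y s) - (\<Sum>l<?r. A $$ (l, i) * y l s)) * E s $$ (i, j)) \<le> (\<bar>B i\<bar> * (norm x * \<eta>) ^ Suc m) * b i"
          unfolding norm_mult by (intro mult_mono 1 b[OF i s] order_trans[OF norm_ge_zero 1]) simp
        then show "cmod ((field_jet \<alpha> p V i (Y s) - (\<Sum>l<?r. A $$ (l, i) * y l s)) * E s $$ (i, j)) \<le> (\<bar>B i\<bar> * \<eta> ^ Suc m * b i) * norm x ^ Suc m"
          unfolding power_mult_distrib by (simp only: mult_ac)
      qed
      then show ?thesis unfolding \<kappa>_def sum_distrib_right .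
    qed
    have "cmod (G T - G 0) \<le> (\<kappa> * norm x ^ Suc m) * T"
      by (rule vector_derivative_difference_le[OF T dG G'b])
    moreover have "G T = jet_basis \<alpha> p j (flow_map V U T (p + x) - p)"
    proof -
      have "G T = (\<Sum>i<?r. y i T * (if i = j then 1 else 0))"
        unfolding G_def E_def using j by (intro sum.cong refl) (simp add: mat_exp_0[OF A])
      also have "\<dots> = y j T" using j by (simp add: mult_delta_right)
      finally show ?thesis unfolding flow_map_eq[OF hol z T] y_def Y_def .
    qed
    moreover have "G 0 = (\<Sum>i<?r. mat_exp A T $$ (i, j) * jet_basis \<alpha> p i x)"
      using z unfolding G_def E_def y_def Y_def ode_solution_def by (intro sum.cong refl) (simp add: mult.commute)
    ultimately show ?thesis by (simp only: mult_ac)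
  qed
  show ?thesis
    unfolding jet_approx_def
    by (rule exI[of _ "\<kappa> * T"], rule exI[of _ "min r0 (min (\<delta> / \<eta>) (r1 / \<eta>))"], intro conjI allI impI main)
      (use r0 tD(1) \<eta> r1 in auto)
qed


section \<open>The least-squares fit on the samples\<close>

text \<open>For v in the kernel of the Gram matrix |U v|^2 = 0, and the lower bound forces v =
  0.\<close>

lemma gram_det_nonzero:
  fixes U :: "complex mat"
  assumes U: "U \<in> carrier_mat N R"
    and low: "\<And>v. \<kappa> * (\<Sum>k<R. (cmod (v k))\<^sup>2) \<le> (\<Sum>s<N. (cmod (\<Sum>k<R. U $$ (s, k) * v k))\<^sup>2)" and \<kappa>: "\<kappa> > 0"
  shows "Determinant.det (mat_adjoint U * U) \<noteq> 0"
proof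
  let ?G = "mat_adjoint U * U"
  have aU: "mat_adjoint U \<in> carrier_mat R N" by (rule mat_adjoint_carrier[OF U])
  have G: "?G \<in> carrier_mat R R" using aU U by simp
  assume "Determinant.det ?G = 0"
  then obtain v where v: "v \<in> carrier_vec R" "v \<noteq> 0\<^sub>v R" "?G *\<^sub>v v = 0\<^sub>v R"
    using det_0_iff_vec_prod_zero[OF G] by blast
  define y where "y = (\<lambda>s. \<Sum>k<R. U $$ (s, k) * vec_index v k)"
  have Gv: "(\<Sum>s<N. cnj (U $$ (s, i)) * y s) = 0" if i: "i < R" for i
  proof -
    have "(\<Sum>s<N. cnj (U $$ (s, i)) * y s) = vec_index (mat_adjoint U *\<^sub>v (U *\<^sub>v v)) i"
      unfolding index_mult_mat_vec_sum[OF aU mult_mat_vec_carrier[OF U v(1)] i]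
      using U i by (intro sum.cong refl) (simp add: index_mult_mat_vec_sum[OF U v(1)] y_def del: index_mult_mat_vec)
    also have "mat_adjoint U *\<^sub>v (U *\<^sub>v v) = 0\<^sub>v R" using v(3) assoc_mult_mat_vec[OF aU U v(1)] by simp
    finally show ?thesis using i by simp
  qed
  have "complex_of_real (\<Sum>s<N. (cmod (y s))\<^sup>2) = (\<Sum>s<N. cnj (y s) * y s)"
    unfolding of_real_sum by (intro sum.cong refl) (simp only: complex_norm_square mult.commute)
  also have "\<dots> = (\<Sum>s<N. \<Sum>i<R. cnj (vec_index v i) * (cnj (U $$ (s, i)) * y s))"
  proof (intro sum.cong refl)
    fix s
    have "cnj (y s) = (\<Sum>i<R. cnj (vec_index v i) * cnj (U $$ (s, i)))"
      unfolding y_def cnj_sum by (intro sum.cong refl) simp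
    then show "cnj (y s) * y s = (\<Sum>i<R. cnj (vec_index v i) * (cnj (U $$ (s, i)) * y s))"
      by (simp add: sum_distrib_right mult.assoc)
  qed
  also have "\<dots> = (\<Sum>i<R. cnj (vec_index v i) * (\<Sum>s<N. cnj (U $$ (s, i)) * y s))"
    by (subst sum.swap) (simp add: sum_distrib_left)
  also have "\<dots> = 0" by (rule sum.neutral) (simp add: Gv)
  finally have "(\<Sum>s<N. (cmod (y s))\<^sup>2) = 0" by (simp only: of_real_eq_0_iff)
  then have "\<kappa> * (\<Sum>k<R. (cmod (vec_index v k))\<^sup>2) \<le> 0" using low[of "\<lambda>k. vec_index v k"] by (simp only: y_def)
  then have "(\<Sum>k<R. (cmod (vec_index v k))\<^sup>2) \<le> 0" using \<kappa> by (simp only: mult_le_0_iff) auto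
  then have "(\<Sum>k<R. (cmod (vec_index v k))\<^sup>2) = 0" by (intro order.antisym sum_nonneg) auto
  then have "\<forall>k\<in>{..<R}. (cmod (vec_index v k))\<^sup>2 = 0" by (subst (asm) sum_nonneg_eq_0_iff) auto
  then have "v = 0\<^sub>v R" using v(1) by (intro eq_vecI) auto
  then show False using v(2) by simp
qed

text \<open>The conjugated j-th row of the matrix behind \<open>C_hat\<close> is the least-squares
  solution for the j-th column of \<open>Y\<close>. Multiplying by the Gram matrix removes the
  pseudo-inverse, by \<open>moore_penrose_full_row_rank\<close> for the adjoint of
  \<open>U\<close>.\<close>

lemma least_squares_normal_equations:
  fixes U Y :: "complex mat"
  assumes U: "U \<in> carrier_mat N R" and Y: "Y \<in> carrier_mat N r" and det: "Determinant.det (mat_adjoint U * U) \<noteq> 0"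
    and i: "i < R" and j: "j < r"
  shows "(\<Sum>s<N. cnj (U $$ (s, i)) * (\<Sum>k<R. U $$ (s, k) * cnj ((mat_adjoint Y * moore_penrose (mat_adjoint U)) $$ (j, k)))) =
    (\<Sum>s<N. cnj (U $$ (s, i)) * Y $$ (s, j))"
proof -
  let ?G = "mat_adjoint U * U"
  let ?Q = "mat_adjoint Y * moore_penrose (mat_adjoint U)"
  have aU: "mat_adjoint U \<in> carrier_mat R N" and aY: "mat_adjoint Y \<in> carrier_mat r N"
    by (rule mat_adjoint_carrier[OF U], rule mat_adjoint_carrier[OF Y])
  have G: "?G \<in> carrier_mat R R" using aU U by simp
  note mp = moore_penrose_full_row_rank[OF aU, unfolded mat_adjoint_adjoint, OF det]
  have Q: "?Q \<in> carrier_mat r R" using aY mp(1) by simp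
  have "?Q * ?G = mat_adjoint Y * (moore_penrose (mat_adjoint U) * ?G)" by (rule assoc_mult_mat[OF aY mp(1) G])
  then have eq: "?Q * ?G = mat_adjoint Y * U" unfolding mp(2) .
  have Gki: "cnj (?G $$ (k, i)) = (\<Sum>s<N. U $$ (s, k) * cnj (U $$ (s, i)))" if k: "k < R" for k
    unfolding index_mult_mat_sum[OF aU U k i] cnj_sum using U k by (intro sum.cong refl) simp
  have "(\<Sum>s<N. cnj (U $$ (s, i)) * (\<Sum>k<R. U $$ (s, k) * cnj (?Q $$ (j, k)))) =
      (\<Sum>s<N. \<Sum>k<R. cnj (?Q $$ (j, k)) * (U $$ (s, k) * cnj (U $$ (s, i))))"
    unfolding sum_distrib_left by (intro sum.cong refl) (simp only: mult_ac)
  also have "\<dots> = (\<Sum>k<R. cnj (?Q $$ (j, k)) * (\<Sum>s<N. U $$ (s, k) * cnj (U $$ (s, i))))"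
    by (subst sum.swap) (simp add: sum_distrib_left)
  also have "\<dots> = (\<Sum>k<R. cnj (?Q $$ (j, k)) * cnj (?G $$ (k, i)))"
    by (intro sum.cong refl) (simp only: Gki lessThan_iff)
  also have "\<dots> = cnj ((?Q * ?G) $$ (j, i))"
    unfolding index_mult_mat_sum[OF Q G j i] cnj_sum complex_cnj_mult ..
  also have "\<dots> = (\<Sum>s<N. cnj (U $$ (s, i)) * Y $$ (s, j))"
    unfolding eq index_mult_mat_sum[OF aY U j i] cnj_sum using Y j by (intro sum.cong refl) simp
  finally show ?thesis .
qed

text \<open>The difference between the fitted coefficients and \<open>b\<close> solves the normal
  equations with the remainder as data, so \<open>least_squares_error\<close> applies. The scales of
  the basis functions are absorbed into the unknowns; the bound thus involves only the scale of the
  index i and not the smallest scale up to order n, which would spoil the rate.\<close>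

lemma pseudo_inverse_fit_error:
  fixes x :: "nat \<Rightarrow> complex ^ 'd" and f :: "complex ^ 'd \<Rightarrow> complex ^ 'd" and b :: "nat \<Rightarrow> complex"
  assumes low: "\<And>v. real N * l * (\<Sum>k<jet_dim TYPE('d) n. (cmod (v k))\<^sup>2)
        \<le> (\<Sum>s=1..N. (cmod (\<Sum>k<jet_dim TYPE('d) n. monomial_fun (\<alpha> (k + 1)) (x s) * v k))\<^sup>2)"
    and pos: "N > 0" "l > 0" "\<kappa> > 0"
    and w: "\<And>s. s \<ge> 1 \<Longrightarrow> \<kappa> \<le> cmod (jet_weight p (x s))"
    and rem: "\<And>s. s \<ge> 1 \<Longrightarrow> cmod (jet_basis \<alpha> p j (f (p + x s) - p) - (\<Sum>k<jet_dim TYPE('d) n. b k * jet_basis \<alpha> p k (x s))) \<le> \<epsilon>"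
    and j: "j < jet_dim TYPE('d) m" and i: "i < jet_dim TYPE('d) n"
  shows "cmod ((mat_adjoint (U_mat \<alpha> p m N (\<lambda>s. f (p + x s))) * moore_penrose (mat_adjoint (U_mat \<alpha> p n N (\<lambda>s. p + x s)))) $$ (j, i) - cnj (b i))
    \<le> \<epsilon> / (cmod (jet_scale \<alpha> p i) * (\<kappa> * sqrt l))"
proof -
  let ?R = "jet_dim TYPE('d) n"
  let ?U = "U_mat \<alpha> p n N (\<lambda>s. p + x s)"
  let ?Y = "U_mat \<alpha> p m N (\<lambda>s. f (p + x s))"
  let ?Q = "mat_adjoint ?Y * moore_penrose (mat_adjoint ?U)"
  have U: "?U \<in> carrier_mat N ?R" and Y: "?Y \<in> carrier_mat N (jet_dim TYPE('d) m)" by (simp_all add: U_mat_def)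
  have Ui: "?U $$ (s, k) = jet_basis \<alpha> p k (x (Suc s))" if "s < N" "k < ?R" for s k
    using that by (simp add: U_mat_def jet_basis_def)
  have Yi: "?Y $$ (s, j) = jet_basis \<alpha> p j (f (p + x (Suc s)) - p)" if "s < N" for s
    using that j by (simp add: U_mat_def jet_basis_def)
  define W where "W s k = monomial_fun (\<alpha> (k + 1)) (x (Suc s)) * jet_weight p (x (Suc s))" for s k
  have UW: "jet_basis \<alpha> p k (x (Suc s)) = jet_scale \<alpha> p k * W s k" for s k by (simp add: jet_basis_eq W_def)
  have lowW: "real N * (\<kappa>\<^sup>2 * l) * (\<Sum>k<?R. (cmod (v k))\<^sup>2) \<le> (\<Sum>s<N. (cmod (\<Sum>k<?R. W s k * v k))\<^sup>2)" for v
  proof -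
    let ?S = "\<lambda>s. \<Sum>k<?R. monomial_fun (\<alpha> (k + 1)) (x (Suc s)) * v k"
    have "\<kappa>\<^sup>2 * (real N * l * (\<Sum>k<?R. (cmod (v k))\<^sup>2)) \<le> \<kappa>\<^sup>2 * (\<Sum>s=1..N. (cmod (\<Sum>k<?R. monomial_fun (\<alpha> (k + 1)) (x s) * v k))\<^sup>2)"
      by (intro mult_left_mono low) simp
    also have "\<dots> = (\<Sum>s<N. \<kappa>\<^sup>2 * (cmod (?S s))\<^sup>2)" by (simp add: sum.atLeast1_atMost_eq sum_distrib_left)
    also have "\<dots> \<le> (\<Sum>s<N. (cmod (\<Sum>k<?R. W s k * v k))\<^sup>2)"
    proof (rule sum_mono)
      fix s
      have "(\<Sum>k<?R. W s k * v k) = jet_weight p (x (Suc s)) * ?S s"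
        unfolding sum_distrib_left W_def by (intro sum.cong refl) (simp only: mult_ac)
      then have "(cmod (\<Sum>k<?R. W s k * v k))\<^sup>2 = (cmod (jet_weight p (x (Suc s))))\<^sup>2 * (cmod (?S s))\<^sup>2"
        by (simp add: norm_mult power_mult_distrib)
      then show "\<kappa>\<^sup>2 * (cmod (?S s))\<^sup>2 \<le> (cmod (\<Sum>k<?R. W s k * v k))\<^sup>2"
        using w[of "Suc s"] pos(3) by (simp add: mult_right_mono power_mono)
    qed
    finally show ?thesis by (simp only: mult_ac)
  qed
  have scale: "(\<Sum>k<?R. ?U $$ (s, k) * v k) = (\<Sum>k<?R. W s k * (jet_scale \<alpha> p k * v k))" if s: "s < N" for s v
    by (intro sum.cong refl) (simp add: Ui[OF s] UW)
  \<comment> \<open>This constant depends on n, but it serves only to show that the Gram matrix is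
    invertible and does not enter the estimate.\<close>
  obtain c where c: "c > 0" "\<And>k. k < ?R \<Longrightarrow> c \<le> (cmod (jet_scale \<alpha> p k))\<^sup>2"
  proof
    let ?A = "(\<lambda>k. (cmod (jet_scale \<alpha> p k))\<^sup>2) ` {..<?R}"
    show "Min ?A > 0" using i by (subst Min_gr_iff) (auto simp: jet_scale_nonzero)
    show "Min ?A \<le> (cmod (jet_scale \<alpha> p k))\<^sup>2" if "k < ?R" for k using that by (intro Min_le) auto
  qed
  have det: "Determinant.det (mat_adjoint ?U * ?U) \<noteq> 0"
  proof (rule gram_det_nonzero[OF U])
    show "real N * (\<kappa>\<^sup>2 * l) * c > 0" using pos c by simp
    show "real N * (\<kappa>\<^sup>2 * l) * c * (\<Sum>k<?R. (cmod (v k))\<^sup>2) \<le> (\<Sum>s<N. (cmod (\<Sum>k<?R. ?U $$ (s, k) * v k))\<^sup>2)" for v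
    proof -
      have "c * (\<Sum>k<?R. (cmod (v k))\<^sup>2) \<le> (\<Sum>k<?R. (cmod (jet_scale \<alpha> p k * v k))\<^sup>2)"
        unfolding sum_distrib_left by (intro sum_mono) (simp add: norm_mult power_mult_distrib mult_right_mono c)
      then have "real N * (\<kappa>\<^sup>2 * l) * (c * (\<Sum>k<?R. (cmod (v k))\<^sup>2)) \<le> real N * (\<kappa>\<^sup>2 * l) * (\<Sum>k<?R. (cmod (jet_scale \<alpha> p k * v k))\<^sup>2)"
        using pos by (intro mult_left_mono) auto
      also have "\<dots> \<le> (\<Sum>s<N. (cmod (\<Sum>k<?R. W s k * (jet_scale \<alpha> p k * v k)))\<^sup>2)" by (rule lowW)
      also have "\<dots> = (\<Sum>s<N. (cmod (\<Sum>k<?R. ?U $$ (s, k) * v k))\<^sup>2)" by (intro sum.cong refl) (simp only: scale lessThan_iff)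
      finally show ?thesis by (simp only: mult.assoc)
    qed
  qed
  define \<delta> where "\<delta> k = cnj (?Q $$ (j, k)) - b k" for k
  define rho where "rho s = jet_basis \<alpha> p j (f (p + x (Suc s)) - p) - (\<Sum>k<?R. b k * jet_basis \<alpha> p k (x (Suc s)))" for s
  have "cmod (jet_scale \<alpha> p i * \<delta> i) \<le> \<epsilon> / sqrt (\<kappa>\<^sup>2 * l)"
  proof (rule least_squares_error[where U = W and N = N and r = ?R and \<rho> = rho and a = "\<lambda>k. jet_scale \<alpha> p k * \<delta> k"])
    fix q assume q: "q < ?R"
    have "(\<Sum>s<N. cnj (?U $$ (s, q)) * (\<Sum>k<?R. ?U $$ (s, k) * \<delta> k)) =
        (\<Sum>s<N. cnj (?U $$ (s, q)) * (\<Sum>k<?R. ?U $$ (s, k) * cnj (?Q $$ (j, k)))) -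
        (\<Sum>s<N. cnj (?U $$ (s, q)) * (\<Sum>k<?R. ?U $$ (s, k) * b k))"
      unfolding \<delta>_def right_diff_distrib sum_subtractf ..
    also have "\<dots> = (\<Sum>s<N. cnj (?U $$ (s, q)) * ?Y $$ (s, j)) - (\<Sum>s<N. cnj (?U $$ (s, q)) * (\<Sum>k<?R. ?U $$ (s, k) * b k))"
      unfolding least_squares_normal_equations[OF U Y det q j] ..
    also have "\<dots> = (\<Sum>s<N. cnj (?U $$ (s, q)) * rho s)"
      unfolding sum_subtractf[symmetric] right_diff_distrib[symmetric]
      by (intro sum.cong refl) (simp add: Ui Yi rho_def mult.commute)
    finally have "(\<Sum>s<N. cnj (jet_scale \<alpha> p q * W s q) * (\<Sum>k<?R. W s k * (jet_scale \<alpha> p k * \<delta> k))) =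
        (\<Sum>s<N. cnj (jet_scale \<alpha> p q * W s q) * rho s)"
      by (simp add: scale Ui[OF _ q] UW)
    then have "cnj (jet_scale \<alpha> p q) * (\<Sum>s<N. cnj (W s q) * (\<Sum>k<?R. W s k * (jet_scale \<alpha> p k * \<delta> k))) =
        cnj (jet_scale \<alpha> p q) * (\<Sum>s<N. cnj (W s q) * rho s)"
      unfolding sum_distrib_left complex_cnj_mult mult.assoc .
    then show "(\<Sum>s<N. cnj (W s q) * (\<Sum>k<?R. W s k * (jet_scale \<alpha> p k * \<delta> k))) = (\<Sum>s<N. cnj (W s q) * rho s)"
      using jet_scale_nonzero[of \<alpha> p q] by (simp only: mult_cancel_left complex_cnj_zero_iff) blast
  next
    show "cmod (rho s) \<le> \<epsilon>" if "s < N" for s unfolding rho_def by (rule rem) simp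
  next
    show "real N * (\<kappa>\<^sup>2 * l) * (\<Sum>k<?R. (cmod (jet_scale \<alpha> p k * \<delta> k))\<^sup>2) \<le> (\<Sum>s<N. (cmod (\<Sum>k<?R. W s k * (jet_scale \<alpha> p k * \<delta> k)))\<^sup>2)"
      by (rule lowW)
  qed (use pos i in auto)
  moreover have "cmod (?Q $$ (j, i) - cnj (b i)) = cmod (\<delta> i)"
  proof -
    have "?Q $$ (j, i) - cnj (b i) = cnj (\<delta> i)" by (simp add: \<delta>_def)
    then show ?thesis by (simp only: complex_mod_cnj)
  qed
  moreover have "sqrt (\<kappa>\<^sup>2 * l) = \<kappa> * sqrt l" using pos by (simp add: real_sqrt_mult)
  ultimately have "cmod (jet_scale \<alpha> p i) * cmod (?Q $$ (j, i) - cnj (b i)) \<le> \<epsilon> / (\<kappa> * sqrt l)" by (simp only: norm_mult)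
  then have "cmod (?Q $$ (j, i) - cnj (b i)) \<le> \<epsilon> / (\<kappa> * sqrt l) / cmod (jet_scale \<alpha> p i)"
    using jet_scale_nonzero[of \<alpha> p i] by (subst pos_le_divide_eq) (simp_all add: mult.commute)
  then show ?thesis by (simp add: mult.commute)
qed


section \<open>The generator matrix, and the vector field determined by its flow\<close>

lemma jet_approx_cong:
  assumes "jet_approx \<alpha> p n h c" "\<And>i. i < jet_dim TYPE('d) n \<Longrightarrow> c i = d i"
  shows "jet_approx \<alpha> p n (h :: complex ^ 'd \<Rightarrow> complex) d"
proof -
  have "(\<Sum>i<jet_dim TYPE('d) n. c i * jet_basis \<alpha> p i x) = (\<Sum>i<jet_dim TYPE('d) n. d i * jet_basis \<alpha> p i x)" for x
    by (intro sum.cong refl) (simp add: assms(2))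
  then show ?thesis using assms(1) unfolding jet_approx_def by simp
qed

text \<open>Links the eigenvalue hypothesis, stated for the matrix of partial derivatives, to the
  Frechet derivative used on jets.\<close>

lemma jacobian_matrix_apply:
  fixes V :: "complex ^ 'd \<Rightarrow> complex ^ 'd"
  assumes D: "(V has_derivative D) (at p)" "\<And>c v. D (c *s v) = c *s D v"
  shows "jacobian_matrix V p *v v = D v"
proof -
  have j: "deriv (\<lambda>t. V (p + axis j t) $ i) 0 = D (axis j 1) $ i" for i j
  proof -
    have "(V has_derivative D) (at (p + 0 *s axis j 1))" using D(1) by simp
    from holomorphic_map_line_derivative[OF this D(2), of i]
    have "((\<lambda>t. V (p + t *s axis j 1) $ i) has_field_derivative D (axis j 1) $ i) (at 0)" .
    moreover have "t *s axis j 1 = axis j t" for t :: complex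
      by (simp add: Finite_Cartesian_Product.vec_eq_iff axis_def)
    ultimately show ?thesis by (simp add: DERIV_imp_deriv)
  qed
  have "D v = D (\<Sum>j\<in>UNIV. (v $ j) *s axis j 1)" by (simp only: basis_expansion)
  also have "\<dots> = (\<Sum>j\<in>UNIV. (v $ j) *s D (axis j 1))"
    by (simp only: linear_sum[OF has_derivative_linear[OF D(1)]] D(2))
  finally have Dv: "D v $ i = (\<Sum>j\<in>UNIV. v $ j * D (axis j 1) $ i)" for i by simp
  show ?thesis
    unfolding Finite_Cartesian_Product.vec_eq_iff
    by (simp add: Dv matrix_vector_mult_def jacobian_matrix_def j mult.commute)
qed

text \<open>Entry (i, j) is the i-th jet coefficient of the generator applied to the j-th basis
  function. It is chosen for all orders at once, independently of m.\<close>

definition generator_coeff ::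
  "(nat \<Rightarrow> nat ^ 'd) \<Rightarrow> complex ^ 'd \<Rightarrow> (complex ^ 'd \<Rightarrow> complex ^ 'd) \<Rightarrow> nat \<Rightarrow> nat \<Rightarrow> complex" where
  "generator_coeff \<alpha> p V = (SOME A. \<forall>m j. jet_approx \<alpha> p m (field_jet \<alpha> p V j) (\<lambda>i. A i j))"

definition generator_matrix ::
  "(nat \<Rightarrow> nat ^ 'd) \<Rightarrow> complex ^ 'd \<Rightarrow> (complex ^ 'd \<Rightarrow> complex ^ 'd) \<Rightarrow> nat \<Rightarrow> complex mat" where
  "generator_matrix \<alpha> p V m = Matrix.mat (jet_dim TYPE('d) m) (jet_dim TYPE('d) m) (\<lambda>(i, j). generator_coeff \<alpha> p V i j)"

text \<open>The generator applied to the combination of basis functions that reproduces the k-th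
  coordinate. It is the limit of the estimator and, by \<open>field_component_jet\<close>, the m-jet
  of V_k.\<close>

definition field_sum ::
  "(nat \<Rightarrow> nat ^ 'd) \<Rightarrow> complex ^ 'd \<Rightarrow> (complex ^ 'd \<Rightarrow> complex ^ 'd) \<Rightarrow> nat \<Rightarrow> 'd \<Rightarrow> complex ^ 'd \<Rightarrow> complex" where
  "field_sum \<alpha> p V m k x = (\<Sum>i<jet_dim TYPE('d) m.
     (\<Sum>j<jet_dim TYPE('d) m. cnj (jet_grad \<alpha> p j k (- p)) * generator_coeff \<alpha> p V i j) * jet_basis \<alpha> p i x)"

lemma generator_matrix_carrier:
  fixes V :: "complex ^ 'd \<Rightarrow> complex ^ 'd"
  shows "generator_matrix \<alpha> p V m \<in> carrier_mat (jet_dim TYPE('d) m) (jet_dim TYPE('d) m)"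
  by (simp add: generator_matrix_def)

text \<open>The hypotheses on V and its flow, separated from the measure and the samples, so that
  two fields with the same time-T map can be compared by interpreting the locale twice.\<close>

locale flow_setup =
  fixes e :: "nat \<Rightarrow> 'd::finite" and \<alpha> :: "nat \<Rightarrow> nat ^ 'd" and K0 :: "(complex ^ 'd) set"
    and p :: "complex ^ 'd" and U :: "(complex ^ 'd) set" and V :: "complex ^ 'd \<Rightarrow> complex ^ 'd" and T :: real
  assumes num: "graded_numbering e \<alpha>"
    and K0: "compact K0" "absolutely_convex K0" "0 \<in> interior K0"
    and U: "open U" "\<And>x. x \<in> K0 \<Longrightarrow> p + x \<in> U"
    and hol: "holomorphic_map_on V U" and Vp: "V p = 0"
    and real_ev: "\<And>c v. v \<noteq> 0 \<Longrightarrow> jacobian_matrix V p *v v = c *s v \<Longrightarrow> c \<in> \<real>"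
    and T: "T > 0" and sol: "\<And>x. x \<in> K0 \<Longrightarrow> \<exists>z. ode_solution V U T (p + x) z"
begin

lemma interior_K0: "x \<in> interior K0 \<Longrightarrow> x \<in> K0"
  using interior_subset by blast

lemma base_point: "p \<in> U"
  using U(2)[OF interior_K0[OF K0(3)]] by simp

lemma ball_in_K0: "\<exists>r>0. \<forall>x. norm x < r \<longrightarrow> x \<in> K0"
proof -
  obtain r where "r > 0" "ball 0 r \<subseteq> K0" using K0(3) mem_interior by blast
  then show ?thesis by (intro exI[of _ r]) auto
qed

lemma generator_jet: "jet_approx \<alpha> p m (field_jet \<alpha> p V j) (\<lambda>i. generator_coeff \<alpha> p V i j)"
  using someI_ex[OF field_jet_matrix_exists[OF num hol U(1) base_point]] unfolding generator_coeff_def by blast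

lemma generator_matrix_jet:
  assumes "j < jet_dim TYPE('d) m"
  shows "jet_approx \<alpha> p m (field_jet \<alpha> p V j) (\<lambda>i. generator_matrix \<alpha> p V m $$ (i, j))"
  by (rule jet_approx_cong[OF generator_jet]) (simp add: generator_matrix_def assms)

lemma generator_eigenvalue_real:
  assumes "eigenvalue (generator_matrix \<alpha> p V m) \<nu>"
  shows "\<nu> \<in> \<real>"
proof -
  obtain D where D: "(V has_derivative D) (at p)" "\<And>c v. D (c *s v) = c *s D v"
    using hol base_point unfolding holomorphic_map_on_def by blast
  have cl: "complex_linear D" unfolding complex_linear_def using D has_derivative_bounded_linear by blast
  have ev: "c \<in> \<real>" if "v \<noteq> 0" "D v = c *s v" for c v
    by (rule real_ev[OF that(1)]) (simp only: jacobian_matrix_apply[OF D] that(2))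
  show ?thesis
    by (rule field_jet_matrix_eigenvalue_real[OF num D(1) Vp cl ev generator_matrix_carrier generator_matrix_jet assms])
qed

lemma generator_adjoint_eigenvalue_real:
  assumes "eigenvalue (mat_adjoint (generator_matrix \<alpha> p V m)) \<nu>"
  shows "\<nu> \<in> \<real>"
  using generator_eigenvalue_real[OF eigenvalue_mat_adjoint[OF generator_matrix_carrier assms]]
  by (simp only: Reals_cnj_iff complex_cnj_cnj) 

lemma flow_jet:
  assumes "j < jet_dim TYPE('d) m"
  shows "jet_approx \<alpha> p m (\<lambda>x. jet_basis \<alpha> p j (flow_map V U T (p + x) - p)) (\<lambda>i. mat_exp (generator_matrix \<alpha> p V m) T $$ (i, j))"
proof -
  obtain r where r: "r > 0" "\<And>x. norm x < r \<Longrightarrow> x \<in> K0" using ball_in_K0 by blast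
  show ?thesis
    by (rule flow_pullback_jet[OF hol U(1) base_point Vp less_imp_le[OF T] r(1) sol[OF r(2)] generator_matrix_carrier generator_matrix_jet assms])
qed

text \<open>The exact counterpart of \<open>A_hat\<close>: the matrix it approximates, up to the
  factor T.\<close>

lemma principal_log_koopman:
  "principal_log (mat_adjoint (mat_exp (generator_matrix \<alpha> p V m) T)) = of_real T \<cdot>\<^sub>m mat_adjoint (generator_matrix \<alpha> p V m)"
  unfolding mat_exp_adjoint[OF generator_matrix_carrier, symmetric]
  by (rule principal_log_mat_exp[OF mat_adjoint_carrier[OF generator_matrix_carrier] generator_adjoint_eigenvalue_real less_imp_le[OF T]])

lemma field_bounded: "\<exists>M\<ge>0. \<forall>x\<in>K0. norm (V (p + x)) \<le> M"
proof -
  have "continuous_on K0 (\<lambda>x. V (p + x))"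
    by (rule continuous_on_compose2[OF holomorphic_map_continuous[OF hol]]) (use U(2) in \<open>auto intro!: continuous_intros\<close>)
  then have "bounded ((\<lambda>x. V (p + x)) ` K0)" by (intro compact_imp_bounded compact_continuous_image K0)
  then show ?thesis unfolding bounded_pos by (auto intro: less_imp_le)
qed

text \<open>V_k has a global expansion with geometric remainder, and by uniqueness of jets its
  coefficients are those of \<open>field_sum\<close>.\<close>

lemma field_remainder:
  assumes M: "\<And>x. x \<in> interior K0 \<Longrightarrow> norm (V (p + x)) \<le> M"
    and w: "\<And>x. x \<in> K0 \<Longrightarrow> cmod (jet_weight p x) \<le> Bw \<and> cmod (1 / jet_weight p x) \<le> Bw"
    and x: "minkowski_norm K0 x \<le> q" "q < 1"
  shows "cmod (V (p + x) $ k - field_sum \<alpha> p V m k x) \<le> M * Bw * Bw * q ^ Suc m / (1 - q)"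
proof -
  have "line_holomorphic (\<lambda>x. V (p + 1 *s x) $ k) (interior K0)"
    by (rule line_holomorphic_affine[OF holomorphic_map_imp_line_holomorphic[OF hol U(1), of k]])
      (use U(2) interior_K0 in simp)
  then have h: "line_holomorphic (\<lambda>x. V (p + x) $ k) (interior K0)" by simp
  have "\<exists>c. (\<forall>n. jet_approx \<alpha> p n (\<lambda>x. V (p + x) $ k) c) \<and> (\<forall>n x q. minkowski_norm K0 x \<le> q \<longrightarrow> q < 1 \<longrightarrow>
    cmod (V (p + x) $ k - (\<Sum>i<jet_dim TYPE('d) n. c i * jet_basis \<alpha> p i x)) \<le> M * Bw * Bw * q ^ Suc n / (1 - q))"
    by (rule global_jet_expansion[OF num K0(2,3) h order_trans[OF component_le_norm M] w])
  then obtain c where c: "\<And>n. jet_approx \<alpha> p n (\<lambda>x. V (p + x) $ k) c"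
    "\<And>n x q. minkowski_norm K0 x \<le> q \<Longrightarrow> q < 1 \<Longrightarrow>
      cmod (V (p + x) $ k - (\<Sum>i<jet_dim TYPE('d) n. c i * jet_basis \<alpha> p i x)) \<le> M * Bw * Bw * q ^ Suc n / (1 - q)"
    by blast
  note d = field_component_jet[OF num hol U(1) base_point Vp generator_jet]
  have "c i = (\<Sum>j<jet_dim TYPE('d) m. cnj (jet_grad \<alpha> p j k (- p)) * generator_coeff \<alpha> p V i j)" if i: "i < jet_dim TYPE('d) m" for i
    by (rule jet_approx_unique[OF num c(1) d i])
  then have "field_sum \<alpha> p V m k x = (\<Sum>i<jet_dim TYPE('d) m. c i * jet_basis \<alpha> p i x)"
    unfolding field_sum_def by (intro sum.cong refl) simp
  then show ?thesis using c(2)[OF x, of m] by (simp only:)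
qed

end

text \<open>The flow determines the matrices of the Koopman operator on jets, their logarithms, and thus the
  Taylor polynomials of the vector field.\<close>

lemma flow_determines_field_sum:
  fixes V W :: "complex ^ 'd \<Rightarrow> complex ^ 'd"
  assumes "flow_setup e \<alpha> K0 p U V T" "flow_setup e \<alpha> K0 p U' W T"
    and eq: "\<And>x. x \<in> K0 \<Longrightarrow> flow_map V U T (p + x) = flow_map W U' T (p + x)"
  shows "field_sum \<alpha> p V m k x = field_sum \<alpha> p W m k x"
proof -
  interpret A: flow_setup e \<alpha> K0 p U V T by fact
  interpret B: flow_setup e \<alpha> K0 p U' W T by fact
  let ?r = "jet_dim TYPE('d) m"
  let ?A = "generator_matrix \<alpha> p V m" and ?B = "generator_matrix \<alpha> p W m"
  obtain r where r: "r > 0" "\<And>x. norm x < r \<Longrightarrow> x \<in> K0" using A.ball_in_K0 by blast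
  have E: "mat_exp ?A T $$ (i, j) = mat_exp ?B T $$ (i, j)" if "i < ?r" "j < ?r" for i j
  proof -
    have "jet_approx \<alpha> p m (\<lambda>x. jet_basis \<alpha> p j (flow_map W U' T (p + x) - p)) (\<lambda>i. mat_exp ?A T $$ (i, j))"
      by (rule jet_approx_transfer[OF A.flow_jet[OF that(2)] r(1), of _ 0]) (simp add: eq[OF r(2)])
    from jet_approx_unique[OF A.num this B.flow_jet[OF that(2)] that(1)] show ?thesis .
  qed
  have "mat_exp ?A T = mat_exp ?B T"
    using mat_exp_carrier[OF generator_matrix_carrier[of \<alpha> p V m], of T] mat_exp_carrier[OF generator_matrix_carrier[of \<alpha> p W m], of T]
    by (intro eq_matI) (auto simp: E carrier_matD[OF generator_matrix_carrier])
  then have "of_real T \<cdot>\<^sub>m mat_adjoint ?A = of_real T \<cdot>\<^sub>m mat_adjoint ?B"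
    unfolding A.principal_log_koopman[symmetric] B.principal_log_koopman[symmetric] by (rule arg_cong)
  then have l: "(of_real T \<cdot>\<^sub>m mat_adjoint ?A) $$ (j, i) = (of_real T \<cdot>\<^sub>m mat_adjoint ?B) $$ (j, i)" for i j by (rule arg_cong)
  have "generator_coeff \<alpha> p V i j = generator_coeff \<alpha> p W i j" if "i < ?r" "j < ?r" for i j
    using l[of j i] that A.T by (simp add: generator_matrix_def)
  then show ?thesis unfolding field_sum_def by (intro sum.cong refl arg_cong2[where f = "(*)"]) simp_all
qed

text \<open>The constant has to be chosen from f alone. Fix one field V with time-T map f. Any other
  such field W has the same \<open>field_sum\<close> for every m, and on the interior both fields
  are the limits of these sums, so W = V there and the bound of V serves W. If no such field exists,
  any constant will do.\<close>

lemma field_remainder_uniform: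
  fixes f :: "complex ^ 'd \<Rightarrow> complex ^ 'd"
  shows "\<exists>c\<ge>0. \<forall>U V. flow_setup e \<alpha> K0 p U V T \<longrightarrow> (\<forall>x\<in>K0. flow_map V U T (p + x) = f (p + x)) \<longrightarrow>
    (\<forall>m k x q. minkowski_norm K0 x \<le> q \<longrightarrow> q < 1 \<longrightarrow> cmod (V (p + x) $ k - field_sum \<alpha> p V m k x) \<le> c * q ^ Suc m / (1 - q))"
proof (cases "\<exists>U V. flow_setup e \<alpha> K0 p U V T \<and> (\<forall>x\<in>K0. flow_map V U T (p + x) = f (p + x))")
  case False
  then show ?thesis by (intro exI[of _ 0]) auto
next
  case True
  then obtain U V where V: "flow_setup e \<alpha> K0 p U V T" "\<And>x. x \<in> K0 \<Longrightarrow> flow_map V U T (p + x) = f (p + x)" by blast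
  interpret A: flow_setup e \<alpha> K0 p U V T by fact
  obtain M where M: "M \<ge> 0" "\<And>x. x \<in> K0 \<Longrightarrow> norm (V (p + x)) \<le> M" using A.field_bounded by blast
  obtain Bw where Bw: "Bw \<ge> 1" "\<And>x. x \<in> K0 \<Longrightarrow> cmod (jet_weight p x) \<le> Bw \<and> cmod (1 / jet_weight p x) \<le> Bw"
    using jet_weight_bounds[OF compact_imp_bounded[OF A.K0(1)]] by blast
  have "cmod (W (p + x) $ k - field_sum \<alpha> p W m k x) \<le> M * Bw * Bw * q ^ Suc m / (1 - q)"
    if W: "flow_setup e \<alpha> K0 p U' W T" "\<And>x. x \<in> K0 \<Longrightarrow> flow_map W U' T (p + x) = f (p + x)"
      and x: "minkowski_norm K0 x \<le> q" "q < 1" for U' W m k x q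
  proof -
    interpret B: flow_setup e \<alpha> K0 p U' W T by fact
    obtain M' where M': "M' \<ge> 0" "\<And>x. x \<in> K0 \<Longrightarrow> norm (W (p + x)) \<le> M'" using B.field_bounded by blast
    have fs: "field_sum \<alpha> p V m k x = field_sum \<alpha> p W m k x" for m k x
      by (rule flow_determines_field_sum[OF V(1) W(1)]) (simp add: V(2) W(2))
    have same: "V (p + y) $ l = W (p + y) $ l" if y: "y \<in> interior K0" for y l
    proof -
      let ?q = "gauge_radius K0 {y}"
      have q: "minkowski_norm K0 y \<le> ?q" "?q < 1" "?q \<ge> 0"
        using gauge_radius_compact_subset[OF A.K0(3), of "{y}"] y by auto
      have le: "cmod (V (p + y) $ l - W (p + y) $ l) \<le> (M * Bw * Bw / (1 - ?q) + M' * Bw * Bw / (1 - ?q)) * ?q ^ Suc n" for n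
      proof -
        have "cmod (V (p + y) $ l - field_sum \<alpha> p V n l y) \<le> M * Bw * Bw * ?q ^ Suc n / (1 - ?q)"
          by (rule A.field_remainder[OF M(2)[OF A.interior_K0] Bw(2) q(1,2)])
        moreover have "cmod (W (p + y) $ l - field_sum \<alpha> p W n l y) \<le> M' * Bw * Bw * ?q ^ Suc n / (1 - ?q)"
          by (rule B.field_remainder[OF M'(2)[OF A.interior_K0] Bw(2) q(1,2)])
        ultimately have "cmod (V (p + y) $ l - W (p + y) $ l) \<le> M * Bw * Bw * ?q ^ Suc n / (1 - ?q) + M' * Bw * Bw * ?q ^ Suc n / (1 - ?q)"
          using norm_triangle_ineq4[of "V (p + y) $ l - field_sum \<alpha> p V n l y" "W (p + y) $ l - field_sum \<alpha> p W n l y"]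
          unfolding fs by simp
        then show ?thesis by (simp only: distrib_right times_divide_eq_left)
      qed
      have "(\<lambda>n. (M * Bw * Bw / (1 - ?q) + M' * Bw * Bw / (1 - ?q)) * ?q ^ Suc n) \<longlonglongrightarrow>
          (M * Bw * Bw / (1 - ?q) + M' * Bw * Bw / (1 - ?q)) * 0"
        by (intro tendsto_mult tendsto_const LIMSEQ_Suc[OF LIMSEQ_realpow_zero] q)
      then have "cmod (V (p + y) $ l - W (p + y) $ l) \<le> (M * Bw * Bw / (1 - ?q) + M' * Bw * Bw / (1 - ?q)) * 0"
        by (rule LIMSEQ_le_const) (use le in blast)
      then show ?thesis by simp
    qed
    have "norm (W (p + y)) \<le> M" if y: "y \<in> interior K0" for y
    proof -
      have "V (p + y) = W (p + y)" using same[OF y] by (simp add: Finite_Cartesian_Product.vec_eq_iff)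
      then show ?thesis using M(2)[OF A.interior_K0[OF y]] by simp
    qed
    from B.field_remainder[OF this Bw(2) x] show ?thesis .
  qed
  then show ?thesis using M(1) Bw(1) by (intro exI[of _ "M * Bw * Bw"] conjI allI impI) auto
qed


section \<open>Convergence of the Koopman matrix, of its logarithm and of the estimator\<close>

lemma line_holomorphic_cong:
  assumes "line_holomorphic h W" "\<And>x. x \<in> W \<Longrightarrow> h x = h' x"
  shows "line_holomorphic h' W"
proof -
  have c: "continuous_on W h" "(\<lambda>t. h (a + t *s v)) holomorphic_on {t. a + t *s v \<in> W}" for a v
    using assms(1) unfolding line_holomorphic_def by blast+
  have "(\<lambda>t. h' (a + t *s v)) holomorphic_on {t. a + t *s v \<in> W}" for a v
    by (rule holomorphic_transform[OF c(2)]) (simp add: assms(2))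
  moreover have "continuous_on W h'" by (rule continuous_on_eq[OF c(1) assms(2)])
  ultimately show ?thesis unfolding line_holomorphic_def by blast
qed

lemma line_holomorphic_jet_basis_compose:
  fixes F :: "complex ^ 'd \<Rightarrow> complex ^ 'd"
  assumes F: "\<And>k. line_holomorphic (\<lambda>x. F x $ k) W"
  shows "line_holomorphic (\<lambda>x. jet_basis \<alpha> p j (F x - p)) W"
proof -
  have 1: "line_holomorphic (\<lambda>x. monomial_fun a (F x - p)) W" for a
    unfolding monomial_fun_def vector_minus_component
    by (intro line_holomorphic_prod line_holomorphic_power line_holomorphic_diff line_holomorphic_const F)
  have 2: "line_holomorphic (\<lambda>x. jet_weight p (F x - p)) W"
    unfolding jet_weight_def add_diff_cancel_left' diff_add_cancel add_diff_eq
    by (intro line_holomorphic_exp line_holomorphic_sum line_holomorphic_mult line_holomorphic_const F)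
  show ?thesis unfolding jet_basis_eq by (intro line_holomorphic_mult line_holomorphic_const 1 2)
qed

context flow_setup
begin

text \<open>The pullback of a basis function by the flow is holomorphic in the interior and bounded,
  so it has a global expansion; uniqueness of jets identifies the first coefficients with a column
  of exp(TA). One \<open>M\<close> serves the finitely many j.\<close>

lemma pullback_expansion:
  shows "\<exists>M\<ge>0. \<forall>j<jet_dim TYPE('d) m. \<exists>c.
    (\<forall>i<jet_dim TYPE('d) m. c i = mat_exp (generator_matrix \<alpha> p V m) T $$ (i, j)) \<and>
    (\<forall>n x q. minkowski_norm K0 x \<le> q \<longrightarrow> q < 1 \<longrightarrow>
      cmod (jet_basis \<alpha> p j (flow_map V U T (p + x) - p) - (\<Sum>i<jet_dim TYPE('d) n. c i * jet_basis \<alpha> p i x)) \<le> M * q ^ Suc n / (1 - q))"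
proof -
  let ?r = "jet_dim TYPE('d) m"
  let ?h = "\<lambda>j x. jet_basis \<alpha> p j (flow_map V U T (p + x) - p)"
  obtain Bw where Bw: "Bw \<ge> 1" "\<And>x. x \<in> K0 \<Longrightarrow> cmod (jet_weight p x) \<le> Bw \<and> cmod (1 / jet_weight p x) \<le> Bw"
    using jet_weight_bounds[OF compact_imp_bounded[OF K0(1)]] by blast
  have solK: "\<exists>z. ode_solution V U T w z" if "w \<in> (+) p ` K0" for w using that sol by auto
  have cont: "continuous_on K0 (?h j)" for j
  proof -
    have "continuous_on UNIV (jet_basis \<alpha> p j)" using line_holomorphic_jet_basis unfolding line_holomorphic_def by blast
    moreover have "continuous_on K0 (\<lambda>x. flow_map V U T (p + x))"
      by (rule continuous_on_compose2[OF flow_continuous[OF hol U(1) less_imp_le[OF T] solK]]) (auto intro!: continuous_intros)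
    then have "continuous_on K0 (\<lambda>x. flow_map V U T (p + x) - p)" by (intro continuous_intros)
    ultimately show ?thesis by (rule continuous_on_compose2) simp
  qed
  have "bounded (\<Union>j\<in>{..<?r}. ?h j ` K0)"
    by (intro bounded_UN finite_lessThan ballI compact_imp_bounded compact_continuous_image cont K0(1))
  then obtain M where M: "M > 0" "\<forall>y\<in>(\<Union>j\<in>{..<?r}. ?h j ` K0). cmod y \<le> M" unfolding bounded_pos by blast
  have hM: "cmod (?h j x) \<le> M" if "j < ?r" "x \<in> interior K0" for j x
    using M(2) that(1) interior_K0[OF that(2)] by blast
  have hl: "line_holomorphic (?h j) (interior K0)" for j
  proof (rule line_holomorphic_jet_basis_compose)
    fix k
    have "line_holomorphic (\<lambda>x. flow_map V U T (p + 1 *s x) $ k) (interior K0)"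
      by (rule line_holomorphic_affine[OF flow_line_holomorphic[where k = k, OF hol U(1) T solK]])
        (auto simp: interior_translation)
    then show "line_holomorphic (\<lambda>x. flow_map V U T (p + x) $ k) (interior K0)" by simp
  qed
  show ?thesis
  proof (intro exI[of _ "M * Bw * Bw"] conjI allI impI)
    show "0 \<le> M * Bw * Bw" using M(1) Bw(1) by simp
    fix j assume j: "j < ?r"
    obtain c where c: "\<And>n. jet_approx \<alpha> p n (?h j) c" "\<And>n x q. minkowski_norm K0 x \<le> q \<Longrightarrow> q < 1 \<Longrightarrow>
      cmod (?h j x - (\<Sum>i<jet_dim TYPE('d) n. c i * jet_basis \<alpha> p i x)) \<le> M * Bw * Bw * q ^ Suc n / (1 - q)"
      using global_jet_expansion[OF num K0(2,3) hl hM[OF j] Bw(2)] by blast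
    have "c i = mat_exp (generator_matrix \<alpha> p V m) T $$ (i, j)" if "i < ?r" for i
      by (rule jet_approx_unique[OF num c(1) flow_jet[OF j] that])
    with c(2) show "\<exists>c. (\<forall>i<?r. c i = mat_exp (generator_matrix \<alpha> p V m) T $$ (i, j)) \<and>
      (\<forall>n x q. minkowski_norm K0 x \<le> q \<longrightarrow> q < 1 \<longrightarrow>
        cmod (?h j x - (\<Sum>i<jet_dim TYPE('d) n. c i * jet_basis \<alpha> p i x)) \<le> M * Bw * Bw * q ^ Suc n / (1 - q))"
      by blast
  qed
qed

text \<open>At the samples the expansion of the pullback has remainder a R^n, and the fit amplifies
  it by a constant over sqrt (\<Lambda>_n / 2). The assumption R^n <= \<rho>^n sqrt \<Lambda>_n
  leaves a multiple of \<rho>^n, with a factor that depends on m but not on n or N.\<close>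

lemma koopman_estimate:
  fixes x :: "nat \<Rightarrow> complex ^ 'd"
  assumes R: "0 \<le> R" "R < 1" and x: "\<And>s. s \<ge> 1 \<Longrightarrow> x s \<in> K0" "\<And>s. s \<ge> 1 \<Longrightarrow> minkowski_norm K0 (x s) \<le> R"
    and f: "\<And>y. y \<in> K0 \<Longrightarrow> f (p + y) = flow_map V U T (p + y)"
    and \<Lambda>: "\<forall>\<^sub>F n in sequentially. \<Lambda> n > 0 \<and> R ^ n \<le> \<rho> ^ n * sqrt (\<Lambda> n)"
    and low: "\<And>n. \<Lambda> n > 0 \<Longrightarrow> \<forall>\<^sub>F N in sequentially. \<forall>v. real N * (\<Lambda> n / 2) * (\<Sum>k<jet_dim TYPE('d) n. (cmod (v k))\<^sup>2)
        \<le> (\<Sum>s=1..N. (cmod (\<Sum>k<jet_dim TYPE('d) n. monomial_fun (\<alpha> (k + 1)) (x s) * v k))\<^sup>2)"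
  shows "\<exists>c\<ge>0. \<forall>\<^sub>F n in sequentially. \<forall>\<^sub>F N in sequentially. \<forall>i<jet_dim TYPE('d) m. \<forall>j<jet_dim TYPE('d) m.
    cmod (C_hat \<alpha> p f m n N (\<lambda>s. p + x s) $$ (i, j) - mat_adjoint (mat_exp (generator_matrix \<alpha> p V m) T) $$ (i, j)) \<le> c * \<rho> ^ n"
proof -
  let ?r = "jet_dim TYPE('d) m"
  let ?E = "mat_exp (generator_matrix \<alpha> p V m) T"
  have E: "?E \<in> carrier_mat ?r ?r" by (rule mat_exp_carrier[OF generator_matrix_carrier])
  obtain Bw where Bw: "Bw \<ge> 1" "\<And>x. x \<in> K0 \<Longrightarrow> cmod (jet_weight p x) \<le> Bw \<and> cmod (1 / jet_weight p x) \<le> Bw"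
    using jet_weight_bounds[OF compact_imp_bounded[OF K0(1)]] by blast
  obtain M where M: "M \<ge> 0" and exp: "\<And>j. j < ?r \<Longrightarrow> \<exists>c. (\<forall>i<?r. c i = ?E $$ (i, j)) \<and>
    (\<forall>n x q. minkowski_norm K0 x \<le> q \<longrightarrow> q < 1 \<longrightarrow>
      cmod (jet_basis \<alpha> p j (flow_map V U T (p + x) - p) - (\<Sum>i<jet_dim TYPE('d) n. c i * jet_basis \<alpha> p i x)) \<le> M * q ^ Suc n / (1 - q))"
    using pullback_expansion by blast
  \<comment> \<open>Only the scales of the indices below r_m enter, so \<open>s0\<close> does not
    depend on n.\<close>
  obtain s0 where s0: "s0 > 0" "\<And>i. i < ?r \<Longrightarrow> s0 \<le> cmod (jet_scale \<alpha> p i)"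
  proof
    let ?A = "(\<lambda>i. cmod (jet_scale \<alpha> p i)) ` {..<?r}"
    have ne: "{..<?r} \<noteq> {}" using jet_dim_pos[where ?'d = 'd, of m] by auto
    show "Min ?A > 0" using ne by (subst Min_gr_iff) (auto simp: jet_scale_nonzero)
    show "Min ?A \<le> cmod (jet_scale \<alpha> p i)" if "i < ?r" for i using that by (intro Min_le) auto
  qed
  define \<kappa> where "\<kappa> = 1 / Bw"
  have \<kappa>: "\<kappa> > 0" using Bw(1) by (simp add: \<kappa>_def)
  have w: "\<kappa> \<le> cmod (jet_weight p (x s))" if "s \<ge> 1" for s
  proof -
    have "1 / cmod (jet_weight p (x s)) \<le> Bw" using Bw(2)[OF x(1)[OF that]] by (simp add: norm_divide)
    then show ?thesis using Bw(1) jet_weight_nonzero[of p "x s"] by (simp add: \<kappa>_def field_simps)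
  qed
  \<comment> \<open>The remainder M R^(n+1) / (1 - R) is written as a R^n.\<close>
  define a where "a = M * R / (1 - R)"
  have a: "a \<ge> 0" using M R by (simp add: a_def)
  show ?thesis
  proof (intro exI[of _ "a * sqrt 2 / (s0 * \<kappa>)"] conjI)
    show "0 \<le> a * sqrt 2 / (s0 * \<kappa>)" using a s0(1) \<kappa> by simp
    show "\<forall>\<^sub>F n in sequentially. \<forall>\<^sub>F N in sequentially. \<forall>i<?r. \<forall>j<?r.
      cmod (C_hat \<alpha> p f m n N (\<lambda>s. p + x s) $$ (i, j) - mat_adjoint ?E $$ (i, j)) \<le> a * sqrt 2 / (s0 * \<kappa>) * \<rho> ^ n"
      using \<Lambda> eventually_ge_at_top[of m]
    proof eventually_elim
      case (elim n)
      then have Lpos: "\<Lambda> n > 0" and Rn: "R ^ n \<le> \<rho> ^ n * sqrt (\<Lambda> n)" and mn: "m \<le> n" by auto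
      from low[OF Lpos] eventually_gt_at_top[of 0] show ?case
      proof eventually_elim
        case (elim N)
        show ?case
        proof (intro allI impI)
          fix i j assume i: "i < ?r" and j: "j < ?r"
          obtain c where c: "\<And>k. k < ?r \<Longrightarrow> c k = ?E $$ (k, i)" "\<And>n x q. minkowski_norm K0 x \<le> q \<Longrightarrow> q < 1 \<Longrightarrow>
              cmod (jet_basis \<alpha> p i (flow_map V U T (p + x) - p) - (\<Sum>k<jet_dim TYPE('d) n. c k * jet_basis \<alpha> p k x)) \<le> M * q ^ Suc n / (1 - q)"
            using exp[OF i] by blast
          have jn: "j < jet_dim TYPE('d) n" using j jet_dim_mono[OF mn, where ?'d = 'd] by linarith
          have eq1: "C_hat \<alpha> p f m n N (\<lambda>s. p + x s) $$ (i, j) =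
              (mat_adjoint (U_mat \<alpha> p m N (\<lambda>s. f (p + x s))) * moore_penrose (mat_adjoint (U_mat \<alpha> p n N (\<lambda>s. p + x s)))) $$ (i, j)"
            unfolding C_hat_def using i j by simp
          have eq2: "mat_adjoint ?E $$ (i, j) = cnj (c j)" by (simp add: carrier_matD[OF generator_matrix_carrier] c(1)[OF j] i j)
          have le1: "cmod ((mat_adjoint (U_mat \<alpha> p m N (\<lambda>s. f (p + x s))) * moore_penrose (mat_adjoint (U_mat \<alpha> p n N (\<lambda>s. p + x s)))) $$ (i, j) - cnj (c j))
              \<le> (a * R ^ n) / (cmod (jet_scale \<alpha> p j) * (\<kappa> * sqrt (\<Lambda> n / 2)))"
          proof (rule pseudo_inverse_fit_error[OF _ _ _ \<kappa> w _ i jn])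
            show "cmod (jet_basis \<alpha> p i (f (p + x s) - p) - (\<Sum>k<jet_dim TYPE('d) n. c k * jet_basis \<alpha> p k (x s))) \<le> a * R ^ n" if "s \<ge> 1" for s
              using c(2)[OF x(2)[OF that] R(2), of n] f[OF x(1)[OF that]] by (simp add: a_def)
          qed (use elim Lpos in auto)
          have le2: "(a * R ^ n) / (cmod (jet_scale \<alpha> p j) * (\<kappa> * sqrt (\<Lambda> n / 2))) \<le> a * sqrt 2 / (s0 * \<kappa>) * \<rho> ^ n"
          proof -
            have "(a * R ^ n) / (cmod (jet_scale \<alpha> p j) * (\<kappa> * sqrt (\<Lambda> n / 2))) \<le> (a * (\<rho> ^ n * sqrt (\<Lambda> n))) / (s0 * (\<kappa> * sqrt (\<Lambda> n / 2)))"
            proof (rule frac_le)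
              show "0 \<le> a * (\<rho> ^ n * sqrt (\<Lambda> n))"
                by (intro mult_nonneg_nonneg[OF a] order_trans[OF zero_le_power[OF R(1)] Rn])
            qed (use a Rn s0 \<kappa> Lpos j in \<open>auto intro!: mult_left_mono mult_right_mono\<close>)
            also have "\<dots> = a * sqrt 2 / (s0 * \<kappa>) * \<rho> ^ n" using Lpos s0(1) \<kappa> by (simp add: real_sqrt_divide field_simps)
            finally show ?thesis .
          qed
          show "cmod (C_hat \<alpha> p f m n N (\<lambda>s. p + x s) $$ (i, j) - mat_adjoint ?E $$ (i, j)) \<le> a * sqrt 2 / (s0 * \<kappa>) * \<rho> ^ n"
            unfolding eq1 eq2 by (rule order_trans[OF le1 le2])
        qed
      qed
    qed
  qed
qed

end


context flow_setup
begin

text \<open>For large n the error c \<rho>^n is within the neighbourhood where the logarithm is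
  defined and Lipschitz; division by T and \<open>principal_log_koopman\<close> turn the error of
  \<open>C_hat\<close> into one of \<open>A_hat\<close>.\<close>

lemma generator_estimate:
  fixes f :: "complex ^ 'd \<Rightarrow> complex ^ 'd"
  assumes \<rho>: "0 < \<rho>" "\<rho> < 1"
    and C: "\<exists>c\<ge>0. \<forall>\<^sub>F n in sequentially. \<forall>\<^sub>F N in sequentially. \<forall>i<jet_dim TYPE('d) m. \<forall>j<jet_dim TYPE('d) m.
      cmod (C_hat \<alpha> p f m n N Z $$ (i, j) - mat_adjoint (mat_exp (generator_matrix \<alpha> p V m) T) $$ (i, j)) \<le> c * \<rho> ^ n"
  shows "\<exists>c\<ge>0. \<forall>\<^sub>F n in sequentially. \<forall>\<^sub>F N in sequentially. no_nonpos_real_eigenvalue (C_hat \<alpha> p f m n N Z) \<and>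
    (\<forall>i<jet_dim TYPE('d) m. \<forall>j<jet_dim TYPE('d) m.
      cmod (A_hat \<alpha> p f T m n N Z $$ (i, j) - cnj (generator_coeff \<alpha> p V j i)) \<le> c * \<rho> ^ n)"
proof -
  let ?r = "jet_dim TYPE('d) m"
  let ?A = "generator_matrix \<alpha> p V m"
  let ?E = "mat_adjoint (mat_exp ?A T)"
  obtain c where c: "c \<ge> 0" and Cc: "\<forall>\<^sub>F n in sequentially. \<forall>\<^sub>F N in sequentially. \<forall>i<?r. \<forall>j<?r.
      cmod (C_hat \<alpha> p f m n N Z $$ (i, j) - ?E $$ (i, j)) \<le> c * \<rho> ^ n" using C by blast
  have E: "?E \<in> carrier_mat ?r ?r" by (rule mat_adjoint_carrier[OF mat_exp_carrier[OF generator_matrix_carrier]])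
  have "Determinant.det (mat_segment ?E t) \<noteq> 0" if "t \<in> {0..1}" for t
    unfolding mat_exp_adjoint[OF generator_matrix_carrier, symmetric]
    by (rule mat_exp_segment_det[OF mat_adjoint_carrier[OF generator_matrix_carrier] generator_adjoint_eigenvalue_real that])
  from principal_log_lipschitz[OF E this]
  obtain \<delta> L where \<delta>: "\<delta> > 0" and L: "L \<ge> 0" and log: "\<And>M \<epsilon>. M \<in> carrier_mat ?r ?r \<Longrightarrow> \<epsilon> \<le> \<delta> \<Longrightarrow>
      (\<forall>i<?r. \<forall>j<?r. cmod (M $$ (i, j) - ?E $$ (i, j)) \<le> \<epsilon>) \<Longrightarrow> no_nonpos_real_eigenvalue M \<and>
      (\<forall>i<?r. \<forall>j<?r. cmod (principal_log M $$ (i, j) - principal_log ?E $$ (i, j)) \<le> L * \<epsilon>)"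
    by blast
  have "(\<lambda>n. c * \<rho> ^ n) \<longlonglongrightarrow> c * 0" using \<rho> by (intro tendsto_mult tendsto_const LIMSEQ_realpow_zero) auto
  then have small: "\<forall>\<^sub>F n in sequentially. c * \<rho> ^ n < \<delta>" using \<delta> by (intro order_tendstoD(2)) auto
  show ?thesis
  proof (intro exI[of _ "L * c / T"] conjI)
    show "L * c / T \<ge> 0" using L c T by simp
    show "\<forall>\<^sub>F n in sequentially. \<forall>\<^sub>F N in sequentially. no_nonpos_real_eigenvalue (C_hat \<alpha> p f m n N Z) \<and>
      (\<forall>i<?r. \<forall>j<?r. cmod (A_hat \<alpha> p f T m n N Z $$ (i, j) - cnj (generator_coeff \<alpha> p V j i)) \<le> L * c / T * \<rho> ^ n)"
      using Cc small
    proof eventually_elim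
      case (elim n)
      then have le: "c * \<rho> ^ n \<le> \<delta>" by simp
      from elim(1) show ?case
      proof eventually_elim
        case (elim N)
        let ?C = "C_hat \<alpha> p f m n N Z"
        have Cm: "?C \<in> carrier_mat ?r ?r" by (simp add: C_hat_def)
        note l = log[OF Cm le elim]
        have "cmod (A_hat \<alpha> p f T m n N Z $$ (i, j) - cnj (generator_coeff \<alpha> p V j i)) \<le> L * c / T * \<rho> ^ n"
          if i: "i < ?r" and j: "j < ?r" for i j
        proof -
          have "principal_log ?E $$ (i, j) = complex_of_real T * cnj (generator_coeff \<alpha> p V j i)"
            unfolding principal_log_koopman using i j by (simp add: generator_matrix_def)
          moreover have "A_hat \<alpha> p f T m n N Z $$ (i, j) = principal_log ?C $$ (i, j) / complex_of_real T"
            using principal_log_carrier[OF Cm] i j by (simp add: A_hat_def)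
          ultimately have "A_hat \<alpha> p f T m n N Z $$ (i, j) - cnj (generator_coeff \<alpha> p V j i) =
              (principal_log ?C $$ (i, j) - principal_log ?E $$ (i, j)) / complex_of_real T"
            using T by (simp add: diff_divide_distrib)
          then have "cmod (A_hat \<alpha> p f T m n N Z $$ (i, j) - cnj (generator_coeff \<alpha> p V j i)) =
              cmod (principal_log ?C $$ (i, j) - principal_log ?E $$ (i, j)) / T"
            using T by (simp add: norm_divide)
          also have "\<dots> \<le> (L * (c * \<rho> ^ n)) / T" using l i j T by (intro divide_right_mono) auto
          finally show ?thesis by simp
        qed
        with l show ?case by blast
      qed
    qed
  qed
qed

end

text \<open>Shows that the estimator has the form of \<open>field_sum\<close>, with the adjoint of
  \<open>A_hat\<close> in the place of the generator coefficients.\<close>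

lemma V_hat_component:
  fixes z :: "complex ^ 'd"
  shows "V_hat \<alpha> p f T m n N Z z $ k = (\<Sum>i<jet_dim TYPE('d) m. \<Sum>j<jet_dim TYPE('d) m.
    cnj (jet_grad \<alpha> p j k (- p)) * cnj (A_hat \<alpha> p f T m n N Z $$ (j, i)) * u_fun \<alpha> p (i + 1) z)"
proof -
  let ?r = "jet_dim TYPE('d) m"
  let ?A = "A_hat \<alpha> p f T m n N Z"
  have z1: "0 < (1 :: nat)" by simp
  have "C_hat \<alpha> p f m n N Z \<in> carrier_mat ?r ?r" by (simp add: C_hat_def)
  then have A: "?A \<in> carrier_mat ?r ?r" unfolding A_hat_def by (intro smult_carrier_mat principal_log_carrier)
  have u: "u_row \<alpha> p m z \<in> carrier_mat 1 ?r" and du: "du_row \<alpha> p m k 0 \<in> carrier_mat 1 ?r"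
    by (simp_all add: u_row_def du_row_def)
  have uA: "u_row \<alpha> p m z * mat_adjoint ?A \<in> carrier_mat 1 ?r" using u mat_adjoint_carrier[OF A] by simp
  have "(u_row \<alpha> p m z * mat_adjoint ?A * mat_adjoint (du_row \<alpha> p m k 0)) $$ (0, 0) =
      (\<Sum>j<?r. (\<Sum>i<?r. u_fun \<alpha> p (i + 1) z * cnj (?A $$ (j, i))) * cnj (jet_grad \<alpha> p j k (- p)))"
    unfolding index_mult_mat_sum[OF uA mat_adjoint_carrier[OF du] z1 z1]
  proof (intro sum.cong refl arg_cong2[where f = "(*)"])
    fix j assume "j \<in> {..<?r}"
    then have j: "j < ?r" by simp
    show "(u_row \<alpha> p m z * mat_adjoint ?A) $$ (0, j) = (\<Sum>i<?r. u_fun \<alpha> p (i + 1) z * cnj (?A $$ (j, i)))"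
      unfolding index_mult_mat_sum[OF u mat_adjoint_carrier[OF A] z1 j]
      using A j by (intro sum.cong refl) (simp add: u_row_def)
    have "mat_adjoint (du_row \<alpha> p m k 0) $$ (j, 0) = cnj (du_row \<alpha> p m k 0 $$ (0, j))" using du j by simp
    also have "du_row \<alpha> p m k 0 $$ (0, j) = jet_grad \<alpha> p j k (- p)"
      unfolding jet_gradient_at_origin[symmetric] using j by (simp add: du_row_def)
    finally show "mat_adjoint (du_row \<alpha> p m k 0) $$ (j, 0) = cnj (jet_grad \<alpha> p j k (- p))" .
  qed
  also have "\<dots> = (\<Sum>j<?r. \<Sum>i<?r. cnj (jet_grad \<alpha> p j k (- p)) * cnj (?A $$ (j, i)) * u_fun \<alpha> p (i + 1) z)"
    unfolding sum_distrib_right by (intro sum.cong refl) (simp only: mult_ac)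
  also have "\<dots> = (\<Sum>i<?r. \<Sum>j<?r. cnj (jet_grad \<alpha> p j k (- p)) * cnj (?A $$ (j, i)) * u_fun \<alpha> p (i + 1) z)"
    by (rule sum.swap)
  finally show ?thesis by (simp add: V_hat_def)
qed

text \<open>Both sides are the same expression, linear in the matrix entries, with finitely many
  basis functions that are bounded on K0; so the constant is independent of n, N and the
  samples.\<close>

lemma V_hat_field_sum_difference:
  fixes K0 :: "(complex ^ 'd) set"
  assumes K0: "compact K0"
  shows "\<exists>c\<ge>0. \<forall>n N Z \<epsilon> x k. x \<in> K0 \<longrightarrow>
    (\<forall>i<jet_dim TYPE('d) m. \<forall>j<jet_dim TYPE('d) m.
      cmod (A_hat \<alpha> p f T m n N Z $$ (i, j) - cnj (generator_coeff \<alpha> p V j i)) \<le> \<epsilon>) \<longrightarrow>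
    cmod (V_hat \<alpha> p f T m n N Z (p + x) $ k - field_sum \<alpha> p V m k x) \<le> c * \<epsilon>"
proof -
  let ?r = "jet_dim TYPE('d) m"
  let ?g = "\<lambda>j k. cnj (jet_grad \<alpha> p j k (- p))"
  have "continuous_on K0 (jet_basis \<alpha> p i)" for i
    using line_holomorphic_jet_basis[where W = K0] unfolding line_holomorphic_def by blast
  then have "bounded (\<Union>i\<in>{..<?r}. jet_basis \<alpha> p i ` K0)"
    by (intro bounded_UN finite_lessThan ballI compact_imp_bounded compact_continuous_image K0)
  then obtain B where B: "B > 0" "\<forall>y\<in>(\<Union>i\<in>{..<?r}. jet_basis \<alpha> p i ` K0). cmod y \<le> B" unfolding bounded_pos by blast
  define c where "c = (\<Sum>i<?r. \<Sum>j<?r. (\<Sum>k\<in>UNIV. cmod (?g j k)) * B)"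
  have c0: "c \<ge> 0" unfolding c_def using B(1) by (intro sum_nonneg mult_nonneg_nonneg) auto
  have "cmod (V_hat \<alpha> p f T m n N Z (p + x) $ k - field_sum \<alpha> p V m k x) \<le> c * \<epsilon>"
    if x: "x \<in> K0" and A: "\<forall>i<?r. \<forall>j<?r. cmod (A_hat \<alpha> p f T m n N Z $$ (i, j) - cnj (generator_coeff \<alpha> p V j i)) \<le> \<epsilon>"
    for n N Z \<epsilon> x k
  proof -
    let ?d = "\<lambda>i j. cnj (A_hat \<alpha> p f T m n N Z $$ (j, i) - cnj (generator_coeff \<alpha> p V i j))"
    have "V_hat \<alpha> p f T m n N Z (p + x) $ k - field_sum \<alpha> p V m k x = (\<Sum>i<?r. \<Sum>j<?r. ?g j k * ?d i j * jet_basis \<alpha> p i x)"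
      unfolding V_hat_component field_sum_def sum_distrib_right sum_subtractf[symmetric]
      by (intro sum.cong refl) (simp add: jet_basis_def left_diff_distrib right_diff_distrib)
    also have "cmod \<dots> \<le> (\<Sum>i<?r. \<Sum>j<?r. ((\<Sum>k\<in>UNIV. cmod (?g j k)) * B) * \<epsilon>)"
    proof (intro order_trans[OF norm_sum sum_mono] order_trans[OF norm_sum sum_mono])
      fix i j assume i: "i \<in> {..<?r}" and j: "j \<in> {..<?r}"
      have 1: "cmod (?d i j) \<le> \<epsilon>" unfolding complex_mod_cnj using A i j by simp
      have 2: "cmod (?g j k) \<le> (\<Sum>k\<in>UNIV. cmod (?g j k))" by (rule member_le_sum) auto
      have 3: "cmod (jet_basis \<alpha> p i x) \<le> B" using B(2) i x by blast
      have "cmod (?g j k * ?d i j * jet_basis \<alpha> p i x) \<le> (\<Sum>k\<in>UNIV. cmod (?g j k)) * \<epsilon> * B"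
        unfolding norm_mult
        by (intro mult_mono 1 2 3 mult_nonneg_nonneg sum_nonneg norm_ge_zero order_trans[OF norm_ge_zero 1])
      then show "cmod (?g j k * ?d i j * jet_basis \<alpha> p i x) \<le> ((\<Sum>k\<in>UNIV. cmod (?g j k)) * B) * \<epsilon>"
        by (simp only: mult_ac)
    qed
    also have "\<dots> = c * \<epsilon>" unfolding c_def sum_distrib_right ..
    finally show ?thesis .
  qed
  with c0 show ?thesis by blast
qed

lemma closed_real_points: "closed (real_points :: (complex ^ 'd) set)"
proof -
  have eq: "(real_points :: (complex ^ 'd) set) = (\<Inter>k\<in>UNIV. (\<lambda>z. z $ k) -` \<real>)" by (auto simp: real_points_def)
  have "closed ((\<lambda>z :: complex ^ 'd. z $ k) -` \<real>)" for k
    by (rule continuous_closed_vimage[OF closed_complex_Reals]) (auto intro!: continuous_intros)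
  then show ?thesis unfolding eq by (intro closed_INT ballI)
qed


section \<open>The estimate of the vector field and the theorem\<close>

text \<open>Two errors are added: from the estimator to \<open>field_sum\<close>, which is
  O(\<rho>^n) with a constant depending on m and provides C m, and from \<open>field_sum\<close> to
  V, which is Taylor's remainder with the constant c. The remainder constant is passed in as a
  hypothesis because it has to be chosen before V.\<close>

lemma (in flow_setup) vector_field_estimate:
  fixes \<mu> :: "(complex ^ 'd) measure" and x :: "nat \<Rightarrow> complex ^ 'd" and c \<rho> :: real
  assumes \<mu>: "sets \<mu> = sets borel" "prob_space \<mu>" "emeasure \<mu> (K0 \<inter> real_points) = 1"
    and ac: "absolutely_continuous (real_lebesgue_on K0) \<mu>"
    and x: "\<And>i. i \<ge> 1 \<Longrightarrow> x i \<in> measure_support \<mu>" and weak: "weakly_converges (\<lambda>N. empirical_measure N x) \<mu>"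
    and \<rho>: "0 < \<rho>" "\<rho> < 1"
    and less: "ereal (gauge_radius K0 (measure_support \<mu>)) / liminf (\<lambda>n. ereal (Lambda_eig \<alpha> n \<mu> powr (1 / (2 * real n)))) < ereal \<rho>"
    and f: "\<And>y. y \<in> K0 \<Longrightarrow> f (p + y) = flow_map V U T (p + y)"
    and c: "c \<ge> 0" "\<And>m k x q. minkowski_norm K0 x \<le> q \<Longrightarrow> q < 1 \<Longrightarrow>
      cmod (V (p + x) $ k - field_sum \<alpha> p V m k x) \<le> c * q ^ Suc m / (1 - q)"
  shows "\<exists>C :: nat \<Rightarrow> real. (\<forall>m. C m > 0) \<and> (\<forall>K1 m. compact K1 \<longrightarrow> K1 \<subseteq> interior K0 \<longrightarrow>
    (\<forall>\<^sub>F n in sequentially.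
      (\<forall>\<^sub>F N in sequentially. no_nonpos_real_eigenvalue (C_hat \<alpha> p f m n N (\<lambda>i. p + x i))) \<and>
      limsup (\<lambda>N. SUP z\<in>(\<lambda>z. p + z) ` K1. ereal (norm (V_hat \<alpha> p f T m n N (\<lambda>i. p + x i) z - V z)))
        \<le> ereal ((real CARD('d) * c + 1) * (C m * \<rho> ^ n + gauge_radius K0 K1 ^ m / (1 - gauge_radius K0 K1)))))"
proof -
  let ?R = "gauge_radius K0 (measure_support \<mu>)"
  let ?D = "real CARD('d)"
  let ?Z = "\<lambda>i. p + x i"
  have rb: "(real_points :: (complex ^ 'd) set) \<in> sets borel" by (rule borel_closed[OF closed_real_points])
  note supp = measure_support_subset_closed[OF compact_imp_closed[OF K0(1)] \<mu> rb]
  have xK: "x i \<in> K0" "minkowski_norm K0 (x i) \<le> ?R" if "i \<ge> 1" for i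
    using supp(1) x[OF that] minkowski_norm_le_gauge_radius[OF supp(1) x[OF that]] by auto
  have Rpos: "?R > 0" by (rule gauge_radius_support_pos[OF K0(1,3) \<mu> rb ac])
  have mb: "Lambda_eig \<alpha> n \<mu> \<ge> 0" "Lambda_eig \<alpha> n \<mu> \<le> 1" for n
    by (rule moment_matrix_bounds(1,2)[OF num K0(1) \<mu>(1,2) supp(2) xK(1) weak], assumption)+
  have low: "\<forall>\<^sub>F N in sequentially. \<forall>v. real N * (Lambda_eig \<alpha> n \<mu> / 2) * (\<Sum>k<jet_dim TYPE('d) n. (cmod (v k))\<^sup>2)
      \<le> (\<Sum>s=1..N. (cmod (\<Sum>k<jet_dim TYPE('d) n. monomial_fun (\<alpha> (k + 1)) (x s) * v k))\<^sup>2)"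
    if "Lambda_eig \<alpha> n \<mu> > 0" for n
    by (rule moment_matrix_bounds(3)[OF num K0(1) \<mu>(1,2) supp(2) xK(1) weak that])
  note root = eigenvalue_root_liminf[OF mb Rpos \<rho>(1) less]
  have "\<exists>\<kappa>\<ge>0. \<forall>\<^sub>F n in sequentially. \<forall>\<^sub>F N in sequentially. no_nonpos_real_eigenvalue (C_hat \<alpha> p f m n N ?Z) \<and>
      (\<forall>y\<in>K0. \<forall>k. cmod (V_hat \<alpha> p f T m n N ?Z (p + y) $ k - field_sum \<alpha> p V m k y) \<le> \<kappa> * \<rho> ^ n)" for m
  proof -
    have R: "0 \<le> ?R" "?R < 1" using Rpos root(1) \<rho>(2) by simp_all
    have koop: "\<exists>c\<ge>0. \<forall>\<^sub>F n in sequentially. \<forall>\<^sub>F N in sequentially. \<forall>i<jet_dim TYPE('d) m. \<forall>j<jet_dim TYPE('d) m.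
        cmod (C_hat \<alpha> p f m n N ?Z $$ (i, j) - mat_adjoint (mat_exp (generator_matrix \<alpha> p V m) T) $$ (i, j)) \<le> c * \<rho> ^ n"
      by (rule koopman_estimate[OF R xK(1) xK(2) f root(2) low])
    from generator_estimate[OF \<rho> koop] obtain a where a: "a \<ge> 0"
      "\<forall>\<^sub>F n in sequentially. \<forall>\<^sub>F N in sequentially. no_nonpos_real_eigenvalue (C_hat \<alpha> p f m n N ?Z) \<and>
        (\<forall>i<jet_dim TYPE('d) m. \<forall>j<jet_dim TYPE('d) m.
          cmod (A_hat \<alpha> p f T m n N ?Z $$ (i, j) - cnj (generator_coeff \<alpha> p V j i)) \<le> a * \<rho> ^ n)"
      by (elim exE conjE)
    from V_hat_field_sum_difference[OF K0(1), of m \<alpha> p f T V] obtain b where b: "b \<ge> 0" and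
      bd: "\<forall>n N Z \<epsilon> y k. y \<in> K0 \<longrightarrow> (\<forall>i<jet_dim TYPE('d) m. \<forall>j<jet_dim TYPE('d) m.
          cmod (A_hat \<alpha> p f T m n N Z $$ (i, j) - cnj (generator_coeff \<alpha> p V j i)) \<le> \<epsilon>) \<longrightarrow>
        cmod (V_hat \<alpha> p f T m n N Z (p + y) $ k - field_sum \<alpha> p V m k y) \<le> b * \<epsilon>"
      by (elim exE conjE)
    show ?thesis
    proof (intro exI[of _ "b * a"] conjI)
      show "\<forall>\<^sub>F n in sequentially. \<forall>\<^sub>F N in sequentially. no_nonpos_real_eigenvalue (C_hat \<alpha> p f m n N ?Z) \<and>
        (\<forall>y\<in>K0. \<forall>k. cmod (V_hat \<alpha> p f T m n N ?Z (p + y) $ k - field_sum \<alpha> p V m k y) \<le> b * a * \<rho> ^ n)"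
        using a(2)
      proof eventually_elim
        case (elim n)
        then show ?case
        proof eventually_elim
          case (elim N)
          have "cmod (V_hat \<alpha> p f T m n N ?Z (p + y) $ k - field_sum \<alpha> p V m k y) \<le> b * a * \<rho> ^ n" if y: "y \<in> K0" for y k
            unfolding mult.assoc using bd[THEN spec, THEN spec, THEN spec, THEN spec, THEN spec, THEN spec, THEN mp, OF y, THEN mp, OF conjunct2[OF elim]] .
          then show ?case using conjunct1[OF elim] by blast
        qed
      qed
    qed (rule mult_nonneg_nonneg[OF b a(1)])
  qed
  then have "\<forall>m. \<exists>\<kappa>. \<kappa> \<ge> 0 \<and> (\<forall>\<^sub>F n in sequentially. \<forall>\<^sub>F N in sequentially. no_nonpos_real_eigenvalue (C_hat \<alpha> p f m n N ?Z) \<and>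
      (\<forall>y\<in>K0. \<forall>k. cmod (V_hat \<alpha> p f T m n N ?Z (p + y) $ k - field_sum \<alpha> p V m k y) \<le> \<kappa> * \<rho> ^ n))" by (rule allI)
  from choice[OF this] obtain \<kappa> where K: "\<forall>m. \<kappa> m \<ge> 0 \<and> (\<forall>\<^sub>F n in sequentially. \<forall>\<^sub>F N in sequentially.
      no_nonpos_real_eigenvalue (C_hat \<alpha> p f m n N ?Z) \<and>
      (\<forall>y\<in>K0. \<forall>k. cmod (V_hat \<alpha> p f T m n N ?Z (p + y) $ k - field_sum \<alpha> p V m k y) \<le> \<kappa> m * \<rho> ^ n))" ..
  note \<kappa> = conjunct1[OF spec[OF K]] and est = conjunct2[OF spec[OF K]]
  show ?thesis
  \<comment> \<open>The dimension factor turns estimates of components into one of the norm; adding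
    1 keeps C m positive when \<open>\<kappa> m\<close> is 0.\<close>
  proof (intro exI[of _ "\<lambda>m. ?D * \<kappa> m + 1"] conjI allI impI)
    show "?D * \<kappa> m + 1 > 0" for m using \<kappa>[of m] by (intro add_nonneg_pos mult_nonneg_nonneg) auto
    fix K1 :: "(complex ^ 'd) set" and m :: nat
    assume K1: "compact K1" "K1 \<subseteq> interior K0"
    let ?q = "gauge_radius K0 K1"
    show "\<forall>\<^sub>F n in sequentially.
      (\<forall>\<^sub>F N in sequentially. no_nonpos_real_eigenvalue (C_hat \<alpha> p f m n N ?Z)) \<and>
      limsup (\<lambda>N. SUP z\<in>(\<lambda>z. p + z) ` K1. ereal (norm (V_hat \<alpha> p f T m n N ?Z z - V z)))
        \<le> ereal ((?D * c + 1) * ((?D * \<kappa> m + 1) * \<rho> ^ n + ?q ^ m / (1 - ?q)))"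
      using est[of m]
    proof eventually_elim
      case (elim n)
      let ?B = "(?D * c + 1) * ((?D * \<kappa> m + 1) * \<rho> ^ n + ?q ^ m / (1 - ?q))"
      have bound: "norm (V_hat \<alpha> p f T m n N ?Z (p + y) - V (p + y)) \<le> ?B"
        if y: "y \<in> K1" and N: "\<forall>y\<in>K0. \<forall>k. cmod (V_hat \<alpha> p f T m n N ?Z (p + y) $ k - field_sum \<alpha> p V m k y) \<le> \<kappa> m * \<rho> ^ n" for y N
      proof -
        have q: "?q < 1" "?q \<ge> 0" "minkowski_norm K0 y \<le> ?q"
          using gauge_radius_compact_subset[OF K0(3) K1] y by auto
        define b where "b = ?q ^ m / (1 - ?q)"
        have b: "b \<ge> 0" using q by (simp add: b_def)
        have yK: "y \<in> K0" using y K1(2) interior_K0 by blast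
        have comp: "cmod ((V_hat \<alpha> p f T m n N ?Z (p + y) - V (p + y)) $ k) \<le> \<kappa> m * \<rho> ^ n + c * b" for k
        proof -
          have "cmod (V_hat \<alpha> p f T m n N ?Z (p + y) $ k - field_sum \<alpha> p V m k y) \<le> \<kappa> m * \<rho> ^ n" using N yK by blast
          moreover have "cmod (V (p + y) $ k - field_sum \<alpha> p V m k y) \<le> c * b"
          proof -
            have "cmod (V (p + y) $ k - field_sum \<alpha> p V m k y) \<le> c * ?q ^ Suc m / (1 - ?q)" by (rule c(2)[OF q(3,1)])
            also have "\<dots> = c * (?q * b)" by (simp add: b_def)
            also have "\<dots> \<le> c * b" using c(1) b q by (intro mult_left_mono mult_left_le_one_le) auto
            finally show ?thesis .
          qed
          ultimately show ?thesis
            using norm_triangle_ineq4[of "V_hat \<alpha> p f T m n N ?Z (p + y) $ k - field_sum \<alpha> p V m k y" "V (p + y) $ k - field_sum \<alpha> p V m k y"]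
            by simp
        qed
        have "norm (V_hat \<alpha> p f T m n N ?Z (p + y) - V (p + y)) \<le> (\<Sum>k\<in>(UNIV :: 'd set). \<kappa> m * \<rho> ^ n + c * b)"
          by (rule order_trans[OF norm_le_sum_components sum_mono[OF comp]])
        also have "\<dots> = ?D * \<kappa> m * \<rho> ^ n + ?D * c * b" by (simp add: distrib_left)
        also have "\<dots> \<le> (?D * c + 1) * ((?D * \<kappa> m + 1) * \<rho> ^ n) + (?D * c + 1) * b"
        proof (rule add_mono)
          have "1 * ((?D * \<kappa> m) * \<rho> ^ n) \<le> (?D * c + 1) * ((?D * \<kappa> m + 1) * \<rho> ^ n)"
            using c(1) \<kappa>[of m] \<rho>(1) by (intro mult_mono mult_right_mono mult_nonneg_nonneg) auto
          then show "?D * \<kappa> m * \<rho> ^ n \<le> (?D * c + 1) * ((?D * \<kappa> m + 1) * \<rho> ^ n)" by simp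
          show "?D * c * b \<le> (?D * c + 1) * b" using b by (intro mult_right_mono) auto
        qed
        also have "\<dots> = ?B" by (simp only: b_def distrib_left)
        finally show ?thesis .
      qed
      have "\<forall>\<^sub>F N in sequentially. (SUP z\<in>(\<lambda>z. p + z) ` K1. ereal (norm (V_hat \<alpha> p f T m n N ?Z z - V z))) \<le> ereal ?B"
        using elim
      proof eventually_elim
        case (elim N)
        show ?case
        \<comment> \<open>For empty K1 there is nothing to check, the supremum being that of the
          empty set in \<open>ereal\<close>; so facts about the gauge radius are only used where K1
          has a point.\<close>
        proof (rule SUP_least)
          fix z assume "z \<in> (\<lambda>z. p + z) ` K1"
          then obtain y where y: "y \<in> K1" "z = p + y" by blast
          show "ereal (norm (V_hat \<alpha> p f T m n N ?Z z - V z)) \<le> ereal ?B"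
            unfolding y(2) ereal_less_eq by (rule bound[OF y(1) conjunct2[OF elim]])
        qed
      qed
      then have "limsup (\<lambda>N. SUP z\<in>(\<lambda>z. p + z) ` K1. ereal (norm (V_hat \<alpha> p f T m n N ?Z z - V z))) \<le> ereal ?B"
        by (rule Limsup_bounded)
      moreover have "\<forall>\<^sub>F N in sequentially. no_nonpos_real_eigenvalue (C_hat \<alpha> p f m n N ?Z)"
        using elim by eventually_elim blast
      ultimately show ?case by blast
    qed
  qed
qed

theorem theorem1p4:
  fixes e :: "nat \<Rightarrow> 'd::finite" and \<alpha> :: "nat \<Rightarrow> nat ^ 'd"
  assumes "graded_numbering e \<alpha>"
  shows
    "\<exists>C' :: (complex ^ 'd \<Rightarrow> complex ^ 'd) \<Rightarrow> real \<Rightarrow> complex ^ 'd \<Rightarrow>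
            (complex ^ 'd) set \<Rightarrow> (complex ^ 'd) set \<Rightarrow> (complex ^ 'd) measure \<Rightarrow> real.
     \<forall>(K0 :: (complex ^ 'd) set) (K :: (complex ^ 'd) set) (p :: complex ^ 'd)
      (U :: (complex ^ 'd) set) (V :: complex ^ 'd \<Rightarrow> complex ^ 'd)
      (\<mu> :: (complex ^ 'd) measure) (x :: nat \<Rightarrow> complex ^ 'd) (T :: real) (\<rho> :: real)
      (f :: complex ^ 'd \<Rightarrow> complex ^ 'd).
       compact K0 \<longrightarrow> absolutely_convex K0 \<longrightarrow> 0 \<in> interior K0 \<longrightarrow>
       p \<in> real_points \<longrightarrow> K = (\<lambda>z. p + z) ` K0 \<longrightarrow>
       open U \<longrightarrow> K \<subseteq> U \<longrightarrow> holomorphic_map_on V U \<longrightarrow>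
       sets \<mu> = sets borel \<longrightarrow> prob_space \<mu> \<longrightarrow> emeasure \<mu> (K0 \<inter> real_points) = 1 \<longrightarrow>
       absolutely_continuous (real_lebesgue_on K0) \<mu> \<longrightarrow>
       (\<forall>i\<ge>1. x i \<in> measure_support \<mu>) \<longrightarrow>
       V p = 0 \<longrightarrow>
       (\<forall>c v. v \<noteq> 0 \<and> jacobian_matrix V p *v v = c *s v \<longrightarrow> c \<in> \<real>) \<longrightarrow>
       T > 0 \<longrightarrow> (\<forall>w\<in>K. \<exists>z. ode_solution V U T w z) \<longrightarrow>
       weakly_converges (\<lambda>N. empirical_measure N x) \<mu> \<longrightarrow>
       0 < \<rho> \<longrightarrow> \<rho> < 1 \<longrightarrow>
       ereal \<rho> > ereal (gauge_radius K0 (measure_support \<mu>)) /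
                 liminf (\<lambda>n. ereal (Lambda_eig \<alpha> n \<mu> powr (1 / (2 * real n)))) \<longrightarrow>
       f = restrict (flow_map V U T) K \<longrightarrow>
       (\<exists>C :: nat \<Rightarrow> real. (\<forall>m. C m > 0) \<and>
         (\<forall>K1 m. compact K1 \<longrightarrow> K1 \<subseteq> interior K0 \<longrightarrow>
           (\<forall>\<^sub>F n in sequentially.
             (\<forall>\<^sub>F N in sequentially.
               no_nonpos_real_eigenvalue (C_hat \<alpha> p f m n N (\<lambda>i. p + x i))) \<and>
             limsup (\<lambda>N. SUP z\<in>(\<lambda>z. p + z) ` K1.
               ereal (norm (V_hat \<alpha> p f T m n N (\<lambda>i. p + x i) z - V z)))
             \<le> ereal (C' f T p K0 K1 \<mu> *
                 (C m * \<rho> ^ n +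
                  gauge_radius K0 K1 ^ m / (1 - gauge_radius K0 K1))))))"
proof -
  let ?P = "\<lambda>(f :: complex ^ 'd \<Rightarrow> complex ^ 'd) T p K0 c. c \<ge> 0 \<and> (\<forall>U V. flow_setup e \<alpha> K0 p U V T \<longrightarrow>
    (\<forall>x\<in>K0. flow_map V U T (p + x) = f (p + x)) \<longrightarrow> (\<forall>m k x q. minkowski_norm K0 x \<le> q \<longrightarrow> q < 1 \<longrightarrow>
      cmod (V (p + x) $ k - field_sum \<alpha> p V m k x) \<le> c * q ^ Suc m / (1 - q)))"
  \<comment> \<open>The choice sees only f, T, p and K0, so the constant cannot depend on V, the
    samples or \<rho>. The dependence on K1 and \<mu> that is allowed for C' is left
    constant.\<close>
  define c where "c f T p K0 = (SOME c. ?P f T p K0 c)" for f T p K0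
  have c: "?P f T p K0 (c f T p K0)" for f T p K0
    unfolding c_def by (rule someI_ex) (rule field_remainder_uniform)
  define C' :: "(complex ^ 'd \<Rightarrow> complex ^ 'd) \<Rightarrow> real \<Rightarrow> complex ^ 'd \<Rightarrow>
      (complex ^ 'd) set \<Rightarrow> (complex ^ 'd) set \<Rightarrow> (complex ^ 'd) measure \<Rightarrow> real"
    where "C' f T p K0 K1 \<mu> = real CARD('d) * c f T p K0 + 1" for f T p K0 K1 \<mu>
  show ?thesis
  proof (rule exI[of _ C'], intro allI impI)
    fix K0 K U :: "(complex ^ 'd) set" and p :: "complex ^ 'd" and V f :: "complex ^ 'd \<Rightarrow> complex ^ 'd"
      and \<mu> :: "(complex ^ 'd) measure" and x :: "nat \<Rightarrow> complex ^ 'd" and T \<rho> :: real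
    assume K0: "compact K0" "absolutely_convex K0" "0 \<in> interior K0"
      and "p \<in> real_points" and K: "K = (\<lambda>z. p + z) ` K0"
      and V: "open U" "K \<subseteq> U" "holomorphic_map_on V U"
      and \<mu>: "sets \<mu> = sets borel" "prob_space \<mu>" "emeasure \<mu> (K0 \<inter> real_points) = 1"
        "absolutely_continuous (real_lebesgue_on K0) \<mu>"
      and x: "\<forall>i\<ge>1. x i \<in> measure_support \<mu>"
      and Vp: "V p = 0" "\<forall>c v. v \<noteq> 0 \<and> jacobian_matrix V p *v v = c *s v \<longrightarrow> c \<in> \<real>"
      and T: "T > 0" "\<forall>w\<in>K. \<exists>z. ode_solution V U T w z"
      and weak: "weakly_converges (\<lambda>N. empirical_measure N x) \<mu>"
      and \<rho>: "0 < \<rho>" "\<rho> < 1"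
        "ereal \<rho> > ereal (gauge_radius K0 (measure_support \<mu>)) /
          liminf (\<lambda>n. ereal (Lambda_eig \<alpha> n \<mu> powr (1 / (2 * real n))))"
      and f: "f = restrict (flow_map V U T) K"
    have flow: "flow_setup e \<alpha> K0 p U V T"
    proof (rule flow_setup.intro[OF assms K0 V(1) _ V(3) Vp(1) _ T(1)])
      show "p + y \<in> U" if "y \<in> K0" for y using V(2) that unfolding K by blast
      show "c \<in> \<real>" if "v \<noteq> 0" "jacobian_matrix V p *v v = c *s v" for c v using Vp(2) that by blast
      show "\<exists>z. ode_solution V U T (p + y) z" if "y \<in> K0" for y using T(2) that unfolding K by blast
    qed
    have fK: "f (p + y) = flow_map V U T (p + y)" if "y \<in> K0" for y
      using that unfolding f K by simp
    have fK': "\<forall>x\<in>K0. flow_map V U T (p + x) = f (p + x)" using fK by simp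
    have rem: "cmod (V (p + x) $ k - field_sum \<alpha> p V m k x) \<le> c f T p K0 * q ^ Suc m / (1 - q)"
      if "minkowski_norm K0 x \<le> q" "q < 1" for m k x q
      by (rule conjunct2[OF c, THEN spec, THEN spec, THEN mp, OF flow, THEN mp, OF fK', rule_format, OF that])
    show "\<exists>C :: nat \<Rightarrow> real. (\<forall>m. C m > 0) \<and>
         (\<forall>K1 m. compact K1 \<longrightarrow> K1 \<subseteq> interior K0 \<longrightarrow>
           (\<forall>\<^sub>F n in sequentially.
             (\<forall>\<^sub>F N in sequentially.
               no_nonpos_real_eigenvalue (C_hat \<alpha> p f m n N (\<lambda>i. p + x i))) \<and>
             limsup (\<lambda>N. SUP z\<in>(\<lambda>z. p + z) ` K1.
               ereal (norm (V_hat \<alpha> p f T m n N (\<lambda>i. p + x i) z - V z)))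
             \<le> ereal (C' f T p K0 K1 \<mu> *
                 (C m * \<rho> ^ n +
                  gauge_radius K0 K1 ^ m / (1 - gauge_radius K0 K1)))))"
      unfolding C'_def
      by (rule flow_setup.vector_field_estimate[OF flow \<mu> _ weak \<rho> fK conjunct1[OF c] rem]) (use x in simp)
  qed
qed

end
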